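(* For terms $\Gamma\vdash e_1,e_2:\tau$ of the Gaussian language, $[\![e_1]\!]=[\![e_2]\!]$ in $\mathrm{Cond}(\mathrm{Gauss})$ if and only if $e_1$ and $e_2$ are contextually equivalent.
   Context: Gaussian language. Types $\tau::=\mathsf R\mid\mathsf I\mid\tau\ast\tau$. Terms $e::=x\mid e+e\mid\alpha\cdot e\mid\underline\beta\mid(e,e)\mid()\mid\mathrm{let}\ x=e\ \mathrm{in}\ e\mid\mathrm{let}\ (x,y)=e\ \mathrm{in}\ e\mid\mathsf{normal}()\mid e=:=e$ ($\alpha,\beta\in\mathbb R$), with the evident typing: $+$, $\alpha\cdot$, $\underline\beta$, $\mathsf{normal}()$ have type $\mathsf R$; $s=:=t:\mathsf I$ for $s,t:\mathsf R$. Operational semantics: configurations are $\bot$ or pairs $(e,\psi)$ with $\psi$ a Gaussian distribution (mean vector, positive semidefinite covariance) on $\mathbb R^r$ and $z_1:\mathsf R,\dots,z_r:\mathsf R\vdash e$. Values $v::=x\mid(v,v)\mid v+v\mid\alpha\cdot v\mid\underline\beta\mid()$; redexes $\mathsf{normal}()$, $v=:=w$, $\mathrm{let}\ x=v\ \mathrm{in}\ e$, $\mathrm{let}\ (x,y)=v\ \mathrm{in}\ e$; call-by-value evaluation contexts $C$ (left-to-right in pairs, sums, $=:=$; under $\alpha\cdot$; in the bound term of lets). Rules: $(\mathsf{normal}(),\psi)\rhd(z_{r+1},\psi\otimes\mathcal N(0,1))$; let rules substitute values; for $v=:=w$, write the affine function $v-w$ of the latent variables as $ux+b$; if $X\sim\psi$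 and $-b$ lies in the support of $uX$, then $(v=:=w,\psi)\rhd((),\psi')$ with $\psi'$ the conditional distribution of $X$ given $uX=-b$ (mean $\mu+\frac{-b-u\mu}{\sigma}\Sigma u^T$, covariance $\Sigma-\frac1\sigma\Sigma u^Tu\Sigma$ with $\sigma=u\Sigma u^T>0$, or $\psi'=\psi$ if $\sigma=0$), otherwise $\rhd\bot$; reduction lifts through evaluation contexts, and $\bot$ propagates. Every closed program from $(e,())$ reaches either a unique value configuration $(v,\psi)$ or $\bot$; its observable outcome is the pushforward $v_*\psi$ or failure. Contextual equivalence $e_1\approx e_2$: for all closed contexts $K[-]$, $K[e_1]$ fails iff $K[e_2]$ fails, and if both reach values $(v_i,\psi_i)$ then $(v_1)_*\psi_1=(v_2)_*\psi_2$. Denotational semantics: $\mathrm{Gauss}$ is the Markov category with objects $n\in\mathbb N$, morphisms $(A,b,\Sigma):m\to n$ ($x\mapsto Ax+b+\mathcal N(0,\Sigma)$), composition $(A,b,\Sigma)(C,d,\Xi)=(AC,Ad+b,A\Xi A^T+\Sigma)$, block-diagonal tensor, copy $x\mapsto(x,x)$. For a Markov category $\mathcal C$ with conditionals and precise supports, $\mathrm{Cond}(\mathcal C)$ has morphisms $X\leadsto Y$ the triples $(K,f,o)$, $f:X\to Y\otimes K$, $o:I\to K$ deterministic, composed by $(K',f',o')\bullet(K,f,o)=(K'\otimes K,(f'\otimes\mathrm{id}_K)f,o'\otimes o)$ and tensored componentwise, quotiented by $F\approx G$ iff for all $A$ and all states $\Psi:I\leadsto A\otimes X$ the inference problems $(\mathrm{Id}_A\otimes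 F)\bullet\Psi$ and $(\mathrm{Id}_A\otimes G)\bullet\Psi$ either both fail or both succeed with equal posterior, where a state $(K,\psi,o)$ succeeds iff $o$ lies in the support of the marginal $\psi_K$ and then has posterior $\psi|_K\,o$ ($\psi|_K$ a conditional). In $\mathrm{Gauss}$, a point $o$ is in the support of $\mathcal N(b,\Sigma)$ iff $o\in b+\mathrm{col}(\Sigma)$. $\mathcal C$ embeds by $J(f)=(I,f,\mathrm{id})$. Interpret $[\![\mathsf R]\!]=1$, $[\![\mathsf I]\!]=0$, $[\![\tau\ast\tau']\!]=[\![\tau]\!]+[\![\tau']\!]$, contexts likewise, and terms $\Gamma\vdash e:\tau$ as morphisms $[\![\Gamma]\!]\leadsto[\![\tau]\!]$ compositionally: variables as projections, pairs as tensor after copying the context, $\mathrm{let}\ x=e\ \mathrm{in}\ t$ as $[\![t]\!]\bullet(\mathrm{Id}\otimes[\![e]\!])\bullet J(\mathrm{copy})$, $+$, $\alpha\cdot$, $\underline\beta$, $\mathsf{normal}()$ as $J$ of the affine/Gaussian maps $(1\ 1)$, $\alpha$, constant $\beta$, $\mathcal N(0,1)$, and $s=:=t$ as the conditioning effect $(1,\mathrm{id}_1,0):1\leadsto0$ applied to $[\![s]\!]-[\![t]\!]$. *)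

theory Defs
  imports Complex_Main "Jordan_Normal_Form.Matrix"
begin

datatype ty = TR | TI | TProd ty ty

type_synonym vname = nat

text \<open>Terms. \<open>Lat i\<close> is the latent variable z_(i+1) of the operational semantics
  (kept as a separate constructor so substitution of values is capture-free);
  \<open>Hole\<close> is the hole of a context K[-]. Source terms contain neither (typing with
  no hole and zero latent variables excludes them).\<close>
datatype tm =
    Var vname
  | Lat nat
  | Plus tm tm
  | Scale real tm
  | Const real
  | Pair tm tm
  | Unit
  | Let vname tm tm
  | LetP vname vname tm tm
  | Normal
  | Eq tm tm
  | Hole

type_synonym env = "(vname \<times> ty) list"

text \<open>Typing judgement. \<open>H = Some (\<Gamma>0, \<tau>0)\<close> allows holes expecting a term
  \<open>\<Gamma>0 \<turnstile> - : \<tau>0\<close>; \<open>r\<close> is the number of latent variables in scope.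
  Contexts are lists, most recent binding first.\<close>
inductive has_ty :: "(env \<times> ty) option \<Rightarrow> nat \<Rightarrow> env \<Rightarrow> tm \<Rightarrow> ty \<Rightarrow> bool" where
  T_Var: "map_of \<Gamma> x = Some \<tau> \<Longrightarrow> has_ty H r \<Gamma> (Var x) \<tau>"
| T_Lat: "i < r \<Longrightarrow> has_ty H r \<Gamma> (Lat i) TR"
| T_Plus: "has_ty H r \<Gamma> e1 TR \<Longrightarrow> has_ty H r \<Gamma> e2 TR \<Longrightarrow> has_ty H r \<Gamma> (Plus e1 e2) TR"
| T_Scale: "has_ty H r \<Gamma> e TR \<Longrightarrow> has_ty H r \<Gamma> (Scale \<alpha> e) TR"
| T_Const: "has_ty H r \<Gamma> (Const \<beta>) TR"
| T_Pair: "has_ty H r \<Gamma> e1 \<tau>1 \<Longrightarrow> has_ty H r \<Gamma> e2 \<tau>2 \<Longrightarrow> has_ty H r \<Gamma> (Pair e1 e2) (TProd \<tau>1 \<tau>2)"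
| T_Unit: "has_ty H r \<Gamma> Unit TI"
| T_Let: "has_ty H r \<Gamma> e \<tau>1 \<Longrightarrow> has_ty H r ((x,\<tau>1) # \<Gamma>) t \<tau>2 \<Longrightarrow> has_ty H r \<Gamma> (Let x e t) \<tau>2"
| T_LetP: "x \<noteq> y \<Longrightarrow> has_ty H r \<Gamma> e (TProd \<tau>1 \<tau>2) \<Longrightarrow> has_ty H r ((x,\<tau>1) # (y,\<tau>2) # \<Gamma>) t \<tau>
           \<Longrightarrow> has_ty H r \<Gamma> (LetP x y e t) \<tau>"
| T_Normal: "has_ty H r \<Gamma> Normal TR"
| T_Eq: "has_ty H r \<Gamma> s TR \<Longrightarrow> has_ty H r \<Gamma> t TR \<Longrightarrow> has_ty H r \<Gamma> (Eq s t) TI"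
| T_Hole: "H = Some (\<Gamma>0, \<tau>0) \<Longrightarrow> (\<forall>z \<sigma>. map_of \<Gamma>0 z = Some \<sigma> \<longrightarrow> map_of \<Gamma> z = Some \<sigma>)
           \<Longrightarrow> has_ty H r \<Gamma> Hole \<tau>0"

fun holes :: "tm \<Rightarrow> nat" where
  "holes Hole = 1"
| "holes (Plus a b) = holes a + holes b"
| "holes (Scale _ a) = holes a"
| "holes (Pair a b) = holes a + holes b"
| "holes (Let _ a b) = holes a + holes b"
| "holes (LetP _ _ a b) = holes a + holes b"
| "holes (Eq a b) = holes a + holes b"
| "holes _ = 0"

text \<open>Plugging a term into a context (not capture-avoiding, as usual).\<close>
fun fill :: "tm \<Rightarrow> tm \<Rightarrow> tm" where
  "fill Hole e = e"
| "fill (Plus a b) e = Plus (fill a e) (fill b e)"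
| "fill (Scale \<alpha> a) e = Scale \<alpha> (fill a e)"
| "fill (Pair a b) e = Pair (fill a e) (fill b e)"
| "fill (Let x a b) e = Let x (fill a e) (fill b e)"
| "fill (LetP x y a b) e = LetP x y (fill a e) (fill b e)"
| "fill (Eq a b) e = Eq (fill a e) (fill b e)"
| "fill t e = t"

inductive is_val :: "tm \<Rightarrow> bool" where
  "is_val (Var x)"
| "is_val (Lat i)"
| "is_val v \<Longrightarrow> is_val w \<Longrightarrow> is_val (Pair v w)"
| "is_val v \<Longrightarrow> is_val w \<Longrightarrow> is_val (Plus v w)"
| "is_val v \<Longrightarrow> is_val (Scale \<alpha> v)"
| "is_val (Const \<beta>)"
| "is_val Unit"

text \<open>Substitution of a value (closed apart from latent variables).\<close>
fun subst :: "vname \<Rightarrow> tm \<Rightarrow> tm \<Rightarrow> tm" where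
  "subst x v (Var y) = (if x = y then v else Var y)"
| "subst x v (Plus a b) = Plus (subst x v a) (subst x v b)"
| "subst x v (Scale \<alpha> a) = Scale \<alpha> (subst x v a)"
| "subst x v (Pair a b) = Pair (subst x v a) (subst x v b)"
| "subst x v (Let y a b) = Let y (subst x v a) (if x = y then b else subst x v b)"
| "subst x v (LetP y z a b) = LetP y z (subst x v a) (if x = y \<or> x = z then b else subst x v b)"
| "subst x v (Eq a b) = Eq (subst x v a) (subst x v b)"
| "subst x v t = t"

text \<open>Gaussian distributions on R^r, given by mean vector and covariance matrix.\<close>
type_synonym gauss = "real vec \<times> real mat"

definition gauss0 :: gauss where
  "gauss0 = (0\<^sub>v 0, 0\<^sub>m 0 0)"

text \<open>\<open>\<psi> \<otimes> N(0,1)\<close>\<close>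
definition gauss_ext :: "gauss \<Rightarrow> gauss" where
  "gauss_ext \<psi> = (let (\<mu>, \<Sigma>) = \<psi>; r = dim_vec \<mu> in
     (\<mu> @\<^sub>v vec 1 (\<lambda>_. 0), four_block_mat \<Sigma> (0\<^sub>m r 1) (0\<^sub>m 1 r) (1\<^sub>m 1)))"

text \<open>Affine form \<open>u x + b\<close> of a (real-typed) value in the latent variables.\<close>
fun lin :: "nat \<Rightarrow> tm \<Rightarrow> real vec" where
  "lin r (Lat i) = unit_vec r i"
| "lin r (Plus a b) = lin r a + lin r b"
| "lin r (Scale \<alpha> a) = \<alpha> \<cdot>\<^sub>v lin r a"
| "lin r _ = 0\<^sub>v r"

fun cst :: "tm \<Rightarrow> real" where
  "cst (Plus a b) = cst a + cst b"
| "cst (Scale \<alpha> a) = \<alpha> * cst a"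
| "cst (Const \<beta>) = \<beta>"
| "cst _ = 0"

definition col_mat :: "real vec \<Rightarrow> real mat" where
  "col_mat u = mat (dim_vec u) 1 (\<lambda>(i, j). u $ i)"

definition row_mat :: "real vec \<Rightarrow> real mat" where
  "row_mat u = mat 1 (dim_vec u) (\<lambda>(i, j). u $ j)"

datatype config = Bot | Conf tm gauss

fun cmap :: "(tm \<Rightarrow> tm) \<Rightarrow> config \<Rightarrow> config" where
  "cmap f Bot = Bot"
| "cmap f (Conf e \<psi>) = Conf (f e) \<psi>"

text \<open>Result of the redex \<open>v =:= w\<close> in state \<open>\<psi>\<close>: condition on \<open>u X = -b\<close>.\<close>
definition cond_step :: "tm \<Rightarrow> tm \<Rightarrow> gauss \<Rightarrow> config" where
  "cond_step v w \<psi> = (let (\<mu>, \<Sigma>) = \<psi>; r = dim_vec \<mu>;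
      u = lin r v - lin r w; b = cst v - cst w; \<sigma> = u \<bullet> (\<Sigma> *\<^sub>v u) in
      if \<sigma> = 0 then (if - b = u \<bullet> \<mu> then Conf Unit \<psi> else Bot)
      else Conf Unit (\<mu> + ((- b - u \<bullet> \<mu>) / \<sigma>) \<cdot>\<^sub>v (\<Sigma> *\<^sub>v u),
                      \<Sigma> - (1 / \<sigma>) \<cdot>\<^sub>m (\<Sigma> * col_mat u * row_mat u * \<Sigma>)))"

inductive step :: "tm \<Rightarrow> gauss \<Rightarrow> config \<Rightarrow> bool" where
  S_Normal: "step Normal \<psi> (Conf (Lat (dim_vec (fst \<psi>))) (gauss_ext \<psi>))"
| S_Eq: "is_val v \<Longrightarrow> is_val w \<Longrightarrow> step (Eq v w) \<psi> (cond_step v w \<psi>)"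
| S_Let: "is_val v \<Longrightarrow> step (Let x v t) \<psi> (Conf (subst x v t) \<psi>)"
| S_LetP: "is_val v1 \<Longrightarrow> is_val v2 \<Longrightarrow>
           step (LetP x y (Pair v1 v2) t) \<psi> (Conf (subst x v1 (subst y v2 t)) \<psi>)"
| C_PlusL: "step e \<psi> c \<Longrightarrow> step (Plus e e2) \<psi> (cmap (\<lambda>e'. Plus e' e2) c)"
| C_PlusR: "is_val v \<Longrightarrow> step e \<psi> c \<Longrightarrow> step (Plus v e) \<psi> (cmap (Plus v) c)"
| C_PairL: "step e \<psi> c \<Longrightarrow> step (Pair e e2) \<psi> (cmap (\<lambda>e'. Pair e' e2) c)"
| C_PairR: "is_val v \<Longrightarrow> step e \<psi> c \<Longrightarrow> step (Pair v e) \<psi> (cmap (Pair v) c)"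
| C_EqL: "step e \<psi> c \<Longrightarrow> step (Eq e e2) \<psi> (cmap (\<lambda>e'. Eq e' e2) c)"
| C_EqR: "is_val v \<Longrightarrow> step e \<psi> c \<Longrightarrow> step (Eq v e) \<psi> (cmap (Eq v) c)"
| C_Scale: "step e \<psi> c \<Longrightarrow> step (Scale \<alpha> e) \<psi> (cmap (Scale \<alpha>) c)"
| C_Let: "step e \<psi> c \<Longrightarrow> step (Let x e t) \<psi> (cmap (\<lambda>e'. Let x e' t) c)"
| C_LetP: "step e \<psi> c \<Longrightarrow> step (LetP x y e t) \<psi> (cmap (\<lambda>e'. LetP x y e' t) c)"

inductive cstep :: "config \<Rightarrow> config \<Rightarrow> bool" where
  "step e \<psi> c \<Longrightarrow> cstep (Conf e \<psi>) c"

abbreviation steps :: "config \<Rightarrow> config \<Rightarrow> bool" where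
  "steps \<equiv> cstep\<^sup>*\<^sup>*"

fun flat :: "tm \<Rightarrow> tm list" where
  "flat (Pair a b) = flat a @ flat b"
| "flat Unit = []"
| "flat v = [v]"

definition push :: "tm \<Rightarrow> gauss \<Rightarrow> gauss" where
  "push v \<psi> = (let (\<mu>, \<Sigma>) = \<psi>; r = dim_vec \<mu>; fl = flat v;
      A = mat (length fl) r (\<lambda>(i, j). lin r (fl ! i) $ j);
      b = vec (length fl) (\<lambda>i. cst (fl ! i)) in
      (A *\<^sub>v \<mu> + b, A * \<Sigma> * transpose_mat A))"

definition ctx_equiv :: "env \<Rightarrow> ty \<Rightarrow> tm \<Rightarrow> tm \<Rightarrow> bool" where
  "ctx_equiv \<Gamma> \<tau> e1 e2 \<longleftrightarrow>
     (\<forall>K \<sigma>. has_ty (Some (\<Gamma>, \<tau>)) 0 [] K \<sigma> \<and> holes K = 1 \<longrightarrow>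
        (steps (Conf (fill K e1) gauss0) Bot \<longleftrightarrow> steps (Conf (fill K e2) gauss0) Bot) \<and>
        (\<forall>v1 \<psi>1 v2 \<psi>2. steps (Conf (fill K e1) gauss0) (Conf v1 \<psi>1) \<and> is_val v1 \<and>
                        steps (Conf (fill K e2) gauss0) (Conf v2 \<psi>2) \<and> is_val v2 \<longrightarrow>
                        push v1 \<psi>1 = push v2 \<psi>2))"

text \<open>A morphism \<open>(A, b, \<Sigma>) : m \<rightarrow> n\<close>, \<open>x \<mapsto> A x + b + N(0, \<Sigma>)\<close>.\<close>
type_synonym gm = "real mat \<times> real vec \<times> real mat"

definition psd :: "real mat \<Rightarrow> bool" where
  "psd S \<longleftrightarrow> transpose_mat S = S \<and> (\<forall>x \<in> carrier_vec (dim_row S). 0 \<le> x \<bullet> (S *\<^sub>v x))"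

definition is_gm :: "nat \<Rightarrow> nat \<Rightarrow> gm \<Rightarrow> bool" where
  "is_gm m n f = (case f of (A, b, S) \<Rightarrow>
     A \<in> carrier_mat n m \<and> b \<in> carrier_vec n \<and> S \<in> carrier_mat n n \<and> psd S)"

definition gcomp :: "gm \<Rightarrow> gm \<Rightarrow> gm" where
  "gcomp f g = (case f of (A, b, S) \<Rightarrow> case g of (C, d, X) \<Rightarrow>
     (A * C, A *\<^sub>v d + b, A * X * transpose_mat A + S))"

definition gtensor :: "gm \<Rightarrow> gm \<Rightarrow> gm" where
  "gtensor f g = (case f of (A1, b1, S1) \<Rightarrow> case g of (A2, b2, S2) \<Rightarrow>
     (four_block_mat A1 (0\<^sub>m (dim_row A1) (dim_col A2)) (0\<^sub>m (dim_row A2) (dim_col A1)) A2,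
      b1 @\<^sub>v b2,
      four_block_mat S1 (0\<^sub>m (dim_row S1) (dim_col S2)) (0\<^sub>m (dim_row S2) (dim_col S1)) S2))"

definition gdet :: "real mat \<Rightarrow> real vec \<Rightarrow> gm" where
  "gdet A b = (A, b, 0\<^sub>m (dim_vec b) (dim_vec b))"

definition gid :: "nat \<Rightarrow> gm" where
  "gid n = gdet (1\<^sub>m n) (0\<^sub>v n)"

definition gcopy :: "nat \<Rightarrow> gm" where
  "gcopy n = gdet (four_block_mat (1\<^sub>m n) (0\<^sub>m n 0) (1\<^sub>m n) (0\<^sub>m n 0)) (0\<^sub>v (2 * n))"

definition proj_mat :: "nat \<Rightarrow> nat \<Rightarrow> nat \<Rightarrow> real mat" where
  "proj_mat m off s = mat s m (\<lambda>(i, j). if j = off + i then 1 else 0)"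

definition gpoint :: "real vec \<Rightarrow> gm" where
  "gpoint ob = gdet (0\<^sub>m (dim_vec ob) 0) ob"

text \<open>A morphism \<open>(K, f, ob) : X \<leadsto> Y\<close> with \<open>f : X \<rightarrow> Y \<otimes> K\<close>, \<open>ob : I \<rightarrow> K\<close> deterministic,
  represented by \<open>(f, ob)\<close> with \<open>K = dim_vec ob\<close>.\<close>
type_synonym cm = "gm \<times> real vec"

definition cJ :: "gm \<Rightarrow> cm" where
  "cJ f = (f, 0\<^sub>v 0)"

definition cid :: "nat \<Rightarrow> cm" where
  "cid n = cJ (gid n)"

definition cbullet :: "cm \<Rightarrow> cm \<Rightarrow> cm" (infixl \<open>\<bullet>\<^sub>c\<close> 70) where
  "cbullet F' F = (case F' of (f', ob') \<Rightarrow> case F of (f, ob) \<Rightarrow>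
     (gcomp (gtensor f' (gid (dim_vec ob))) f, ob' @\<^sub>v ob))"

definition cout :: "cm \<Rightarrow> nat" where
  "cout F = (case F of ((A, b, S), ob) \<Rightarrow> dim_vec b - dim_vec ob)"

text \<open>Permutation \<open>Y1 \<otimes> K1 \<otimes> Y2 \<otimes> K2 \<rightarrow> Y1 \<otimes> Y2 \<otimes> K1 \<otimes> K2\<close>.\<close>
definition swap_mid :: "nat \<Rightarrow> nat \<Rightarrow> nat \<Rightarrow> nat \<Rightarrow> real mat" where
  "swap_mid n1 k1 n2 k2 = (let N = n1 + k1 + n2 + k2 in
     mat N N (\<lambda>(i, j). if j = (if i < n1 then i
                          else if i < n1 + n2 then i - n1 + n1 + k1
                          else if i < n1 + n2 + k1 then i - n1 - n2 + n1
                          else i - n1 - n2 - k1 + n1 + k1 + n2) then 1 else 0))"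

definition ctensor :: "cm \<Rightarrow> cm \<Rightarrow> cm" (infixl \<open>\<otimes>\<^sub>c\<close> 71) where
  "ctensor F1 F2 = (case F1 of (f1, ob1) \<Rightarrow> case F2 of (f2, ob2) \<Rightarrow>
     (gcomp (gdet (swap_mid (cout F1) (dim_vec ob1) (cout F2) (dim_vec ob2))
                  (0\<^sub>v (cout F1 + dim_vec ob1 + cout F2 + dim_vec ob2)))
            (gtensor f1 f2),
      ob1 @\<^sub>v ob2))"

definition is_cm :: "nat \<Rightarrow> nat \<Rightarrow> cm \<Rightarrow> bool" where
  "is_cm m n F = (case F of (f, ob) \<Rightarrow> is_gm m (n + dim_vec ob) f)"

text \<open>Inference problems (states \<open>I \<leadsto> N\<close>): \<open>\<psi> : I \<rightarrow> N \<otimes> K\<close>, \<open>ob \<in> R^K\<close>.\<close>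

definition marg_K :: "nat \<Rightarrow> nat \<Rightarrow> gm \<Rightarrow> gm" where
  "marg_K N k \<psi> = gcomp (gdet (proj_mat (N + k) N k) (0\<^sub>v k)) \<psi>"

definition in_support :: "real vec \<Rightarrow> gm \<Rightarrow> bool" where
  "in_support ob \<phi> = (case \<phi> of (A, b, S) \<Rightarrow> \<exists>x \<in> carrier_vec (dim_col S). ob = b + S *\<^sub>v x)"

definition succeeds :: "nat \<Rightarrow> cm \<Rightarrow> bool" where
  "succeeds N P = (case P of (\<psi>, ob) \<Rightarrow> in_support ob (marg_K N (dim_vec ob) \<psi>))"

definition is_conditional :: "nat \<Rightarrow> nat \<Rightarrow> gm \<Rightarrow> gm \<Rightarrow> bool" where
  "is_conditional N k \<psi> c \<longleftrightarrow> is_gm k N c \<and>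
     \<psi> = gcomp (gtensor c (gid k)) (gcomp (gcopy k) (marg_K N k \<psi>))"

definition same_posterior :: "nat \<Rightarrow> cm \<Rightarrow> cm \<Rightarrow> bool" where
  "same_posterior N P1 P2 = (case P1 of (\<psi>1, ob1) \<Rightarrow> case P2 of (\<psi>2, ob2) \<Rightarrow>
     \<forall>c1 c2. is_conditional N (dim_vec ob1) \<psi>1 c1 \<and> is_conditional N (dim_vec ob2) \<psi>2 c2 \<longrightarrow>
        gcomp c1 (gpoint ob1) = gcomp c2 (gpoint ob2))"

text \<open>The equivalence \<open>\<approx>\<close> defining the quotient Cond(Gauss).\<close>
definition cequiv :: "nat \<Rightarrow> nat \<Rightarrow> cm \<Rightarrow> cm \<Rightarrow> bool" where
  "cequiv m n F G \<longleftrightarrow>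
     (\<forall>a \<Psi>. is_cm 0 (a + m) \<Psi> \<longrightarrow>
        (succeeds (a + n) (ctensor (cid a) F \<bullet>\<^sub>c \<Psi>) \<longleftrightarrow> succeeds (a + n) (ctensor (cid a) G \<bullet>\<^sub>c \<Psi>)) \<and>
        (succeeds (a + n) (ctensor (cid a) F \<bullet>\<^sub>c \<Psi>) \<and> succeeds (a + n) (ctensor (cid a) G \<bullet>\<^sub>c \<Psi>) \<longrightarrow>
           same_posterior (a + n) (ctensor (cid a) F \<bullet>\<^sub>c \<Psi>) (ctensor (cid a) G \<bullet>\<^sub>c \<Psi>)))"

fun tdim :: "ty \<Rightarrow> nat" where
  "tdim TR = 1"
| "tdim TI = 0"
| "tdim (TProd a b) = tdim a + tdim b"

definition ctx_dim :: "env \<Rightarrow> nat" where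
  "ctx_dim \<Gamma> = sum_list (map (tdim \<circ> snd) \<Gamma>)"

fun lookup_off :: "env \<Rightarrow> vname \<Rightarrow> (nat \<times> ty) option" where
  "lookup_off [] x = None"
| "lookup_off ((y, \<tau>) # \<Gamma>) x = (if x = y then Some (0, \<tau>)
      else map_option (\<lambda>(off, \<sigma>). (tdim \<tau> + off, \<sigma>)) (lookup_off \<Gamma> x))"

fun infer :: "env \<Rightarrow> tm \<Rightarrow> ty option" where
  "infer \<Gamma> (Var x) = map_of \<Gamma> x"
| "infer \<Gamma> (Lat i) = Some TR"
| "infer \<Gamma> (Plus a b) = Some TR"
| "infer \<Gamma> (Scale \<alpha> a) = Some TR"
| "infer \<Gamma> (Const \<beta>) = Some TR"
| "infer \<Gamma> (Pair a b) = (case (infer \<Gamma> a, infer \<Gamma> b) of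
      (Some \<tau>1, Some \<tau>2) \<Rightarrow> Some (TProd \<tau>1 \<tau>2) | _ \<Rightarrow> None)"
| "infer \<Gamma> Unit = Some TI"
| "infer \<Gamma> (Let x e t) = (case infer \<Gamma> e of Some \<tau>1 \<Rightarrow> infer ((x, \<tau>1) # \<Gamma>) t | None \<Rightarrow> None)"
| "infer \<Gamma> (LetP x y e t) = (case infer \<Gamma> e of
      Some (TProd \<tau>1 \<tau>2) \<Rightarrow> infer ((x, \<tau>1) # (y, \<tau>2) # \<Gamma>) t | _ \<Rightarrow> None)"
| "infer \<Gamma> Normal = Some TR"
| "infer \<Gamma> (Eq a b) = Some TI"
| "infer \<Gamma> Hole = None"

definition gconst :: "nat \<Rightarrow> real \<Rightarrow> real \<Rightarrow> gm" where
  "gconst m \<beta> s = (0\<^sub>m 1 m, vec 1 (\<lambda>_. \<beta>), mat 1 1 (\<lambda>_. s))"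

definition row2 :: "real \<Rightarrow> real \<Rightarrow> real mat" where
  "row2 a b = mat 1 2 (\<lambda>(i, j). if j = 0 then a else b)"

definition cobs :: cm where
  "cobs = (gid 1, 0\<^sub>v 1)"

text \<open>\<open>[[\<Gamma> \<turnstile> e]] : [[\<Gamma>]] \<leadsto> [[\<tau>]]\<close>; the context is interpreted with the most recent
  binding first (a fixed isomorphism away from the paper's ordering).\<close>
fun den :: "env \<Rightarrow> tm \<Rightarrow> cm" where
  "den \<Gamma> (Var x) = (case lookup_off \<Gamma> x of
      Some (off, \<tau>) \<Rightarrow> cJ (gdet (proj_mat (ctx_dim \<Gamma>) off (tdim \<tau>)) (0\<^sub>v (tdim \<tau>)))
    | None \<Rightarrow> cJ (gdet (0\<^sub>m 0 (ctx_dim \<Gamma>)) (0\<^sub>v 0)))"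
| "den \<Gamma> (Plus a b) =
     cJ (gdet (row2 1 1) (0\<^sub>v 1)) \<bullet>\<^sub>c (den \<Gamma> a \<otimes>\<^sub>c den \<Gamma> b) \<bullet>\<^sub>c cJ (gcopy (ctx_dim \<Gamma>))"
| "den \<Gamma> (Scale \<alpha> a) = cJ (gdet (mat 1 1 (\<lambda>_. \<alpha>)) (0\<^sub>v 1)) \<bullet>\<^sub>c den \<Gamma> a"
| "den \<Gamma> (Const \<beta>) = cJ (gconst (ctx_dim \<Gamma>) \<beta> 0)"
| "den \<Gamma> Normal = cJ (gconst (ctx_dim \<Gamma>) 0 1)"
| "den \<Gamma> (Pair a b) = (den \<Gamma> a \<otimes>\<^sub>c den \<Gamma> b) \<bullet>\<^sub>c cJ (gcopy (ctx_dim \<Gamma>))"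
| "den \<Gamma> Unit = cJ (gdet (0\<^sub>m 0 (ctx_dim \<Gamma>)) (0\<^sub>v 0))"
| "den \<Gamma> (Let x e t) = (case infer \<Gamma> e of
      Some \<tau>1 \<Rightarrow> den ((x, \<tau>1) # \<Gamma>) t \<bullet>\<^sub>c (den \<Gamma> e \<otimes>\<^sub>c cid (ctx_dim \<Gamma>)) \<bullet>\<^sub>c cJ (gcopy (ctx_dim \<Gamma>))
    | None \<Rightarrow> cJ (gdet (0\<^sub>m 0 (ctx_dim \<Gamma>)) (0\<^sub>v 0)))"
| "den \<Gamma> (LetP x y e t) = (case infer \<Gamma> e of
      Some (TProd \<tau>1 \<tau>2) \<Rightarrow>
        den ((x, \<tau>1) # (y, \<tau>2) # \<Gamma>) t \<bullet>\<^sub>c (den \<Gamma> e \<otimes>\<^sub>c cid (ctx_dim \<Gamma>)) \<bullet>\<^sub>c cJ (gcopy (ctx_dim \<Gamma>))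
    | _ \<Rightarrow> cJ (gdet (0\<^sub>m 0 (ctx_dim \<Gamma>)) (0\<^sub>v 0)))"
| "den \<Gamma> (Eq s t) =
     cobs \<bullet>\<^sub>c cJ (gdet (row2 1 (-1)) (0\<^sub>v 1)) \<bullet>\<^sub>c (den \<Gamma> s \<otimes>\<^sub>c den \<Gamma> t) \<bullet>\<^sub>c cJ (gcopy (ctx_dim \<Gamma>))"
| "den \<Gamma> (Lat i) = cJ (gdet (0\<^sub>m 0 (ctx_dim \<Gamma>)) (0\<^sub>v 0))"
| "den \<Gamma> Hole = cJ (gdet (0\<^sub>m 0 (ctx_dim \<Gamma>)) (0\<^sub>v 0))"

end

theory Submission
  imports Defs
begin

text \<open>
  A closed program amounts to a tuple of affine functionals of a standard normal vector (its value)
  together with affine functionals that are required to vanish (its conditions). The operational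
  state is always the standard Gaussian conditioned on the solution space of the conditions met so
  far: its mean is the least-norm solution and its covariance an orthogonal projection. The
  denotation, whose covariance has the form \<open>M M\<^sup>T\<close>, is generated by the same functionals, so both
  equivalences compare the law of the value given the conditions. Imposing further equations and
  adding independent noise depend on this law only. For a program context, the variables drawn
  before the hole is reached become the auxiliary outputs of an inference problem, which gives one
  direction. Conversely, every covariance matrix factors as \<open>M M\<^sup>T\<close>, hence every inference problem
  is definable by a program context.
\<close>

subsection \<open>Conditioning a standard Gaussian on an affine subspace\<close>

text \<open>The operational semantics conditions equation by equation on a state of growing
  dimension, whereas the denotation collects all observations and conditions once. Both are
  described by the solution set of the equations in the space of all draws, and a standard Gaussian
  conditioned on an affine set depends on that set alone (\<open>stdcond_unique\<close>); neither
  the order nor the redundancy of the equations matters. The other obstacle is that equivalent terms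
  may draw different numbers of variables and impose different numbers of conditions: there is no
  common sample space, and only laws can be compared (\<open>law_eq\<close>). A context must
  therefore act on both programs through data that refer to no sample space: its result and its
  conditions are affine combinations, with fixed weights, of its own draws and of the value in the
  hole. The number of draws is static, since the language has neither branching nor recursion. In a
  factor M of a covariance M M^T the columns stand for draws and the rows for functionals, and the
  orthogonal projection onto a kernel does the work of a pseudo-inverse.\<close>

lemma sym_scalar:
  fixes S :: "real mat"
  assumes "S \<in> carrier_mat n n" "transpose_mat S = S" "x \<in> carrier_vec n" "y \<in> carrier_vec n"
  shows "x \<bullet> (S *\<^sub>v y) = (S *\<^sub>v x) \<bullet> y"
  using transpose_vec_mult_scalar[of S n n y x] assms by simp

lemma sym_matI:
  fixes A B :: "real mat"
  assumes A: "A \<in> carrier_mat n m" and B: "B \<in> carrier_mat n m"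
    and eq: "\<And>x y. x \<in> carrier_vec n \<Longrightarrow> y \<in> carrier_vec m \<Longrightarrow> x \<bullet> (A *\<^sub>v y) = x \<bullet> (B *\<^sub>v y)"
  shows "A = B"
proof (rule eq_matI)
  fix i j assume ij: "i < dim_row B" "j < dim_col B"
  have "unit_vec n i \<bullet> (C *\<^sub>v unit_vec m j) = C $$ (i, j)" if C: "C \<in> carrier_mat n m" for C :: "real mat"
    using ij B C by (simp add: scalar_prod_left_unit[of _ n])
  with eq[of "unit_vec n i" "unit_vec m j"] A B show "A $$ (i, j) = B $$ (i, j)" by simp
qed (use A B in auto)

text \<open>The rank-one downdate of \<open>S\<close> along \<open>S u\<close>, which is the new
  covariance in \<open>cond_step\<close>. The same formula is a Gram-Schmidt step when
  \<open>S\<close> is a projection and an elimination step with a pivot when \<open>S\<close> is a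
  general covariance; it serves in all three roles.\<close>

definition deflate :: "real mat \<Rightarrow> real vec \<Rightarrow> real mat" where
  "deflate S u = S - (1 / (u \<bullet> (S *\<^sub>v u))) \<cdot>\<^sub>m (S * col_mat u * row_mat u * S)"

text \<open>Symmetry identifies the row vector u^T S with \<open>S u\<close>, so the product is the
  outer square of \<open>S u\<close>.\<close>

lemma rank_one_index:
  fixes S :: "real mat"
  assumes S: "S \<in> carrier_mat n n" and sym: "transpose_mat S = S" and u: "u \<in> carrier_vec n"
    and ij: "i < n" "j < n"
  shows "(S * col_mat u * row_mat u * S) $$ (i, j) = (S *\<^sub>v u) $ i * (S *\<^sub>v u) $ j"
proof -
  have c: "col_mat u \<in> carrier_mat n 1" and r: "row_mat u \<in> carrier_mat 1 n"
    using u by (auto simp: col_mat_def row_mat_def)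
  have "S * col_mat u * row_mat u * S = (S * col_mat u) * (row_mat u * S)"
    using S c r by (subst assoc_mult_mat[of _ n 1 _ n _ n]) auto
  moreover have "((S * col_mat u) * (row_mat u * S)) $$ (i, j)
      = (S * col_mat u) $$ (i, 0) * (row_mat u * S) $$ (0, j)"
    using S c r ij by (simp add: scalar_prod_def)
  moreover have "(S * col_mat u) $$ (i, 0) = (S *\<^sub>v u) $ i"
    using S c u ij by (simp add: col_mat_def scalar_prod_def)
  moreover have "(row_mat u * S) $$ (0, j) = (S *\<^sub>v u) $ j"
  proof -
    have "(row_mat u * S) $$ (0, j) = u \<bullet> col S j"
      using S r u ij by (simp add: row_mat_def scalar_prod_def)
    also have "col S j = row S j" using sym S ij by (metis carrier_matD(1) row_transpose carrier_matD(2))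
    also have "u \<bullet> row S j = (S *\<^sub>v u) $ j" using S u ij by (simp add: comm_scalar_prod[of u n])
    finally show ?thesis .
  qed
  ultimately show ?thesis by simp
qed

lemma deflate_carrier: "S \<in> carrier_mat n n \<Longrightarrow> deflate S u \<in> carrier_mat n n"
  by (auto simp: deflate_def)

lemma deflate_index:
  fixes S :: "real mat"
  assumes S: "S \<in> carrier_mat n n" and sym: "transpose_mat S = S" and u: "u \<in> carrier_vec n"
    and ij: "i < n" "j < n"
  shows "deflate S u $$ (i, j) = S $$ (i, j) - (S *\<^sub>v u) $ i * (S *\<^sub>v u) $ j / (u \<bullet> (S *\<^sub>v u))"
proof -
  have "dim_row (S * col_mat u * row_mat u * S) = n" "dim_col (S * col_mat u * row_mat u * S) = n"
    using S by auto
  then show ?thesis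
    using rank_one_index[OF S sym u ij] ij S by (simp add: deflate_def)
qed

lemma deflate_sym:
  fixes S :: "real mat"
  assumes S: "S \<in> carrier_mat n n" and sym: "transpose_mat S = S" and u: "u \<in> carrier_vec n"
  shows "transpose_mat (deflate S u) = deflate S u"
proof (rule eq_matI)
  note d = deflate_carrier[OF S, of u]
  fix i j assume "i < dim_row (deflate S u)" "j < dim_col (deflate S u)"
  then have ij: "i < n" "j < n" using d by auto
  have "S $$ (i, j) = S $$ (j, i)" using sym S ij by (metis index_transpose_mat(1) carrier_matD)
  then show "transpose_mat (deflate S u) $$ (i, j) = deflate S u $$ (i, j)"
    using deflate_index[OF S sym u] ij d by (simp add: mult.commute)
qed (use deflate_carrier[OF S, of u] in auto)

lemma deflate_mult_vec:
  fixes S :: "real mat"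
  assumes S: "S \<in> carrier_mat n n" and sym: "transpose_mat S = S" and u: "u \<in> carrier_vec n"
    and x: "x \<in> carrier_vec n"
  shows "deflate S u *\<^sub>v x = S *\<^sub>v x - (((S *\<^sub>v u) \<bullet> x) / (u \<bullet> (S *\<^sub>v u))) \<cdot>\<^sub>v (S *\<^sub>v u)"
proof (rule eq_vecI)
  note d = deflate_carrier[OF S, of u]
  let ?s = "u \<bullet> (S *\<^sub>v u)"
  fix i assume "i < dim_vec (S *\<^sub>v x - (((S *\<^sub>v u) \<bullet> x) / ?s) \<cdot>\<^sub>v (S *\<^sub>v u))"
  then have i: "i < n" using S by auto
  have "(deflate S u *\<^sub>v x) $ i = (\<Sum>j<n. deflate S u $$ (i, j) * x $ j)"
    using d x i by (simp add: scalar_prod_def lessThan_atLeast0)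
  also have "\<dots> = (\<Sum>j<n. S $$ (i, j) * x $ j - (S *\<^sub>v u) $ i / ?s * ((S *\<^sub>v u) $ j * x $ j))"
    by (intro sum.cong refl) (simp add: deflate_index[OF S sym u i] algebra_simps)
  also have "\<dots> = (S *\<^sub>v x) $ i - (S *\<^sub>v u) $ i / ?s * ((S *\<^sub>v u) \<bullet> x)"
    unfolding sum_subtractf sum_distrib_left[symmetric]
    using S x i by (simp add: scalar_prod_def lessThan_atLeast0)
  finally show "(deflate S u *\<^sub>v x) $ i = (S *\<^sub>v x - (((S *\<^sub>v u) \<bullet> x) / ?s) \<cdot>\<^sub>v (S *\<^sub>v u)) $ i"
    using i S by simp
qed (use S deflate_carrier[OF S, of u] in auto)

text \<open>Orthogonal projections. Idempotence is stated on vectors, the form in which it is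
  applied.\<close>

definition proj :: "nat \<Rightarrow> real mat \<Rightarrow> bool" where
  "proj r P \<longleftrightarrow> P \<in> carrier_mat r r \<and> transpose_mat P = P \<and>
     (\<forall>x \<in> carrier_vec r. P *\<^sub>v (P *\<^sub>v x) = P *\<^sub>v x)"

text \<open>Under a projection covariance the variance of a functional is a squared length. It
  vanishes only if \<open>P u = 0\<close>, which is how the degenerate case of
  \<open>cond_step\<close> is controlled.\<close>

lemma proj_norm:
  assumes "proj r P" "u \<in> carrier_vec r"
  shows "u \<bullet> (P *\<^sub>v u) = (P *\<^sub>v u) \<bullet> (P *\<^sub>v u)"
  using assms sym_scalar[of P r "P *\<^sub>v u" u] sym_scalar[of P r u u]
  unfolding proj_def by auto

lemma scalar_self_zero:
  fixes v :: "real vec"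
  assumes "v \<in> carrier_vec n" "v \<bullet> v = 0"
  shows "v = 0\<^sub>v n"
proof (rule eq_vecI)
  fix i assume i: "i < dim_vec (0\<^sub>v n :: real vec)"
  have "(\<Sum>i<n. v $ i * v $ i) = 0" using assms by (auto simp: scalar_prod_def lessThan_atLeast0)
  then have "v $ i * v $ i = 0"
    using i by (subst (asm) sum_nonneg_eq_0_iff) auto
  then show "v $ i = 0\<^sub>v n $ i" using i by simp
qed (use assms in auto)

text \<open>With p = P u one has u.p = p.p, so deflating subtracts from \<open>P\<close> the
  orthogonal projection onto the line through p, a line inside the range of \<open>P\<close>. What
  remains projects onto the vectors of that range orthogonal to p.\<close>

lemma proj_deflate:
  assumes P: "proj r P" and u: "u \<in> carrier_vec r" and nz: "u \<bullet> (P *\<^sub>v u) \<noteq> 0"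
  shows "proj r (deflate P u)" and "deflate P u *\<^sub>v u = 0\<^sub>v r"
    and "\<And>x. x \<in> carrier_vec r \<Longrightarrow> deflate P u *\<^sub>v (P *\<^sub>v x) = deflate P u *\<^sub>v x"
    and "\<And>x. x \<in> carrier_vec r \<Longrightarrow> P *\<^sub>v (deflate P u *\<^sub>v x) = deflate P u *\<^sub>v x"
proof -
  have Pc: "P \<in> carrier_mat r r" and sym: "transpose_mat P = P"
    and idem: "\<And>x. x \<in> carrier_vec r \<Longrightarrow> P *\<^sub>v (P *\<^sub>v x) = P *\<^sub>v x"
    using P unfolding proj_def by auto
  define p where "p = P *\<^sub>v u"
  have p: "p \<in> carrier_vec r" using Pc u p_def by auto
  have Pp: "P *\<^sub>v p = p" using idem u p_def by auto
  have up: "u \<bullet> p = p \<bullet> p" using proj_norm[OF P u] p_def by simp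
  have nz': "p \<bullet> p \<noteq> 0" using nz up p_def by simp
  have D: "deflate P u *\<^sub>v x = P *\<^sub>v x - ((p \<bullet> x) / (p \<bullet> p)) \<cdot>\<^sub>v p" if "x \<in> carrier_vec r" for x
    using deflate_mult_vec[OF Pc sym u that] up p_def by simp
  have pP: "p \<bullet> (P *\<^sub>v x) = p \<bullet> x" if "x \<in> carrier_vec r" for x
    using sym_scalar[OF Pc sym p that] Pp by simp
  show 1: "deflate P u *\<^sub>v (P *\<^sub>v x) = deflate P u *\<^sub>v x" if x: "x \<in> carrier_vec r" for x
    using D[of x] D[of "P *\<^sub>v x"] x Pc idem pP by simp
  show 2: "P *\<^sub>v (deflate P u *\<^sub>v x) = deflate P u *\<^sub>v x" if x: "x \<in> carrier_vec r" for x
    using D[OF x] x Pc p idem Pp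
    by (simp add: mult_minus_distrib_mat_vec[of _ r r] mult_mat_vec[of _ r r])
  have Dp: "deflate P u *\<^sub>v p = 0\<^sub>v r" using D[OF p] Pp p nz' by (intro eq_vecI) auto
  show "deflate P u *\<^sub>v u = 0\<^sub>v r" using Dp 1[OF u] p_def by simp
  have "deflate P u *\<^sub>v (deflate P u *\<^sub>v x) = deflate P u *\<^sub>v x" if x: "x \<in> carrier_vec r" for x
  proof -
    have "deflate P u *\<^sub>v (deflate P u *\<^sub>v x)
       = deflate P u *\<^sub>v (P *\<^sub>v x) - ((p \<bullet> x) / (p \<bullet> p)) \<cdot>\<^sub>v (deflate P u *\<^sub>v p)"
      unfolding D[OF x] using deflate_carrier[OF Pc, of u] Pc p x
      by (simp add: mult_minus_distrib_mat_vec[of _ r r] mult_mat_vec[of _ r r])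
    also have "\<dots> = deflate P u *\<^sub>v x"
      unfolding Dp 1[OF x] using deflate_carrier[OF Pc, of u] x by (intro eq_vecI) auto
    finally show ?thesis .
  qed
  then show "proj r (deflate P u)"
    unfolding proj_def using deflate_carrier[OF Pc, of u] deflate_sym[OF Pc sym u] by auto
qed

text \<open>\<open>stdcond r L (\<mu>, P)\<close>: the pair \<open>(\<mu>, P)\<close> is the mean and covariance of a standard Gaussian
  on \<open>R^r\<close> conditioned on the affine subspace \<open>L\<close>: the covariance is the orthogonal projection
  onto the direction of \<open>L\<close>, the mean is the point of \<open>L\<close> of least norm.\<close>
definition stdcond :: "nat \<Rightarrow> real vec set \<Rightarrow> gauss \<Rightarrow> bool" where
  "stdcond r L \<psi> \<longleftrightarrow> proj r (snd \<psi>) \<and> fst \<psi> \<in> carrier_vec r \<and> snd \<psi> *\<^sub>v fst \<psi> = 0\<^sub>v r \<and>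
     L = {\<xi> \<in> carrier_vec r. snd \<psi> *\<^sub>v (\<xi> - fst \<psi>) = \<xi> - fst \<psi>}"

lemma stdcond_mean: "stdcond r L (\<mu>, P) \<Longrightarrow> \<mu> \<in> L"
  unfolding stdcond_def proj_def by auto

text \<open>The range of each projection is the direction of \<open>L\<close>, so each projection
  fixes the range of the other, and by symmetry they coincide. The difference of the means lies in
  this range as a difference of two points of \<open>L\<close>, and is annihilated by the projection
  because both means are; hence it is zero.\<close>

lemma stdcond_unique:
  assumes 1: "stdcond r L (\<mu>, P)" and 2: "stdcond r L (\<nu>, Q)"
  shows "\<mu> = \<nu> \<and> P = Q"
proof -
  have P: "proj r P" "\<mu> \<in> carrier_vec r" "P *\<^sub>v \<mu> = 0\<^sub>v r"
      "L = {\<xi> \<in> carrier_vec r. P *\<^sub>v (\<xi> - \<mu>) = \<xi> - \<mu>}"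
    and Q: "proj r Q" "\<nu> \<in> carrier_vec r" "Q *\<^sub>v \<nu> = 0\<^sub>v r"
      "L = {\<xi> \<in> carrier_vec r. Q *\<^sub>v (\<xi> - \<nu>) = \<xi> - \<nu>}"
    using 1 2 unfolding stdcond_def by auto
  \<comment> \<open>Moving from \<open>\<mu>\<close> by \<open>P x\<close> stays in
    \<open>L\<close>, and the difference of two points of \<open>L\<close> is fixed by
    \<open>Q\<close>.\<close>
  have key: "Q *\<^sub>v (P *\<^sub>v x) = P *\<^sub>v x"
    if P: "proj r P" "\<mu> \<in> carrier_vec r" "L = {\<xi> \<in> carrier_vec r. P *\<^sub>v (\<xi> - \<mu>) = \<xi> - \<mu>}"
    and Q: "proj r Q" "\<nu> \<in> carrier_vec r" "L = {\<xi> \<in> carrier_vec r. Q *\<^sub>v (\<xi> - \<nu>) = \<xi> - \<nu>}"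
    and x: "x \<in> carrier_vec r" for P Q \<mu> \<nu> x
  proof -
    have Pc: "P \<in> carrier_mat r r" and Qc: "Q \<in> carrier_mat r r"
      and idem: "P *\<^sub>v (P *\<^sub>v x) = P *\<^sub>v x" using P Q x unfolding proj_def by auto
    define y where "y = P *\<^sub>v x"
    have y: "y \<in> carrier_vec r" using Pc x y_def by auto
    have "\<mu> + y - \<mu> = y" using y P(2) by (intro eq_vecI) auto
    then have "\<mu> + y \<in> L" using P(3) P(2) y idem y_def by auto
    moreover have "P *\<^sub>v (\<mu> - \<mu>) = \<mu> - \<mu>" using Pc P(2) by (intro eq_vecI) auto
    then have "\<mu> \<in> L" using P by auto
    ultimately have "Q *\<^sub>v (\<mu> + y - \<nu>) = \<mu> + y - \<nu>" "Q *\<^sub>v (\<mu> - \<nu>) = \<mu> - \<nu>"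
      using Q(3) by auto
    moreover have "\<mu> + y - \<nu> = (\<mu> - \<nu>) + y" using y P(2) Q(2) by (intro eq_vecI) auto
    ultimately have "(\<mu> - \<nu>) + Q *\<^sub>v y = (\<mu> - \<nu>) + y"
      using mult_add_distrib_mat_vec[OF Qc, of "\<mu> - \<nu>" y] y P(2) Q(2) by simp
    then have "Q *\<^sub>v y = y"
      using y P(2) Q(2) Qc by (simp add: vec_eq_iff)
    then show ?thesis using y_def by simp
  qed
  have Pc: "P \<in> carrier_mat r r" and Qc: "Q \<in> carrier_mat r r"
    and sP: "transpose_mat P = P" and sQ: "transpose_mat Q = Q" using P Q unfolding proj_def by auto
  have QP: "Q *\<^sub>v (P *\<^sub>v x) = P *\<^sub>v x" if "x \<in> carrier_vec r" for x
    using key[OF P(1,2,4) Q(1,2,4) that] .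
  have PQ: "P *\<^sub>v (Q *\<^sub>v x) = Q *\<^sub>v x" if "x \<in> carrier_vec r" for x
    using key[OF Q(1,2,4) P(1,2,4) that] .
  have eq: "P = Q"
  proof (rule sym_matI[OF Pc Qc])
    fix x y :: "real vec" assume x: "x \<in> carrier_vec r" and y: "y \<in> carrier_vec r"
    have "x \<bullet> (P *\<^sub>v y) = x \<bullet> (Q *\<^sub>v (P *\<^sub>v y))" using QP y by simp
    also have "\<dots> = (Q *\<^sub>v x) \<bullet> (P *\<^sub>v y)" using sym_scalar[OF Qc sQ x] Pc y by simp
    also have "\<dots> = (P *\<^sub>v (Q *\<^sub>v x)) \<bullet> y" using sym_scalar[OF Pc sP _ y] Qc x by simp
    also have "\<dots> = x \<bullet> (Q *\<^sub>v y)" using PQ[OF x] sym_scalar[OF Qc sQ x y] by simp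
    finally show "x \<bullet> (P *\<^sub>v y) = x \<bullet> (Q *\<^sub>v y)" .
  qed
  have "\<nu> \<in> L" using stdcond_mean 2 by auto
  then have "P *\<^sub>v (\<nu> - \<mu>) = \<nu> - \<mu>" using P by auto
  moreover have "P *\<^sub>v (\<nu> - \<mu>) = 0\<^sub>v r"
    using mult_minus_distrib_mat_vec[OF Pc Q(2) P(2)] P(3) Q(3) eq by simp
  ultimately have "\<nu> - \<mu> = 0\<^sub>v r" by simp
  then have "\<mu> = \<nu>" using P(2) Q(2) by (auto simp: vec_eq_iff)
  with eq show ?thesis by simp
qed

text \<open>Correctness of conditioning on one equation. On \<open>L\<close> the displacement from
  \<open>\<mu>\<close> is fixed by \<open>P\<close>, so the functional equals its value at
  \<open>\<mu>\<close> plus the inner product of p = P u with the displacement. If p = 0 it is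
  constant on \<open>L\<close>, and the equation is vacuous or contradictory. Otherwise the equation
  cuts \<open>L\<close> by a hyperplane with normal p, and the least-norm point moves along
  p.\<close>

lemma stdcond_step:
  assumes st: "stdcond r L (\<mu>, P)" and u: "u \<in> carrier_vec r"
  shows "u \<bullet> (P *\<^sub>v u) = 0 \<Longrightarrow> {\<xi> \<in> L. u \<bullet> \<xi> + b = 0} = (if u \<bullet> \<mu> + b = 0 then L else {})"
    and "u \<bullet> (P *\<^sub>v u) = 0 \<Longrightarrow> P *\<^sub>v u = 0\<^sub>v r"
    and "u \<bullet> (P *\<^sub>v u) \<noteq> 0 \<Longrightarrow> stdcond r {\<xi> \<in> L. u \<bullet> \<xi> + b = 0}
       (\<mu> + ((- b - u \<bullet> \<mu>) / (u \<bullet> (P *\<^sub>v u))) \<cdot>\<^sub>v (P *\<^sub>v u), deflate P u)"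
proof -
  have P: "proj r P" and m: "\<mu> \<in> carrier_vec r" and Pm: "P *\<^sub>v \<mu> = 0\<^sub>v r"
    and L: "L = {\<xi> \<in> carrier_vec r. P *\<^sub>v (\<xi> - \<mu>) = \<xi> - \<mu>}"
    using st unfolding stdcond_def by auto
  have Pc: "P \<in> carrier_mat r r" and sym: "transpose_mat P = P"
    and idem: "\<And>x. x \<in> carrier_vec r \<Longrightarrow> P *\<^sub>v (P *\<^sub>v x) = P *\<^sub>v x"
    using P unfolding proj_def by auto
  define p where "p = P *\<^sub>v u"
  have p: "p \<in> carrier_vec r" using Pc u p_def by auto
  have Lp: "u \<bullet> \<xi> = u \<bullet> \<mu> + p \<bullet> (\<xi> - \<mu>)" if "\<xi> \<in> L" for \<xi>
  proof -
    have x: "\<xi> \<in> carrier_vec r" "P *\<^sub>v (\<xi> - \<mu>) = \<xi> - \<mu>" using that L by auto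
    have "p \<bullet> (\<xi> - \<mu>) = u \<bullet> (\<xi> - \<mu>)"
      using sym_scalar[OF Pc sym u, of "\<xi> - \<mu>"] x m p_def by simp
    then show ?thesis using scalar_prod_minus_distrib[OF u x(1) m] by simp
  qed
  show p0: "P *\<^sub>v u = 0\<^sub>v r" if "u \<bullet> (P *\<^sub>v u) = 0"
    using scalar_self_zero[OF p] proj_norm[OF P u] that p_def by simp
  show "{\<xi> \<in> L. u \<bullet> \<xi> + b = 0} = (if u \<bullet> \<mu> + b = 0 then L else {})" if "u \<bullet> (P *\<^sub>v u) = 0"
  proof -
    have "u \<bullet> \<xi> = u \<bullet> \<mu>" if "\<xi> \<in> L" for \<xi>
      using Lp[OF that] p0[OF \<open>u \<bullet> (P *\<^sub>v u) = 0\<close>] p_def that L m by auto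
    then show ?thesis by auto
  qed
  assume nz: "u \<bullet> (P *\<^sub>v u) \<noteq> 0"
  \<comment> \<open>The multiple of p that carries the mean into the hyperplane.\<close>
  define t where "t = (- b - u \<bullet> \<mu>) / (u \<bullet> p)"
  have up: "u \<bullet> p = p \<bullet> p" using proj_norm[OF P u] p_def by simp
  have nz': "p \<bullet> p \<noteq> 0" using nz up p_def by simp
  note D = proj_deflate[OF P u nz]
  define P' where "P' = deflate P u"
  have P': "proj r P'" and P'c: "P' \<in> carrier_mat r r" using D(1) P'_def unfolding proj_def by auto
  have P'x: "P' *\<^sub>v x = P *\<^sub>v x - ((p \<bullet> x) / (p \<bullet> p)) \<cdot>\<^sub>v p" if "x \<in> carrier_vec r" for x
    using deflate_mult_vec[OF Pc sym u that] up p_def P'_def by simp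
  have P'p: "P' *\<^sub>v p = 0\<^sub>v r" using D(2) D(3)[OF u] p_def P'_def by simp
  have P'm: "P' *\<^sub>v \<mu> = 0\<^sub>v r" using D(3)[OF m] Pm P'c P'_def by (auto simp: vec_eq_iff)
  have iff: "\<xi> \<in> L \<and> u \<bullet> \<xi> + b = 0 \<longleftrightarrow> P' *\<^sub>v (\<xi> - (\<mu> + t \<cdot>\<^sub>v p)) = \<xi> - (\<mu> + t \<cdot>\<^sub>v p)"
    if x: "\<xi> \<in> carrier_vec r" for \<xi>
  proof -
    define y where "y = \<xi> - \<mu>"
    have y: "y \<in> carrier_vec r" using x m y_def by auto
    have e: "\<xi> - (\<mu> + t \<cdot>\<^sub>v p) = y - t \<cdot>\<^sub>v p" using x m p y_def by (intro eq_vecI) auto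
    have l: "P' *\<^sub>v (y - t \<cdot>\<^sub>v p) = P' *\<^sub>v y"
      using P'c y p P'p by (simp add: mult_minus_distrib_mat_vec[of _ r r] mult_mat_vec[of _ r r])
        (auto simp: vec_eq_iff)
    have "\<xi> \<in> L \<longleftrightarrow> P *\<^sub>v y = y" using L x y_def by auto
    moreover have "u \<bullet> \<xi> + b = 0 \<longleftrightarrow> p \<bullet> y = t * (p \<bullet> p)" if "\<xi> \<in> L"
    proof -
      have "t * (p \<bullet> p) = - b - u \<bullet> \<mu>" using nz' up unfolding t_def by simp
      then show ?thesis using Lp[OF that] unfolding y_def by auto
    qed
    moreover have "(P *\<^sub>v y = y \<and> p \<bullet> y = t * (p \<bullet> p)) \<longleftrightarrow> P' *\<^sub>v y = y - t \<cdot>\<^sub>v p"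
    proof
      assume "P *\<^sub>v y = y \<and> p \<bullet> y = t * (p \<bullet> p)"
      then show "P' *\<^sub>v y = y - t \<cdot>\<^sub>v p" using P'x[OF y] nz' by simp
    next
      \<comment> \<open>Now y - t p lies in the range of the deflated projection. That range is
        contained in the range of \<open>P\<close>, which gives the first claim, and is orthogonal
        to p, which gives the second.\<close>
      assume a: "P' *\<^sub>v y = y - t \<cdot>\<^sub>v p"
      have "P *\<^sub>v (y - t \<cdot>\<^sub>v p) = y - t \<cdot>\<^sub>v p" using D(4)[OF y] a P'_def by simp
      then have "P *\<^sub>v y - t \<cdot>\<^sub>v p = y - t \<cdot>\<^sub>v p"
        using Pc y p idem[OF u] p_def
        by (simp add: mult_minus_distrib_mat_vec[of _ r r] mult_mat_vec[of _ r r])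
      then have Py: "P *\<^sub>v y = y" using Pc y p by (simp add: vec_eq_iff)
      have "p \<bullet> (P' *\<^sub>v y) = (P' *\<^sub>v p) \<bullet> y"
        using sym_scalar[OF P'c _ p y] P' unfolding proj_def by simp
      then have "p \<bullet> (y - t \<cdot>\<^sub>v p) = 0" using a P'p y by simp
      then have "p \<bullet> y = t * (p \<bullet> p)" using scalar_prod_minus_distrib[OF p y, of "t \<cdot>\<^sub>v p"] p by simp
      with Py show "P *\<^sub>v y = y \<and> p \<bullet> y = t * (p \<bullet> p)" by simp
    qed
    ultimately show ?thesis unfolding e l by auto
  qed
  have "P' *\<^sub>v (\<mu> + t \<cdot>\<^sub>v p) = 0\<^sub>v r"
    using P'c m p P'm P'p by (simp add: mult_add_distrib_mat_vec[of _ r r] mult_mat_vec[of _ r r])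
      (auto simp: vec_eq_iff)
  moreover have "{\<xi> \<in> L. u \<bullet> \<xi> + b = 0} =
      {\<xi> \<in> carrier_vec r. P' *\<^sub>v (\<xi> - (\<mu> + t \<cdot>\<^sub>v p)) = \<xi> - (\<mu> + t \<cdot>\<^sub>v p)}"
    using iff L by auto
  ultimately show "stdcond r {\<xi> \<in> L. u \<bullet> \<xi> + b = 0}
       (\<mu> + ((- b - u \<bullet> \<mu>) / (u \<bullet> (P *\<^sub>v u))) \<cdot>\<^sub>v (P *\<^sub>v u), deflate P u)"
    using P' m p unfolding stdcond_def p_def[symmetric] t_def P'_def by auto
qed

subsection \<open>Joint laws of affine functionals\<close>

lemma sym_scalar_swap:
  fixes S :: "real mat"
  assumes "S \<in> carrier_mat n n" "transpose_mat S = S" "x \<in> carrier_vec n" "y \<in> carrier_vec n"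
  shows "x \<bullet> (S *\<^sub>v y) = y \<bullet> (S *\<^sub>v x)"
  using sym_scalar[OF assms] comm_scalar_prod[of "S *\<^sub>v x" n y] assms by simp

text \<open>Only the values on \<open>carrier_vec r\<close> are constrained, since a functional of
  this type is also defined on vectors of other dimensions.\<close>

definition affv :: "nat \<Rightarrow> (real vec \<Rightarrow> real) \<Rightarrow> bool" where
  "affv r f \<longleftrightarrow> (\<exists>u \<in> carrier_vec r. \<exists>b. \<forall>\<xi> \<in> carrier_vec r. f \<xi> = u \<bullet> \<xi> + b)"

text \<open>Recovers the coefficient vector from the values of the function, so that no choice of
  coefficients has to be carried along; it depends only on the values on
  \<open>carrier_vec r\<close> (\<open>lpart_cong\<close>).\<close>

definition lpart :: "nat \<Rightarrow> (real vec \<Rightarrow> real) \<Rightarrow> real vec" where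
  "lpart r f = vec r (\<lambda>i. f (unit_vec r i) - f (0\<^sub>v r))"

lemma lpart_carrier [simp]: "lpart r f \<in> carrier_vec r"
  by (simp add: lpart_def)

lemma lpart_eqI:
  assumes "u \<in> carrier_vec r" "\<And>\<xi>. \<xi> \<in> carrier_vec r \<Longrightarrow> f \<xi> = u \<bullet> \<xi> + b"
  shows "lpart r f = u"
  using assms by (intro eq_vecI) (auto simp: lpart_def)

lemma affv_lpart:
  assumes "affv r f" "\<xi> \<in> carrier_vec r"
  shows "f \<xi> = lpart r f \<bullet> \<xi> + f (0\<^sub>v r)"
proof -
  from assms(1) obtain u b where u: "u \<in> carrier_vec r"
    and f: "\<And>\<xi>. \<xi> \<in> carrier_vec r \<Longrightarrow> f \<xi> = u \<bullet> \<xi> + b" unfolding affv_def by blast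
  have "f (0\<^sub>v r) = b" using f[of "0\<^sub>v r"] u by simp
  then show ?thesis using lpart_eqI[OF u f] f[OF assms(2)] by simp
qed

lemma lpart_cong:
  assumes "\<And>\<xi>. \<xi> \<in> carrier_vec r \<Longrightarrow> f \<xi> = g \<xi>"
  shows "lpart r f = lpart r g"
  using assms by (auto simp: lpart_def)

text \<open>Pushforward along the affine map with components \<open>fs\<close>: the counterpart of
  \<open>push\<close> for functionals instead of terms.\<close>

definition pushf :: "nat \<Rightarrow> (real vec \<Rightarrow> real) list \<Rightarrow> gauss \<Rightarrow> gauss" where
  "pushf r fs \<psi> = (vec (length fs) (\<lambda>i. (fs ! i) (fst \<psi>)),
     mat (length fs) (length fs) (\<lambda>(i, j). lpart r (fs ! i) \<bullet> (snd \<psi> *\<^sub>v lpart r (fs ! j))))"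

lemma pushf_cong:
  assumes "length fs = length gs" "fst \<psi> \<in> carrier_vec r"
    and "\<And>i \<xi>. i < length fs \<Longrightarrow> \<xi> \<in> carrier_vec r \<Longrightarrow> (fs ! i) \<xi> = (gs ! i) \<xi>"
  shows "pushf r fs \<psi> = pushf r gs \<psi>"
proof -
  have "lpart r (fs ! i) = lpart r (gs ! i)" if "i < length gs" for i
    using assms that by (intro lpart_cong) auto
  then show ?thesis unfolding pushf_def using assms by (auto intro!: eq_vecI eq_matI)
qed

text \<open>The law of \<open>fs\<close> for a standard Gaussian conditioned on \<open>L\<close>. It
  is a relation because no law exists when \<open>L\<close> is empty; where a law exists, it is
  unique.\<close>

definition has_law :: "nat \<Rightarrow> real vec set \<Rightarrow> (real vec \<Rightarrow> real) list \<Rightarrow> gauss \<Rightarrow> bool" where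
  "has_law r L fs G \<longleftrightarrow> (\<exists>\<psi>. stdcond r L \<psi> \<and> pushf r fs \<psi> = G)"

lemma has_law_unique:
  assumes "has_law r L fs G" "has_law r L fs G'"
  shows "G = G'"
proof -
  from assms obtain \<psi> \<psi>' where "stdcond r L \<psi>" "pushf r fs \<psi> = G" "stdcond r L \<psi>'" "pushf r fs \<psi>' = G'"
    unfolding has_law_def by blast
  moreover from this have "\<psi> = \<psi>'" using stdcond_unique[of r L "fst \<psi>" "snd \<psi>" "fst \<psi>'" "snd \<psi>'"]
    by (simp add: prod_eq_iff)
  ultimately show ?thesis by simp
qed

lemma has_law_nonempty:
  assumes "has_law r L fs G"
  shows "L \<noteq> {}"
proof -
  from assms obtain \<psi> where "stdcond r L \<psi>" unfolding has_law_def by blast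
  then show ?thesis using stdcond_mean[of r L "fst \<psi>" "snd \<psi>"] by auto
qed

lemma has_law_cong:
  assumes law: "has_law r L fs G" and len: "length fs = length gs"
    and eq: "\<And>i \<xi>. i < length fs \<Longrightarrow> \<xi> \<in> carrier_vec r \<Longrightarrow> (fs ! i) \<xi> = (gs ! i) \<xi>"
  shows "has_law r L gs G"
proof -
  from law obtain \<psi> where st: "stdcond r L \<psi>" and G: "pushf r fs \<psi> = G"
    unfolding has_law_def by blast
  have "fst \<psi> \<in> carrier_vec r" using st unfolding stdcond_def by simp
  then have "pushf r gs \<psi> = G" using pushf_cong[OF len _ eq] G by simp
  with st show ?thesis unfolding has_law_def by blast
qed

text \<open>The weights are separated from the functionals so that one and the same combination can
  be formed on two different sample spaces.\<close>

definition lcomb :: "(nat \<Rightarrow> real) \<Rightarrow> real \<Rightarrow> (real vec \<Rightarrow> real) list \<Rightarrow> real vec \<Rightarrow> real" where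
  "lcomb w b fs \<xi> = (\<Sum>i<length fs. w i * (fs ! i) \<xi>) + b"

lemma lcomb_affv:
  fixes w :: "nat \<Rightarrow> real"
  assumes aff: "\<And>f. f \<in> set fs \<Longrightarrow> affv r f"
  defines "u \<equiv> vec r (\<lambda>k. \<Sum>i<length fs. w i * lpart r (fs ! i) $ k)"
  shows "lpart r (lcomb w b fs) = u"
    and "\<And>\<xi>. \<xi> \<in> carrier_vec r \<Longrightarrow> u \<bullet> \<xi> = (\<Sum>i<length fs. w i * (lpart r (fs ! i) \<bullet> \<xi>))"
    and "\<And>\<xi>. \<xi> \<in> carrier_vec r \<Longrightarrow>
      lcomb w b fs \<xi> = u \<bullet> \<xi> + ((\<Sum>i<length fs. w i * (fs ! i) (0\<^sub>v r)) + b)"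
    and "affv r (lcomb w b fs)"
proof -
  show 1: "u \<bullet> \<xi> = (\<Sum>i<length fs. w i * (lpart r (fs ! i) \<bullet> \<xi>))" if "\<xi> \<in> carrier_vec r" for \<xi>
  proof -
    have "u \<bullet> \<xi> = (\<Sum>k<r. \<Sum>i<length fs. w i * (lpart r (fs ! i) $ k * \<xi> $ k))"
      using that by (simp add: u_def scalar_prod_def lessThan_atLeast0 sum_distrib_right mult.assoc)
    also have "\<dots> = (\<Sum>i<length fs. \<Sum>k<r. w i * (lpart r (fs ! i) $ k * \<xi> $ k))" by (rule sum.swap)
    also have "\<dots> = (\<Sum>i<length fs. w i * (lpart r (fs ! i) \<bullet> \<xi>))"
      using that by (simp add: scalar_prod_def lessThan_atLeast0 sum_distrib_left)
    finally show ?thesis .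
  qed
  show 2: "lcomb w b fs \<xi> = u \<bullet> \<xi> + ((\<Sum>i<length fs. w i * (fs ! i) (0\<^sub>v r)) + b)"
    if "\<xi> \<in> carrier_vec r" for \<xi>
  proof -
    have "(\<Sum>i<length fs. w i * (fs ! i) \<xi>)
      = (\<Sum>i<length fs. w i * (lpart r (fs ! i) \<bullet> \<xi>) + w i * (fs ! i) (0\<^sub>v r))"
    proof (intro sum.cong refl)
      fix i assume "i \<in> {..<length fs}"
      then have "(fs ! i) \<xi> = lpart r (fs ! i) \<bullet> \<xi> + (fs ! i) (0\<^sub>v r)"
        using aff that by (intro affv_lpart) auto
      then show "w i * (fs ! i) \<xi> = w i * (lpart r (fs ! i) \<bullet> \<xi>) + w i * (fs ! i) (0\<^sub>v r)"
        by (metis distrib_left)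
    qed
    then show ?thesis unfolding lcomb_def 1[OF that] by (simp add: sum.distrib)
  qed
  have u: "u \<in> carrier_vec r" by (simp add: u_def)
  show "lpart r (lcomb w b fs) = u" by (rule lpart_eqI[OF u 2])
  show "affv r (lcomb w b fs)" unfolding affv_def using u 2 by blast
qed

text \<open>Equality of conditional laws; impossible conditions are identified.\<close>
definition law_eq ::
  "nat \<Rightarrow> real vec set \<Rightarrow> (real vec \<Rightarrow> real) list \<Rightarrow> nat \<Rightarrow> real vec set \<Rightarrow> (real vec \<Rightarrow> real) list \<Rightarrow> bool" where
  "law_eq r1 L1 fs1 r2 L2 fs2 \<longleftrightarrow>
     (L1 = {} \<and> L2 = {}) \<or> (\<exists>G. has_law r1 L1 fs1 G \<and> has_law r2 L2 fs2 G)"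

text \<open>Mean and covariance of the combinations are computed from the weights and from mean and
  covariance of \<open>fs\<close> alone. Both sides use the same weights, so equality of the laws is
  inherited.\<close>

lemma law_eq_out:
  assumes eq: "law_eq r1 L1 fs1 r2 L2 fs2"
    and len: "length fs1 = n" "length fs2 = n" "length hs1 = N" "length hs2 = N"
    and aff: "\<And>f. f \<in> set fs1 \<Longrightarrow> affv r1 f" "\<And>f. f \<in> set fs2 \<Longrightarrow> affv r2 f"
    and h1: "\<And>i \<xi>. i < N \<Longrightarrow> \<xi> \<in> carrier_vec r1 \<Longrightarrow> (hs1 ! i) \<xi> = lcomb (w i) (b i) fs1 \<xi>"
    and h2: "\<And>i \<xi>. i < N \<Longrightarrow> \<xi> \<in> carrier_vec r2 \<Longrightarrow> (hs2 ! i) \<xi> = lcomb (w i) (b i) fs2 \<xi>"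
  shows "law_eq r1 L1 hs1 r2 L2 hs2"
proof -
  \<comment> \<open>The right-hand side depends on the sample space only through
    \<open>pushf r fs \<psi>\<close>.\<close>
  have P: "pushf r hs \<psi> = (vec N (\<lambda>i. (\<Sum>k<n. w i k * fst (pushf r fs \<psi>) $ k) + b i),
      mat N N (\<lambda>(i, j). \<Sum>k<n. w i k * (\<Sum>l<n. w j l * snd (pushf r fs \<psi>) $$ (k, l))))"
    if st: "stdcond r L \<psi>" and len: "length fs = n" "length hs = N"
      and aff: "\<And>f. f \<in> set fs \<Longrightarrow> affv r f"
      and h: "\<And>i \<xi>. i < N \<Longrightarrow> \<xi> \<in> carrier_vec r \<Longrightarrow> (hs ! i) \<xi> = lcomb (w i) (b i) fs \<xi>"
    for r L \<psi> fs hs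
  proof -
    have m: "fst \<psi> \<in> carrier_vec r" and S: "snd \<psi> \<in> carrier_mat r r"
      and sym: "transpose_mat (snd \<psi>) = snd \<psi>"
      using st unfolding stdcond_def proj_def by auto
    have "lpart r (hs ! i) \<bullet> (snd \<psi> *\<^sub>v lpart r (hs ! j))
       = (\<Sum>k<n. w i k * (\<Sum>l<n. w j l * (lpart r (fs ! k) \<bullet> (snd \<psi> *\<^sub>v lpart r (fs ! l)))))"
      if ij: "i < N" "j < N" for i j
    proof -
      have li: "lpart r (hs ! i) = lpart r (lcomb (w i) (b i) fs)" if "i < N" for i
        using h[OF that] by (rule lpart_cong)
      have dot: "lpart r (hs ! i) \<bullet> y = (\<Sum>k<n. w i k * (lpart r (fs ! k) \<bullet> y))"
        if "i < N" "y \<in> carrier_vec r" for i y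
        using lcomb_affv(1,2)[where fs = fs and w = "w i" and r = r, OF aff] that len li by simp
      have "lpart r (fs ! k) \<bullet> (snd \<psi> *\<^sub>v lpart r (hs ! j))
         = (\<Sum>l<n. w j l * (lpart r (fs ! k) \<bullet> (snd \<psi> *\<^sub>v lpart r (fs ! l))))" for k
      proof -
        have "lpart r (fs ! k) \<bullet> (snd \<psi> *\<^sub>v lpart r (hs ! j)) = lpart r (hs ! j) \<bullet> (snd \<psi> *\<^sub>v lpart r (fs ! k))"
          by (rule sym_scalar_swap[OF S sym]) auto
        also have "\<dots> = (\<Sum>l<n. w j l * (lpart r (fs ! l) \<bullet> (snd \<psi> *\<^sub>v lpart r (fs ! k))))"
          using dot[OF ij(2)] S by simp
        also have "\<dots> = (\<Sum>l<n. w j l * (lpart r (fs ! k) \<bullet> (snd \<psi> *\<^sub>v lpart r (fs ! l))))"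
          by (intro sum.cong refl arg_cong2[of _ _ _ _ "(*)"] sym_scalar_swap[OF S sym]) auto
        finally show ?thesis .
      qed
      then show ?thesis using dot[OF ij(1)] S by simp
    qed
    then show ?thesis unfolding pushf_def using len h m
      by (auto intro!: eq_vecI eq_matI sum.cong simp: lcomb_def)
  qed
  show ?thesis
  proof (cases "L1 = {} \<and> L2 = {}")
    case False
    then obtain \<psi>1 \<psi>2 where st: "stdcond r1 L1 \<psi>1" "stdcond r2 L2 \<psi>2"
      and e: "pushf r1 fs1 \<psi>1 = pushf r2 fs2 \<psi>2"
      using eq unfolding law_eq_def has_law_def by metis
    have "pushf r1 hs1 \<psi>1 = pushf r2 hs2 \<psi>2"
      using P[OF st(1) len(1,3) aff(1) h1] P[OF st(2) len(2,4) aff(2) h2] e by simp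
    then show ?thesis using st unfolding law_eq_def has_law_def by metis
  qed (simp add: law_eq_def)
qed

text \<open>When the functional conditioned on is a combination of \<open>fs\<close>, the
  conditional law of \<open>fs\<close> is a function of their joint law, and so is the decision
  whether the condition is vacuous, contradictory or proper. Equal laws thus stay equal, and the two
  sides fail together.\<close>

lemma law_eq_cond1:
  assumes eq: "law_eq r1 L1 fs1 r2 L2 fs2"
    and len: "length fs1 = n" "length fs2 = n"
    and aff: "\<And>f. f \<in> set fs1 \<Longrightarrow> affv r1 f" "\<And>f. f \<in> set fs2 \<Longrightarrow> affv r2 f"
  shows "law_eq r1 {\<xi> \<in> L1. lcomb w b fs1 \<xi> = 0} fs1 r2 {\<xi> \<in> L2. lcomb w b fs2 \<xi> = 0} fs2"
proof (cases "L1 = {} \<and> L2 = {}")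
  case False
  \<comment> \<open>\<open>C G i\<close> is the covariance of output \<open>i\<close> with the
    functional to be conditioned on, \<open>s G\<close> the variance of that functional and
    \<open>t G\<close> its mean; \<open>G'\<close> is the usual formula for conditioning it to be
    zero.\<close>
  define C where "C G i = (\<Sum>j<n. w j * snd G $$ (j, i))" for G :: gauss and i
  define s where "s G = (\<Sum>i<n. w i * C G i)" for G :: gauss
  define t where "t G = (\<Sum>i<n. w i * fst G $ i) + b" for G :: gauss
  define G' where "G' G = (vec n (\<lambda>i. fst G $ i - t G / s G * C G i),
      mat n n (\<lambda>(i, j). snd G $$ (i, j) - C G i * C G j / s G))" for G :: gauss
  have step: "(s G = 0 \<longrightarrow> {\<xi> \<in> L. lcomb w b fs \<xi> = 0} = (if t G = 0 then L else {})) \<and>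
     (s G \<noteq> 0 \<longrightarrow> has_law r {\<xi> \<in> L. lcomb w b fs \<xi> = 0} fs (G' G))"
    if st: "stdcond r L \<psi>" and len: "length fs = n" and aff: "\<And>f. f \<in> set fs \<Longrightarrow> affv r f"
      and G: "G = pushf r fs \<psi>" for r L \<psi> fs G
  proof -
    obtain \<mu> P where psi: "\<psi> = (\<mu>, P)" by force
    have m: "\<mu> \<in> carrier_vec r" and P: "proj r P" and Pc: "P \<in> carrier_mat r r"
      and sym: "transpose_mat P = P" and Lc: "L \<subseteq> carrier_vec r"
      using st unfolding stdcond_def proj_def psi by auto
    define u where "u = vec r (\<lambda>k. \<Sum>i<length fs. w i * lpart r (fs ! i) $ k)"
    define c where "c = (\<Sum>i<length fs. w i * (fs ! i) (0\<^sub>v r)) + b"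
    have u: "u \<in> carrier_vec r" by (simp add: u_def)
    have ud: "u \<bullet> y = (\<Sum>i<n. w i * (lpart r (fs ! i) \<bullet> y))" if "y \<in> carrier_vec r" for y
      using lcomb_affv(2)[where fs = fs and w = w and r = r, OF aff] that len unfolding u_def by simp
    have g: "lcomb w b fs \<xi> = u \<bullet> \<xi> + c" if "\<xi> \<in> carrier_vec r" for \<xi>
      using lcomb_affv(3)[where fs = fs and w = w and r = r, OF aff] that unfolding u_def c_def by simp
    have Leq: "{\<xi> \<in> L. lcomb w b fs \<xi> = 0} = {\<xi> \<in> L. u \<bullet> \<xi> + c = 0}"
      using g Lc by auto
    have Pu: "P *\<^sub>v u \<in> carrier_vec r" using Pc u by auto
    have Ci: "lpart r (fs ! i) \<bullet> (P *\<^sub>v u) = C G i" if "i < n" for i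
    proof -
      have "lpart r (fs ! i) \<bullet> (P *\<^sub>v u) = u \<bullet> (P *\<^sub>v lpart r (fs ! i))"
        using u by (intro sym_scalar_swap[OF Pc sym]) auto
      also have "\<dots> = C G i" using ud[of "P *\<^sub>v lpart r (fs ! i)"] Pc that len
        by (simp add: C_def G pushf_def psi)
      finally show ?thesis .
    qed
    have sG: "u \<bullet> (P *\<^sub>v u) = s G" using ud[OF Pu] Ci by (simp add: s_def)
    have tG: "u \<bullet> \<mu> + c = t G"
      using g[OF m] len by (simp add: t_def lcomb_def G pushf_def psi)
    note S = stdcond_step[OF st[unfolded psi] u]
    show ?thesis
    proof (intro conjI impI)
      assume "s G = 0"
      then show "{\<xi> \<in> L. lcomb w b fs \<xi> = 0} = (if t G = 0 then L else {})"
        using S(1)[of c] sG tG Leq by simp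
    next
      assume nz: "s G \<noteq> 0"
      define \<mu>' where "\<mu>' = \<mu> + ((- c - u \<bullet> \<mu>) / (u \<bullet> (P *\<^sub>v u))) \<cdot>\<^sub>v (P *\<^sub>v u)"
      have st': "stdcond r {\<xi> \<in> L. lcomb w b fs \<xi> = 0} (\<mu>', deflate P u)"
        using S(3)[of c] sG nz Leq unfolding \<mu>'_def by simp
      have "pushf r fs (\<mu>', deflate P u) = G' G"
      proof -
        have "(fs ! i) \<mu>' = fst G $ i - t G / s G * C G i" if i: "i < n" for i
        proof -
          have f: "affv r (fs ! i)" using aff i len by simp
          have "(fs ! i) \<mu>' = lpart r (fs ! i) \<bullet> \<mu>' + (fs ! i) (0\<^sub>v r)"
            using affv_lpart[OF f, of \<mu>'] m Pu by (simp add: \<mu>'_def)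
          also have "\<dots> = lpart r (fs ! i) \<bullet> \<mu> + (fs ! i) (0\<^sub>v r) + ((- c - u \<bullet> \<mu>) / s G) * C G i"
            unfolding \<mu>'_def using m Pu Ci[OF i] sG
            by (simp add: scalar_prod_add_distrib[of _ r] scalar_prod_smult_distrib[of _ r])
          also have "- c - u \<bullet> \<mu> = - t G" using tG by simp
          finally show ?thesis using affv_lpart[OF f m] i len by (simp add: G pushf_def psi)
        qed
        moreover have "lpart r (fs ! i) \<bullet> (deflate P u *\<^sub>v lpart r (fs ! j))
            = snd G $$ (i, j) - C G i * C G j / s G" if "i < n" "j < n" for i j
        proof -
          have "lpart r (fs ! i) \<bullet> (deflate P u *\<^sub>v lpart r (fs ! j))
            = lpart r (fs ! i) \<bullet> (P *\<^sub>v lpart r (fs ! j)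
                - (((P *\<^sub>v u) \<bullet> lpart r (fs ! j)) / s G) \<cdot>\<^sub>v (P *\<^sub>v u))"
            using deflate_mult_vec[OF Pc sym u, of "lpart r (fs ! j)"] sG by simp
          also have "\<dots> = lpart r (fs ! i) \<bullet> (P *\<^sub>v lpart r (fs ! j))
                - ((P *\<^sub>v u) \<bullet> lpart r (fs ! j)) / s G * (lpart r (fs ! i) \<bullet> (P *\<^sub>v u))"
            using Pc Pu by (subst scalar_prod_minus_distrib[of _ r]) auto
          also have "(P *\<^sub>v u) \<bullet> lpart r (fs ! j) = C G j"
            using Ci[OF that(2)] comm_scalar_prod[OF Pu, of "lpart r (fs ! j)"] by simp
          finally show ?thesis using Ci that len by (simp add: G pushf_def psi)
        qed
        ultimately show ?thesis using len unfolding G'_def pushf_def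
          by (auto intro!: eq_vecI eq_matI)
      qed
      with st' show "has_law r {\<xi> \<in> L. lcomb w b fs \<xi> = 0} fs (G' G)"
        unfolding has_law_def by blast
    qed
  qed
  from False obtain \<psi>1 \<psi>2 where st: "stdcond r1 L1 \<psi>1" "stdcond r2 L2 \<psi>2"
    and e: "pushf r1 fs1 \<psi>1 = pushf r2 fs2 \<psi>2"
    using eq unfolding law_eq_def has_law_def by metis
  define G where "G = pushf r1 fs1 \<psi>1"
  note s1 = step[OF st(1) len(1) aff(1) G_def] and s2 = step[OF st(2) len(2) aff(2) G_def[unfolded e]]
  show ?thesis
  proof (cases "s G = 0")
    case True
    then show ?thesis using s1 s2 eq unfolding law_eq_def by (cases "t G = 0") auto
  next
    case False
    then show ?thesis using s1 s2 unfolding law_eq_def by blast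
  qed
qed (simp add: law_eq_def)

lemma law_eq_cond:
  fixes N :: nat
  assumes eq: "law_eq r1 L1 fs1 r2 L2 fs2"
    and len: "length fs1 = n" "length fs2 = n"
    and aff: "\<And>f. f \<in> set fs1 \<Longrightarrow> affv r1 f" "\<And>f. f \<in> set fs2 \<Longrightarrow> affv r2 f"
  shows "law_eq r1 {\<xi> \<in> L1. \<forall>k<N. lcomb (w k) (b k) fs1 \<xi> = 0} fs1
                r2 {\<xi> \<in> L2. \<forall>k<N. lcomb (w k) (b k) fs2 \<xi> = 0} fs2"
proof (induction N)
  case (Suc N)
  have split: "{\<xi> \<in> L. \<forall>k<Suc N. Q k \<xi>} = {\<xi> \<in> {\<xi> \<in> L. \<forall>k<N. Q k \<xi>}. Q N \<xi>}"
    for L :: "real vec set" and Q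
    by (auto simp: less_Suc_eq)
  show ?case unfolding split by (rule law_eq_cond1[OF Suc len aff])
qed (simp add: eq)

section \<open>Functionals of the first coordinates, and adjoining fresh noise\<close>

text \<open>Unlike \<open>affv\<close>, the equation holds for vectors of every dimension and reads
  only the first \<open>r\<close> coordinates. A functional of the draws made so far therefore
  remains the same function when further draws enlarge the sample space.\<close>

definition aff :: "nat \<Rightarrow> (real vec \<Rightarrow> real) \<Rightarrow> bool" where
  "aff r f \<longleftrightarrow> (\<exists>u b. \<forall>\<xi>. f \<xi> = (\<Sum>i<r. u i * \<xi> $ i) + b)"

lemma aff_coord: "i < r \<Longrightarrow> aff r (\<lambda>\<xi>. \<xi> $ i)"
  unfolding aff_def
  by (intro exI[of _ "\<lambda>j. if j = i then 1 else 0"] exI[of _ 0])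
    (auto simp: if_distrib[of "\<lambda>x. x * _"] sum.delta cong: if_cong)

lemma aff_const: "aff r (\<lambda>\<xi>. b)"
  unfolding aff_def by (intro exI[of _ "\<lambda>j. 0"] exI[of _ b]) simp

lemma aff_add:
  assumes "aff r f" "aff r g" shows "aff r (\<lambda>\<xi>. f \<xi> + g \<xi>)"
proof -
  from assms obtain u b v c where "\<And>\<xi>. f \<xi> = (\<Sum>i<r. u i * \<xi> $ i) + b"
    "\<And>\<xi>. g \<xi> = (\<Sum>i<r. v i * \<xi> $ i) + c" unfolding aff_def by metis
  then show ?thesis unfolding aff_def
    by (intro exI[of _ "\<lambda>i. u i + v i"] exI[of _ "b + c"]) (simp add: sum.distrib distrib_right)
qed

lemma aff_scale:
  assumes "aff r f" shows "aff r (\<lambda>\<xi>. c * f \<xi>)"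
proof -
  from assms obtain u b where "\<And>\<xi>. f \<xi> = (\<Sum>i<r. u i * \<xi> $ i) + b" unfolding aff_def by metis
  then show ?thesis unfolding aff_def
    by (intro exI[of _ "\<lambda>i. c * u i"] exI[of _ "c * b"])
      (simp add: sum_distrib_left distrib_left mult.assoc)
qed

lemma aff_mono:
  assumes "aff r f" "r \<le> r'" shows "aff r' f"
proof -
  from assms obtain u b where f: "\<And>\<xi>. f \<xi> = (\<Sum>i<r. u i * \<xi> $ i) + b" unfolding aff_def by metis
  have "(\<Sum>i<r'. (if i < r then u i else 0) * \<xi> $ i) = (\<Sum>i<r. u i * \<xi> $ i)" for \<xi> :: "real vec"
    using assms(2) by (intro sum.mono_neutral_cong_right) auto
  then show ?thesis using f unfolding aff_def by metis
qed

lemma aff_vec: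
  assumes "aff r f"
  obtains u b where "u \<in> carrier_vec r"
    "\<And>n \<xi>. r \<le> n \<Longrightarrow> \<xi> \<in> carrier_vec n \<Longrightarrow> f \<xi> = u \<bullet> vec_first \<xi> r + b"
proof -
  from assms obtain u b where f: "\<And>\<xi>. f \<xi> = (\<Sum>i<r. u i * \<xi> $ i) + b" unfolding aff_def by metis
  show ?thesis
  proof (rule that[of "vec r u" b])
    fix n and \<xi> :: "real vec" assume "r \<le> n" "\<xi> \<in> carrier_vec n"
    then show "f \<xi> = vec r u \<bullet> vec_first \<xi> r + b"
      unfolding f by (simp add: scalar_prod_def lessThan_atLeast0 vec_first_def)
  qed simp
qed

lemma vec_first_id [simp]: "\<xi> \<in> carrier_vec r \<Longrightarrow> vec_first \<xi> r = \<xi>"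
  by (auto simp: vec_first_def)

lemma aff_affv: "aff r f \<Longrightarrow> affv r f"
proof -
  assume "aff r f"
  then obtain u b where u: "u \<in> carrier_vec r"
    and f: "\<And>n \<xi>. r \<le> n \<Longrightarrow> \<xi> \<in> carrier_vec n \<Longrightarrow> f \<xi> = u \<bullet> vec_first \<xi> r + b"
    by (rule aff_vec) blast
  show "affv r f" unfolding affv_def using u f[OF order_refl] by auto
qed

text \<open>A fresh draw is unconstrained: the affine set becomes a product with a line, its
  projection gains an identity block, and the least-norm point gains a zero coordinate.\<close>

lemma stdcond_ext:
  assumes "stdcond r L \<psi>"
  shows "stdcond (Suc r) {\<xi> \<in> carrier_vec (Suc r). vec_first \<xi> r \<in> L} (gauss_ext \<psi>)"
proof -
  obtain \<mu> P where psi: "\<psi> = (\<mu>, P)" by force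
  have m: "\<mu> \<in> carrier_vec r" and P: "proj r P" and Pc: "P \<in> carrier_mat r r"
    and sym: "transpose_mat P = P" and Pm: "P *\<^sub>v \<mu> = 0\<^sub>v r"
    and L: "L = {\<xi> \<in> carrier_vec r. P *\<^sub>v (\<xi> - \<mu>) = \<xi> - \<mu>}"
    using assms unfolding stdcond_def proj_def psi by auto
  define \<mu>' where "\<mu>' = \<mu> @\<^sub>v (vec 1 (\<lambda>_. 0) :: real vec)"
  define Q where "Q = four_block_mat P (0\<^sub>m r 1) (0\<^sub>m 1 r) (1\<^sub>m 1)"
  have ge: "gauss_ext \<psi> = (\<mu>', Q)" using m by (simp add: gauss_ext_def psi \<mu>'_def Q_def)
  have Qc: "Q \<in> carrier_mat (Suc r) (Suc r)" using Pc by (auto simp: Q_def)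
  have act: "Q *\<^sub>v (a @\<^sub>v d) = (P *\<^sub>v a) @\<^sub>v d" if "a \<in> carrier_vec r" "d \<in> carrier_vec 1" for a d
    unfolding Q_def using mult_mat_vec_split[OF Pc, of "1\<^sub>m 1" 1 a d] that by simp
  have dec: "x = vec_first x r @\<^sub>v vec_last x 1" if "x \<in> carrier_vec (Suc r)" for x :: "real vec"
    using that by simp
  have m': "\<mu>' \<in> carrier_vec (Suc r)" using m by (auto simp: \<mu>'_def intro!: carrier_vecI)
  have z: "0\<^sub>v r @\<^sub>v vec 1 (\<lambda>_. 0) = (0\<^sub>v (Suc r) :: real vec)" by (intro eq_vecI) auto
  have 1: "proj (Suc r) Q"
  proof -
    have "transpose_mat Q = Q" unfolding Q_def
      using Pc sym by (subst transpose_four_block_mat[of _ r r _ 1 _ 1]) auto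
    moreover have "Q *\<^sub>v (Q *\<^sub>v x) = Q *\<^sub>v x" if "x \<in> carrier_vec (Suc r)" for x
    proof -
      have "Q *\<^sub>v x = (P *\<^sub>v vec_first x r) @\<^sub>v vec_last x 1" using act dec[OF that] by (metis vec_first_carrier vec_last_carrier)
      then show ?thesis using act[of "P *\<^sub>v vec_first x r" "vec_last x 1"] Pc P
        unfolding proj_def by simp
    qed
    ultimately show ?thesis using Qc unfolding proj_def by blast
  qed
  have 2: "Q *\<^sub>v \<mu>' = 0\<^sub>v (Suc r)" unfolding \<mu>'_def using act m Pm z by simp
  have 3: "vec_first \<xi> r \<in> L \<longleftrightarrow> Q *\<^sub>v (\<xi> - \<mu>') = \<xi> - \<mu>'" if x: "\<xi> \<in> carrier_vec (Suc r)" for \<xi>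
  proof -
    have "\<xi> - \<mu>' = (vec_first \<xi> r - \<mu>) @\<^sub>v vec_last \<xi> 1"
      using x m by (intro eq_vecI) (auto simp: \<mu>'_def vec_first_def vec_last_def less_Suc_eq)
    then have "Q *\<^sub>v (\<xi> - \<mu>') = \<xi> - \<mu>' \<longleftrightarrow> P *\<^sub>v (vec_first \<xi> r - \<mu>) = vec_first \<xi> r - \<mu>"
      using act[of "vec_first \<xi> r - \<mu>" "vec_last \<xi> 1"] m Pc
      by (simp add: append_vec_eq[of _ r])
    then show ?thesis using L by simp
  qed
  show ?thesis unfolding stdcond_def ge using 1 m' 2 3 by auto
qed

text \<open>The new coordinate is independent of the old functionals, so the extended joint law is
  \<open>gauss_ext\<close> of the old one and is determined by it.\<close>

lemma law_eq_ext:
  assumes eq: "law_eq r1 L1 fs1 r2 L2 fs2"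
    and len: "length fs1 = n" "length fs2 = n"
    and aff: "\<And>f. f \<in> set fs1 \<Longrightarrow> aff r1 f" "\<And>f. f \<in> set fs2 \<Longrightarrow> aff r2 f"
  shows "law_eq (Suc r1) {\<xi> \<in> carrier_vec (Suc r1). vec_first \<xi> r1 \<in> L1} (fs1 @ [\<lambda>\<xi>. \<xi> $ r1])
                (Suc r2) {\<xi> \<in> carrier_vec (Suc r2). vec_first \<xi> r2 \<in> L2} (fs2 @ [\<lambda>\<xi>. \<xi> $ r2])"
proof (cases "L1 = {} \<and> L2 = {}")
  case False
  have ext: "pushf (Suc r) (fs @ [\<lambda>\<xi>. \<xi> $ r]) (gauss_ext \<psi>) = gauss_ext (pushf r fs \<psi>)"
    if st: "stdcond r L \<psi>" and aff: "\<And>f. f \<in> set fs \<Longrightarrow> aff r f" for r L \<psi> fs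
  proof -
    obtain \<mu> P where psi: "\<psi> = (\<mu>, P)" by force
    have m: "\<mu> \<in> carrier_vec r" and Pc: "P \<in> carrier_mat r r"
      using st unfolding stdcond_def proj_def psi by auto
    define z where "z = (vec 1 (\<lambda>_. 0) :: real vec)"
    define o1 where "o1 = (vec 1 (\<lambda>_. 1) :: real vec)"
    have zo: "z \<in> carrier_vec 1" "o1 \<in> carrier_vec 1" "z \<bullet> z = 0" "o1 \<bullet> o1 = 1" "z \<bullet> o1 = 0" "o1 \<bullet> z = 0"
      by (auto simp: z_def o1_def scalar_prod_def)
    define Q where "Q = four_block_mat P (0\<^sub>m r 1) (0\<^sub>m 1 r) (1\<^sub>m 1)"
    have ge: "gauss_ext \<psi> = (\<mu> @\<^sub>v z, Q)" using m by (simp add: gauss_ext_def psi z_def Q_def)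
    have act: "Q *\<^sub>v (a @\<^sub>v d) = (P *\<^sub>v a) @\<^sub>v d" if "a \<in> carrier_vec r" "d \<in> carrier_vec 1" for a d
      unfolding Q_def using mult_mat_vec_split[OF Pc, of "1\<^sub>m 1" 1 a d] that by simp
    have f1: "f (\<mu> @\<^sub>v z) = f \<mu> \<and> lpart (Suc r) f = lpart r f @\<^sub>v z" if fin: "f \<in> set fs" for f
    proof -
      obtain u b where u: "u \<in> carrier_vec r"
        and f: "\<And>n \<xi>. r \<le> n \<Longrightarrow> \<xi> \<in> carrier_vec n \<Longrightarrow> f \<xi> = u \<bullet> vec_first \<xi> r + b"
        by (rule aff_vec[OF aff[OF fin]]) blast
      have l1: "lpart r f = u" using f[OF order_refl] by (intro lpart_eqI[OF u, of _ b]) simp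
      have vf: "vec_first (\<mu> @\<^sub>v z) r = \<mu>" using m by (auto simp: vec_first_def)
      have "\<mu> @\<^sub>v z \<in> carrier_vec (Suc r)" using m zo(1) by (intro carrier_vecI) simp
      then have "f (\<mu> @\<^sub>v z) = u \<bullet> \<mu> + b" using f[of "Suc r" "\<mu> @\<^sub>v z"] unfolding vf by simp
      then have "f (\<mu> @\<^sub>v z) = f \<mu>" using f[OF order_refl m] m by simp
      moreover have "lpart (Suc r) f = u @\<^sub>v z"
      proof (rule lpart_eqI[of _ _ _ b])
        show "u @\<^sub>v z \<in> carrier_vec (Suc r)" using u zo(1) by (intro carrier_vecI) simp
        fix \<xi> :: "real vec" assume x: "\<xi> \<in> carrier_vec (Suc r)"
        have "(u @\<^sub>v z) \<bullet> (vec_first \<xi> r @\<^sub>v vec_last \<xi> 1) = u \<bullet> vec_first \<xi> r + z \<bullet> vec_last \<xi> 1"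
          using u zo by (intro scalar_prod_append[of _ r _ 1]) auto
        moreover have "z \<bullet> vec_last \<xi> 1 = 0" by (simp add: z_def scalar_prod_def)
        ultimately show "f \<xi> = (u @\<^sub>v z) \<bullet> \<xi> + b" using f[of "Suc r" \<xi>] x by simp
      qed
      ultimately show ?thesis using l1 by simp
    qed
    have f2: "lpart (Suc r) (\<lambda>\<xi>. \<xi> $ r) = 0\<^sub>v r @\<^sub>v o1"
    proof (rule lpart_eqI[of _ _ _ 0])
      show "0\<^sub>v r @\<^sub>v o1 \<in> carrier_vec (Suc r)" using zo(2) by (intro carrier_vecI) simp
      fix \<xi> :: "real vec" assume x: "\<xi> \<in> carrier_vec (Suc r)"
      have "(0\<^sub>v r @\<^sub>v o1) \<bullet> (vec_first \<xi> r @\<^sub>v vec_last \<xi> 1) = 0\<^sub>v r \<bullet> vec_first \<xi> r + o1 \<bullet> vec_last \<xi> 1"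
        using zo by (intro scalar_prod_append[of _ r _ 1]) auto
      moreover have "o1 \<bullet> vec_last \<xi> 1 = \<xi> $ r" using x by (simp add: o1_def scalar_prod_def vec_last_def)
      ultimately show "\<xi> $ r = (0\<^sub>v r @\<^sub>v o1) \<bullet> \<xi> + 0" using x by simp
    qed
    let ?fs = "fs @ [\<lambda>\<xi>. \<xi> $ r]" and ?N = "length fs"
    have L: "lpart (Suc r) (?fs ! i) = (if i < ?N then lpart r (fs ! i) @\<^sub>v z else 0\<^sub>v r @\<^sub>v o1)"
      if "i < Suc ?N" for i
      using that f1 f2 by (auto simp: nth_append less_Suc_eq)
    have dot: "(a @\<^sub>v d) \<bullet> (Q *\<^sub>v (a' @\<^sub>v d')) = a \<bullet> (P *\<^sub>v a') + d \<bullet> d'"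
      if "a \<in> carrier_vec r" "d \<in> carrier_vec 1" "a' \<in> carrier_vec r" "d' \<in> carrier_vec 1" for a d a' d'
      using act[OF that(3,4)] that Pc by (simp add: scalar_prod_append[of _ r _ 1])
    have P0: "P *\<^sub>v 0\<^sub>v r = 0\<^sub>v r" using Pc by (intro eq_vecI) auto
    have "vec (Suc ?N) (\<lambda>i. (?fs ! i) (\<mu> @\<^sub>v z)) = vec ?N (\<lambda>i. (fs ! i) \<mu>) @\<^sub>v vec 1 (\<lambda>_. 0)"
      using f1 m by (intro eq_vecI) (auto simp: nth_append less_Suc_eq z_def)
    moreover have "mat (Suc ?N) (Suc ?N) (\<lambda>(i, j). lpart (Suc r) (?fs ! i) \<bullet> (Q *\<^sub>v lpart (Suc r) (?fs ! j)))
       = four_block_mat (mat ?N ?N (\<lambda>(i, j). lpart r (fs ! i) \<bullet> (P *\<^sub>v lpart r (fs ! j))))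
          (0\<^sub>m ?N 1) (0\<^sub>m 1 ?N) (1\<^sub>m 1)"
      using zo Pc by (intro eq_matI) (auto simp: L dot P0 less_Suc_eq)
    ultimately show ?thesis unfolding ge unfolding psi pushf_def gauss_ext_def Let_def by simp
  qed
  from False obtain \<psi>1 \<psi>2 where st: "stdcond r1 L1 \<psi>1" "stdcond r2 L2 \<psi>2"
    and e: "pushf r1 fs1 \<psi>1 = pushf r2 fs2 \<psi>2"
    using eq unfolding law_eq_def has_law_def by metis
  have "has_law (Suc r1) {\<xi> \<in> carrier_vec (Suc r1). vec_first \<xi> r1 \<in> L1} (fs1 @ [\<lambda>\<xi>. \<xi> $ r1])
      (gauss_ext (pushf r1 fs1 \<psi>1))"
    unfolding has_law_def using stdcond_ext[OF st(1)] ext[OF st(1) aff(1)] by blast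
  moreover have "has_law (Suc r2) {\<xi> \<in> carrier_vec (Suc r2). vec_first \<xi> r2 \<in> L2} (fs2 @ [\<lambda>\<xi>. \<xi> $ r2])
      (gauss_ext (pushf r1 fs1 \<psi>1))"
    unfolding has_law_def e using stdcond_ext[OF st(2)] ext[OF st(2) aff(2)] by blast
  ultimately show ?thesis unfolding law_eq_def by blast
qed (simp add: law_eq_def)

subsection \<open>Posteriors of Gaussian inference problems\<close>

text \<open>The projection onto the kernel of \<open>M\<close>, obtained from the identity by
  deflating along one row after the other. The second property, that \<open>x - P x\<close> lies in
  the row space, takes over the part of a pseudo-inverse: it provides coefficient vectors wherever a
  preimage is needed.\<close>

lemma row_space_proj:
  fixes M :: "real mat"
  assumes M: "M \<in> carrier_mat k r"
  shows "\<exists>P. proj r P \<and> (\<forall>x \<in> carrier_vec r. M *\<^sub>v (P *\<^sub>v x) = 0\<^sub>v k) \<and>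
     (\<forall>x \<in> carrier_vec r. \<exists>y \<in> carrier_vec k. x - P *\<^sub>v x = transpose_mat M *\<^sub>v y)"
proof -
  have Mt: "transpose_mat M \<in> carrier_mat r k" using M by simp
  have "\<exists>P. proj r P \<and> (\<forall>j<i. \<forall>x \<in> carrier_vec r. row M j \<bullet> (P *\<^sub>v x) = 0) \<and>
     (\<forall>x \<in> carrier_vec r. \<exists>y \<in> carrier_vec k. x - P *\<^sub>v x = transpose_mat M *\<^sub>v y)" if "i \<le> k" for i
    using that
  proof (induction i)
    case 0
    have "proj r (1\<^sub>m r)" by (auto simp: proj_def)
    moreover have "\<exists>y \<in> carrier_vec k. x - 1\<^sub>m r *\<^sub>v x = transpose_mat M *\<^sub>v y" if "x \<in> carrier_vec r" for x :: "real vec"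
      using that M by (intro bexI[of _ "0\<^sub>v k"]) (auto intro!: eq_vecI)
    ultimately show ?case by auto
  next
    case (Suc i)
    then obtain P where P: "proj r P" and k: "\<And>j x. j < i \<Longrightarrow> x \<in> carrier_vec r \<Longrightarrow> row M j \<bullet> (P *\<^sub>v x) = 0"
      and sp: "\<And>x. x \<in> carrier_vec r \<Longrightarrow> \<exists>y \<in> carrier_vec k. x - P *\<^sub>v x = transpose_mat M *\<^sub>v y"
      by auto
    have Pc: "P \<in> carrier_mat r r" and sym: "transpose_mat P = P" using P unfolding proj_def by auto
    have i: "i < k" using Suc.prems by simp
    define u where "u = row M i"
    have u: "u \<in> carrier_vec r" using M i by (simp add: u_def)
    have Pu: "P *\<^sub>v u \<in> carrier_vec r" using Pc u by auto
    show ?case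
    proof (cases "u \<bullet> (P *\<^sub>v u) = 0")
      \<comment> \<open>The row is already orthogonal to the range of \<open>P\<close>, which stays
        as it is.\<close>
      case True
      have "P *\<^sub>v u = 0\<^sub>v r"
        using scalar_self_zero[OF Pu] proj_norm[OF P u] True by simp
      then have "u \<bullet> (P *\<^sub>v x) = 0" if "x \<in> carrier_vec r" for x
        using sym_scalar[OF Pc sym u that] that by simp
      then show ?thesis using P k sp unfolding u_def by (auto simp: less_Suc_eq)
    next
      case False
      note D = proj_deflate[OF P u False]
      have Dc: "deflate P u \<in> carrier_mat r r" "transpose_mat (deflate P u) = deflate P u"
        using D(1) unfolding proj_def by auto
      have "row M j \<bullet> (deflate P u *\<^sub>v x) = 0" if j: "j < Suc i" and x: "x \<in> carrier_vec r" for j x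
      proof (cases "j = i")
        case True
        then show ?thesis using sym_scalar[OF Dc u x] D(2) x u_def by simp
      next
        case False
        have "row M j \<bullet> (P *\<^sub>v (deflate P u *\<^sub>v x)) = 0" using k[of j "deflate P u *\<^sub>v x"] j False Dc x by auto
        then show ?thesis using D(4)[OF x] by simp
      qed
      moreover have "\<exists>y \<in> carrier_vec k. x - deflate P u *\<^sub>v x = transpose_mat M *\<^sub>v y" if x: "x \<in> carrier_vec r" for x
      proof -
        obtain y where y: "y \<in> carrier_vec k" "x - P *\<^sub>v x = transpose_mat M *\<^sub>v y" using sp[OF x] by blast
        obtain z where z: "z \<in> carrier_vec k" "u - P *\<^sub>v u = transpose_mat M *\<^sub>v z" using sp[OF u] by blast
        define c where "c = ((P *\<^sub>v u) \<bullet> x) / (u \<bullet> (P *\<^sub>v u))"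
        have ui: "transpose_mat M *\<^sub>v unit_vec k i = u" using M i
          by (intro eq_vecI) (auto simp: u_def)
        \<comment> \<open>The subtracted multiple of \<open>P u\<close> is rewritten with
          \<open>P u = u - (u - P u)\<close>: \<open>u\<close> is row \<open>i\<close> itself, and
          the remainder is the combination \<open>z\<close> of rows supplied by the induction
          hypothesis.\<close>
        have "x - deflate P u *\<^sub>v x = (x - P *\<^sub>v x) + c \<cdot>\<^sub>v (u - (u - P *\<^sub>v u))"
          unfolding deflate_mult_vec[OF Pc sym u x] c_def[symmetric]
          using x u Pc by (intro eq_vecI) (auto simp: algebra_simps)
        also have "\<dots> = transpose_mat M *\<^sub>v (y + c \<cdot>\<^sub>v (unit_vec k i - z))"
        proof -
          have "transpose_mat M *\<^sub>v (y + c \<cdot>\<^sub>v (unit_vec k i - z))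
             = transpose_mat M *\<^sub>v y + c \<cdot>\<^sub>v (transpose_mat M *\<^sub>v unit_vec k i - transpose_mat M *\<^sub>v z)"
            using y z mult_add_distrib_mat_vec[OF Mt y(1), of "c \<cdot>\<^sub>v (unit_vec k i - z)"]
              mult_mat_vec[OF Mt, of "unit_vec k i - z" c] mult_minus_distrib_mat_vec[OF Mt, of "unit_vec k i" z]
            by simp
          then show ?thesis using y z ui by simp
        qed
        finally show ?thesis using y z by (intro bexI[of _ "y + c \<cdot>\<^sub>v (unit_vec k i - z)"]) auto
      qed
      ultimately show ?thesis using D(1) by blast
    qed
  qed
  from this[of k] obtain P where P: "proj r P" and k: "\<And>j x. j < k \<Longrightarrow> x \<in> carrier_vec r \<Longrightarrow> row M j \<bullet> (P *\<^sub>v x) = 0"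
    and sp: "\<forall>x \<in> carrier_vec r. \<exists>y \<in> carrier_vec k. x - P *\<^sub>v x = transpose_mat M *\<^sub>v y"
    by auto
  have "M *\<^sub>v (P *\<^sub>v x) = 0\<^sub>v k" if "x \<in> carrier_vec r" for x
    using k[OF _ that] M by (intro eq_vecI) auto
  with P sp show ?thesis by blast
qed

lemma psd_gram:
  fixes M :: "real mat"
  assumes M: "M \<in> carrier_mat n r"
  shows "psd (M * transpose_mat M)"
proof -
  have "0 \<le> x \<bullet> ((M * transpose_mat M) *\<^sub>v x)" if x: "x \<in> carrier_vec n" for x
  proof -
    have "(M * transpose_mat M) *\<^sub>v x = M *\<^sub>v (transpose_mat M *\<^sub>v x)"
      using M x by (intro assoc_mult_mat_vec) auto
    moreover have "x \<bullet> (M *\<^sub>v (transpose_mat M *\<^sub>v x)) = (transpose_mat M *\<^sub>v x) \<bullet> (transpose_mat M *\<^sub>v x)"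
      using transpose_vec_mult_scalar[OF M, of "transpose_mat M *\<^sub>v x" x] M x by simp
    ultimately show ?thesis by (simp add: scalar_prod_def sum_nonneg)
  qed
  moreover have "transpose_mat (M * transpose_mat M) = M * transpose_mat M"
    using M by (subst transpose_mult[of _ n r _ n]) auto
  ultimately show ?thesis using M unfolding psd_def by auto
qed

lemma gram_index:
  fixes M N :: "real mat"
  assumes "M \<in> carrier_mat n r" "N \<in> carrier_mat m r" "i < n" "j < m"
  shows "(M * transpose_mat N) $$ (i, j) = row M i \<bullet> row N j"
  using assms by simp

lemma gram_conj:
  fixes Q M :: "real mat"
  assumes Q: "Q \<in> carrier_mat k n" and M: "M \<in> carrier_mat n r"
  shows "Q * (M * transpose_mat M) * transpose_mat Q = (Q * M) * transpose_mat (Q * M)"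
proof -
  have "Q * (M * transpose_mat M) = (Q * M) * transpose_mat M"
    using Q M by (subst assoc_mult_mat[of _ k n _ r _ n]) auto
  moreover have "(Q * M) * transpose_mat M * transpose_mat Q = (Q * M) * (transpose_mat M * transpose_mat Q)"
    using Q M by (subst assoc_mult_mat[of _ k r _ n _ k]) auto
  ultimately show ?thesis using transpose_mult[OF Q M] by simp
qed

text \<open>\<open>rep m p r f \<phi>\<close>: the Gaussian morphism \<open>f : m \<rightarrow> p\<close> is generated by the affine map
  \<open>\<phi> x \<xi>\<close>, where the noise \<open>\<xi>\<close> is standard normal on \<open>R^r\<close>.\<close>
definition rep :: "nat \<Rightarrow> nat \<Rightarrow> nat \<Rightarrow> gm \<Rightarrow> (real vec \<Rightarrow> real vec \<Rightarrow> real vec) \<Rightarrow> bool" where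
  "rep m p r f \<phi> \<longleftrightarrow> (\<exists>A b M. f = (A, b, M * transpose_mat M) \<and>
     A \<in> carrier_mat p m \<and> b \<in> carrier_vec p \<and> M \<in> carrier_mat p r \<and>
     (\<forall>x \<in> carrier_vec m. \<forall>\<xi> \<in> carrier_vec r. \<phi> x \<xi> = A *\<^sub>v x + b + M *\<^sub>v \<xi>))"

lemma rep_carrier: "rep m p r f \<phi> \<Longrightarrow> x \<in> carrier_vec m \<Longrightarrow> \<xi> \<in> carrier_vec r \<Longrightarrow> \<phi> x \<xi> \<in> carrier_vec p"
  unfolding rep_def by auto

lemma rep_cong:
  assumes "rep m p r f \<phi>"
    and "\<And>x \<xi>. x \<in> carrier_vec m \<Longrightarrow> \<xi> \<in> carrier_vec r \<Longrightarrow> \<phi> x \<xi> = \<gamma> x \<xi>"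
  shows "rep m p r f \<gamma>"
proof -
  from assms(1) obtain A b M where "f = (A, b, M * transpose_mat M)"
     "A \<in> carrier_mat p m" "b \<in> carrier_vec p" "M \<in> carrier_mat p r"
     "\<forall>x \<in> carrier_vec m. \<forall>\<xi> \<in> carrier_vec r. \<phi> x \<xi> = A *\<^sub>v x + b + M *\<^sub>v \<xi>"
    unfolding rep_def by blast
  then show ?thesis unfolding rep_def using assms(2)
    by (intro exI[of _ A] exI[of _ b] exI[of _ M]) simp
qed

section \<open>Conditionals computed from a factored covariance\<close>

lemma marg_K_gram:
  fixes M1 M2 :: "real mat"
  assumes A: "A \<in> carrier_mat (N + k) 0" and b: "b1 \<in> carrier_vec N" "b2 \<in> carrier_vec k"
    and M: "M1 \<in> carrier_mat N r" "M2 \<in> carrier_mat k r"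
  shows "marg_K N k (A, b1 @\<^sub>v b2, (M1 @\<^sub>r M2) * transpose_mat (M1 @\<^sub>r M2)) = (0\<^sub>m k 0, b2, M2 * transpose_mat M2)"
proof -
  let ?M = "M1 @\<^sub>r M2" and ?Q = "proj_mat (N + k) N k"
  have Mc: "?M \<in> carrier_mat (N + k) r" using M by (rule carrier_append_rows)
  have Q: "?Q \<in> carrier_mat k (N + k)" by (simp add: proj_mat_def)
  have rowQ: "row ?Q i = unit_vec (N + k) (N + i)" if "i < k" for i
    using that by (intro eq_vecI) (auto simp: proj_mat_def)
  have QM: "?Q * ?M = M2"
  proof (rule eq_matI)
    fix i j assume ij: "i < dim_row M2" "j < dim_col M2"
    then have "(?Q * ?M) $$ (i, j) = unit_vec (N + k) (N + i) \<bullet> col ?M j"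
      using Q carrier_matD[OF Mc] M rowQ by simp
    also have "\<dots> = ?M $$ (N + i, j)" using ij M carrier_matD[OF Mc] by (subst scalar_prod_left_unit[of _ "N + k"]) auto
    also have "\<dots> = M2 $$ (i, j)" using ij M by (simp add: append_rows_def)
    finally show "(?Q * ?M) $$ (i, j) = M2 $$ (i, j)" .
  qed (use Q carrier_matD[OF Mc] M in auto)
  have "?Q * (?M * transpose_mat ?M) * transpose_mat ?Q = (?Q * ?M) * transpose_mat (?Q * ?M)"
    by (rule gram_conj[OF Q Mc])
  moreover have "?Q *\<^sub>v (b1 @\<^sub>v b2) = b2"
  proof (rule eq_vecI)
    fix i assume "i < dim_vec b2"
    then show "(?Q *\<^sub>v (b1 @\<^sub>v b2)) $ i = b2 $ i"
      using b Q rowQ scalar_prod_left_unit[of "b1 @\<^sub>v b2" "N + k" "N + i"] by auto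
  qed (use b Q in auto)
  moreover have "?Q * A = 0\<^sub>m k 0" using Q A by (intro eq_matI) auto
  ultimately show ?thesis using b M QM unfolding marg_K_def gcomp_def gdet_def by auto
qed

lemma four_block_eq_iff:
  assumes "A \<in> carrier_mat n1 m1" "B \<in> carrier_mat n1 m2" "C \<in> carrier_mat n2 m1" "D \<in> carrier_mat n2 m2"
    "A' \<in> carrier_mat n1 m1" "B' \<in> carrier_mat n1 m2" "C' \<in> carrier_mat n2 m1" "D' \<in> carrier_mat n2 m2"
  shows "four_block_mat A B C D = four_block_mat A' B' C' D' \<longleftrightarrow> A = A' \<and> B = B' \<and> C = C' \<and> D = D'"
proof
  assume e: "four_block_mat A B C D = four_block_mat A' B' C' D'"
  have ix: "four_block_mat A B C D $$ (i, j) = four_block_mat A' B' C' D' $$ (i, j)" for i j using e by simp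
  show "A = A' \<and> B = B' \<and> C = C' \<and> D = D'"
  proof (intro conjI eq_matI)
    fix i j assume "i < dim_row A'" "j < dim_col A'"
    then show "A $$ (i, j) = A' $$ (i, j)" using ix[of i j] assms by simp
  next
    fix i j assume "i < dim_row B'" "j < dim_col B'"
    then show "B $$ (i, j) = B' $$ (i, j)" using ix[of i "m1 + j"] assms by simp
  next
    fix i j assume "i < dim_row C'" "j < dim_col C'"
    then show "C $$ (i, j) = C' $$ (i, j)" using ix[of "n1 + i" j] assms by simp
  next
    fix i j assume "i < dim_row D'" "j < dim_col D'"
    then show "D $$ (i, j) = D' $$ (i, j)" using ix[of "n1 + i" "m1 + j"] assms by simp
  qed (use assms in auto)
qed simp

lemma append_rows_gram:
  fixes M1 M2 :: "real mat"
  assumes M: "M1 \<in> carrier_mat N r" "M2 \<in> carrier_mat k r"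
  shows "(M1 @\<^sub>r M2) * transpose_mat (M1 @\<^sub>r M2) =
     four_block_mat (M1 * transpose_mat M1) (M1 * transpose_mat M2)
                    (M2 * transpose_mat M1) (M2 * transpose_mat M2)"
proof -
  have rw: "row (M1 @\<^sub>r M2) i = (if i < N then row M1 i else row M2 (i - N))" if "i < N + k" for i
    using that M by (intro eq_vecI) (auto simp: append_rows_def)
  have c: "M1 @\<^sub>r M2 \<in> carrier_mat (N + k) r" using M by (rule carrier_append_rows)
  show ?thesis using carrier_matD[OF c] M by (intro eq_matI) (auto simp: rw)
qed

text \<open>Copying the marginal and applying the linear map \<open>C\<close> to the first copy
  stacks \<open>C M2\<close> on \<open>M2\<close>, on the level of the noise factor. This is the
  noise-free part of the right-hand side of the equation defining a conditional.\<close>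

lemma copy_apply_gram:
  fixes C M2 :: "real mat"
  assumes C: "C \<in> carrier_mat N k" and M: "M2 \<in> carrier_mat k r"
  defines "B \<equiv> four_block_mat C (0\<^sub>m N k) (0\<^sub>m k k) (1\<^sub>m k)"
  defines "E \<equiv> four_block_mat (1\<^sub>m k) (0\<^sub>m k 0) (1\<^sub>m k) (0\<^sub>m k 0) :: real mat"
  shows "B * (E * (M2 * transpose_mat M2) * transpose_mat E) * transpose_mat B
      = ((C * M2) @\<^sub>r M2) * transpose_mat ((C * M2) @\<^sub>r M2)"
    and "b \<in> carrier_vec k \<Longrightarrow> B *\<^sub>v (E *\<^sub>v b) = (C *\<^sub>v b) @\<^sub>v b"
proof -
  have E: "E \<in> carrier_mat (k + k) k"
    unfolding E_def using four_block_carrier_mat[of "1\<^sub>m k" k k "0\<^sub>m k 0" k 0] by simp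
  have B: "B \<in> carrier_mat (N + k) (k + k)" using C by (auto simp: B_def)
  have Ev: "E *\<^sub>v b = b @\<^sub>v b" if "b \<in> carrier_vec k" for b
  proof -
    have "row E i = unit_vec k (if i < k then i else i - k)" if "i < k + k" for i
      using that by (intro eq_vecI) (auto simp: E_def)
    then have "(E *\<^sub>v b) $ i = (b @\<^sub>v b) $ i" if "i < k + k" for i
      using that E \<open>b \<in> carrier_vec k\<close> scalar_prod_left_unit[of b k "if i < k then i else i - k"] by auto
    then show ?thesis using E that by (intro eq_vecI) auto
  qed
  have BE: "B *\<^sub>v (E *\<^sub>v b) = (C *\<^sub>v b) @\<^sub>v b" if b: "b \<in> carrier_vec k" for b
  proof -
    have "B *\<^sub>v (b @\<^sub>v b) = (C *\<^sub>v b + 0\<^sub>m N k *\<^sub>v b) @\<^sub>v (0\<^sub>m k k *\<^sub>v b + 1\<^sub>m k *\<^sub>v b)"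
      unfolding B_def using C b by (intro four_block_mat_mult_vec[of _ N k _ k _ k]) auto
    also have "\<dots> = (C *\<^sub>v b) @\<^sub>v b" using C b by (intro arg_cong2[of _ _ _ _ append_vec] eq_vecI) auto
    finally show ?thesis unfolding Ev[OF b] .
  qed
  then show "b \<in> carrier_vec k \<Longrightarrow> B *\<^sub>v (E *\<^sub>v b) = (C *\<^sub>v b) @\<^sub>v b" .
  have W: "B * (E * M2) = (C * M2) @\<^sub>r M2"
  proof (rule mat_col_eqI)
    have c: "(C * M2) @\<^sub>r M2 \<in> carrier_mat (N + k) r" using C M by (intro carrier_append_rows) auto
    fix j assume "j < dim_col ((C * M2) @\<^sub>r M2)"
    then have j: "j < r" using c by simp
    have "col (B * (E * M2)) j = B *\<^sub>v (E *\<^sub>v col M2 j)"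
      unfolding col_mult2[OF B mult_carrier_mat[OF E M] j] col_mult2[OF E M j] ..
    also have "\<dots> = (C *\<^sub>v col M2 j) @\<^sub>v col M2 j" using BE[of "col M2 j"] M j by auto
    also have "\<dots> = col ((C * M2) @\<^sub>r M2) j" using C M j c
      by (intro eq_vecI) (auto simp: append_rows_def)
    finally show "col (B * (E * M2)) j = col ((C * M2) @\<^sub>r M2) j" .
  qed (use B E C M carrier_matD[OF carrier_append_rows[OF mult_carrier_mat[OF C M] M]] in auto)
  have EM: "E * M2 \<in> carrier_mat (k + k) r" using E M by simp
  have "E * (M2 * transpose_mat M2) * transpose_mat E = (E * M2) * transpose_mat (E * M2)"
    by (rule gram_conj[OF E M])
  then have "B * (E * (M2 * transpose_mat M2) * transpose_mat E) * transpose_mat B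
     = B * ((E * M2) * transpose_mat (E * M2)) * transpose_mat B" by simp
  also have "\<dots> = (B * (E * M2)) * transpose_mat (B * (E * M2))"
    by (rule gram_conj[OF B EM])
  finally show "B * (E * (M2 * transpose_mat M2) * transpose_mat E) * transpose_mat B
      = ((C * M2) @\<^sub>r M2) * transpose_mat ((C * M2) @\<^sub>r M2)" unfolding W .
qed

text \<open>The defining equation is compared block by block. The lower right blocks are identical
  and the lower left ones are transposes of the upper right ones, which leaves the mean, the output
  covariance and the cross covariance.\<close>

lemma is_conditional_iff:
  fixes M1 M2 :: "real mat"
  assumes A: "A \<in> carrier_mat (N + k) 0" and b: "b1 \<in> carrier_vec N" "b2 \<in> carrier_vec k"
    and M: "M1 \<in> carrier_mat N r" "M2 \<in> carrier_mat k r" and c: "is_gm k N (C, d, T)"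
  shows "is_conditional N k (A, b1 @\<^sub>v b2, (M1 @\<^sub>r M2) * transpose_mat (M1 @\<^sub>r M2)) (C, d, T) \<longleftrightarrow>
     b1 = C *\<^sub>v b2 + d \<and>
     M1 * transpose_mat M1 = (C * M2) * transpose_mat (C * M2) + T \<and>
     M1 * transpose_mat M2 = (C * M2) * transpose_mat M2"
proof -
  have C: "C \<in> carrier_mat N k" and d: "d \<in> carrier_vec N" and T: "T \<in> carrier_mat N N"
    using c unfolding is_gm_def by auto
  define B where "B = four_block_mat C (0\<^sub>m N k) (0\<^sub>m k k) (1\<^sub>m k)"
  define E where "E = (four_block_mat (1\<^sub>m k) (0\<^sub>m k 0) (1\<^sub>m k) (0\<^sub>m k 0) :: real mat)"
  have E: "E \<in> carrier_mat (k + k) k"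
    unfolding E_def using four_block_carrier_mat[of "1\<^sub>m k" k k "0\<^sub>m k 0" k 0] by simp
  have B: "B \<in> carrier_mat (N + k) (k + k)" using C by (auto simp: B_def)
  note cg = copy_apply_gram[OF C M(2), folded B_def E_def]
  let ?S2 = "M2 * transpose_mat M2" and ?T = "four_block_mat T (0\<^sub>m N k) (0\<^sub>m k N) (0\<^sub>m k k)"
  let ?W = "(C * M2) @\<^sub>r M2"
  have g1: "gcomp (gcopy k) (0\<^sub>m k 0, b2, ?S2) = (0\<^sub>m (k + k) 0, E *\<^sub>v b2, E * ?S2 * transpose_mat E)"
  proof -
    have "E * 0\<^sub>m k 0 = 0\<^sub>m (k + k) 0" using E by auto
    moreover have "E *\<^sub>v b2 + 0\<^sub>v (2 * k) = E *\<^sub>v b2" using E b by (intro eq_vecI) auto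
    moreover have "E * ?S2 * transpose_mat E + 0\<^sub>m (2 * k) (2 * k) = E * ?S2 * transpose_mat E"
      using E M by (intro eq_matI) auto
    ultimately show ?thesis unfolding gcopy_def gdet_def gcomp_def E_def by simp
  qed
  have g2: "gtensor (C, d, T) (gid k) = (B, d @\<^sub>v 0\<^sub>v k, ?T)"
    using C T d unfolding gtensor_def gid_def gdet_def B_def by simp
  have "gcomp (gtensor (C, d, T) (gid k)) (gcomp (gcopy k) (0\<^sub>m k 0, b2, ?S2))
     = (0\<^sub>m (N + k) 0, B *\<^sub>v (E *\<^sub>v b2) + (d @\<^sub>v 0\<^sub>v k), B * (E * ?S2 * transpose_mat E) * transpose_mat B + ?T)"
    unfolding g1 g2 unfolding gcomp_def using B by auto
  also have "B *\<^sub>v (E *\<^sub>v b2) + (d @\<^sub>v 0\<^sub>v k) = (C *\<^sub>v b2 + d) @\<^sub>v b2"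
    unfolding cg(2)[OF b(2)] using C b d by (subst append_vec_add[of _ N _ _ k]) auto
  also have "B * (E * ?S2 * transpose_mat E) * transpose_mat B + ?T
     = four_block_mat ((C * M2) * transpose_mat (C * M2) + T) ((C * M2) * transpose_mat M2)
                    (M2 * transpose_mat (C * M2)) (M2 * transpose_mat M2)"
    unfolding cg(1) append_rows_gram[OF mult_carrier_mat[OF C M(2)] M(2)]
    using C M T by (subst add_four_block_mat[of _ N N _ k _ k]) auto
  finally have eq: "gcomp (gtensor (C, d, T) (gid k)) (gcomp (gcopy k) (0\<^sub>m k 0, b2, ?S2))
    = (0\<^sub>m (N + k) 0, (C *\<^sub>v b2 + d) @\<^sub>v b2,
       four_block_mat ((C * M2) * transpose_mat (C * M2) + T) ((C * M2) * transpose_mat M2)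
                    (M2 * transpose_mat (C * M2)) (M2 * transpose_mat M2))" .
  have A0: "A = 0\<^sub>m (N + k) 0" using A by auto
  have tr: "M2 * transpose_mat M1 = M2 * transpose_mat (C * M2)" if e: "M1 * transpose_mat M2 = (C * M2) * transpose_mat M2"
  proof -
    have "transpose_mat (M1 * transpose_mat M2) = M2 * transpose_mat M1"
      using M by (subst transpose_mult[of _ N r _ k]) auto
    moreover have "transpose_mat ((C * M2) * transpose_mat M2) = M2 * transpose_mat (C * M2)"
      using M C by (subst transpose_mult[of _ N r _ k]) auto
    ultimately show ?thesis using e by simp
  qed
  have bl: "four_block_mat (M1 * transpose_mat M1) (M1 * transpose_mat M2) (M2 * transpose_mat M1) ?S2
     = four_block_mat ((C * M2) * transpose_mat (C * M2) + T) ((C * M2) * transpose_mat M2)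
                    (M2 * transpose_mat (C * M2)) ?S2 \<longleftrightarrow>
     M1 * transpose_mat M1 = (C * M2) * transpose_mat (C * M2) + T \<and>
     M1 * transpose_mat M2 = (C * M2) * transpose_mat M2"
    using M C T tr by (subst four_block_eq_iff[of _ N N _ k _ k]) auto
  have bb: "b1 @\<^sub>v b2 = (C *\<^sub>v b2 + d) @\<^sub>v b2 \<longleftrightarrow> b1 = C *\<^sub>v b2 + d"
    using b C d by (subst append_vec_eq[of _ N]) auto
  show ?thesis
    unfolding is_conditional_def
    unfolding marg_K_gram[OF A b M]
    unfolding eq append_rows_gram[OF M]
    unfolding A0 prod.inject bl bb using c by blast
qed

lemma row_eqI:
  fixes u v :: "real vec"
  assumes "u \<in> carrier_vec n" "v \<in> carrier_vec n" "\<And>x. x \<in> carrier_vec n \<Longrightarrow> u \<bullet> x = v \<bullet> x"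
  shows "u = v"
proof (rule eq_vecI)
  fix i assume "i < dim_vec v"
  then show "u $ i = v $ i" using assms(1,2) assms(3)[of "unit_vec n i"] by simp
qed (use assms in auto)

lemma split_rows:
  assumes M: "M \<in> carrier_mat (N + k) r"
  obtains M1 M2 where "M1 \<in> carrier_mat N r" "M2 \<in> carrier_mat k r" "M = M1 @\<^sub>r M2"
proof
  show "mat N r (\<lambda>ij. M $$ ij) \<in> carrier_mat N r" "mat k r (\<lambda>(i, j). M $$ (N + i, j)) \<in> carrier_mat k r"
    by auto
  show "M = mat N r (\<lambda>ij. M $$ ij) @\<^sub>r mat k r (\<lambda>(i, j). M $$ (N + i, j))"
    using M by (intro eq_matI) (auto simp: append_rows_def)
qed

lemma append_rows_mult_vec:
  fixes M1 M2 :: "real mat"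
  assumes M: "M1 \<in> carrier_mat N r" "M2 \<in> carrier_mat k r" and x: "x \<in> carrier_vec r"
  shows "(M1 @\<^sub>r M2) *\<^sub>v x = (M1 *\<^sub>v x) @\<^sub>v (M2 *\<^sub>v x)"
proof (rule eq_vecI)
  have c: "dim_row (M1 @\<^sub>r M2) = N + k" using carrier_matD[OF carrier_append_rows[OF M]] by simp
  then show "dim_vec ((M1 @\<^sub>r M2) *\<^sub>v x) = dim_vec ((M1 *\<^sub>v x) @\<^sub>v (M2 *\<^sub>v x))" using M by simp
  fix i assume "i < dim_vec ((M1 *\<^sub>v x) @\<^sub>v (M2 *\<^sub>v x))"
  then have i: "i < N + k" using M by simp
  have "row (M1 @\<^sub>r M2) i = (if i < N then row M1 i else row M2 (i - N))"
    using i M by (intro eq_vecI) (auto simp: append_rows_def)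
  then show "((M1 @\<^sub>r M2) *\<^sub>v x) $ i = ((M1 *\<^sub>v x) @\<^sub>v (M2 *\<^sub>v x)) $ i"
    using i M c by simp
qed

text \<open>The range of \<open>P\<close> is exactly the kernel of \<open>M\<close>, hence the
  direction of the solution space. Subtracting from any solution its component in the kernel gives
  the solution annihilated by \<open>P\<close>, the one of least norm.\<close>

lemma stdcond_solutions:
  fixes M :: "real mat"
  assumes M: "M \<in> carrier_mat k r" and P: "proj r P"
    and MP: "\<And>x. x \<in> carrier_vec r \<Longrightarrow> M *\<^sub>v (P *\<^sub>v x) = 0\<^sub>v k"
    and sp: "\<And>x. x \<in> carrier_vec r \<Longrightarrow> \<exists>y \<in> carrier_vec k. x - P *\<^sub>v x = transpose_mat M *\<^sub>v y"
    and \<xi>: "\<xi> \<in> carrier_vec r" "M *\<^sub>v \<xi> = c"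
  shows "stdcond r {\<zeta> \<in> carrier_vec r. M *\<^sub>v \<zeta> = c} (\<xi> - P *\<^sub>v \<xi>, P)"
proof -
  have Pc: "P \<in> carrier_mat r r" and sym: "transpose_mat P = P"
    and idem: "\<And>x. x \<in> carrier_vec r \<Longrightarrow> P *\<^sub>v (P *\<^sub>v x) = P *\<^sub>v x" using P unfolding proj_def by auto
  have cc: "c \<in> carrier_vec k" using M \<xi> by auto
  have P\<xi>: "P *\<^sub>v \<xi> \<in> carrier_vec r" using Pc \<xi> by auto
  have Px: "P *\<^sub>v x = x" if x: "x \<in> carrier_vec r" and z: "M *\<^sub>v x = 0\<^sub>v k" for x
  proof -
    define d where "d = x - P *\<^sub>v x"
    have d: "d \<in> carrier_vec r" using x Pc by (simp add: d_def)
    obtain y where y: "y \<in> carrier_vec k" "d = transpose_mat M *\<^sub>v y" using sp[OF x] d_def by blast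
    have Md: "M *\<^sub>v d = 0\<^sub>v k" unfolding d_def
      using mult_minus_distrib_mat_vec[OF M x, of "P *\<^sub>v x"] Pc x z MP[OF x] by simp
    \<comment> \<open>The row space is orthogonal to the kernel, and \<open>d\<close> belongs to
      both.\<close>
    have "d \<bullet> d = y \<bullet> (M *\<^sub>v d)" using transpose_vec_mult_scalar[OF M d y(1)] y(2) by simp
    also have "\<dots> = 0" using Md y by simp
    finally have "d = 0\<^sub>v r" by (rule scalar_self_zero[OF d])
    then show ?thesis using d_def x Pc by (auto simp: vec_eq_iff)
  qed
  have "M *\<^sub>v \<zeta> = c \<longleftrightarrow> P *\<^sub>v (\<zeta> - (\<xi> - P *\<^sub>v \<xi>)) = \<zeta> - (\<xi> - P *\<^sub>v \<xi>)" if z: "\<zeta> \<in> carrier_vec r" for \<zeta>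
  proof -
    define x where "x = \<zeta> - \<xi>"
    have x: "x \<in> carrier_vec r" using z \<xi> by (simp add: x_def)
    have e: "\<zeta> - (\<xi> - P *\<^sub>v \<xi>) = x + P *\<^sub>v \<xi>" using z \<xi> P\<xi> Pc by (intro eq_vecI) (auto simp: x_def)
    have "P *\<^sub>v (x + P *\<^sub>v \<xi>) = P *\<^sub>v x + P *\<^sub>v \<xi>"
      using mult_add_distrib_mat_vec[OF Pc x P\<xi>] idem[OF \<xi>(1)] by simp
    then have "P *\<^sub>v (\<zeta> - (\<xi> - P *\<^sub>v \<xi>)) = \<zeta> - (\<xi> - P *\<^sub>v \<xi>) \<longleftrightarrow> P *\<^sub>v x = x"
      unfolding e using x P\<xi> Pc by (auto simp: vec_eq_iff)
    also have "\<dots> \<longleftrightarrow> M *\<^sub>v x = 0\<^sub>v k" using Px[OF x] MP[OF x] by auto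
    also have "M *\<^sub>v x = M *\<^sub>v \<zeta> - c" unfolding x_def
      using mult_minus_distrib_mat_vec[OF M z \<xi>(1)] \<xi> by simp
    also have "M *\<^sub>v \<zeta> - c = 0\<^sub>v k \<longleftrightarrow> M *\<^sub>v \<zeta> = c" using M cc by (auto simp: vec_eq_iff)
    finally show ?thesis by simp
  qed
  moreover have "P *\<^sub>v (\<xi> - P *\<^sub>v \<xi>) = 0\<^sub>v r"
    using mult_minus_distrib_mat_vec[OF Pc \<xi>(1) P\<xi>] idem[OF \<xi>(1)] P\<xi> by simp
  ultimately show ?thesis using P \<xi> P\<xi> unfolding stdcond_def by auto
qed

text \<open>The matrix \<open>C\<close> is in general not unique, but \<open>C M2\<close> is: its
  rows are the components of the rows of \<open>M1\<close> in the row space of \<open>M2\<close>,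
  that is, the regression of the outputs on the conditions. The residual noise of the outputs is
  projected onto the kernel of \<open>M2\<close>, which gives \<open>T\<close>.\<close>

lemma is_conditional_rows:
  fixes M1 M2 :: "real mat"
  assumes A: "A \<in> carrier_mat (N + k) 0" and b: "b1 \<in> carrier_vec N" "b2 \<in> carrier_vec k"
    and M: "M1 \<in> carrier_mat N r" "M2 \<in> carrier_mat k r" and P: "proj r P"
    and MP: "\<And>x. x \<in> carrier_vec r \<Longrightarrow> M2 *\<^sub>v (P *\<^sub>v x) = 0\<^sub>v k"
    and sp: "\<And>x. x \<in> carrier_vec r \<Longrightarrow> \<exists>y \<in> carrier_vec k. x - P *\<^sub>v x = transpose_mat M2 *\<^sub>v y"
    and c: "is_gm k N (C, d, T)"
  shows "is_conditional N k (A, b1 @\<^sub>v b2, (M1 @\<^sub>r M2) * transpose_mat (M1 @\<^sub>r M2)) (C, d, T) \<longleftrightarrow>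
     b1 = C *\<^sub>v b2 + d \<and>
     (\<forall>i<N. row (C * M2) i = row M1 i - P *\<^sub>v row M1 i) \<and>
     (\<forall>i<N. \<forall>j<N. T $$ (i, j) = row M1 i \<bullet> (P *\<^sub>v row M1 j))"
proof -
  have Pc: "P \<in> carrier_mat r r" and sym: "transpose_mat P = P"
    and idem: "\<And>x. x \<in> carrier_vec r \<Longrightarrow> P *\<^sub>v (P *\<^sub>v x) = P *\<^sub>v x" using P unfolding proj_def by auto
  have C: "C \<in> carrier_mat N k" and d: "d \<in> carrier_vec N" and T: "T \<in> carrier_mat N N"
    using c unfolding is_gm_def by auto
  have CM: "C * M2 \<in> carrier_mat N r" using C M by simp
  define a where "a i = row M1 i" for i
  define q where "q i = row (C * M2) i" for i
  have a: "a i \<in> carrier_vec r" if "i < N" for i using M that by (simp add: a_def)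
  have q: "q i \<in> carrier_vec r" if "i < N" for i using row_carrier_vec[OF that CM] by (simp add: q_def)
  have Pv: "P *\<^sub>v x \<in> carrier_vec r" if "x \<in> carrier_vec r" for x using Pc that by auto
  have aPa: "a i \<bullet> (P *\<^sub>v a j) = (P *\<^sub>v a i) \<bullet> (P *\<^sub>v a j)" if "i < N" "j < N" for i j
    using sym_scalar[OF Pc sym a[OF that(1)] Pv[OF a[OF that(2)]]] idem[OF a[OF that(2)]] by simp
  have mP: "P *\<^sub>v row M2 j = 0\<^sub>v r" if j: "j < k" for j
  proof (rule row_eqI)
    fix x :: "real vec" assume x: "x \<in> carrier_vec r"
    have "(P *\<^sub>v row M2 j) \<bullet> x = row M2 j \<bullet> (P *\<^sub>v x)"
      using sym_scalar[OF Pc sym _ x, of "row M2 j"] M j by simp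
    also have "\<dots> = (M2 *\<^sub>v (P *\<^sub>v x)) $ j" using M j by simp
    also have "\<dots> = 0" using MP[OF x] j by simp
    finally show "(P *\<^sub>v row M2 j) \<bullet> x = 0\<^sub>v r \<bullet> x" using x by simp
  qed (use M Pc j in auto)
  have mat1: "M1 * transpose_mat M2 = (C * M2) * transpose_mat M2 \<longleftrightarrow>
      (\<forall>i<N. \<forall>j<k. a i \<bullet> row M2 j = q i \<bullet> row M2 j)"
  proof -
    have "M1 * transpose_mat M2 = X * transpose_mat M2 \<longleftrightarrow>
      (\<forall>i<N. \<forall>j<k. row M1 i \<bullet> row M2 j = row X i \<bullet> row M2 j)" if "X \<in> carrier_mat N r" for X
      using M that unfolding mat_eq_iff by auto
    from this[OF CM] show ?thesis unfolding a_def q_def .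
  qed
  have mat2: "M1 * transpose_mat M1 = (C * M2) * transpose_mat (C * M2) + T \<longleftrightarrow>
      (\<forall>i<N. \<forall>j<N. a i \<bullet> a j = q i \<bullet> q j + T $$ (i, j))"
  proof -
    have "M1 * transpose_mat M1 = X * transpose_mat X + T \<longleftrightarrow>
      (\<forall>i<N. \<forall>j<N. row M1 i \<bullet> row M1 j = row X i \<bullet> row X j + T $$ (i, j))" if "X \<in> carrier_mat N r" for X
      using M T that unfolding mat_eq_iff by auto
    from this[OF CM] show ?thesis unfolding a_def q_def .
  qed
  \<comment> \<open>Both \<open>q i\<close> and \<open>a i - P a i\<close> lie in the row space of
    \<open>M2\<close>, where a vector is determined by its inner products with the rows of
    \<open>M2\<close>.\<close>
  have rows: "(\<forall>i<N. \<forall>j<k. a i \<bullet> row M2 j = q i \<bullet> row M2 j) \<longleftrightarrow> (\<forall>i<N. q i = a i - P *\<^sub>v a i)"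
  proof (intro iffI allI impI)
    fix i assume h: "\<forall>i<N. \<forall>j<k. a i \<bullet> row M2 j = q i \<bullet> row M2 j" and i: "i < N"
    have Ma: "M2 *\<^sub>v a i = M2 *\<^sub>v q i"
    proof (rule eq_vecI)
      fix j assume "j < dim_vec (M2 *\<^sub>v q i)"
      then have j: "j < k" using M by simp
      then show "(M2 *\<^sub>v a i) $ j = (M2 *\<^sub>v q i) $ j"
        using h i M a[OF i] q[OF i] comm_scalar_prod[of "row M2 j" r "a i"]
          comm_scalar_prod[of "row M2 j" r "q i"] by simp
    qed (use M in auto)
    show "q i = a i - P *\<^sub>v a i"
    proof (rule row_eqI)
      fix x :: "real vec" assume x: "x \<in> carrier_vec r"
      obtain y where y: "y \<in> carrier_vec k" "x - P *\<^sub>v x = transpose_mat M2 *\<^sub>v y" using sp[OF x] by blast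
      have s: "v \<bullet> (x - P *\<^sub>v x) = y \<bullet> (M2 *\<^sub>v v)" if v: "v \<in> carrier_vec r" for v
      proof -
        have "x - P *\<^sub>v x \<in> carrier_vec r" using x Pv by simp
        from comm_scalar_prod[OF v this] show ?thesis
          using transpose_vec_mult_scalar[OF M(2) v y(1)] y(2) by simp
      qed
      have "q i \<bullet> (P *\<^sub>v x) = 0"
      proof -
        have "q i = transpose_mat M2 *\<^sub>v row C i" using C M i
          by (intro eq_vecI) (auto simp: q_def comm_scalar_prod[of _ k])
        then have "q i \<bullet> (P *\<^sub>v x) = row C i \<bullet> (M2 *\<^sub>v (P *\<^sub>v x))"
          using transpose_vec_mult_scalar[OF M(2) Pv[OF x], of "row C i"] C i by simp
        then show ?thesis using MP[OF x] C i by simp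
      qed
      then have "q i \<bullet> x = q i \<bullet> (x - P *\<^sub>v x)"
        using scalar_prod_minus_distrib[OF q[OF i] x Pv[OF x]] by simp
      also have "\<dots> = a i \<bullet> (x - P *\<^sub>v x)" using s[OF q[OF i]] s[OF a[OF i]] Ma by simp
      also have "\<dots> = a i \<bullet> x - a i \<bullet> (P *\<^sub>v x)"
        using scalar_prod_minus_distrib[OF a[OF i] x Pv[OF x]] .
      also have "\<dots> = (a i - P *\<^sub>v a i) \<bullet> x"
        using minus_scalar_prod_distrib[OF a[OF i] Pv[OF a[OF i]] x] sym_scalar[OF Pc sym a[OF i] x] by simp
      finally show "q i \<bullet> x = (a i - P *\<^sub>v a i) \<bullet> x" .
    qed (use a[OF i] q[OF i] Pv in auto)
  next
    fix i j assume h: "\<forall>i<N. q i = a i - P *\<^sub>v a i" and i: "i < N" and j: "j < k"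
    have m: "row M2 j \<in> carrier_vec r" using M j by simp
    have "q i \<bullet> row M2 j = a i \<bullet> row M2 j - (P *\<^sub>v a i) \<bullet> row M2 j"
      using h i minus_scalar_prod_distrib[OF a[OF i] Pv[OF a[OF i]] m] by simp
    also have "(P *\<^sub>v a i) \<bullet> row M2 j = 0"
      using sym_scalar[OF Pc sym a[OF i] m] mP[OF j] a[OF i] by simp
    finally show "a i \<bullet> row M2 j = q i \<bullet> row M2 j" by simp
  qed
  have cov: "(a i \<bullet> a j = q i \<bullet> q j + T $$ (i, j)) \<longleftrightarrow> T $$ (i, j) = a i \<bullet> (P *\<^sub>v a j)"
    if h: "\<forall>i<N. q i = a i - P *\<^sub>v a i" and ij: "i < N" "j < N" for i j
  proof -
    note ai = a[OF ij(1)] and aj = a[OF ij(2)]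
    have "q i \<bullet> q j = (a i - P *\<^sub>v a i) \<bullet> (a j - P *\<^sub>v a j)" using h ij by simp
    also have "\<dots> = (a i \<bullet> a j - a i \<bullet> (P *\<^sub>v a j)) - ((P *\<^sub>v a i) \<bullet> a j - (P *\<^sub>v a i) \<bullet> (P *\<^sub>v a j))"
      using ai aj Pv[OF ai] Pv[OF aj]
      by (simp add: minus_scalar_prod_distrib[of _ r] scalar_prod_minus_distrib[of _ r])
    also have "\<dots> = a i \<bullet> a j - a i \<bullet> (P *\<^sub>v a j)"
      using aPa[OF ij] sym_scalar[OF Pc sym ai aj] by simp
    finally show ?thesis by auto
  qed
  show ?thesis
    unfolding is_conditional_iff[OF A b M c] mat1 mat2 rows
    unfolding q_def[symmetric] a_def[symmetric] using cov by blast
qed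

text \<open>The support condition asks for a solution in the column space of M2 M2^T, which equals
  that of \<open>M2\<close>, so success means that the equations are solvable. A conditional applied
  to \<open>ob\<close> has mean \<open>b1 + C (M2 \<mu>)\<close>, where \<open>\<mu>\<close> is the
  least-norm solution; only \<open>C M2\<close> enters, so the posterior does not depend on the
  conditional chosen, and it is the law of the outputs given \<open>L\<close>.\<close>

lemma inference:
  assumes rep: "rep 0 (N + k) r \<psi> \<phi>" and ob: "ob \<in> carrier_vec k"
  defines "L \<equiv> {\<xi> \<in> carrier_vec r. \<forall>j<k. \<phi> (0\<^sub>v 0) \<xi> $ (N + j) = ob $ j}"
    and "fs \<equiv> map (\<lambda>i \<xi>. \<phi> (0\<^sub>v 0) \<xi> $ i) [0..<N]"
  shows "succeeds N (\<psi>, ob) \<longleftrightarrow> L \<noteq> {}"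
    and "L \<noteq> {} \<Longrightarrow> \<exists>G. has_law r L fs G \<and> (\<exists>c. is_conditional N k \<psi> c) \<and>
       (\<forall>c. is_conditional N k \<psi> c \<longrightarrow> gcomp c (gpoint ob) = (0\<^sub>m N 0, fst G, snd G))"
proof -
  obtain A b M where psi: "\<psi> = (A, b, M * transpose_mat M)"
    and A: "A \<in> carrier_mat (N + k) 0" and bc: "b \<in> carrier_vec (N + k)" and Mc: "M \<in> carrier_mat (N + k) r"
    and phi: "\<And>x \<xi>. x \<in> carrier_vec 0 \<Longrightarrow> \<xi> \<in> carrier_vec r \<Longrightarrow> \<phi> x \<xi> = A *\<^sub>v x + b + M *\<^sub>v \<xi>"
    using rep unfolding rep_def by blast
  obtain M1 M2 where M: "M1 \<in> carrier_mat N r" "M2 \<in> carrier_mat k r" and MM: "M = M1 @\<^sub>r M2"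
    using split_rows[OF Mc] by blast
  define b1 b2 where "b1 = vec_first b N" and "b2 = vec_last b k"
  have b: "b1 \<in> carrier_vec N" "b2 \<in> carrier_vec k" and bb: "b = b1 @\<^sub>v b2"
    using bc by (simp_all add: b1_def b2_def)
  have ph: "\<phi> (0\<^sub>v 0) \<xi> = (b1 + M1 *\<^sub>v \<xi>) @\<^sub>v (b2 + M2 *\<^sub>v \<xi>)" if x: "\<xi> \<in> carrier_vec r" for \<xi>
  proof -
    have "A *\<^sub>v 0\<^sub>v 0 + b = b" using A bc by (intro eq_vecI) (auto simp: scalar_prod_def)
    then have "\<phi> (0\<^sub>v 0) \<xi> = b + M *\<^sub>v \<xi>" using phi[OF _ x, of "0\<^sub>v 0"] by simp
    also have "\<dots> = (b1 + M1 *\<^sub>v \<xi>) @\<^sub>v (b2 + M2 *\<^sub>v \<xi>)"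
      unfolding bb MM append_rows_mult_vec[OF M x] using b M x by (subst append_vec_add[of _ N _ _ k]) auto
    finally show ?thesis .
  qed
  have L: "L = {\<xi> \<in> carrier_vec r. M2 *\<^sub>v \<xi> = ob - b2}"
  proof -
    have "(\<forall>j<k. \<phi> (0\<^sub>v 0) \<xi> $ (N + j) = ob $ j) \<longleftrightarrow> M2 *\<^sub>v \<xi> = ob - b2" if "\<xi> \<in> carrier_vec r" for \<xi>
    proof -
      have "\<phi> (0\<^sub>v 0) \<xi> $ (N + j) = b2 $ j + (M2 *\<^sub>v \<xi>) $ j" if "j < k" for j
        unfolding ph[OF \<open>\<xi> \<in> carrier_vec r\<close>] using that b M
        by (simp add: index_append_vec(1) del: index_mult_mat_vec)
      then have "(\<forall>j<k. \<phi> (0\<^sub>v 0) \<xi> $ (N + j) = ob $ j) \<longleftrightarrow> (\<forall>j<k. (M2 *\<^sub>v \<xi>) $ j = ob $ j - b2 $ j)"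
        by (auto simp: algebra_simps)
      also have "\<dots> \<longleftrightarrow> M2 *\<^sub>v \<xi> = ob - b2"
        using b M ob by (auto simp: vec_eq_iff)
      finally show ?thesis .
    qed
    then show ?thesis unfolding L_def by blast
  qed
  obtain P where P: "proj r P" and MP: "\<And>x. x \<in> carrier_vec r \<Longrightarrow> M2 *\<^sub>v (P *\<^sub>v x) = 0\<^sub>v k"
    and sp: "\<And>x. x \<in> carrier_vec r \<Longrightarrow> \<exists>y \<in> carrier_vec k. x - P *\<^sub>v x = transpose_mat M2 *\<^sub>v y"
    using row_space_proj[OF M(2)] by blast
  have Pc: "P \<in> carrier_mat r r" and sym: "transpose_mat P = P"
    and idem: "\<And>x. x \<in> carrier_vec r \<Longrightarrow> P *\<^sub>v (P *\<^sub>v x) = P *\<^sub>v x" using P unfolding proj_def by auto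
  have M2t: "transpose_mat M2 \<in> carrier_mat r k" using M by simp
  have dob: "dim_vec ob = k" using ob by simp
  have marg: "marg_K N k \<psi> = (0\<^sub>m k 0, b2, M2 * transpose_mat M2)"
    unfolding psi bb MM by (rule marg_K_gram[OF A b M])
  have assoc: "(M2 * transpose_mat M2) *\<^sub>v y = M2 *\<^sub>v (transpose_mat M2 *\<^sub>v y)" if "y \<in> carrier_vec k" for y
    using M M2t that by (intro assoc_mult_mat_vec) auto
  show "succeeds N (\<psi>, ob) \<longleftrightarrow> L \<noteq> {}"
  proof
    assume "succeeds N (\<psi>, ob)"
    then obtain y where y: "y \<in> carrier_vec k" "ob = b2 + (M2 * transpose_mat M2) *\<^sub>v y"
      unfolding succeeds_def in_support_def using marg dob M by auto
    then have "M2 *\<^sub>v (transpose_mat M2 *\<^sub>v y) = ob - b2" using b M assoc[OF y(1)]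
      by (simp add: vec_eq_iff)
    then have "transpose_mat M2 *\<^sub>v y \<in> L"
      unfolding L using mult_mat_vec_carrier[OF M2t y(1)] by blast
    then show "L \<noteq> {}" by blast
  next
    assume "L \<noteq> {}"
    then obtain \<xi> where \<xi>: "\<xi> \<in> carrier_vec r" "M2 *\<^sub>v \<xi> = ob - b2" using L by auto
    \<comment> \<open>Dropping the kernel component of a solution leaves a solution in the row
      space, which M2^T then factors through.\<close>
    obtain y where y: "y \<in> carrier_vec k" "\<xi> - P *\<^sub>v \<xi> = transpose_mat M2 *\<^sub>v y" using sp[OF \<xi>(1)] by blast
    have "M2 *\<^sub>v (\<xi> - P *\<^sub>v \<xi>) = ob - b2"
      using mult_minus_distrib_mat_vec[OF M(2) \<xi>(1), of "P *\<^sub>v \<xi>"] MP[OF \<xi>(1)] Pc \<xi> ob b by simp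
    then have "ob = b2 + (M2 * transpose_mat M2) *\<^sub>v y" using assoc[OF y(1)] y(2) ob b
      by (auto simp: vec_eq_iff)
    then show "succeeds N (\<psi>, ob)"
      unfolding succeeds_def in_support_def using marg dob M y by auto
  qed
  assume "L \<noteq> {}"
  then obtain \<xi> where \<xi>: "\<xi> \<in> carrier_vec r" "M2 *\<^sub>v \<xi> = ob - b2" using L by auto
  define \<mu> where "\<mu> = \<xi> - P *\<^sub>v \<xi>"
  have \<mu>: "\<mu> \<in> carrier_vec r" using \<xi> Pc by (simp add: \<mu>_def)
  have st: "stdcond r L (\<mu>, P)"
    unfolding L \<mu>_def by (rule stdcond_solutions[OF M(2) P MP sp \<xi>])
  have P\<mu>: "P *\<^sub>v \<mu> = 0\<^sub>v r" and M\<mu>: "M2 *\<^sub>v \<mu> = ob - b2"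
    using st stdcond_mean[OF st] L unfolding stdcond_def by auto
  have G: "pushf r fs (\<mu>, P) = (b1 + M1 *\<^sub>v \<mu>, mat N N (\<lambda>(i, j). row M1 i \<bullet> (P *\<^sub>v row M1 j)))"
  proof -
    have fi: "(fs ! i) \<xi> = row M1 i \<bullet> \<xi> + b1 $ i" if "i < N" "\<xi> \<in> carrier_vec r" for i \<xi>
    proof -
      have "(fs ! i) \<xi> = \<phi> (0\<^sub>v 0) \<xi> $ i" using that by (simp add: fs_def)
      then show ?thesis unfolding ph[OF that(2)] using that b M by simp
    qed
    have "lpart r (fs ! i) = row M1 i" if "i < N" for i
      using M that fi[OF that] by (intro lpart_eqI[of _ _ _ "b1 $ i"]) auto
    then show ?thesis unfolding pushf_def using fi \<mu> M b
      by (auto simp: fs_def intro!: eq_vecI eq_matI)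
  qed
  have cond: "is_conditional N k (A, b1 @\<^sub>v b2, (M1 @\<^sub>r M2) * transpose_mat (M1 @\<^sub>r M2)) (C, d, T) \<longleftrightarrow>
     b1 = C *\<^sub>v b2 + d \<and>
     (\<forall>i<N. row (C * M2) i = row M1 i - P *\<^sub>v row M1 i) \<and>
     (\<forall>i<N. \<forall>j<N. T $$ (i, j) = row M1 i \<bullet> (P *\<^sub>v row M1 j))"
    if "is_gm k N (C, d, T)" for C d T
    by (rule is_conditional_rows[OF A b M P MP sp that])
  show "\<exists>G. has_law r L fs G \<and> (\<exists>c. is_conditional N k \<psi> c) \<and>
       (\<forall>c. is_conditional N k \<psi> c \<longrightarrow> gcomp c (gpoint ob) = (0\<^sub>m N 0, fst G, snd G))"
  proof (intro exI conjI allI impI)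
    show "has_law r L fs (pushf r fs (\<mu>, P))" unfolding has_law_def using st by blast
    define Y where "Y i = (SOME y. y \<in> carrier_vec k \<and> row M1 i - P *\<^sub>v row M1 i = transpose_mat M2 *\<^sub>v y)" for i
    have Y: "Y i \<in> carrier_vec k \<and> row M1 i - P *\<^sub>v row M1 i = transpose_mat M2 *\<^sub>v Y i" if "i < N" for i
    proof -
      have "row M1 i \<in> carrier_vec r" using M that by simp
      from sp[OF this] have "\<exists>y. y \<in> carrier_vec k \<and> row M1 i - P *\<^sub>v row M1 i = transpose_mat M2 *\<^sub>v y" by blast
      from someI_ex[OF this] show ?thesis unfolding Y_def .
    qed
    define C where "C = mat N k (\<lambda>(i, j). Y i $ j)"
    have C: "C \<in> carrier_mat N k" by (simp add: C_def)
    have rC: "row C i = Y i" if "i < N" for i using that Y[OF that] by (intro eq_vecI) (auto simp: C_def)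
    \<comment> \<open>The residual covariance M1 P M1^T equals W W^T because \<open>P\<close> is a
      symmetric idempotent, and in this form it is visibly positive semidefinite.\<close>
    define W where "W = M1 * P"
    have W: "W \<in> carrier_mat N r" using M Pc by (simp add: W_def)
    have rW: "row W i = P *\<^sub>v row M1 i" if i: "i < N" for i
    proof (rule eq_vecI)
      fix j assume "j < dim_vec (P *\<^sub>v row M1 i)"
      then have j: "j < r" using Pc by simp
      have "col P j = row P j" using sym Pc j by (metis carrier_matD(1) row_transpose carrier_matD(2))
      then show "row W i $ j = (P *\<^sub>v row M1 i) $ j"
        using i j M Pc comm_scalar_prod[of "row M1 i" r "row P j"] by (simp add: W_def)
    qed (use W Pc in auto)
    define c where "c = (C, b1 - C *\<^sub>v b2, W * transpose_mat W)"
    have gm: "is_gm k N c" unfolding is_gm_def c_def using C b W psd_gram[OF W] by auto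
    have "b1 = C *\<^sub>v b2 + (b1 - C *\<^sub>v b2)" using C b by (intro eq_vecI) auto
    moreover have "row (C * M2) i = row M1 i - P *\<^sub>v row M1 i" if i: "i < N" for i
    proof -
      have "row (C * M2) i = transpose_mat M2 *\<^sub>v row C i" using C M i
        by (intro eq_vecI) (auto simp: comm_scalar_prod[of _ k])
      then show ?thesis using rC[OF i] Y[OF i] by simp
    qed
    moreover have "(W * transpose_mat W) $$ (i, j) = row M1 i \<bullet> (P *\<^sub>v row M1 j)" if "i < N" "j < N" for i j
    proof -
      have "(W * transpose_mat W) $$ (i, j) = (P *\<^sub>v row M1 i) \<bullet> (P *\<^sub>v row M1 j)"
        using gram_index[OF W W that] rW that by simp
      also have "\<dots> = row M1 i \<bullet> (P *\<^sub>v row M1 j)"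
        using sym_scalar[OF Pc sym, of "row M1 i" "P *\<^sub>v row M1 j"] idem[of "row M1 j"] M Pc that by simp
      finally show ?thesis .
    qed
    ultimately show "is_conditional N k \<psi> c"
      unfolding psi bb MM c_def using cond[OF gm[unfolded c_def]] by simp
  next
    fix c assume c: "is_conditional N k \<psi> c"
    obtain C d T where cc: "c = (C, d, T)" by (cases c) auto
    have gm: "is_gm k N (C, d, T)" using c unfolding is_conditional_def cc by simp
    then have C: "C \<in> carrier_mat N k" and d: "d \<in> carrier_vec N" and T: "T \<in> carrier_mat N N"
      unfolding is_gm_def by auto
    have m: "b1 = C *\<^sub>v b2 + d" and r: "\<And>i. i < N \<Longrightarrow> row (C * M2) i = row M1 i - P *\<^sub>v row M1 i"
      and t: "\<And>i j. i < N \<Longrightarrow> j < N \<Longrightarrow> T $$ (i, j) = row M1 i \<bullet> (P *\<^sub>v row M1 j)"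
      using c unfolding psi bb MM cc cond[OF gm] by auto
    \<comment> \<open>By the equation for the rows, \<open>C M2\<close> differs from
      \<open>M1\<close> only by a term factoring through \<open>P\<close>, and
      \<open>P \<mu> = 0\<close>.\<close>
    have CM: "C *\<^sub>v (M2 *\<^sub>v \<mu>) = M1 *\<^sub>v \<mu>"
    proof (rule eq_vecI)
      fix i assume "i < dim_vec (M1 *\<^sub>v \<mu>)"
      then have i: "i < N" using M by simp
      have ri: "row M1 i \<in> carrier_vec r" using M i by simp
      have "C *\<^sub>v (M2 *\<^sub>v \<mu>) = (C * M2) *\<^sub>v \<mu>" using assoc_mult_mat_vec[OF C M(2) \<mu>] by simp
      then have "(C *\<^sub>v (M2 *\<^sub>v \<mu>)) $ i = (row M1 i - P *\<^sub>v row M1 i) \<bullet> \<mu>"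
        using r[OF i] C M i by simp
      also have "\<dots> = row M1 i \<bullet> \<mu> - row M1 i \<bullet> (P *\<^sub>v \<mu>)"
        using minus_scalar_prod_distrib[OF ri _ \<mu>, of "P *\<^sub>v row M1 i"] sym_scalar[OF Pc sym ri \<mu>] Pc ri by simp
      also have "\<dots> = (M1 *\<^sub>v \<mu>) $ i" using P\<mu> ri M i by simp
      finally show "(C *\<^sub>v (M2 *\<^sub>v \<mu>)) $ i = (M1 *\<^sub>v \<mu>) $ i" .
    qed (use C M in auto)
    have "C *\<^sub>v (ob - b2) = C *\<^sub>v ob - C *\<^sub>v b2" by (rule mult_minus_distrib_mat_vec[OF C ob b(2)])
    then have "C *\<^sub>v ob + d = b1 + M1 *\<^sub>v \<mu>" using CM M\<mu> m C d ob b M by (auto simp: vec_eq_iff)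
    moreover have "C * 0\<^sub>m k 0 = 0\<^sub>m N 0" using C by auto
    moreover have "C * 0\<^sub>m k k * transpose_mat C + T = mat N N (\<lambda>(i, j). row M1 i \<bullet> (P *\<^sub>v row M1 j))"
      using C T t by (intro eq_matI) auto
    ultimately show "gcomp c (gpoint ob) = (0\<^sub>m N 0, fst (pushf r fs (\<mu>, P)), snd (pushf r fs (\<mu>, P)))"
      unfolding cc gpoint_def gcomp_def gdet_def G by (simp add: dob)
  qed
qed

text \<open>\<open>same_posterior\<close> quantifies universally over conditionals; since each side
  has at least one, it can be instantiated and yields an actual equality of laws.\<close>

lemma inference_law_eq:
  assumes rep1: "rep 0 (N + k1) r1 \<psi>1 \<phi>1" and ob1: "ob1 \<in> carrier_vec k1"
    and rep2: "rep 0 (N + k2) r2 \<psi>2 \<phi>2" and ob2: "ob2 \<in> carrier_vec k2"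
  shows "((succeeds N (\<psi>1, ob1) \<longleftrightarrow> succeeds N (\<psi>2, ob2)) \<and>
      (succeeds N (\<psi>1, ob1) \<and> succeeds N (\<psi>2, ob2) \<longrightarrow> same_posterior N (\<psi>1, ob1) (\<psi>2, ob2))) \<longleftrightarrow>
     law_eq r1 {\<xi> \<in> carrier_vec r1. \<forall>j<k1. \<phi>1 (0\<^sub>v 0) \<xi> $ (N + j) = ob1 $ j}
               (map (\<lambda>i \<xi>. \<phi>1 (0\<^sub>v 0) \<xi> $ i) [0..<N])
            r2 {\<xi> \<in> carrier_vec r2. \<forall>j<k2. \<phi>2 (0\<^sub>v 0) \<xi> $ (N + j) = ob2 $ j}
               (map (\<lambda>i \<xi>. \<phi>2 (0\<^sub>v 0) \<xi> $ i) [0..<N])"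
    (is "?lhs \<longleftrightarrow> law_eq r1 ?L1 ?f1 r2 ?L2 ?f2")
proof -
  note i1 = inference[OF rep1 ob1] and i2 = inference[OF rep2 ob2]
  show ?thesis
  proof (cases "?L1 = {} \<or> ?L2 = {}")
    case True
    have "law_eq r1 ?L1 ?f1 r2 ?L2 ?f2 \<longleftrightarrow> (?L1 = {} \<longleftrightarrow> ?L2 = {})"
      unfolding law_eq_def using True has_law_nonempty by blast
    then show ?thesis unfolding i1(1) i2(1) using True by blast
  next
    case False
    then have ne: "?L1 \<noteq> {}" "?L2 \<noteq> {}" by auto
    obtain G1 where G1: "has_law r1 ?L1 ?f1 G1" "\<exists>c. is_conditional N k1 \<psi>1 c"
      "\<And>c. is_conditional N k1 \<psi>1 c \<Longrightarrow> gcomp c (gpoint ob1) = (0\<^sub>m N 0, fst G1, snd G1)"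
      using i1(2)[OF ne(1)] by blast
    obtain G2 where G2: "has_law r2 ?L2 ?f2 G2" "\<exists>c. is_conditional N k2 \<psi>2 c"
      "\<And>c. is_conditional N k2 \<psi>2 c \<Longrightarrow> gcomp c (gpoint ob2) = (0\<^sub>m N 0, fst G2, snd G2)"
      using i2(2)[OF ne(2)] by blast
    have d: "dim_vec ob1 = k1" "dim_vec ob2 = k2" using ob1 ob2 by auto
    have "same_posterior N (\<psi>1, ob1) (\<psi>2, ob2) \<longleftrightarrow> G1 = G2"
    proof
      assume s: "same_posterior N (\<psi>1, ob1) (\<psi>2, ob2)"
      obtain c1 c2 where c: "is_conditional N k1 \<psi>1 c1" "is_conditional N k2 \<psi>2 c2"
        using G1(2) G2(2) by blast
      then have "gcomp c1 (gpoint ob1) = gcomp c2 (gpoint ob2)"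
        using s unfolding same_posterior_def prod.case d by blast
      then show "G1 = G2" using G1(3)[OF c(1)] G2(3)[OF c(2)] by (simp add: prod_eq_iff)
    next
      assume "G1 = G2"
      then show "same_posterior N (\<psi>1, ob1) (\<psi>2, ob2)"
        unfolding same_posterior_def prod.case d using G1(3) G2(3) by metis
    qed
    moreover have "law_eq r1 ?L1 ?f1 r2 ?L2 ?f2 \<longleftrightarrow> G1 = G2"
      unfolding law_eq_def using ne G1(1) G2(1) has_law_unique by blast
    ultimately show ?thesis unfolding i1(1) i2(1) using ne by blast
  qed
qed

subsection \<open>Generating maps of composite morphisms\<close>

text \<open>Independent noise sources side by side: the sum of two covariances M M^T + N N^T is the
  Gram matrix of the juxtaposed factors.\<close>

definition hcat :: "real mat \<Rightarrow> real mat \<Rightarrow> real mat" where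
  "hcat A B = mat (dim_row A) (dim_col A + dim_col B)
     (\<lambda>(i, j). if j < dim_col A then A $$ (i, j) else B $$ (i, j - dim_col A))"

lemma hcat_carrier: "A \<in> carrier_mat n a \<Longrightarrow> B \<in> carrier_mat n b \<Longrightarrow> hcat A B \<in> carrier_mat n (a + b)"
  by (auto simp: hcat_def)

lemma row_hcat:
  assumes "A \<in> carrier_mat n a" "B \<in> carrier_mat n b" "i < n"
  shows "row (hcat A B) i = row A i @\<^sub>v row B i"
  using assms by (intro eq_vecI) (auto simp: hcat_def)

lemma hcat_mult_vec:
  assumes A: "A \<in> carrier_mat n a" and B: "B \<in> carrier_mat n b"
    and x: "x \<in> carrier_vec a" "y \<in> carrier_vec b"
  shows "hcat A B *\<^sub>v (x @\<^sub>v y) = A *\<^sub>v x + B *\<^sub>v y"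
proof (rule eq_vecI)
  fix i assume "i < dim_vec (A *\<^sub>v x + B *\<^sub>v y)"
  then have i: "i < n" using B by simp
  have "(hcat A B *\<^sub>v (x @\<^sub>v y)) $ i = (row A i @\<^sub>v row B i) \<bullet> (x @\<^sub>v y)"
    using row_hcat[OF A B i] carrier_matD[OF hcat_carrier[OF A B]] i by simp
  also have "\<dots> = row A i \<bullet> x + row B i \<bullet> y"
    using A B x i by (intro scalar_prod_append[of _ a _ b]) auto
  finally show "(hcat A B *\<^sub>v (x @\<^sub>v y)) $ i = (A *\<^sub>v x + B *\<^sub>v y) $ i" using A B i by simp
qed (use carrier_matD[OF hcat_carrier[OF A B]] B in auto)

lemma hcat_gram:
  assumes A: "A \<in> carrier_mat n a" and B: "B \<in> carrier_mat n b"
  shows "hcat A B * transpose_mat (hcat A B) = A * transpose_mat A + B * transpose_mat B"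
proof (rule eq_matI)
  note h = hcat_carrier[OF A B]
  fix i j assume "i < dim_row (A * transpose_mat A + B * transpose_mat B)"
    "j < dim_col (A * transpose_mat A + B * transpose_mat B)"
  then have ij: "i < n" "j < n" using A B by auto
  have "(hcat A B * transpose_mat (hcat A B)) $$ (i, j) = (row A i @\<^sub>v row B i) \<bullet> (row A j @\<^sub>v row B j)"
    unfolding gram_index[OF h h ij] row_hcat[OF A B ij(1)] row_hcat[OF A B ij(2)] ..
  also have "\<dots> = row A i \<bullet> row A j + row B i \<bullet> row B j"
    using A B ij by (intro scalar_prod_append[of _ a _ b]) auto
  finally show "(hcat A B * transpose_mat (hcat A B)) $$ (i, j) = (A * transpose_mat A + B * transpose_mat B) $$ (i, j)"
    using A B ij by simp
qed (use carrier_matD[OF hcat_carrier[OF A B]] A B in auto)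

text \<open>The noise of the morphism applied first occupies the first \<open>r\<close> coordinates,
  in agreement with the order in which a program draws its variables.\<close>

lemma rep_gcomp:
  assumes f: "rep m p r f \<phi>" and g: "rep p q s g \<gamma>"
  shows "rep m q (r + s) (gcomp g f) (\<lambda>x \<xi>. \<gamma> (\<phi> x (vec_first \<xi> r)) (vec_last \<xi> s))"
proof -
  obtain A b M where ff: "f = (A, b, M * transpose_mat M)"
    and A: "A \<in> carrier_mat p m" and b: "b \<in> carrier_vec p" and M: "M \<in> carrier_mat p r"
    and phi: "\<And>x \<xi>. x \<in> carrier_vec m \<Longrightarrow> \<xi> \<in> carrier_vec r \<Longrightarrow> \<phi> x \<xi> = A *\<^sub>v x + b + M *\<^sub>v \<xi>"
    using f unfolding rep_def by blast
  obtain C d N where gg: "g = (C, d, N * transpose_mat N)"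
    and C: "C \<in> carrier_mat q p" and d: "d \<in> carrier_vec q" and N: "N \<in> carrier_mat q s"
    and gam: "\<And>x \<xi>. x \<in> carrier_vec p \<Longrightarrow> \<xi> \<in> carrier_vec s \<Longrightarrow> \<gamma> x \<xi> = C *\<^sub>v x + d + N *\<^sub>v \<xi>"
    using g unfolding rep_def by blast
  have CM: "C * M \<in> carrier_mat q r" using C M by simp
  have "gcomp g f = (C * A, C *\<^sub>v b + d, hcat (C * M) N * transpose_mat (hcat (C * M) N))"
    unfolding ff gg gcomp_def hcat_gram[OF CM N] gram_conj[OF C M, symmetric] by simp
  moreover have "\<gamma> (\<phi> x (vec_first \<xi> r)) (vec_last \<xi> s) = (C * A) *\<^sub>v x + (C *\<^sub>v b + d) + hcat (C * M) N *\<^sub>v \<xi>"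
    if x: "x \<in> carrier_vec m" and xi: "\<xi> \<in> carrier_vec (r + s)" for x \<xi>
  proof -
    define \<xi>1 \<xi>2 where "\<xi>1 = vec_first \<xi> r" and "\<xi>2 = vec_last \<xi> s"
    have X: "\<xi>1 \<in> carrier_vec r" "\<xi>2 \<in> carrier_vec s" and xx: "\<xi> = \<xi>1 @\<^sub>v \<xi>2"
      using xi by (simp_all add: \<xi>1_def \<xi>2_def)
    have Ax: "A *\<^sub>v x \<in> carrier_vec p" and Mx: "M *\<^sub>v \<xi>1 \<in> carrier_vec p" using A M x X by auto
    have "C *\<^sub>v (A *\<^sub>v x + b + M *\<^sub>v \<xi>1) = C *\<^sub>v (A *\<^sub>v x) + C *\<^sub>v b + C *\<^sub>v (M *\<^sub>v \<xi>1)"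
      using mult_add_distrib_mat_vec[OF C, of "A *\<^sub>v x + b" "M *\<^sub>v \<xi>1"]
        mult_add_distrib_mat_vec[OF C Ax b] Ax Mx b by simp
    also have "C *\<^sub>v (A *\<^sub>v x) = (C * A) *\<^sub>v x" using assoc_mult_mat_vec[OF C A x] by simp
    also have "C *\<^sub>v (M *\<^sub>v \<xi>1) = (C * M) *\<^sub>v \<xi>1" using assoc_mult_mat_vec[OF C M X(1)] by simp
    finally have e: "C *\<^sub>v (A *\<^sub>v x + b + M *\<^sub>v \<xi>1) = (C * A) *\<^sub>v x + C *\<^sub>v b + (C * M) *\<^sub>v \<xi>1" .
    have c: "(C * A) *\<^sub>v x \<in> carrier_vec q" "C *\<^sub>v b \<in> carrier_vec q" "(C * M) *\<^sub>v \<xi>1 \<in> carrier_vec q" "N *\<^sub>v \<xi>2 \<in> carrier_vec q"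
      using mult_mat_vec_carrier[OF mult_carrier_mat[OF C A] x] mult_mat_vec_carrier[OF C b]
        mult_mat_vec_carrier[OF CM X(1)] mult_mat_vec_carrier[OF N X(2)] by auto
    have "\<gamma> (\<phi> x \<xi>1) \<xi>2 = C *\<^sub>v (A *\<^sub>v x + b + M *\<^sub>v \<xi>1) + d + N *\<^sub>v \<xi>2"
      using gam[of "\<phi> x \<xi>1" \<xi>2] phi[OF x X(1)] X Ax b Mx by simp
    also have "\<dots> = (C * A) *\<^sub>v x + (C *\<^sub>v b + d) + ((C * M) *\<^sub>v \<xi>1 + N *\<^sub>v \<xi>2)"
      unfolding e
    proof (rule eq_vecI)
      fix i assume "i < dim_vec ((C * A) *\<^sub>v x + (C *\<^sub>v b + d) + ((C * M) *\<^sub>v \<xi>1 + N *\<^sub>v \<xi>2))"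
      then have "i < q" using c N by simp
      then show "((C * A) *\<^sub>v x + C *\<^sub>v b + (C * M) *\<^sub>v \<xi>1 + d + N *\<^sub>v \<xi>2) $ i
          = ((C * A) *\<^sub>v x + (C *\<^sub>v b + d) + ((C * M) *\<^sub>v \<xi>1 + N *\<^sub>v \<xi>2)) $ i"
        using carrier_vecD[OF c(1)] carrier_vecD[OF c(2)] carrier_vecD[OF c(3)] carrier_vecD[OF c(4)]
          carrier_vecD[OF d] by (simp del: index_mult_mat_vec assoc_mult_mat_vec dim_mult_mat_vec)
    qed (use N in simp)
    also have "(C * M) *\<^sub>v \<xi>1 + N *\<^sub>v \<xi>2 = hcat (C * M) N *\<^sub>v \<xi>"
      unfolding xx using hcat_mult_vec[OF CM N X] by simp
    finally show ?thesis unfolding \<xi>1_def \<xi>2_def .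
  qed
  ultimately show ?thesis
    unfolding rep_def using C A b d hcat_carrier[OF CM N]
    by (intro exI[of _ "C * A"] exI[of _ "C *\<^sub>v b + d"] exI[of _ "hcat (C * M) N"]) auto
qed

definition dsum :: "real mat \<Rightarrow> real mat \<Rightarrow> real mat" where
  "dsum A B = four_block_mat A (0\<^sub>m (dim_row A) (dim_col B)) (0\<^sub>m (dim_row B) (dim_col A)) B"

lemma dsum_carrier:
  "A \<in> carrier_mat n a \<Longrightarrow> B \<in> carrier_mat m b \<Longrightarrow> dsum A B \<in> carrier_mat (n + m) (a + b)"
  by (auto simp: dsum_def)

lemma dsum_mult_vec:
  assumes A: "A \<in> carrier_mat n a" and B: "B \<in> carrier_mat m b"
    and x: "x \<in> carrier_vec a" "y \<in> carrier_vec b"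
  shows "dsum A B *\<^sub>v (x @\<^sub>v y) = (A *\<^sub>v x) @\<^sub>v (B *\<^sub>v y)"
proof -
  have "dsum A B *\<^sub>v (x @\<^sub>v y) = (A *\<^sub>v x + 0\<^sub>m n b *\<^sub>v y) @\<^sub>v (0\<^sub>m m a *\<^sub>v x + B *\<^sub>v y)"
    unfolding dsum_def using A B x by (simp add: four_block_mat_mult_vec[of _ n a _ b _ m])
  moreover have "A *\<^sub>v x + 0\<^sub>m n b *\<^sub>v y = A *\<^sub>v x" "0\<^sub>m m a *\<^sub>v x + B *\<^sub>v y = B *\<^sub>v y"
    using A B x by (auto intro!: eq_vecI)
  ultimately show ?thesis by simp
qed

lemma dsum_gram:
  assumes A: "A \<in> carrier_mat n a" and B: "B \<in> carrier_mat m b"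
  shows "dsum A B * transpose_mat (dsum A B) = dsum (A * transpose_mat A) (B * transpose_mat B)"
proof -
  have d: "dsum A B = four_block_mat A (0\<^sub>m n b) (0\<^sub>m m a) B" using A B by (simp add: dsum_def)
  have tr: "transpose_mat (dsum A B) = four_block_mat (transpose_mat A) (0\<^sub>m a m) (0\<^sub>m b n) (transpose_mat B)"
    unfolding d using A B by (subst transpose_four_block_mat[of _ n a _ b _ m]) auto
  have "dsum A B * transpose_mat (dsum A B) = four_block_mat
      (A * transpose_mat A + 0\<^sub>m n b * 0\<^sub>m b n) (A * 0\<^sub>m a m + 0\<^sub>m n b * transpose_mat B)
      (0\<^sub>m m a * transpose_mat A + B * 0\<^sub>m b n) (0\<^sub>m m a * 0\<^sub>m a m + B * transpose_mat B)"
    unfolding tr unfolding d using A B by (subst mult_four_block_mat[of _ n a _ b _ m _ _ n _ m]) auto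
  also have "\<dots> = dsum (A * transpose_mat A) (B * transpose_mat B)"
    using A B by (simp add: dsum_def)
  finally show ?thesis .
qed

lemma rep_gtensor:
  assumes f: "rep m1 p1 r1 f \<phi>" and g: "rep m2 p2 r2 g \<gamma>"
  shows "rep (m1 + m2) (p1 + p2) (r1 + r2) (gtensor f g)
    (\<lambda>x \<xi>. \<phi> (vec_first x m1) (vec_first \<xi> r1) @\<^sub>v \<gamma> (vec_last x m2) (vec_last \<xi> r2))"
proof -
  obtain A b M where ff: "f = (A, b, M * transpose_mat M)"
    and A: "A \<in> carrier_mat p1 m1" and b: "b \<in> carrier_vec p1" and M: "M \<in> carrier_mat p1 r1"
    and phi: "\<And>x \<xi>. x \<in> carrier_vec m1 \<Longrightarrow> \<xi> \<in> carrier_vec r1 \<Longrightarrow> \<phi> x \<xi> = A *\<^sub>v x + b + M *\<^sub>v \<xi>"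
    using f unfolding rep_def by blast
  obtain C d N where gg: "g = (C, d, N * transpose_mat N)"
    and C: "C \<in> carrier_mat p2 m2" and d: "d \<in> carrier_vec p2" and N: "N \<in> carrier_mat p2 r2"
    and gam: "\<And>x \<xi>. x \<in> carrier_vec m2 \<Longrightarrow> \<xi> \<in> carrier_vec r2 \<Longrightarrow> \<gamma> x \<xi> = C *\<^sub>v x + d + N *\<^sub>v \<xi>"
    using g unfolding rep_def by blast
  have "gtensor f g = (dsum A C, b @\<^sub>v d, dsum M N * transpose_mat (dsum M N))"
    unfolding ff gg gtensor_def dsum_gram[OF M N] by (simp add: dsum_def)
  moreover have "\<phi> (vec_first x m1) (vec_first \<xi> r1) @\<^sub>v \<gamma> (vec_last x m2) (vec_last \<xi> r2)
     = dsum A C *\<^sub>v x + (b @\<^sub>v d) + dsum M N *\<^sub>v \<xi>"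
    if x: "x \<in> carrier_vec (m1 + m2)" and xi: "\<xi> \<in> carrier_vec (r1 + r2)" for x \<xi>
  proof -
    define x1 x2 \<xi>1 \<xi>2 where "x1 = vec_first x m1" and "x2 = vec_last x m2"
      and "\<xi>1 = vec_first \<xi> r1" and "\<xi>2 = vec_last \<xi> r2"
    have X: "x1 \<in> carrier_vec m1" "x2 \<in> carrier_vec m2" "\<xi>1 \<in> carrier_vec r1" "\<xi>2 \<in> carrier_vec r2"
      and xx: "x = x1 @\<^sub>v x2" "\<xi> = \<xi>1 @\<^sub>v \<xi>2"
      using x xi by (simp_all add: x1_def x2_def \<xi>1_def \<xi>2_def)
    have "dsum A C *\<^sub>v x + (b @\<^sub>v d) + dsum M N *\<^sub>v \<xi>
      = ((A *\<^sub>v x1) @\<^sub>v (C *\<^sub>v x2)) + (b @\<^sub>v d) + ((M *\<^sub>v \<xi>1) @\<^sub>v (N *\<^sub>v \<xi>2))"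
      unfolding xx dsum_mult_vec[OF A C X(1,2)] dsum_mult_vec[OF M N X(3,4)] ..
    also have "((A *\<^sub>v x1) @\<^sub>v (C *\<^sub>v x2)) + (b @\<^sub>v d) = (A *\<^sub>v x1 + b) @\<^sub>v (C *\<^sub>v x2 + d)"
      using A C b d X by (intro append_vec_add[of _ p1 _ _ p2]) auto
    also have "\<dots> + ((M *\<^sub>v \<xi>1) @\<^sub>v (N *\<^sub>v \<xi>2)) = (A *\<^sub>v x1 + b + M *\<^sub>v \<xi>1) @\<^sub>v (C *\<^sub>v x2 + d + N *\<^sub>v \<xi>2)"
      using A C b d M N X by (intro append_vec_add[of _ p1 _ _ p2]) auto
    also have "\<dots> = \<phi> x1 \<xi>1 @\<^sub>v \<gamma> x2 \<xi>2" using phi[OF X(1,3)] gam[OF X(2,4)] by simp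
    finally show ?thesis unfolding x1_def x2_def \<xi>1_def \<xi>2_def by simp
  qed
  moreover have "b @\<^sub>v d \<in> carrier_vec (p1 + p2)" using b d by (intro carrier_vecI) simp
  ultimately show ?thesis
    unfolding rep_def using dsum_carrier[OF A C] dsum_carrier[OF M N]
    by (intro exI[of _ "dsum A C"] exI[of _ "b @\<^sub>v d"] exI[of _ "dsum M N"]) auto
qed

lemma rep_gdet:
  assumes A: "A \<in> carrier_mat p m" and b: "b \<in> carrier_vec p"
  shows "rep m p 0 (gdet A b) (\<lambda>x \<xi>. A *\<^sub>v x + b)"
proof -
  \<comment> \<open>A deterministic map uses no noise: its factor has no columns, and the empty sums
    give the zero covariance.\<close>
  have z: "0\<^sub>m p p = 0\<^sub>m p 0 * transpose_mat (0\<^sub>m p 0 :: real mat)" by (intro eq_matI) (auto simp: scalar_prod_def)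
  have "0\<^sub>m p 0 *\<^sub>v \<xi> = 0\<^sub>v p" if "\<xi> \<in> carrier_vec 0" for \<xi> :: "real vec"
    using that by (intro eq_vecI) (auto simp: scalar_prod_def)
  then show ?thesis
    unfolding rep_def gdet_def using A b
    by (intro exI[of _ A] exI[of _ b] exI[of _ "0\<^sub>m p 0"]) (auto simp: z[symmetric] simp del: zero_transpose_mat)
qed

text \<open>Generating maps of morphisms \<open>m \<leadsto> n\<close> with \<open>k\<close> conditions: \<open>v\<close> yields the output,
  \<open>c\<close> the conditioned quantities.\<close>
definition crep :: "nat \<Rightarrow> nat \<Rightarrow> nat \<Rightarrow> nat \<Rightarrow> cm \<Rightarrow> (real vec \<Rightarrow> real vec \<Rightarrow> real vec) \<Rightarrow>
    (real vec \<Rightarrow> real vec \<Rightarrow> real vec) \<Rightarrow> bool" where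
  "crep m n k r F v c \<longleftrightarrow> snd F \<in> carrier_vec k \<and>
     (\<forall>x \<in> carrier_vec m. \<forall>\<xi> \<in> carrier_vec r. v x \<xi> \<in> carrier_vec n \<and> c x \<xi> \<in> carrier_vec k) \<and>
     rep m (n + k) r (fst F) (\<lambda>x \<xi>. v x \<xi> @\<^sub>v c x \<xi>)"

lemma vec_first_append [simp]: "a \<in> carrier_vec n \<Longrightarrow> vec_first (a @\<^sub>v b) n = a"
  by (auto simp: vec_first_def)

lemma vec_last_append [simp]: "b \<in> carrier_vec n \<Longrightarrow> vec_last (a @\<^sub>v b) n = b"
  by (auto simp: vec_last_def)

lemma append_vec_assoc: "(a @\<^sub>v b) @\<^sub>v c = a @\<^sub>v (b @\<^sub>v c)"
  by (intro eq_vecI) auto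

lemma vec_last_id: "\<xi> \<in> carrier_vec r \<Longrightarrow> vec_last \<xi> r = \<xi>"
  by (auto simp: vec_last_def)

lemma crep_cJ:
  assumes "rep m n r f \<phi>"
  shows "crep m n 0 r (cJ f) \<phi> (\<lambda>_ _. 0\<^sub>v 0)"
proof -
  have "\<phi> x \<xi> @\<^sub>v 0\<^sub>v 0 = \<phi> x \<xi>" for x \<xi> by (intro eq_vecI) auto
  then show ?thesis using assms rep_carrier[OF assms] unfolding crep_def cJ_def by simp
qed

lemma rep_gid: "rep k k 0 (gid k) (\<lambda>x \<xi>. x)"
  unfolding gid_def by (rule rep_cong[OF rep_gdet]) auto

lemma crep_cid: "crep k k 0 0 (cid k) (\<lambda>x \<xi>. x) (\<lambda>_ _. 0\<^sub>v 0)"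
  unfolding cid_def by (rule crep_cJ[OF rep_gid])

text \<open>The earlier conditions are carried through the identity factor and end up behind the new
  ones. Conditions thus accumulate in reverse order of execution, while noise accumulates in
  order.\<close>

lemma crep_cbullet:
  assumes F: "crep m n k r F v c" and F': "crep n p k' r' F' v' c'"
  shows "crep m p (k' + k) (r + r') (F' \<bullet>\<^sub>c F)
     (\<lambda>x \<xi>. v' (v x (vec_first \<xi> r)) (vec_last \<xi> r'))
     (\<lambda>x \<xi>. c' (v x (vec_first \<xi> r)) (vec_last \<xi> r') @\<^sub>v c x (vec_first \<xi> r))"
proof -
  obtain f ob where FF: "F = (f, ob)" by (cases F)
  obtain f' ob' where FF': "F' = (f', ob')" by (cases F')
  have ob: "ob \<in> carrier_vec k" "ob' \<in> carrier_vec k'" using F F' by (auto simp: crep_def FF FF')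
  have rf: "rep m (n + k) r f (\<lambda>x \<xi>. v x \<xi> @\<^sub>v c x \<xi>)"
    and vc: "\<And>x \<xi>. x \<in> carrier_vec m \<Longrightarrow> \<xi> \<in> carrier_vec r \<Longrightarrow> v x \<xi> \<in> carrier_vec n \<and> c x \<xi> \<in> carrier_vec k"
    using F by (auto simp: crep_def FF)
  have rf': "rep n (p + k') r' f' (\<lambda>x \<xi>. v' x \<xi> @\<^sub>v c' x \<xi>)"
    and vc': "\<And>x \<xi>. x \<in> carrier_vec n \<Longrightarrow> \<xi> \<in> carrier_vec r' \<Longrightarrow> v' x \<xi> \<in> carrier_vec p \<and> c' x \<xi> \<in> carrier_vec k'"
    using F' by (auto simp: crep_def FF')
  have d: "dim_vec ob = k" using ob by simp
  have "rep m (p + (k' + k)) (r + r') (gcomp (gtensor f' (gid k)) f)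
    (\<lambda>x \<xi>. v' (v x (vec_first \<xi> r)) (vec_last \<xi> r') @\<^sub>v
       (c' (v x (vec_first \<xi> r)) (vec_last \<xi> r') @\<^sub>v c x (vec_first \<xi> r)))"
  proof (rule rep_cong[OF rep_gcomp[OF rf rep_gtensor[OF rf' rep_gid[of k]], unfolded add_0_right add.assoc]])
    fix x \<xi> :: "real vec" assume x: "x \<in> carrier_vec m" and xi: "\<xi> \<in> carrier_vec (r + r')"
    have y: "v x (vec_first \<xi> r) \<in> carrier_vec n" "c x (vec_first \<xi> r) \<in> carrier_vec k"
      using vc[OF x] by auto
    show "(v' (vec_first (v x (vec_first \<xi> r) @\<^sub>v c x (vec_first \<xi> r)) n) (vec_first (vec_last \<xi> r') r') @\<^sub>v
          c' (vec_first (v x (vec_first \<xi> r) @\<^sub>v c x (vec_first \<xi> r)) n) (vec_first (vec_last \<xi> r') r')) @\<^sub>v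
         vec_last (v x (vec_first \<xi> r) @\<^sub>v c x (vec_first \<xi> r)) k
       = v' (v x (vec_first \<xi> r)) (vec_last \<xi> r') @\<^sub>v
         (c' (v x (vec_first \<xi> r)) (vec_last \<xi> r') @\<^sub>v c x (vec_first \<xi> r))"
      using y by (simp add: append_vec_assoc)
  qed
  then show ?thesis unfolding crep_def cbullet_def FF FF' using ob vc vc' by (simp add: d)
qed

lemma swap_mid_apply:
  assumes a: "a1 \<in> carrier_vec n1" "a2 \<in> carrier_vec n2" and b: "b1 \<in> carrier_vec k1" "b2 \<in> carrier_vec k2"
  shows "swap_mid n1 k1 n2 k2 *\<^sub>v ((a1 @\<^sub>v b1) @\<^sub>v (a2 @\<^sub>v b2)) = (a1 @\<^sub>v a2) @\<^sub>v (b1 @\<^sub>v b2)"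
proof (rule eq_vecI)
  let ?N = "n1 + k1 + n2 + k2" and ?y = "(a1 @\<^sub>v b1) @\<^sub>v (a2 @\<^sub>v b2)"
  have dims: "dim_vec a1 = n1" "dim_vec a2 = n2" "dim_vec b1 = k1" "dim_vec b2 = k2" using a b by auto
  show "dim_vec (swap_mid n1 k1 n2 k2 *\<^sub>v ?y) = dim_vec ((a1 @\<^sub>v a2) @\<^sub>v (b1 @\<^sub>v b2))"
    using dims by (simp add: swap_mid_def Let_def)
  fix i assume "i < dim_vec ((a1 @\<^sub>v a2) @\<^sub>v (b1 @\<^sub>v b2))"
  then have i: "i < ?N" using dims by simp
  define s where "s = (if i < n1 then i
                          else if i < n1 + n2 then i - n1 + n1 + k1
                          else if i < n1 + n2 + k1 then i - n1 - n2 + n1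
                          else i - n1 - n2 - k1 + n1 + k1 + n2)"
  have s: "s < ?N" using i by (auto simp: s_def)
  have y: "?y \<in> carrier_vec ?N" using dims by (intro carrier_vecI) simp
  have "row (swap_mid n1 k1 n2 k2) i = unit_vec ?N s"
    using i by (intro eq_vecI) (auto simp: swap_mid_def Let_def s_def)
  then have "(swap_mid n1 k1 n2 k2 *\<^sub>v ?y) $ i = ?y $ s"
    using i scalar_prod_left_unit[OF y s] by (simp add: swap_mid_def Let_def)
  also have "\<dots> = ((a1 @\<^sub>v a2) @\<^sub>v (b1 @\<^sub>v b2)) $ i"
  proof -
    consider "i < n1" | "n1 \<le> i" "i < n1 + n2" | "n1 + n2 \<le> i" "i < n1 + n2 + k1" | "n1 + n2 + k1 \<le> i"
      by linarith
    then show ?thesis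
    proof cases
      case 1
      then show ?thesis using i dims by (simp add: s_def)
    next
      case 2
      then have "s = i + k1" "i - n1 < n2" by (auto simp: s_def)
      then show ?thesis using 2 i dims by simp
    next
      case 3
      define j where "j = i - n1 - n2"
      then have "s = n1 + j" "i = n1 + n2 + j" "j < k1" using 3 by (auto simp: s_def)
      then show ?thesis using dims by simp
    next
      case 4
      define j where "j = i - n1 - n2 - k1"
      then have "s = n1 + k1 + n2 + j" "i = n1 + n2 + k1 + j" "j < k2" using 4 i by (auto simp: s_def)
      then show ?thesis using dims by simp
    qed
  qed
  finally show "(swap_mid n1 k1 n2 k2 *\<^sub>v ?y) $ i = ((a1 @\<^sub>v a2) @\<^sub>v (b1 @\<^sub>v b2)) $ i" .
qed

text \<open>A \<open>cm\<close> does not record its number of outputs; \<open>ctensor\<close>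
  recovers it from the lengths of mean and observation, correctly for every morphism that has a
  generating map.\<close>

lemma crep_cout:
  assumes "crep m n k r F v c" shows "cout F = n"
  using assms unfolding crep_def rep_def cout_def by (cases F) auto

lemma crep_ctensor:
  assumes F1: "crep m1 n1 k1 r1 F1 v1 c1" and F2: "crep m2 n2 k2 r2 F2 v2 c2"
  shows "crep (m1 + m2) (n1 + n2) (k1 + k2) (r1 + r2) (F1 \<otimes>\<^sub>c F2)
     (\<lambda>x \<xi>. v1 (vec_first x m1) (vec_first \<xi> r1) @\<^sub>v v2 (vec_last x m2) (vec_last \<xi> r2))
     (\<lambda>x \<xi>. c1 (vec_first x m1) (vec_first \<xi> r1) @\<^sub>v c2 (vec_last x m2) (vec_last \<xi> r2))"
proof -
  obtain f1 ob1 where FF1: "F1 = (f1, ob1)" by (cases F1)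
  obtain f2 ob2 where FF2: "F2 = (f2, ob2)" by (cases F2)
  have ob: "ob1 \<in> carrier_vec k1" "ob2 \<in> carrier_vec k2" using F1 F2 by (auto simp: crep_def FF1 FF2)
  have d: "dim_vec ob1 = k1" "dim_vec ob2 = k2" using ob by auto
  have co: "cout (f1, ob1) = n1" "cout (f2, ob2) = n2" using crep_cout F1 F2 unfolding FF1 FF2 by auto
  have rf1: "rep m1 (n1 + k1) r1 f1 (\<lambda>x \<xi>. v1 x \<xi> @\<^sub>v c1 x \<xi>)"
    and vc1: "\<And>x \<xi>. x \<in> carrier_vec m1 \<Longrightarrow> \<xi> \<in> carrier_vec r1 \<Longrightarrow> v1 x \<xi> \<in> carrier_vec n1 \<and> c1 x \<xi> \<in> carrier_vec k1"
    using F1 by (auto simp: crep_def FF1)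
  have rf2: "rep m2 (n2 + k2) r2 f2 (\<lambda>x \<xi>. v2 x \<xi> @\<^sub>v c2 x \<xi>)"
    and vc2: "\<And>x \<xi>. x \<in> carrier_vec m2 \<Longrightarrow> \<xi> \<in> carrier_vec r2 \<Longrightarrow> v2 x \<xi> \<in> carrier_vec n2 \<and> c2 x \<xi> \<in> carrier_vec k2"
    using F2 by (auto simp: crep_def FF2)
  let ?S = "swap_mid n1 k1 n2 k2" and ?N = "n1 + k1 + n2 + k2"
  have S: "?S \<in> carrier_mat (n1 + n2 + (k1 + k2)) (n1 + k1 + (n2 + k2))"
    by (intro carrier_matI) (auto simp: swap_mid_def Let_def)
  have z: "0\<^sub>v ?N \<in> carrier_vec (n1 + n2 + (k1 + k2))" by (intro carrier_vecI) simp
  have rs: "rep (n1 + k1 + (n2 + k2)) (n1 + n2 + (k1 + k2)) 0 (gdet ?S (0\<^sub>v ?N)) (\<lambda>x \<xi>. ?S *\<^sub>v x + 0\<^sub>v ?N)"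
    by (rule rep_gdet[OF S z])
  have R: "rep (m1 + m2) (n1 + n2 + (k1 + k2)) (r1 + r2) (gcomp (gdet ?S (0\<^sub>v ?N)) (gtensor f1 f2))
    (\<lambda>x \<xi>. (v1 (vec_first x m1) (vec_first \<xi> r1) @\<^sub>v v2 (vec_last x m2) (vec_last \<xi> r2)) @\<^sub>v
       (c1 (vec_first x m1) (vec_first \<xi> r1) @\<^sub>v c2 (vec_last x m2) (vec_last \<xi> r2)))"
  proof (rule rep_cong[OF rep_gcomp[OF rep_gtensor[OF rf1 rf2] rs, unfolded add_0_right]])
    fix x \<xi> :: "real vec" assume x: "x \<in> carrier_vec (m1 + m2)" and xi: "\<xi> \<in> carrier_vec (r1 + r2)"
    define x1 x2 \<xi>1 \<xi>2 where "x1 = vec_first x m1" and "x2 = vec_last x m2"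
      and "\<xi>1 = vec_first \<xi> r1" and "\<xi>2 = vec_last \<xi> r2"
    have X: "x1 \<in> carrier_vec m1" "x2 \<in> carrier_vec m2" "\<xi>1 \<in> carrier_vec r1" "\<xi>2 \<in> carrier_vec r2"
      by (simp_all add: x1_def x2_def \<xi>1_def \<xi>2_def)
    have w: "v1 x1 \<xi>1 \<in> carrier_vec n1" "c1 x1 \<xi>1 \<in> carrier_vec k1" "v2 x2 \<xi>2 \<in> carrier_vec n2" "c2 x2 \<xi>2 \<in> carrier_vec k2"
      using vc1[OF X(1,3)] vc2[OF X(2,4)] by auto
    have "?S *\<^sub>v ((v1 x1 \<xi>1 @\<^sub>v c1 x1 \<xi>1) @\<^sub>v (v2 x2 \<xi>2 @\<^sub>v c2 x2 \<xi>2)) + 0\<^sub>v ?N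
       = (v1 x1 \<xi>1 @\<^sub>v v2 x2 \<xi>2) @\<^sub>v (c1 x1 \<xi>1 @\<^sub>v c2 x2 \<xi>2)"
      unfolding swap_mid_apply[OF w(1,3,2,4)] using w by (intro right_zero_vec carrier_vecI) simp
    moreover have "vec_first \<xi> (r1 + r2) = \<xi>" using xi by simp
    ultimately show "?S *\<^sub>v ((v1 (vec_first x m1) (vec_first (vec_first \<xi> (r1 + r2)) r1) @\<^sub>v
           c1 (vec_first x m1) (vec_first (vec_first \<xi> (r1 + r2)) r1)) @\<^sub>v
          (v2 (vec_last x m2) (vec_last (vec_first \<xi> (r1 + r2)) r2) @\<^sub>v
           c2 (vec_last x m2) (vec_last (vec_first \<xi> (r1 + r2)) r2))) + 0\<^sub>v ?N
       = (v1 (vec_first x m1) (vec_first \<xi> r1) @\<^sub>v v2 (vec_last x m2) (vec_last \<xi> r2)) @\<^sub>v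
         (c1 (vec_first x m1) (vec_first \<xi> r1) @\<^sub>v c2 (vec_last x m2) (vec_last \<xi> r2))"
      unfolding x1_def x2_def \<xi>1_def \<xi>2_def by simp
  qed
  have FT: "F1 \<otimes>\<^sub>c F2 = (gcomp (gdet ?S (0\<^sub>v ?N)) (gtensor f1 f2), ob1 @\<^sub>v ob2)"
    unfolding ctensor_def FF1 FF2 prod.case co d ..
  show ?thesis unfolding crep_def FT using R ob vc1 vc2 by simp
qed

lemma crep_copy: "crep m (m + m) 0 0 (cJ (gcopy m)) (\<lambda>x \<xi>. x @\<^sub>v x) (\<lambda>_ _. 0\<^sub>v 0)"
proof (rule crep_cJ)
  let ?E = "four_block_mat (1\<^sub>m m) (0\<^sub>m m 0) (1\<^sub>m m) (0\<^sub>m m 0) :: real mat"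
  have E: "?E \<in> carrier_mat (m + m) m" using four_block_carrier_mat[of "1\<^sub>m m" m m "0\<^sub>m m 0" m 0] by simp
  have z: "0\<^sub>v (2 * m) \<in> carrier_vec (m + m)" by (intro carrier_vecI) simp
  have "?E *\<^sub>v x + 0\<^sub>v (2 * m) = x @\<^sub>v x" if x: "x \<in> carrier_vec m" for x
  proof -
    have "row ?E i = unit_vec m (if i < m then i else i - m)" if "i < m + m" for i
      using that by (intro eq_vecI) auto
    then have "(?E *\<^sub>v x) $ i = (x @\<^sub>v x) $ i" if "i < m + m" for i
      using that E x scalar_prod_left_unit[OF x, of "if i < m then i else i - m"] by auto
    then show ?thesis using E x by (intro eq_vecI) auto
  qed
  then show "rep m (m + m) 0 (gcopy m) (\<lambda>x \<xi>. x @\<^sub>v x)"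
    unfolding gcopy_def by (intro rep_cong[OF rep_gdet[OF E z]]) auto
qed

subsection \<open>Symbolic evaluation\<close>

text \<open>Value trees are polymorphic in their leaves so that random variables on different sample
  spaces can be exchanged leaf by leaf with \<open>map_sv\<close>.\<close>

datatype 'a sv = VR 'a | VU | VP "'a sv" "'a sv"

type_synonym 'w rv = "'w \<Rightarrow> real"

fun flatv :: "'a sv \<Rightarrow> 'a list" where
  "flatv (VR a) = [a]"
| "flatv VU = []"
| "flatv (VP a b) = flatv a @ flatv b"

text \<open>The accessors are total, with 0 and \<open>VU\<close> as defaults. Typing keeps
  well-typed terms away from the defaults, by \<open>shp_val\<close>.\<close>

fun rvl :: "'w rv sv \<Rightarrow> 'w rv" where
  "rvl (VR f) = f"
| "rvl _ = (\<lambda>_. 0)"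

fun vfst :: "'a sv \<Rightarrow> 'a sv" where
  "vfst (VP a b) = a"
| "vfst _ = VU"

fun vsnd :: "'a sv \<Rightarrow> 'a sv" where
  "vsnd (VP a b) = b"
| "vsnd _ = VU"

text \<open>A syntactic count suffices for the number of draws: every subterm is evaluated exactly
  once, and substitution copies only values, which contain no \<open>Normal\<close>.\<close>

fun nn :: "tm \<Rightarrow> nat" where
  "nn (Plus a b) = nn a + nn b"
| "nn (Scale \<alpha> a) = nn a"
| "nn (Pair a b) = nn a + nn b"
| "nn (Let x a b) = nn a + nn b"
| "nn (LetP x y a b) = nn a + nn b"
| "nn (Eq a b) = nn a + nn b"
| "nn Normal = 1"
| "nn _ = 0"

definition shift :: "nat \<Rightarrow> (nat \<Rightarrow> 'a) \<Rightarrow> nat \<Rightarrow> 'a" where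
  "shift n X = (\<lambda>i. X (n + i))"

lemma shift_shift [simp]: "shift n (shift m X) = shift (m + n) X"
  by (simp add: shift_def add.assoc)

lemma shift_0 [simp]: "shift 0 X = X"
  by (simp add: shift_def)

text \<open>The value of a term, as random variables on a sample space: \<open>\<rho>\<close> interprets variables, latent
  variables and the hole, and \<open>X\<close> is the stream of random variables drawn by \<open>Normal\<close>.\<close>
fun val :: "tm \<Rightarrow> (tm \<Rightarrow> 'w rv sv) \<Rightarrow> (nat \<Rightarrow> 'w rv) \<Rightarrow> 'w rv sv" where
  "val (Var x) \<rho> X = \<rho> (Var x)"
| "val (Lat i) \<rho> X = \<rho> (Lat i)"
| "val Hole \<rho> X = \<rho> Hole"
| "val (Plus a b) \<rho> X = VR (\<lambda>\<omega>. rvl (val a \<rho> X) \<omega> + rvl (val b \<rho> (shift (nn a) X)) \<omega>)"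
| "val (Scale \<alpha> a) \<rho> X = VR (\<lambda>\<omega>. \<alpha> * rvl (val a \<rho> X) \<omega>)"
| "val (Const \<beta>) \<rho> X = VR (\<lambda>_. \<beta>)"
| "val Unit \<rho> X = VU"
| "val (Pair a b) \<rho> X = VP (val a \<rho> X) (val b \<rho> (shift (nn a) X))"
| "val (Let x e t) \<rho> X = val t (\<rho>(Var x := val e \<rho> X)) (shift (nn e) X)"
| "val (LetP x y e t) \<rho> X =
     val t (\<rho>(Var y := vsnd (val e \<rho> X), Var x := vfst (val e \<rho> X))) (shift (nn e) X)"
| "val Normal \<rho> X = VR (X 0)"
| "val (Eq a b) \<rho> X = VU"

text \<open>The random variables conditioned to be zero, those of the latest \<open>let\<close> body first (the order in
  which \<open>\<bullet>\<^sub>c\<close> collects observations).\<close>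
fun con :: "tm \<Rightarrow> (tm \<Rightarrow> 'w rv sv) \<Rightarrow> (nat \<Rightarrow> 'w rv) \<Rightarrow> 'w rv list" where
  "con (Plus a b) \<rho> X = con a \<rho> X @ con b \<rho> (shift (nn a) X)"
| "con (Scale \<alpha> a) \<rho> X = con a \<rho> X"
| "con (Pair a b) \<rho> X = con a \<rho> X @ con b \<rho> (shift (nn a) X)"
| "con (Let x e t) \<rho> X = con t (\<rho>(Var x := val e \<rho> X)) (shift (nn e) X) @ con e \<rho> X"
| "con (LetP x y e t) \<rho> X =
     con t (\<rho>(Var y := vsnd (val e \<rho> X), Var x := vfst (val e \<rho> X))) (shift (nn e) X) @ con e \<rho> X"
| "con (Eq a b) \<rho> X = (\<lambda>\<omega>. rvl (val a \<rho> X) \<omega> - rvl (val b \<rho> (shift (nn a) X)) \<omega>) #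
     con a \<rho> X @ con b \<rho> (shift (nn a) X)"
| "con _ \<rho> X = []"

fun shp :: "ty \<Rightarrow> 'a sv \<Rightarrow> bool" where
  "shp TR v \<longleftrightarrow> (\<exists>f. v = VR f)"
| "shp TI v \<longleftrightarrow> v = VU"
| "shp (TProd \<tau>1 \<tau>2) v \<longleftrightarrow> (\<exists>a b. v = VP a b \<and> shp \<tau>1 a \<and> shp \<tau>2 b)"

lemma length_flatv: "shp \<tau> v \<Longrightarrow> length (flatv v) = tdim \<tau>"
  by (induction \<tau> arbitrary: v) auto

definition env_shp :: "(env \<times> ty) option \<Rightarrow> nat \<Rightarrow> env \<Rightarrow> (tm \<Rightarrow> 'a sv) \<Rightarrow> bool" where
  "env_shp H r \<Gamma> \<rho> \<longleftrightarrow> (\<forall>x \<sigma>. map_of \<Gamma> x = Some \<sigma> \<longrightarrow> shp \<sigma> (\<rho> (Var x))) \<and>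
     (\<forall>i<r. shp TR (\<rho> (Lat i))) \<and> (\<forall>\<Gamma>0 \<tau>0. H = Some (\<Gamma>0, \<tau>0) \<longrightarrow> shp \<tau>0 (\<rho> Hole))"

lemma env_shp_upd: "env_shp H r \<Gamma> \<rho> \<Longrightarrow> shp \<tau> v \<Longrightarrow> env_shp H r ((x, \<tau>) # \<Gamma>) (\<rho>(Var x := v))"
  by (auto simp: env_shp_def)

lemma shp_val: "has_ty H r \<Gamma> e \<tau> \<Longrightarrow> env_shp H r \<Gamma> \<rho> \<Longrightarrow> shp \<tau> (val e \<rho> X)"
proof (induction arbitrary: \<rho> X rule: has_ty.induct)
  case (T_Let H r \<Gamma> e \<tau>1 x t \<tau>2)
  then show ?case using env_shp_upd by fastforce
next
  case (T_LetP x y H r \<Gamma> e \<tau>1 \<tau>2 t \<tau>)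
  have "shp (TProd \<tau>1 \<tau>2) (val e \<rho> X)" by (rule T_LetP.IH(1)[OF T_LetP.prems])
  then obtain a b where "val e \<rho> X = VP a b" "shp \<tau>1 a" "shp \<tau>2 b" by auto
  moreover from this have "env_shp H r ((x, \<tau>1) # (y, \<tau>2) # \<Gamma>) (\<rho>(Var y := b, Var x := a))"
    by (intro env_shp_upd T_LetP.prems)
  ultimately show ?case using T_LetP.IH(2) by simp
qed (auto simp: env_shp_def)

definition rv_closed :: "('w rv \<Rightarrow> bool) \<Rightarrow> bool" where
  "rv_closed C \<longleftrightarrow> (\<forall>b. C (\<lambda>_. b)) \<and> (\<forall>f g. C f \<longrightarrow> C g \<longrightarrow> C (\<lambda>\<omega>. f \<omega> + g \<omega>)) \<and>
     (\<forall>c f. C f \<longrightarrow> C (\<lambda>\<omega>. c * f \<omega>))"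

lemma rv_closed_aff: "rv_closed (aff r)"
  unfolding rv_closed_def using aff_const aff_add aff_scale by blast

lemma rvl_closed: "rv_closed C \<Longrightarrow> \<forall>f \<in> set (flatv v). C f \<Longrightarrow> C (rvl v)"
  by (cases v) (auto simp: rv_closed_def)

text \<open>Terms act on random variables only by constants, sums and scalings, so a class closed
  under these and containing the inputs contains all results and all conditions. The class is
  applied with \<open>C\<close> the functionals affine in the first coordinates.\<close>

lemma val_con_closed:
  assumes C: "rv_closed C"
  shows "(\<And>a. \<forall>f \<in> set (flatv (\<rho> a)). C f) \<Longrightarrow> (\<And>i. i < nn e \<Longrightarrow> C (X i)) \<Longrightarrow>
    (\<forall>f \<in> set (flatv (val e \<rho> X)). C f) \<and> (\<forall>f \<in> set (con e \<rho> X). C f)"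
proof -
  have cb: "\<And>b. C (\<lambda>_. b)" and ca: "\<And>f g. C f \<Longrightarrow> C g \<Longrightarrow> C (\<lambda>\<omega>. f \<omega> + g \<omega>)"
    and cs: "\<And>c f. C f \<Longrightarrow> C (\<lambda>\<omega>. c * f \<omega>)" using C unfolding rv_closed_def by blast+
  have sub: "C (\<lambda>\<omega>. f \<omega> - g \<omega>)" if "C f" "C g" for f g
    using ca[OF that(1) cs[OF that(2), of "-1"]] by simp
  show "(\<And>a. \<forall>f \<in> set (flatv (\<rho> a)). C f) \<Longrightarrow> (\<And>i. i < nn e \<Longrightarrow> C (X i)) \<Longrightarrow>
    (\<forall>f \<in> set (flatv (val e \<rho> X)). C f) \<and> (\<forall>f \<in> set (con e \<rho> X). C f)"
  proof (induction e arbitrary: \<rho> X)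
  case (Plus a b)
  have a: "(\<forall>f \<in> set (flatv (val a \<rho> X)). C f) \<and> (\<forall>f \<in> set (con a \<rho> X). C f)"
    by (rule Plus.IH(1)) (use Plus.prems in auto)
  have b: "(\<forall>f \<in> set (flatv (val b \<rho> (shift (nn a) X))). C f) \<and>
      (\<forall>f \<in> set (con b \<rho> (shift (nn a) X)). C f)"
    by (rule Plus.IH(2)) (use Plus.prems in \<open>auto simp: shift_def\<close>)
  note ab = a b
  have "C (\<lambda>\<omega>. rvl (val a \<rho> X) \<omega> + rvl (val b \<rho> (shift (nn a) X)) \<omega>)"
    by (intro ca rvl_closed[OF C]) (use ab in blast)+
  with ab show ?case by (simp add: ball_Un)
next
  case (Eq a b)
  have a: "(\<forall>f \<in> set (flatv (val a \<rho> X)). C f) \<and> (\<forall>f \<in> set (con a \<rho> X). C f)"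
    by (rule Eq.IH(1)) (use Eq.prems in auto)
  have b: "(\<forall>f \<in> set (flatv (val b \<rho> (shift (nn a) X))). C f) \<and>
      (\<forall>f \<in> set (con b \<rho> (shift (nn a) X)). C f)"
    by (rule Eq.IH(2)) (use Eq.prems in \<open>auto simp: shift_def\<close>)
  note ab = a b
  have "C (\<lambda>\<omega>. rvl (val a \<rho> X) \<omega> - rvl (val b \<rho> (shift (nn a) X)) \<omega>)"
    by (intro sub rvl_closed[OF C]) (use ab in blast)+
  with ab show ?case by (simp add: ball_Un)
next
  case (Pair a b)
  have a: "(\<forall>f \<in> set (flatv (val a \<rho> X)). C f) \<and> (\<forall>f \<in> set (con a \<rho> X). C f)"
    by (rule Pair.IH(1)) (use Pair.prems in auto)
  have b: "(\<forall>f \<in> set (flatv (val b \<rho> (shift (nn a) X))). C f) \<and>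
      (\<forall>f \<in> set (con b \<rho> (shift (nn a) X)). C f)"
    by (rule Pair.IH(2)) (use Pair.prems in \<open>auto simp: shift_def\<close>)
  show ?case using a b by (simp add: ball_Un)
next
  case (Let x e t)
  have e: "(\<forall>f \<in> set (flatv (val e \<rho> X)). C f) \<and> (\<forall>f \<in> set (con e \<rho> X). C f)"
    by (rule Let.IH(1)) (use Let.prems in auto)
  have "(\<forall>f \<in> set (flatv (val t (\<rho>(Var x := val e \<rho> X)) (shift (nn e) X))). C f) \<and>
     (\<forall>f \<in> set (con t (\<rho>(Var x := val e \<rho> X)) (shift (nn e) X)). C f)"
    by (rule Let.IH(2)) (use Let.prems e in \<open>auto simp: shift_def\<close>)
  with e show ?case by (simp add: ball_Un)
next
  case (LetP x y e t)
  have e: "(\<forall>f \<in> set (flatv (val e \<rho> X)). C f) \<and> (\<forall>f \<in> set (con e \<rho> X). C f)"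
    by (rule LetP.IH(1)) (use LetP.prems in auto)
  have fs: "\<forall>f \<in> set (flatv (vfst v)) \<union> set (flatv (vsnd v)). C f" if "\<forall>f \<in> set (flatv v). C f" for v
    using that by (cases v) auto
  have "(\<forall>f \<in> set (flatv (val t (\<rho>(Var y := vsnd (val e \<rho> X), Var x := vfst (val e \<rho> X))) (shift (nn e) X))). C f) \<and>
     (\<forall>f \<in> set (con t (\<rho>(Var y := vsnd (val e \<rho> X), Var x := vfst (val e \<rho> X))) (shift (nn e) X)). C f)"
    by (rule LetP.IH(2)) (use LetP.prems e fs[of "val e \<rho> X"] in \<open>auto simp: shift_def\<close>)
  with e show ?case by (simp add: ball_Un)
next
  case (Scale \<alpha> a)
  have a: "(\<forall>f \<in> set (flatv (val a \<rho> X)). C f) \<and> (\<forall>f \<in> set (con a \<rho> X). C f)"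
    by (rule Scale.IH) (use Scale.prems in auto)
  then have "C (\<lambda>\<omega>. \<alpha> * rvl (val a \<rho> X) \<omega>)" by (intro cs rvl_closed[OF C]) blast
  with a show ?case by simp
next
  case (Const \<beta>)
  show ?case by (simp add: cb)
qed auto
qed

lemma infer_has_ty: "has_ty H r \<Gamma> e \<tau> \<Longrightarrow> H = None \<Longrightarrow> infer \<Gamma> e = Some \<tau>"
  by (induction rule: has_ty.induct) auto

lemma lookup_off_map_of:
  "map_of \<Gamma> x = Some \<tau> \<Longrightarrow> \<exists>off. lookup_off \<Gamma> x = Some (off, \<tau>) \<and> off + tdim \<tau> \<le> ctx_dim \<Gamma>"
  by (induction \<Gamma>) (auto simp: ctx_dim_def split: if_splits)

lemma lookup_off_map_of': "lookup_off \<Gamma> x = Some (off, \<tau>) \<Longrightarrow> map_of \<Gamma> x = Some \<tau>"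
  by (induction \<Gamma> arbitrary: off) (auto split: if_splits)

subsection \<open>The denotation is generated by symbolic evaluation\<close>

definition evl :: "'w rv list \<Rightarrow> 'w \<Rightarrow> real vec" where
  "evl fs \<omega> = vec_of_list (map (\<lambda>f. f \<omega>) fs)"

lemma evl_append: "evl (fs @ gs) \<omega> = evl fs \<omega> @\<^sub>v evl gs \<omega>"
  by (intro eq_vecI) (auto simp: evl_def index_vec_of_list nth_append)

lemma dim_evl [simp]: "dim_vec (evl fs \<omega>) = length fs"
  by (simp add: evl_def)

lemma evl_nth [simp]: "i < length fs \<Longrightarrow> evl fs \<omega> $ i = (fs ! i) \<omega>"
  by (simp add: evl_def index_vec_of_list)

lemma evl_carrier: "length fs = n \<Longrightarrow> evl fs \<omega> \<in> carrier_vec n"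
  by (intro carrier_vecI) simp

lemma evl_single: "evl [f] \<omega> = vec 1 (\<lambda>_. f \<omega>)"
  by (intro eq_vecI) (auto simp: evl_def index_vec_of_list)

text \<open>At the sample point \<open>\<omega>\<close>, the vector \<open>x\<close> is the
  numerical environment of the denotation and \<open>\<rho>\<close> the symbolic one. They are
  compared through lookups, so entries of \<open>x\<close> belonging to shadowed bindings are
  unconstrained.\<close>

definition env_rel :: "env \<Rightarrow> (tm \<Rightarrow> 'w rv sv) \<Rightarrow> 'w \<Rightarrow> real vec \<Rightarrow> bool" where
  "env_rel \<Gamma> \<rho> \<omega> x \<longleftrightarrow> x \<in> carrier_vec (ctx_dim \<Gamma>) \<and>
     (\<forall>y off \<tau>. lookup_off \<Gamma> y = Some (off, \<tau>) \<longrightarrow>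
        shp \<tau> (\<rho> (Var y)) \<and> (\<forall>i<tdim \<tau>. x $ (off + i) = (flatv (\<rho> (Var y)) ! i) \<omega>))"

lemma env_rel_upd:
  assumes rel: "env_rel \<Gamma> \<rho> \<omega> x" and v: "shp \<tau> v"
  shows "env_rel ((y, \<tau>) # \<Gamma>) (\<rho>(Var y := v)) \<omega> (evl (flatv v) \<omega> @\<^sub>v x)"
proof -
  have x: "x \<in> carrier_vec (ctx_dim \<Gamma>)"
    and lk: "\<And>y off \<tau>. lookup_off \<Gamma> y = Some (off, \<tau>) \<Longrightarrow>
        shp \<tau> (\<rho> (Var y)) \<and> (\<forall>i<tdim \<tau>. x $ (off + i) = (flatv (\<rho> (Var y)) ! i) \<omega>)"
    using rel unfolding env_rel_def by auto
  have l: "length (flatv v) = tdim \<tau>" by (rule length_flatv[OF v])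
  have "evl (flatv v) \<omega> @\<^sub>v x \<in> carrier_vec (ctx_dim ((y, \<tau>) # \<Gamma>))"
    using x l by (intro carrier_vecI) (simp add: ctx_dim_def)
  moreover have "shp \<sigma> ((\<rho>(Var y := v)) (Var z)) \<and>
      (\<forall>i<tdim \<sigma>. (evl (flatv v) \<omega> @\<^sub>v x) $ (off + i) = (flatv ((\<rho>(Var y := v)) (Var z)) ! i) \<omega>)"
    if lz: "lookup_off ((y, \<tau>) # \<Gamma>) z = Some (off, \<sigma>)" for z off \<sigma>
  proof (cases "z = y")
    case True
    then show ?thesis using lz v l by auto
  next
    case False
    then obtain off' where o: "lookup_off \<Gamma> z = Some (off', \<sigma>)" "off = tdim \<tau> + off'" using lz by auto
    obtain off'' where "lookup_off \<Gamma> z = Some (off'', \<sigma>)" "off'' + tdim \<sigma> \<le> ctx_dim \<Gamma>"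
      using lookup_off_map_of[OF lookup_off_map_of'[OF o(1)]] by auto
    then have "off' + tdim \<sigma> \<le> ctx_dim \<Gamma>" using o by simp
    then show ?thesis using lk[OF o(1)] o False l x by auto
  qed
  ultimately show ?thesis unfolding env_rel_def by blast
qed

lemma vec_first_vec [simp]: "vec_first (vec (a + b) f) a = vec a f"
  by (auto simp: vec_first_def)

lemma vec_last_vec [simp]: "vec_last (vec (a + b) f) b = vec b (\<lambda>i. f (a + i))"
  by (auto simp: vec_last_def)

definition noise :: "nat \<Rightarrow> (nat \<Rightarrow> 'w rv) \<Rightarrow> 'w \<Rightarrow> real vec" where
  "noise r X \<omega> = vec r (\<lambda>i. X i \<omega>)"

lemma noise_carrier [simp]: "noise r X \<omega> \<in> carrier_vec r"
  by (simp add: noise_def)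

lemma noise_first [simp]: "vec_first (noise (a + b) X \<omega>) a = noise a X \<omega>"
  by (simp add: noise_def)

lemma noise_last [simp]: "vec_last (noise (a + b) X \<omega>) b = noise b (shift a X) \<omega>"
  by (simp add: noise_def shift_def)

lemma zero_append [simp]: "0\<^sub>v a @\<^sub>v 0\<^sub>v b = (0\<^sub>v (a + b) :: real vec)"
  by (intro eq_vecI) auto

lemma cbullet_snd: "snd (F' \<bullet>\<^sub>c F) = snd F' @\<^sub>v snd F"
  unfolding cbullet_def by (simp split: prod.splits)

lemma ctensor_snd: "snd (F1 \<otimes>\<^sub>c F2) = snd F1 @\<^sub>v snd F2"
  unfolding ctensor_def by (simp split: prod.splits)

lemma cJ_snd [simp]: "snd (cJ f) = 0\<^sub>v 0"
  by (simp add: cJ_def)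

lemma evl_Nil [simp]: "evl [] \<omega> = vNil"
  by (simp add: evl_def)

lemma append_vNil_right [simp]: "a @\<^sub>v vNil = (a :: real vec)"
  by (intro eq_vecI) auto

text \<open>The agreement is pointwise: at every sample point, feeding the sampled noise and
  environment into the generating maps gives the values \<open>V\<close> and \<open>C\<close> of the
  symbolic expressions. The relation \<open>R\<close> says which environments are admissible. All
  observations are zero, as the only source of observations in a denotation is
  \<open>cobs\<close>.\<close>

definition generates ::
  "nat \<Rightarrow> nat \<Rightarrow> nat \<Rightarrow> cm \<Rightarrow> ('w \<Rightarrow> real vec \<Rightarrow> (tm \<Rightarrow> 'w rv sv) \<Rightarrow> bool) \<Rightarrow>
    ('w \<Rightarrow> real vec \<Rightarrow> (tm \<Rightarrow> 'w rv sv) \<Rightarrow> (nat \<Rightarrow> 'w rv) \<Rightarrow> real vec) \<Rightarrow>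
    ('w \<Rightarrow> real vec \<Rightarrow> (tm \<Rightarrow> 'w rv sv) \<Rightarrow> (nat \<Rightarrow> 'w rv) \<Rightarrow> real vec) \<Rightarrow> bool" where
  "generates m n r F R V C \<longleftrightarrow> (\<exists>k v c. crep m n k r F v c \<and> snd F = 0\<^sub>v k \<and>
     (\<forall>\<omega> x \<rho> X. R \<omega> x \<rho> \<longrightarrow> v x (noise r X \<omega>) = V \<omega> x \<rho> X \<and> c x (noise r X \<omega>) = C \<omega> x \<rho> X))"

lemma generatesI:
  assumes "crep m n k r F v c" "snd F = 0\<^sub>v k"
    and "\<And>\<omega> x \<rho> X. R \<omega> x \<rho> \<Longrightarrow> v x (noise r X \<omega>) = V \<omega> x \<rho> X"
    and "\<And>\<omega> x \<rho> X. R \<omega> x \<rho> \<Longrightarrow> c x (noise r X \<omega>) = C \<omega> x \<rho> X"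
  shows "generates m n r F R V C"
  using assms unfolding generates_def by blast

lemma generates_cong:
  assumes "generates m n r F R V C"
    and "\<And>\<omega> x \<rho> X. R' \<omega> x \<rho> \<Longrightarrow> R \<omega> x \<rho> \<and> V \<omega> x \<rho> X = V' \<omega> x \<rho> X \<and> C \<omega> x \<rho> X = C' \<omega> x \<rho> X"
  shows "generates m n r F R' V' C'"
proof -
  obtain k v c where 1: "crep m n k r F v c" "snd F = 0\<^sub>v k"
    and e: "\<And>\<omega> x \<rho> X. R \<omega> x \<rho> \<Longrightarrow> v x (noise r X \<omega>) = V \<omega> x \<rho> X \<and> c x (noise r X \<omega>) = C \<omega> x \<rho> X"
    using assms(1) unfolding generates_def by blast
  show ?thesis
  proof (rule generatesI[OF 1])
    show "v x (noise r X \<omega>) = V' \<omega> x \<rho> X" if "R' \<omega> x \<rho>" for \<omega> x \<rho> X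
      using e[of \<omega> x \<rho> X] assms(2)[OF that, of X] by simp
    show "c x (noise r X \<omega>) = C' \<omega> x \<rho> X" if "R' \<omega> x \<rho>" for \<omega> x \<rho> X
      using e[of \<omega> x \<rho> X] assms(2)[OF that, of X] by simp
  qed
qed

text \<open>Admissibility of an environment vector after it has been copied.\<close>

definition dup :: "('w \<Rightarrow> real vec \<Rightarrow> 'r \<Rightarrow> bool) \<Rightarrow> 'w \<Rightarrow> real vec \<Rightarrow> 'r \<Rightarrow> bool" where
  "dup R \<omega> x \<rho> \<longleftrightarrow> (\<exists>y. R \<omega> y \<rho> \<and> x = y @\<^sub>v y)"

lemma generates_tensor:
  assumes F: "generates m n1 r1 F R V1 C1" and G: "generates m n2 r2 G R V2 C2"
    and R: "\<And>\<omega> x \<rho>. R \<omega> x \<rho> \<Longrightarrow> x \<in> carrier_vec m"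
  shows "generates (m + m) (n1 + n2) (r1 + r2) (F \<otimes>\<^sub>c G) (dup R)
     (\<lambda>\<omega> x \<rho> X. V1 \<omega> (vec_first x m) \<rho> X @\<^sub>v V2 \<omega> (vec_first x m) \<rho> (shift r1 X))
     (\<lambda>\<omega> x \<rho> X. C1 \<omega> (vec_first x m) \<rho> X @\<^sub>v C2 \<omega> (vec_first x m) \<rho> (shift r1 X))"
proof -
  obtain k1 v1 c1 where 1: "crep m n1 k1 r1 F v1 c1" "snd F = 0\<^sub>v k1"
    and e1: "\<And>\<omega> x \<rho> X. R \<omega> x \<rho> \<Longrightarrow> v1 x (noise r1 X \<omega>) = V1 \<omega> x \<rho> X \<and> c1 x (noise r1 X \<omega>) = C1 \<omega> x \<rho> X"
    using F unfolding generates_def by blast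
  obtain k2 v2 c2 where 2: "crep m n2 k2 r2 G v2 c2" "snd G = 0\<^sub>v k2"
    and e2: "\<And>\<omega> x \<rho> X. R \<omega> x \<rho> \<Longrightarrow> v2 x (noise r2 X \<omega>) = V2 \<omega> x \<rho> X \<and> c2 x (noise r2 X \<omega>) = C2 \<omega> x \<rho> X"
    using G unfolding generates_def by blast
  show ?thesis
  proof (rule generatesI[OF crep_ctensor[OF 1(1) 2(1)]])
    show "snd (F \<otimes>\<^sub>c G) = 0\<^sub>v (k1 + k2)" using 1 2 by (simp add: ctensor_snd)
  next
    fix \<omega> x \<rho> and X :: "nat \<Rightarrow> 'a rv" assume "dup R \<omega> x \<rho>"
    then obtain y where y: "R \<omega> y \<rho>" "x = y @\<^sub>v y" unfolding dup_def by blast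
    have f: "vec_first x m = y" "vec_last x m = y" using R[OF y(1)] y(2) by auto
    show "v1 (vec_first x m) (vec_first (noise (r1 + r2) X \<omega>) r1) @\<^sub>v
        v2 (vec_last x m) (vec_last (noise (r1 + r2) X \<omega>) r2)
       = V1 \<omega> (vec_first x m) \<rho> X @\<^sub>v V2 \<omega> (vec_first x m) \<rho> (shift r1 X)"
      unfolding f using e1[OF y(1), of X] e2[OF y(1), of "shift r1 X"] by simp
    show "c1 (vec_first x m) (vec_first (noise (r1 + r2) X \<omega>) r1) @\<^sub>v
        c2 (vec_last x m) (vec_last (noise (r1 + r2) X \<omega>) r2)
       = C1 \<omega> (vec_first x m) \<rho> X @\<^sub>v C2 \<omega> (vec_first x m) \<rho> (shift r1 X)"
      unfolding f using e1[OF y(1), of X] e2[OF y(1), of "shift r1 X"] by simp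
  qed
qed

lemma generates_copy:
  assumes G: "generates (m + m) n r G (dup R) V C"
    and R: "\<And>\<omega> x \<rho>. R \<omega> x \<rho> \<Longrightarrow> x \<in> carrier_vec m"
  shows "generates m n r (G \<bullet>\<^sub>c cJ (gcopy m)) R (\<lambda>\<omega> x. V \<omega> (x @\<^sub>v x)) (\<lambda>\<omega> x. C \<omega> (x @\<^sub>v x))"
proof -
  obtain k v c where 1: "crep (m + m) n k r G v c" "snd G = 0\<^sub>v k"
    and e: "\<And>\<omega> x \<rho> X. dup R \<omega> x \<rho> \<Longrightarrow> v x (noise r X \<omega>) = V \<omega> x \<rho> X \<and> c x (noise r X \<omega>) = C \<omega> x \<rho> X"
    using G unfolding generates_def by blast
  show ?thesis
  proof (rule generatesI[OF crep_cbullet[OF crep_copy 1(1), unfolded add_0_left add_0_right]])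
    show "snd (G \<bullet>\<^sub>c cJ (gcopy m)) = 0\<^sub>v k" using 1 by (simp add: cbullet_snd)
  next
    fix \<omega> x \<rho> and X :: "nat \<Rightarrow> 'a rv" assume "R \<omega> x \<rho>"
    then have d: "dup R \<omega> (x @\<^sub>v x) \<rho>" unfolding dup_def by blast
    have n: "vec_last (noise r X \<omega>) r = noise r X \<omega>" by (simp add: vec_last_id)
    show "v (x @\<^sub>v x) (vec_last (noise r X \<omega>) r) = V \<omega> (x @\<^sub>v x) \<rho> X"
      unfolding n using e[OF d] by simp
    show "c (x @\<^sub>v x) (vec_last (noise r X \<omega>) r) @\<^sub>v 0\<^sub>v 0 = C \<omega> (x @\<^sub>v x) \<rho> X"
      unfolding n using e[OF d] by simp
  qed
qed

text \<open>The function \<open>h\<close> is the change of symbolic environment between the two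
  stages: for a let it adds the bound value, while for arithmetic the second stage admits any
  environment.\<close>

lemma generates_bullet:
  assumes F: "generates m n r F R V C" and G: "generates n p s G Q W D"
    and RQ: "\<And>\<omega> x \<rho> X. R \<omega> x \<rho> \<Longrightarrow> Q \<omega> (V \<omega> x \<rho> X) (h \<rho> X)"
  shows "generates m p (r + s) (G \<bullet>\<^sub>c F) R
     (\<lambda>\<omega> x \<rho> X. W \<omega> (V \<omega> x \<rho> X) (h \<rho> X) (shift r X))
     (\<lambda>\<omega> x \<rho> X. D \<omega> (V \<omega> x \<rho> X) (h \<rho> X) (shift r X) @\<^sub>v C \<omega> x \<rho> X)"
proof -
  obtain k1 v1 c1 where 1: "crep m n k1 r F v1 c1" "snd F = 0\<^sub>v k1"
    and e1: "\<And>\<omega> x \<rho> X. R \<omega> x \<rho> \<Longrightarrow> v1 x (noise r X \<omega>) = V \<omega> x \<rho> X \<and> c1 x (noise r X \<omega>) = C \<omega> x \<rho> X"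
    using F unfolding generates_def by blast
  obtain k2 v2 c2 where 2: "crep n p k2 s G v2 c2" "snd G = 0\<^sub>v k2"
    and e2: "\<And>\<omega> x \<rho> X. Q \<omega> x \<rho> \<Longrightarrow> v2 x (noise s X \<omega>) = W \<omega> x \<rho> X \<and> c2 x (noise s X \<omega>) = D \<omega> x \<rho> X"
    using G unfolding generates_def by blast
  show ?thesis
  proof (rule generatesI[OF crep_cbullet[OF 1(1) 2(1)]])
    show "snd (G \<bullet>\<^sub>c F) = 0\<^sub>v (k2 + k1)" using 1 2 by (simp add: cbullet_snd)
  next
    fix \<omega> x \<rho> and X :: "nat \<Rightarrow> 'a rv" assume r: "R \<omega> x \<rho>"
    show "v2 (v1 x (vec_first (noise (r + s) X \<omega>) r)) (vec_last (noise (r + s) X \<omega>) s)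
        = W \<omega> (V \<omega> x \<rho> X) (h \<rho> X) (shift r X)"
      using e1[OF r, of X] e2[OF RQ[OF r, of X], of "shift r X"] by simp
    show "c2 (v1 x (vec_first (noise (r + s) X \<omega>) r)) (vec_last (noise (r + s) X \<omega>) s) @\<^sub>v c1 x (vec_first (noise (r + s) X \<omega>) r)
       = D \<omega> (V \<omega> x \<rho> X) (h \<rho> X) (shift r X) @\<^sub>v C \<omega> x \<rho> X"
      using e1[OF r, of X] e2[OF RQ[OF r, of X], of "shift r X"] by simp
  qed
qed

section \<open>Generating maps of the primitive morphisms and of binary constructs\<close>

lemma generates_det:
  assumes A: "A \<in> carrier_mat n m" and b: "b \<in> carrier_vec n"
    and e: "\<And>\<omega> x \<rho> X. R \<omega> x \<rho> \<Longrightarrow> A *\<^sub>v x + b = V \<omega> x \<rho> X"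
  shows "generates m n 0 (cJ (gdet A b)) R V (\<lambda>_ _ _ _. vNil)"
  by (rule generatesI[OF crep_cJ[OF rep_gdet[OF A b]]]) (use e in auto)

lemma generates_cid: "generates m m 0 (cid m) R (\<lambda>\<omega> x \<rho> X. x) (\<lambda>_ _ _ _. vNil)"
  by (rule generatesI[OF crep_cid]) (auto simp: cid_def)

lemma generates_normal: "generates m 1 1 (cJ (gconst m 0 1)) R (\<lambda>\<omega> x \<rho> X. vec 1 (\<lambda>_. X 0 \<omega>)) (\<lambda>_ _ _ _. vNil)"
proof -
  have "rep m 1 1 (gconst m 0 1) (\<lambda>x \<xi>. \<xi>)"
  proof -
    have "mat 1 1 (\<lambda>_. 1) = (1\<^sub>m 1 :: real mat)" by (intro eq_matI) auto
    then show ?thesis unfolding rep_def gconst_def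
      by (intro exI[of _ "0\<^sub>m 1 m"] exI[of _ "0\<^sub>v 1"] exI[of _ "1\<^sub>m 1"]) (auto intro!: eq_vecI)
  qed
  from crep_cJ[OF this] show ?thesis
    by (rule generatesI) (auto simp: noise_def)
qed

lemma generates_const: "generates m 1 0 (cJ (gconst m \<beta> 0)) R (\<lambda>\<omega> x \<rho> X. vec 1 (\<lambda>_. \<beta>)) (\<lambda>_ _ _ _. vNil)"
proof -
  have "gconst m \<beta> 0 = gdet (0\<^sub>m 1 m) (vec 1 (\<lambda>_. \<beta>))"
    unfolding gconst_def gdet_def by (auto intro!: eq_matI)
  moreover have "rep m 1 0 (gdet (0\<^sub>m 1 m) (vec 1 (\<lambda>_. \<beta>))) (\<lambda>x \<xi>. vec 1 (\<lambda>_. \<beta>))"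
    by (rule rep_cong[OF rep_gdet]) (auto intro!: eq_vecI)
  ultimately have "rep m 1 0 (gconst m \<beta> 0) (\<lambda>x \<xi>. vec 1 (\<lambda>_. \<beta>))" by simp
  from crep_cJ[OF this] show ?thesis by (rule generatesI) auto
qed

lemma generates_cobs: "generates 1 0 0 cobs R (\<lambda>\<omega> x \<rho> X. vNil) (\<lambda>\<omega> x \<rho> X. x)"
proof -
  have "crep 1 0 1 0 cobs (\<lambda>x \<xi>. vNil) (\<lambda>x \<xi>. x)"
  proof -
    have "rep 1 (0 + 1) 0 (gid 1) (\<lambda>x \<xi>. vNil @\<^sub>v x)" using rep_gid[of 1] by simp
    moreover have "vNil \<in> carrier_vec 0" by (intro carrier_vecI) simp
    ultimately show ?thesis unfolding crep_def cobs_def by auto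
  qed
  then show ?thesis by (rule generatesI) (auto simp: cobs_def)
qed

text \<open>The common shape of sums, equations and lets: copy the environment, run two morphisms on
  the copies, process the pair. For a let the second morphism is the identity, so the pair is the
  extended environment, and \<open>P\<close> is the body.\<close>

lemma generates_binary:
  assumes F: "generates m n1 r1 F R V1 C1" and G: "generates m n2 r2 G R V2 C2"
    and P: "generates (n1 + n2) p s P Q W D"
    and R: "\<And>\<omega> x \<rho>. R \<omega> x \<rho> \<Longrightarrow> x \<in> carrier_vec m"
    and RQ: "\<And>\<omega> x \<rho> X. R \<omega> x \<rho> \<Longrightarrow> Q \<omega> (V1 \<omega> x \<rho> X @\<^sub>v V2 \<omega> x \<rho> (shift r1 X)) (h \<rho> X)"
  shows "generates m p (r1 + r2 + s) (P \<bullet>\<^sub>c (F \<otimes>\<^sub>c G) \<bullet>\<^sub>c cJ (gcopy m)) R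
     (\<lambda>\<omega> x \<rho> X. W \<omega> (V1 \<omega> x \<rho> X @\<^sub>v V2 \<omega> x \<rho> (shift r1 X)) (h \<rho> X) (shift (r1 + r2) X))
     (\<lambda>\<omega> x \<rho> X. D \<omega> (V1 \<omega> x \<rho> X @\<^sub>v V2 \<omega> x \<rho> (shift r1 X)) (h \<rho> X) (shift (r1 + r2) X) @\<^sub>v
        (C1 \<omega> x \<rho> X @\<^sub>v C2 \<omega> x \<rho> (shift r1 X)))"
proof -
  have d: "Q \<omega> (V1 \<omega> (vec_first x m) \<rho> X @\<^sub>v V2 \<omega> (vec_first x m) \<rho> (shift r1 X)) (h \<rho> X)"
    if "dup R \<omega> x \<rho>" for \<omega> x \<rho> and X :: "nat \<Rightarrow> 'a rv"
  proof -
    from that obtain y where y: "R \<omega> y \<rho>" "x = y @\<^sub>v y" unfolding dup_def by blast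
    then have "vec_first x m = y" using R[OF y(1)] by simp
    then show ?thesis using RQ[OF y(1)] by simp
  qed
  show ?thesis
    by (rule generates_cong[OF generates_copy[OF generates_bullet[OF generates_tensor[OF F G R] P d] R]])
      (auto dest: R)
qed

lemma evl_rvl: "shp TR v \<Longrightarrow> evl (flatv v) \<omega> = vec 1 (\<lambda>_. rvl v \<omega>)"
  by (cases v) (auto simp: evl_single)

lemma row2_apply: "row2 a b *\<^sub>v (vec 1 (\<lambda>_. x) @\<^sub>v vec 1 (\<lambda>_. y)) + 0\<^sub>v 1 = vec 1 (\<lambda>_. a * x + b * y)"
  by (intro eq_vecI) (auto simp: row2_def scalar_prod_def numeral_2_eq_2)

lemma env_rel_shp: "env_rel \<Gamma> \<rho> \<omega> x \<Longrightarrow> env_shp None 0 \<Gamma> \<rho>"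
  unfolding env_rel_def env_shp_def using lookup_off_map_of by blast

text \<open>Noise and conditions are arranged by the combinators in exactly the order of
  \<open>val\<close> and \<open>con\<close>, so the induction needs no permutations. The premises on
  \<open>H\<close> and \<open>r\<close> exclude holes and latent variables, for which
  \<open>den\<close> is a mere placeholder.\<close>

lemma den_generates:
  "has_ty H r \<Gamma> e \<tau> \<Longrightarrow> H = None \<Longrightarrow> r = 0 \<Longrightarrow>
   generates (ctx_dim \<Gamma>) (tdim \<tau>) (nn e) (den \<Gamma> e) (\<lambda>(\<omega> :: 'w) x \<rho>. env_rel \<Gamma> \<rho> \<omega> x)
     (\<lambda>\<omega> x \<rho> X. evl (flatv (val e \<rho> X)) \<omega>) (\<lambda>\<omega> x \<rho> X. evl (con e \<rho> X) \<omega>)"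
proof (induction rule: has_ty.induct)
  case (T_Var \<Gamma> x \<tau> H r)
  obtain off where lk: "lookup_off \<Gamma> x = Some (off, \<tau>)" and le: "off + tdim \<tau> \<le> ctx_dim \<Gamma>"
    using lookup_off_map_of[OF T_Var(1)] by blast
  have "generates (ctx_dim \<Gamma>) (tdim \<tau>) 0 (cJ (gdet (proj_mat (ctx_dim \<Gamma>) off (tdim \<tau>)) (0\<^sub>v (tdim \<tau>))))
    (\<lambda>(\<omega> :: 'w) x \<rho>. env_rel \<Gamma> \<rho> \<omega> x) (\<lambda>\<omega> y \<rho> X. evl (flatv (\<rho> (Var x))) \<omega>) (\<lambda>_ _ _ _. vNil)"
  proof (rule generates_det)
    fix \<omega> y \<rho> assume rel: "env_rel \<Gamma> \<rho> \<omega> y"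
    then have y: "y \<in> carrier_vec (ctx_dim \<Gamma>)" and s: "shp \<tau> (\<rho> (Var x))"
      and ix: "\<And>i. i < tdim \<tau> \<Longrightarrow> y $ (off + i) = (flatv (\<rho> (Var x)) ! i) \<omega>"
      using lk unfolding env_rel_def by auto
    note l = length_flatv[OF s]
    show "proj_mat (ctx_dim \<Gamma>) off (tdim \<tau>) *\<^sub>v y + 0\<^sub>v (tdim \<tau>) = evl (flatv (\<rho> (Var x))) \<omega>"
    proof (rule eq_vecI)
      fix i assume "i < dim_vec (evl (flatv (\<rho> (Var x))) \<omega>)"
      then have i: "i < tdim \<tau>" using l by simp
      have "row (proj_mat (ctx_dim \<Gamma>) off (tdim \<tau>)) i = unit_vec (ctx_dim \<Gamma>) (off + i)"
        using i le by (intro eq_vecI) (auto simp: proj_mat_def)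
      then have "(proj_mat (ctx_dim \<Gamma>) off (tdim \<tau>) *\<^sub>v y) $ i = y $ (off + i)"
        using i le scalar_prod_left_unit[OF y, of "off + i"] by (simp add: proj_mat_def)
      then show "(proj_mat (ctx_dim \<Gamma>) off (tdim \<tau>) *\<^sub>v y + 0\<^sub>v (tdim \<tau>)) $ i = evl (flatv (\<rho> (Var x))) \<omega> $ i"
        using i l ix by simp
    qed (use l in \<open>simp add: proj_mat_def\<close>)
  qed (auto simp: proj_mat_def)
  then show ?case using lk by simp
next
  case (T_Plus H r \<Gamma> a b)
  have sh: "shp TR (val a \<rho> X)" "shp TR (val b \<rho> X)" if "env_rel \<Gamma> \<rho> \<omega> x" for \<rho> \<omega> x and X :: "nat \<Rightarrow> 'w rv"
    using shp_val[OF T_Plus(1), of \<rho>] shp_val[OF T_Plus(2), of \<rho>] env_rel_shp[OF that] T_Plus.prems by auto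
  have D: "generates (1 + 1) 1 0 (cJ (gdet (row2 1 1) (0\<^sub>v 1))) (\<lambda>\<omega> x \<rho>. True)
      (\<lambda>\<omega> x \<rho> X. row2 1 1 *\<^sub>v x + 0\<^sub>v 1) (\<lambda>_ _ _ _. vNil)"
    by (rule generates_det) (auto simp: row2_def)
  note IH = T_Plus.IH(1)[OF T_Plus.prems, unfolded tdim.simps] T_Plus.IH(2)[OF T_Plus.prems, unfolded tdim.simps]
  have R: "env_rel \<Gamma> \<rho> \<omega> x \<Longrightarrow> x \<in> carrier_vec (ctx_dim \<Gamma>)" for \<rho> \<omega> x unfolding env_rel_def by simp
  have "generates (ctx_dim \<Gamma>) 1 (nn a + nn b + 0) (den \<Gamma> (Plus a b)) (\<lambda>(\<omega> :: 'w) x \<rho>. env_rel \<Gamma> \<rho> \<omega> x)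
     (\<lambda>\<omega> x \<rho> X. evl (flatv (val (Plus a b) \<rho> X)) \<omega>) (\<lambda>\<omega> x \<rho> X. evl (con (Plus a b) \<rho> X) \<omega>)"
    unfolding den.simps
    by (rule generates_cong[OF generates_binary[OF IH D R]])
      (auto simp: evl_append evl_rvl[OF sh(1)] evl_rvl[OF sh(2)] row2_apply evl_single simp del: One_nat_def)
  then show ?case by simp
next
  case (T_Scale H r \<Gamma> a \<alpha>)
  have sh: "shp TR (val a \<rho> X)" if "env_rel \<Gamma> \<rho> \<omega> x" for \<rho> \<omega> x and X :: "nat \<Rightarrow> 'w rv"
    using shp_val[OF T_Scale(1), of \<rho>] env_rel_shp[OF that] T_Scale.prems by auto
  have D: "generates 1 1 0 (cJ (gdet (mat 1 1 (\<lambda>_. \<alpha>)) (0\<^sub>v 1))) (\<lambda>\<omega> x \<rho>. True)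
      (\<lambda>\<omega> x \<rho> X. mat 1 1 (\<lambda>_. \<alpha>) *\<^sub>v x + 0\<^sub>v 1) (\<lambda>_ _ _ _. vNil)"
    by (rule generates_det) auto
  note IH = T_Scale.IH[OF T_Scale.prems, unfolded tdim.simps]
  have m: "mat 1 1 (\<lambda>_. \<alpha>) *\<^sub>v vec 1 (\<lambda>_. x) + 0\<^sub>v 1 = vec 1 (\<lambda>_. \<alpha> * x)" for x :: real
    by (intro eq_vecI) (auto simp: scalar_prod_def)
  have "generates (ctx_dim \<Gamma>) 1 (nn a + 0) (den \<Gamma> (Scale \<alpha> a)) (\<lambda>(\<omega> :: 'w) x \<rho>. env_rel \<Gamma> \<rho> \<omega> x)
     (\<lambda>\<omega> x \<rho> X. evl (flatv (val (Scale \<alpha> a) \<rho> X)) \<omega>) (\<lambda>\<omega> x \<rho> X. evl (con (Scale \<alpha> a) \<rho> X) \<omega>)"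
    unfolding den.simps
    by (rule generates_cong[OF generates_bullet[OF IH D]])
      (auto simp: evl_rvl[OF sh] m evl_single simp del: One_nat_def)
  then show ?case by simp
next
  case (T_Const H r \<Gamma> \<beta>)
  show ?case using generates_const by (simp add: evl_single)
next
  case (T_Pair H r \<Gamma> a \<tau>1 b \<tau>2)
  have R: "env_rel \<Gamma> \<rho> \<omega> x \<Longrightarrow> x \<in> carrier_vec (ctx_dim \<Gamma>)" for \<rho> \<omega> x unfolding env_rel_def by simp
  show ?case
    unfolding den.simps tdim.simps nn.simps
    by (rule generates_cong[OF generates_copy[OF generates_tensor[OF T_Pair.IH(1)[OF T_Pair.prems] T_Pair.IH(2)[OF T_Pair.prems] R] R]])
      (auto simp: evl_append dest: R)
next
  case (T_Unit H r \<Gamma>)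
  show ?case unfolding den.simps tdim.simps nn.simps
    by (rule generates_cong[OF generates_det[where V = "\<lambda>_ _ _ _. vNil"]]) auto
next
  case (T_Let H r \<Gamma> e \<tau>1 x t \<tau>2)
  have R: "env_rel \<Gamma> \<rho> \<omega> x \<Longrightarrow> x \<in> carrier_vec (ctx_dim \<Gamma>)" for \<rho> \<omega> x unfolding env_rel_def by simp
  have inf: "infer \<Gamma> e = Some \<tau>1" by (rule infer_has_ty[OF T_Let(1) T_Let.prems(1)])
  have sh: "shp \<tau>1 (val e \<rho> X)" if "env_rel \<Gamma> \<rho> \<omega> y" for \<rho> \<omega> y and X :: "nat \<Rightarrow> 'w rv"
    using shp_val[OF T_Let(1), of \<rho>] env_rel_shp[OF that] T_Let.prems by auto
  have c: "ctx_dim ((x, \<tau>1) # \<Gamma>) = tdim \<tau>1 + ctx_dim \<Gamma>" by (simp add: ctx_dim_def)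
  have rel: "env_rel ((x, \<tau>1) # \<Gamma>) (\<rho>(Var x := val e \<rho> X)) \<omega> (evl (flatv (val e \<rho> X)) \<omega> @\<^sub>v z)"
    if r: "env_rel \<Gamma> \<rho> \<omega> z" for \<rho> \<omega> z and X :: "nat \<Rightarrow> 'w rv"
    by (rule env_rel_upd[OF r sh[OF r]])
  have "generates (ctx_dim \<Gamma>) (tdim \<tau>2) (nn e + 0 + nn t) (den \<Gamma> (Let x e t)) (\<lambda>(\<omega> :: 'w) x \<rho>. env_rel \<Gamma> \<rho> \<omega> x)
     (\<lambda>\<omega> y \<rho> X. evl (flatv (val (Let x e t) \<rho> X)) \<omega>) (\<lambda>\<omega> y \<rho> X. evl (con (Let x e t) \<rho> X) \<omega>)"
    unfolding den.simps inf option.case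
    by (rule generates_cong[OF generates_binary[OF T_Let.IH(1)[OF T_Let.prems] generates_cid
          T_Let.IH(2)[OF T_Let.prems, unfolded c] R rel]])
      (auto simp: evl_append fun_upd_def)
  then show ?case by simp
next
  case (T_LetP x y H r \<Gamma> e \<tau>1 \<tau>2 t \<tau>)
  have R: "env_rel \<Gamma> \<rho> \<omega> x \<Longrightarrow> x \<in> carrier_vec (ctx_dim \<Gamma>)" for \<rho> \<omega> x unfolding env_rel_def by simp
  have inf: "infer \<Gamma> e = Some (TProd \<tau>1 \<tau>2)" by (rule infer_has_ty[OF T_LetP(2) T_LetP.prems(1)])
  have c: "ctx_dim ((x, \<tau>1) # (y, \<tau>2) # \<Gamma>) = tdim (TProd \<tau>1 \<tau>2) + ctx_dim \<Gamma>" by (simp add: ctx_dim_def)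
  have rel: "env_rel ((x, \<tau>1) # (y, \<tau>2) # \<Gamma>) (\<rho>(Var y := vsnd (val e \<rho> X), Var x := vfst (val e \<rho> X))) \<omega>
      (evl (flatv (val e \<rho> X)) \<omega> @\<^sub>v z)" if r: "env_rel \<Gamma> \<rho> \<omega> z" for \<rho> \<omega> z and X :: "nat \<Rightarrow> 'w rv"
  proof -
    have "shp (TProd \<tau>1 \<tau>2) (val e \<rho> X)"
      using shp_val[OF T_LetP(2), of \<rho>] env_rel_shp[OF r] T_LetP.prems by auto
    then obtain a b where ab: "val e \<rho> X = VP a b" "shp \<tau>1 a" "shp \<tau>2 b" by auto
    show ?thesis using env_rel_upd[OF env_rel_upd[OF r ab(3), of y] ab(2), of x] ab(1)
      by (simp add: evl_append append_vec_assoc)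
  qed
  have "generates (ctx_dim \<Gamma>) (tdim \<tau>) (nn e + 0 + nn t) (den \<Gamma> (LetP x y e t)) (\<lambda>(\<omega> :: 'w) x \<rho>. env_rel \<Gamma> \<rho> \<omega> x)
     (\<lambda>\<omega> z \<rho> X. evl (flatv (val (LetP x y e t) \<rho> X)) \<omega>) (\<lambda>\<omega> z \<rho> X. evl (con (LetP x y e t) \<rho> X) \<omega>)"
    unfolding den.simps inf option.case ty.case
    by (rule generates_cong[OF generates_binary[OF T_LetP.IH(1)[OF T_LetP.prems] generates_cid
          T_LetP.IH(2)[OF T_LetP.prems, unfolded c] R rel]])
      (auto simp: evl_append fun_upd_def)
  then show ?case by simp
next
  case (T_Normal H r \<Gamma>)
  show ?case using generates_normal by (simp add: evl_single)
next
  case (T_Eq H r \<Gamma> a b)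
  have sh: "shp TR (val a \<rho> X)" "shp TR (val b \<rho> X)" if "env_rel \<Gamma> \<rho> \<omega> x" for \<rho> \<omega> x and X :: "nat \<Rightarrow> 'w rv"
    using shp_val[OF T_Eq(1), of \<rho>] shp_val[OF T_Eq(2), of \<rho>] env_rel_shp[OF that] T_Eq.prems by auto
  have D: "generates (1 + 1) 1 0 (cJ (gdet (row2 1 (-1)) (0\<^sub>v 1))) (\<lambda>\<omega> x \<rho>. True)
      (\<lambda>\<omega> x \<rho> X. row2 1 (-1) *\<^sub>v x + 0\<^sub>v 1) (\<lambda>_ _ _ _. vNil)"
    by (rule generates_det) (auto simp: row2_def)
  have D2: "generates (1 + 1) 0 0 (cobs \<bullet>\<^sub>c cJ (gdet (row2 1 (-1)) (0\<^sub>v 1))) (\<lambda>\<omega> x \<rho>. True)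
      (\<lambda>\<omega> x \<rho> X. vNil) (\<lambda>\<omega> x \<rho> X. row2 1 (-1) *\<^sub>v x + 0\<^sub>v 1)"
    using generates_bullet[OF D generates_cobs[where R = "\<lambda>_ _ _. True"]] by simp
  note IH = T_Eq.IH(1)[OF T_Eq.prems, unfolded tdim.simps] T_Eq.IH(2)[OF T_Eq.prems, unfolded tdim.simps]
  have R: "env_rel \<Gamma> \<rho> \<omega> x \<Longrightarrow> x \<in> carrier_vec (ctx_dim \<Gamma>)" for \<rho> \<omega> x unfolding env_rel_def by simp
  have Cons: "evl (f # fs) \<omega> = vec 1 (\<lambda>_. f \<omega>) @\<^sub>v evl fs \<omega>" for f fs and \<omega> :: 'w
    using evl_append[of "[f]" fs \<omega>] by (simp add: evl_single)
  have "generates (ctx_dim \<Gamma>) 0 (nn a + nn b + 0) (den \<Gamma> (Eq a b)) (\<lambda>(\<omega> :: 'w) x \<rho>. env_rel \<Gamma> \<rho> \<omega> x)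
     (\<lambda>\<omega> x \<rho> X. evl (flatv (val (Eq a b) \<rho> X)) \<omega>) (\<lambda>\<omega> x \<rho> X. evl (con (Eq a b) \<rho> X) \<omega>)"
    unfolding den.simps
    by (rule generates_cong[OF generates_binary[OF IH D2 R]])
      (auto simp: Cons evl_append evl_rvl[OF sh(1)] evl_rvl[OF sh(2)] row2_apply simp del: One_nat_def)
  then show ?case by simp
qed auto

subsection \<open>Operational semantics\<close>

lemma is_val_simps [simp]:
  "is_val (Var x)" "is_val (Lat i)" "is_val (Const \<beta>)" "is_val Unit"
  "is_val (Plus a b) \<longleftrightarrow> is_val a \<and> is_val b"
  "is_val (Scale \<alpha> a) \<longleftrightarrow> is_val a"
  "is_val (Pair a b) \<longleftrightarrow> is_val a \<and> is_val b"
  "\<not> is_val (Let x a b)" "\<not> is_val (LetP x y a b)" "\<not> is_val Normal" "\<not> is_val (Eq a b)" "\<not> is_val Hole"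
  by (auto intro: is_val.intros elim: is_val.cases)

lemma has_ty_simps:
  "has_ty H r \<Gamma> (Var x) \<tau> \<longleftrightarrow> map_of \<Gamma> x = Some \<tau>"
  "has_ty H r \<Gamma> (Lat i) \<tau> \<longleftrightarrow> i < r \<and> \<tau> = TR"
  "has_ty H r \<Gamma> (Plus a b) \<tau> \<longleftrightarrow> \<tau> = TR \<and> has_ty H r \<Gamma> a TR \<and> has_ty H r \<Gamma> b TR"
  "has_ty H r \<Gamma> (Scale \<alpha> a) \<tau> \<longleftrightarrow> \<tau> = TR \<and> has_ty H r \<Gamma> a TR"
  "has_ty H r \<Gamma> (Const \<beta>) \<tau> \<longleftrightarrow> \<tau> = TR"
  "has_ty H r \<Gamma> (Pair a b) \<tau> \<longleftrightarrow> (\<exists>\<tau>1 \<tau>2. \<tau> = TProd \<tau>1 \<tau>2 \<and> has_ty H r \<Gamma> a \<tau>1 \<and> has_ty H r \<Gamma> b \<tau>2)"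
  "has_ty H r \<Gamma> Unit \<tau> \<longleftrightarrow> \<tau> = TI"
  "has_ty H r \<Gamma> (Let x a b) \<tau> \<longleftrightarrow> (\<exists>\<tau>1. has_ty H r \<Gamma> a \<tau>1 \<and> has_ty H r ((x, \<tau>1) # \<Gamma>) b \<tau>)"
  "has_ty H r \<Gamma> (LetP x y a b) \<tau> \<longleftrightarrow>
     x \<noteq> y \<and> (\<exists>\<tau>1 \<tau>2. has_ty H r \<Gamma> a (TProd \<tau>1 \<tau>2) \<and> has_ty H r ((x, \<tau>1) # (y, \<tau>2) # \<Gamma>) b \<tau>)"
  "has_ty H r \<Gamma> Normal \<tau> \<longleftrightarrow> \<tau> = TR"
  "has_ty H r \<Gamma> (Eq a b) \<tau> \<longleftrightarrow> \<tau> = TI \<and> has_ty H r \<Gamma> a TR \<and> has_ty H r \<Gamma> b TR"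
  "has_ty H r \<Gamma> Hole \<tau> \<longleftrightarrow> (\<exists>\<Gamma>0. H = Some (\<Gamma>0, \<tau>) \<and> (\<forall>z \<sigma>. map_of \<Gamma>0 z = Some \<sigma> \<longrightarrow> map_of \<Gamma> z = Some \<sigma>))"
  by (rule iffI; (erule has_ty.cases; simp; blast)?; (auto intro: has_ty.intros)?)+

lemma has_ty_mono:
  "has_ty H r \<Gamma> e \<tau> \<Longrightarrow> (\<And>z \<sigma>. map_of \<Gamma> z = Some \<sigma> \<Longrightarrow> map_of \<Gamma>' z = Some \<sigma>) \<Longrightarrow> r \<le> r' \<Longrightarrow>
    has_ty H r' \<Gamma>' e \<tau>"
proof (induction arbitrary: \<Gamma>' rule: has_ty.induct)
  case (T_Let H r \<Gamma> e \<tau>1 x t \<tau>2)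
  have "has_ty H r' ((x, \<tau>1) # \<Gamma>') t \<tau>2"
    by (rule T_Let.IH(2)) (use T_Let.prems in \<open>auto split: if_splits\<close>)
  then show ?case using T_Let.IH(1)[OF T_Let.prems] by (auto simp: has_ty_simps)
next
  case (T_LetP x y H r \<Gamma> e \<tau>1 \<tau>2 t \<tau>)
  have "has_ty H r' ((x, \<tau>1) # (y, \<tau>2) # \<Gamma>') t \<tau>"
    by (rule T_LetP.IH(2)) (use T_LetP.prems in \<open>auto split: if_splits\<close>)
  then show ?case using T_LetP.IH(1)[OF T_LetP.prems] T_LetP(1) by (auto simp: has_ty_simps)
qed (auto simp: has_ty_simps)

text \<open>The two contexts are related by lookup away from \<open>x\<close> and not by their
  shape; in this form the statement passes under binders, including those that shadow
  \<open>x\<close>.\<close>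

lemma subst_ty:
  "has_ty H r \<Gamma> t \<tau> \<Longrightarrow> H = None \<Longrightarrow> map_of \<Gamma> x = Some \<tau>1 \<Longrightarrow> has_ty None r [] v \<tau>1 \<Longrightarrow>
    (\<And>z \<sigma>. z \<noteq> x \<Longrightarrow> map_of \<Gamma> z = Some \<sigma> \<Longrightarrow> map_of \<Gamma>' z = Some \<sigma>) \<Longrightarrow>
    has_ty None r \<Gamma>' (subst x v t) \<tau>"
proof (induction arbitrary: \<Gamma>' rule: has_ty.induct)
  case (T_Var \<Gamma> y \<tau> H r)
  then show ?case using has_ty_mono[of None r "[]" v \<tau>1 \<Gamma>' r] by (auto simp: has_ty_simps)
next
  case (T_Let H r \<Gamma> e \<sigma> y t \<tau>2)
  have e: "has_ty None r \<Gamma>' (subst x v e) \<sigma>" by (rule T_Let.IH(1)) (use T_Let.prems in auto)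
  have "has_ty None r ((y, \<sigma>) # \<Gamma>') (if x = y then t else subst x v t) \<tau>2"
  proof (cases "x = y")
    case True
    have "has_ty H r ((y, \<sigma>) # \<Gamma>') t \<tau>2"
      by (rule has_ty_mono[OF T_Let(2)]) (use T_Let.prems True in \<open>auto split: if_splits\<close>)
    then show ?thesis using True T_Let.prems by simp
  next
    case False
    have "has_ty None r ((y, \<sigma>) # \<Gamma>') (subst x v t) \<tau>2"
      by (rule T_Let.IH(2)) (use T_Let.prems False in \<open>auto split: if_splits\<close>)
    then show ?thesis using False by simp
  qed
  with e show ?case by (auto simp: has_ty_simps)
next
  case (T_LetP y z H r \<Gamma> e \<sigma>1 \<sigma>2 t \<tau>)
  have e: "has_ty None r \<Gamma>' (subst x v e) (TProd \<sigma>1 \<sigma>2)" by (rule T_LetP.IH(1)) (use T_LetP.prems in auto)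
  have b: "has_ty None r ((y, \<sigma>1) # (z, \<sigma>2) # \<Gamma>') (if x = y \<or> x = z then t else subst x v t) \<tau>"
  proof (cases "x = y \<or> x = z")
    case True
    have "has_ty H r ((y, \<sigma>1) # (z, \<sigma>2) # \<Gamma>') t \<tau>"
      by (rule has_ty_mono[OF T_LetP(3)]) (use T_LetP.prems True in \<open>auto split: if_splits\<close>)
    then show ?thesis using True T_LetP.prems by simp
  next
    case False
    have "has_ty None r ((y, \<sigma>1) # (z, \<sigma>2) # \<Gamma>') (subst x v t) \<tau>"
      by (rule T_LetP.IH(2)) (use T_LetP.prems False in \<open>auto split: if_splits\<close>)
    then show ?thesis using False by simp
  qed
  show ?case unfolding subst.simps by (rule has_ty.T_LetP[OF T_LetP(1) e b])
qed (auto simp: has_ty_simps)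

section \<open>Termination measure, values and substitution\<close>

text \<open>Counts the constructors that can become redexes. Values contain none, so substitution
  leaves the count unchanged (\<open>subst_red\<close>) and every step lowers it.\<close>

fun red :: "tm \<Rightarrow> nat" where
  "red (Plus a b) = red a + red b"
| "red (Scale \<alpha> a) = red a"
| "red (Pair a b) = red a + red b"
| "red (Let x a b) = Suc (red a + red b)"
| "red (LetP x y a b) = Suc (red a + red b)"
| "red (Eq a b) = Suc (red a + red b)"
| "red Normal = 1"
| "red _ = 0"

lemma is_val_nn: "is_val v \<Longrightarrow> nn v = 0"
  by (induction v) auto

lemma is_val_red: "is_val v \<Longrightarrow> red v = 0"
  by (induction v) auto

lemma is_val_con: "is_val v \<Longrightarrow> con v \<rho> X = []"
  by (induction v arbitrary: \<rho> X) auto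

lemma is_val_val: "is_val v \<Longrightarrow> val v \<rho> X = val v \<rho> X'"
proof (induction v arbitrary: X X')
  case (Plus a b)
  have "val a \<rho> X = val a \<rho> X'" "val b \<rho> X = val b \<rho> X'"
    using Plus.prems by (auto intro: Plus.IH)
  then show ?case using Plus.prems by (simp add: is_val_nn)
next
  case (Pair a b)
  have "val a \<rho> X = val a \<rho> X'" "val b \<rho> X = val b \<rho> X'"
    using Pair.prems by (auto intro: Pair.IH)
  then show ?case using Pair.prems by (simp add: is_val_nn)
next
  case (Scale \<alpha> a)
  have "val a \<rho> X = val a \<rho> X'" using Scale.prems by (auto intro: Scale.IH)
  then show ?case by simp
qed auto

lemma val_closed:
  "is_val v \<Longrightarrow> has_ty None r [] v \<tau> \<Longrightarrow> (\<And>i. \<rho> (Lat i) = \<rho>' (Lat i)) \<Longrightarrow> val v \<rho> X = val v \<rho>' X"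
proof (induction v arbitrary: \<tau> X)
  case (Plus a b)
  have "val a \<rho> X = val a \<rho>' X" by (rule Plus.IH(1)) (use Plus.prems in \<open>auto simp: has_ty_simps\<close>)
  moreover have "val b \<rho> (shift (nn a) X) = val b \<rho>' (shift (nn a) X)"
    by (rule Plus.IH(2)) (use Plus.prems in \<open>auto simp: has_ty_simps\<close>)
  ultimately show ?case by simp
next
  case (Pair a b)
  obtain \<tau>1 \<tau>2 where t: "has_ty None r [] a \<tau>1" "has_ty None r [] b \<tau>2" using Pair.prems by (auto simp: has_ty_simps)
  have "val a \<rho> X = val a \<rho>' X" by (rule Pair.IH(1)[OF _ t(1)]) (use Pair.prems in auto)
  moreover have "val b \<rho> (shift (nn a) X) = val b \<rho>' (shift (nn a) X)"
    by (rule Pair.IH(2)[OF _ t(2)]) (use Pair.prems in auto)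
  ultimately show ?case by simp
next
  case (Scale \<alpha> a)
  have "val a \<rho> X = val a \<rho>' X" by (rule Scale.IH) (use Scale.prems in \<open>auto simp: has_ty_simps\<close>)
  then show ?case by simp
qed (auto simp: has_ty_simps)

lemma subst_nn: "nn v = 0 \<Longrightarrow> nn (subst x v t) = nn t"
  by (induction t) auto

lemma subst_red: "red v = 0 \<Longrightarrow> red (subst x v t) = red t"
  by (induction t) auto

text \<open>The value is met under binders, in environments other than the initial one. The
  hypotheses therefore demand that its meaning be the same \<open>w\<close> in all environments that
  agree on the latent variables, which holds for values without free variables.\<close>

lemma subst_sem:
  fixes \<rho> :: "tm \<Rightarrow> 'w rv sv"
  assumes n: "nn v = 0" and c: "\<And>(\<rho> :: tm \<Rightarrow> 'w rv sv) X. con v \<rho> X = []"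
    and v: "\<And>(\<rho> :: tm \<Rightarrow> 'w rv sv) X. (\<And>i. \<rho> (Lat i) = L i) \<Longrightarrow> val v \<rho> X = w"
  shows "(\<And>i. \<rho> (Lat i) = L i) \<Longrightarrow>
    val (subst x v t) \<rho> X = val t (\<rho>(Var x := w)) X \<and> con (subst x v t) \<rho> X = con t (\<rho>(Var x := w)) X"
proof (induction t arbitrary: \<rho> X)
  case (Var y)
  then show ?case using v c by auto
next
  case (Let y e t)
  have e: "val (subst x v e) \<rho> X = val e (\<rho>(Var x := w)) X \<and> con (subst x v e) \<rho> X = con e (\<rho>(Var x := w)) X"
    by (rule Let.IH(1)[OF Let.prems])
  show ?case
  proof (cases "x = y")
    case True
    have "\<rho>(Var x := w, Var y := z) = \<rho>(Var y := z)" for z using True by simp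
    then show ?thesis using e True
      unfolding subst.simps val.simps con.simps subst_nn[OF n] by (simp del: fun_upd_apply)
  next
    case False
    have "val (subst x v t) (\<rho>(Var y := z)) X = val t (\<rho>(Var y := z, Var x := w)) X \<and>
       con (subst x v t) (\<rho>(Var y := z)) X = con t (\<rho>(Var y := z, Var x := w)) X" for z X
      by (rule Let.IH(2)) (use Let.prems in auto)
    moreover have "\<rho>(Var y := z, Var x := w) = \<rho>(Var x := w, Var y := z)" for z
      using False by (simp add: fun_upd_twist)
    ultimately show ?thesis using e False by (simp add: subst_nn[OF n] del: fun_upd_apply)
  qed
next
  case (LetP y z e t)
  have e: "val (subst x v e) \<rho> X = val e (\<rho>(Var x := w)) X \<and> con (subst x v e) \<rho> X = con e (\<rho>(Var x := w)) X"
    by (rule LetP.IH(1)[OF LetP.prems])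
  show ?case
  proof (cases "x = y \<or> x = z")
    case True
    have "\<rho>(Var x := w, Var z := a, Var y := b) = \<rho>(Var z := a, Var y := b)" for a b
      using True by (auto simp: fun_eq_iff)
    then show ?thesis using e True by (simp add: subst_nn[OF n] del: fun_upd_apply)
  next
    case False
    have "val (subst x v t) (\<rho>(Var z := a, Var y := b)) X = val t (\<rho>(Var z := a, Var y := b, Var x := w)) X \<and>
       con (subst x v t) (\<rho>(Var z := a, Var y := b)) X = con t (\<rho>(Var z := a, Var y := b, Var x := w)) X" for a b X
      by (rule LetP.IH(2)) (use LetP.prems in auto)
    moreover have "\<rho>(Var z := a, Var y := b, Var x := w) = \<rho>(Var x := w, Var z := a, Var y := b)" for a b
      using False by (auto simp: fun_eq_iff)
    ultimately show ?thesis using e False by (simp add: subst_nn[OF n] del: fun_upd_apply)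
  qed
next
  case (Plus a b)
  then show ?case by (simp add: subst_nn[OF n] del: fun_upd_apply)
next
  case (Pair a b)
  then show ?case by (simp add: subst_nn[OF n] del: fun_upd_apply)
next
  case (Eq a b)
  then show ?case by (simp add: subst_nn[OF n] del: fun_upd_apply)
next
  case (Scale \<alpha> a)
  then show ?case by (simp add: subst_nn[OF n] del: fun_upd_apply)
qed auto

section \<open>Determinism and progress\<close>

lemma val_no_step: "step e \<psi> c \<Longrightarrow> \<not> is_val e"
  by (induction rule: step.induct) auto

lemma step_deterministic: "step e \<psi> c \<Longrightarrow> step e \<psi> c' \<Longrightarrow> c = c'"
proof (induction arbitrary: c' rule: step.induct)
  case (S_Normal \<psi>) from S_Normal.prems show ?case by cases simp
next
  case (S_Eq v w \<psi>) from S_Eq.prems show ?case using S_Eq.hyps by cases (auto dest: val_no_step)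
next
  case (S_Let v x t \<psi>) from S_Let.prems show ?case using S_Let.hyps by cases (auto dest: val_no_step)
next
  case (S_LetP v1 v2 x y t \<psi>) from S_LetP.prems show ?case
    using S_LetP.hyps by cases (auto dest!: val_no_step)
next
  case (C_PlusL e \<psi> c e2) from C_PlusL.prems show ?case
    using C_PlusL.hyps by cases (auto dest: val_no_step C_PlusL.IH)
next
  case (C_PlusR v e \<psi> c) from C_PlusR.prems show ?case
    using C_PlusR.hyps by cases (auto dest: val_no_step C_PlusR.IH)
next
  case (C_PairL e \<psi> c e2) from C_PairL.prems show ?case
    using C_PairL.hyps by cases (auto dest: val_no_step C_PairL.IH)
next
  case (C_PairR v e \<psi> c) from C_PairR.prems show ?case
    using C_PairR.hyps by cases (auto dest: val_no_step C_PairR.IH)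
next
  case (C_EqL e \<psi> c e2) from C_EqL.prems show ?case
    using C_EqL.hyps by cases (auto dest: val_no_step C_EqL.IH)
next
  case (C_EqR v e \<psi> c) from C_EqR.prems show ?case
    using C_EqR.hyps by cases (auto dest: val_no_step C_EqR.IH)
next
  case (C_Scale e \<psi> c \<alpha>) from C_Scale.prems show ?case by cases (auto dest: C_Scale.IH)
next
  case (C_Let e \<psi> c x t) from C_Let.prems show ?case
    using C_Let.hyps by cases (auto dest: val_no_step C_Let.IH)
next
  case (C_LetP e \<psi> c x y t) from C_LetP.prems show ?case
    using C_LetP.hyps by cases (auto dest: val_no_step C_LetP.IH)
qed

lemma progress: "has_ty H r \<Gamma> e \<tau> \<Longrightarrow> H = None \<Longrightarrow> \<Gamma> = [] \<Longrightarrow> is_val e \<or> (\<exists>c. step e \<psi> c)"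
proof (induction rule: has_ty.induct)
  case (T_Plus H r \<Gamma> e1 e2)
  then show ?case by (auto intro: step.intros)
next
  case (T_Scale H r \<Gamma> e \<alpha>)
  then show ?case by (auto intro: step.intros)
next
  case (T_Pair H r \<Gamma> e1 \<tau>1 e2 \<tau>2)
  then show ?case by (auto intro: step.intros)
next
  case (T_Let H r \<Gamma> e \<tau>1 x t \<tau>2)
  then show ?case by (auto intro: step.intros)
next
  case (T_LetP x y H r \<Gamma> e \<tau>1 \<tau>2 t \<tau>)
  show ?case
  proof (cases "is_val e")
    case True
    then obtain v1 v2 where "e = Pair v1 v2" using T_LetP.prems T_LetP.hyps(2)
      by (cases e) (auto simp: has_ty_simps)
    then show ?thesis using True S_LetP[of v1 v2 x y t \<psi>] by auto
  next
    case False
    then show ?thesis using T_LetP.IH(1)[OF T_LetP.prems] by (auto intro: step.intros)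
  qed
next
  case (T_Eq H r \<Gamma> s t)
  then show ?case by (auto intro: step.intros)
qed (auto intro: step.intros)

section \<open>The effect of one reduction step\<close>

text \<open>Terms over latent variables as functions of the vector of all latent variables; latents not yet
  drawn are read off the positions they will occupy.\<close>
definition latent :: "tm \<Rightarrow> real vec rv sv" where
  "latent a = (case a of Lat i \<Rightarrow> VR (\<lambda>\<xi>. \<xi> $ i) | _ \<Rightarrow> VU)"

definition fresh :: "nat \<Rightarrow> nat \<Rightarrow> real vec rv" where
  "fresh r = (\<lambda>i \<xi>. \<xi> $ (r + i))"

lemma shift_fresh [simp]: "shift n (fresh r) = fresh (r + n)"
  by (simp add: shift_def fresh_def add.assoc)

fun upd :: "tm \<Rightarrow> gauss option \<Rightarrow> config" where
  "upd e None = Bot"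
| "upd e (Some \<psi>) = Conf e \<psi>"

lemma cmap_upd: "cmap f (upd e s) = upd (f e) s"
  by (cases s) auto

text \<open>\<open>\<delta>\<close> is the number of latent variables drawn, \<open>g\<close> the equation imposed.\<close>
definition eff :: "gauss \<Rightarrow> nat \<Rightarrow> (tm \<times> tm) option \<Rightarrow> gauss option \<Rightarrow> bool" where
  "eff \<psi> \<delta> g s \<longleftrightarrow> (\<delta> = 1 \<and> g = None \<and> s = Some (gauss_ext \<psi>)) \<or> (\<delta> = 0 \<and> g = None \<and> s = Some \<psi>) \<or>
     (\<exists>v w. \<delta> = 0 \<and> g = Some (v, w) \<and> is_val v \<and> is_val w \<and>
        has_ty None (dim_vec (fst \<psi>)) [] v TR \<and> has_ty None (dim_vec (fst \<psi>)) [] w TR \<and>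
        cond_step v w \<psi> = upd Unit s)"

definition eqn :: "(tm \<times> tm) option \<Rightarrow> real vec rv set" where
  "eqn g = (case g of None \<Rightarrow> {} | Some (v, w) \<Rightarrow>
     {\<lambda>\<xi>. rvl (val v latent (fresh 0)) \<xi> - rvl (val w latent (fresh 0)) \<xi>})"

text \<open>When \<open>\<delta>\<close> variables are drawn, the position of the next draw moves
  from \<open>r\<close> to \<open>r + \<delta>\<close>; as a function of the vector of all latent
  variables, past and future, the value of the term does not change. An imposed equation leaves the
  pending conditions and becomes part of the state.\<close>

definition step_inv :: "nat \<Rightarrow> ty \<Rightarrow> tm \<Rightarrow> tm \<Rightarrow> nat \<Rightarrow> (tm \<times> tm) option \<Rightarrow> bool" where
  "step_inv r \<tau> e e' \<delta> g \<longleftrightarrow> has_ty None (r + \<delta>) [] e' \<tau> \<and>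
     val e' latent (fresh (r + \<delta>)) = val e latent (fresh r) \<and>
     set (con e latent (fresh r)) = eqn g \<union> set (con e' latent (fresh (r + \<delta>))) \<and>
     nn e = nn e' + \<delta> \<and> red e' < red e"

lemma cond_step_upd: "\<exists>s. cond_step v w \<psi> = upd Unit s"
proof -
  have "cond_step v w \<psi> = Bot \<or> (\<exists>\<psi>'. cond_step v w \<psi> = Conf Unit \<psi>')"
    unfolding cond_step_def by (simp add: Let_def split: prod.split)
  then show ?thesis by (metis upd.simps)
qed

text \<open>A draw replaces \<open>Normal\<close>, which denotes coordinate \<open>r\<close> as the
  next draw, by \<open>Lat r\<close>, which denotes the same coordinate. In the congruence cases the
  sibling that is evaluated later keeps its position in the stream, because the draws removed from
  the reduced subterm are exactly those by which the stream has advanced.\<close>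

lemma step_sem:
  "step e \<psi> c \<Longrightarrow> has_ty None r [] e \<tau> \<Longrightarrow> r = dim_vec (fst \<psi>) \<Longrightarrow>
   \<exists>e' \<delta> g s. c = upd e' s \<and> eff \<psi> \<delta> g s \<and> step_inv r \<tau> e e' \<delta> g"
proof (induction arbitrary: \<tau> rule: step.induct)
  case (S_Normal \<psi>)
  then have "step_inv r \<tau> Normal (Lat (dim_vec (fst \<psi>))) 1 None"
    by (auto simp: step_inv_def has_ty_simps latent_def fresh_def eqn_def)
  moreover have "eff \<psi> 1 None (Some (gauss_ext \<psi>))" by (simp add: eff_def)
  moreover have "Conf (Lat (dim_vec (fst \<psi>))) (gauss_ext \<psi>) = upd (Lat (dim_vec (fst \<psi>))) (Some (gauss_ext \<psi>))"
    by simp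
  ultimately show ?case by blast
next
  case (S_Eq v w \<psi>)
  obtain s where s: "cond_step v w \<psi> = upd Unit s" using cond_step_upd by blast
  have t: "\<tau> = TI" "has_ty None r [] v TR" "has_ty None r [] w TR" using S_Eq.prems by (auto simp: has_ty_simps)
  have "eff \<psi> 0 (Some (v, w)) s" using S_Eq s t by (auto simp: eff_def)
  moreover have "step_inv r \<tau> (Eq v w) Unit 0 (Some (v, w))"
    using S_Eq.hyps t is_val_val[of v latent "fresh r" "fresh 0"] is_val_val[of w latent "fresh r" "fresh 0"]
    by (simp add: step_inv_def has_ty_simps eqn_def is_val_nn is_val_con is_val_red)
  ultimately show ?case using s by blast
next
  case (S_Let v x t \<psi>)
  obtain \<tau>1 where t: "has_ty None r [] v \<tau>1" "has_ty None r [(x, \<tau>1)] t \<tau>"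
    using S_Let.prems by (auto simp: has_ty_simps)
  have ty: "has_ty None r [] (subst x v t) \<tau>" by (rule subst_ty[OF t(2) refl _ t(1)]) (auto split: if_splits)
  have w: "val v \<rho> X = val v latent (fresh r)" if "\<And>i. \<rho> (Lat i) = latent (Lat i)" for \<rho> X
    using val_closed[OF S_Let.hyps t(1), of \<rho> latent X, OF that] is_val_val[OF S_Let.hyps] by metis
  have sem: "val (subst x v t) latent (fresh r) = val t (latent(Var x := val v latent (fresh r))) (fresh r) \<and>
     con (subst x v t) latent (fresh r) = con t (latent(Var x := val v latent (fresh r))) (fresh r)"
    by (rule subst_sem[OF is_val_nn[OF S_Let.hyps] is_val_con[OF S_Let.hyps] w]) auto
  have "step_inv r \<tau> (Let x v t) (subst x v t) 0 None"
    using sem ty S_Let.hyps by (simp add: step_inv_def eqn_def is_val_nn is_val_con is_val_red subst_nn subst_red del: fun_upd_apply)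
  moreover have "eff \<psi> 0 None (Some \<psi>)" by (simp add: eff_def)
  moreover have "Conf (subst x v t) \<psi> = upd (subst x v t) (Some \<psi>)" by simp
  ultimately show ?case by blast
next
  case (S_LetP v1 v2 x y t \<psi>)
  obtain \<tau>1 \<tau>2 where xy: "x \<noteq> y" and t: "has_ty None r [] v1 \<tau>1" "has_ty None r [] v2 \<tau>2"
    "has_ty None r [(x, \<tau>1), (y, \<tau>2)] t \<tau>"
    using S_LetP.prems by (auto simp: has_ty_simps)
  have ty1: "has_ty None r [(x, \<tau>1)] (subst y v2 t) \<tau>"
    by (rule subst_ty[OF t(3) refl _ t(2)]) (use xy in \<open>auto split: if_splits\<close>)
  have ty: "has_ty None r [] (subst x v1 (subst y v2 t)) \<tau>"
    by (rule subst_ty[OF ty1 refl _ t(1)]) (auto split: if_splits)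
  have w1: "val v1 \<rho> X = val v1 latent (fresh r)" if "\<And>i. \<rho> (Lat i) = latent (Lat i)" for \<rho> X
    using val_closed[OF S_LetP.hyps(1) t(1), of \<rho> latent X, OF that] is_val_val[OF S_LetP.hyps(1)] by metis
  have w2: "val v2 \<rho> X = val v2 latent (fresh r)" if "\<And>i. \<rho> (Lat i) = latent (Lat i)" for \<rho> X
    using val_closed[OF S_LetP.hyps(2) t(2), of \<rho> latent X, OF that] is_val_val[OF S_LetP.hyps(2)] by metis
  let ?w1 = "val v1 latent (fresh r)" and ?w2 = "val v2 latent (fresh r)" and ?t = "subst y v2 t"
  have sem1: "val (subst x v1 ?t) latent (fresh r) = val ?t (latent(Var x := ?w1)) (fresh r) \<and>
     con (subst x v1 ?t) latent (fresh r) = con ?t (latent(Var x := ?w1)) (fresh r)"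
    by (rule subst_sem[OF is_val_nn[OF S_LetP.hyps(1)] is_val_con[OF S_LetP.hyps(1)] w1]) auto
  have sem2: "val ?t (latent(Var x := ?w1)) (fresh r) = val t (latent(Var x := ?w1, Var y := ?w2)) (fresh r) \<and>
     con ?t (latent(Var x := ?w1)) (fresh r) = con t (latent(Var x := ?w1, Var y := ?w2)) (fresh r)"
    by (rule subst_sem[OF is_val_nn[OF S_LetP.hyps(2)] is_val_con[OF S_LetP.hyps(2)] w2]) auto
  have tw: "latent(Var x := ?w1, Var y := ?w2) = latent(Var y := ?w2, Var x := ?w1)"
    using xy by (simp add: fun_upd_twist)
  have "step_inv r \<tau> (LetP x y (Pair v1 v2) t) (subst x v1 ?t) 0 None"
    using sem1 sem2 ty S_LetP.hyps unfolding tw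
    by (simp add: step_inv_def eqn_def is_val_nn is_val_con is_val_red subst_nn subst_red del: fun_upd_apply)
  moreover have "eff \<psi> 0 None (Some \<psi>)" by (simp add: eff_def)
  moreover have "Conf (subst x v1 ?t) \<psi> = upd (subst x v1 ?t) (Some \<psi>)" by simp
  ultimately show ?case by blast
next
  case (C_PlusL e \<psi> c e2)
  have t: "\<tau> = TR" "has_ty None r [] e TR" "has_ty None r [] e2 TR" using C_PlusL.prems by (auto simp: has_ty_simps)
  obtain e' \<delta> g s where c: "c = upd e' s" and ef: "eff \<psi> \<delta> g s" and i: "step_inv r TR e e' \<delta> g"
    using C_PlusL.IH[OF t(2) C_PlusL.prems(2)] by blast
  have "has_ty None (r + \<delta>) [] e2 TR" by (rule has_ty_mono[OF t(3)]) auto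
  then have "step_inv r \<tau> (Plus e e2) (Plus e' e2) \<delta> g"
    using i t(1) by (auto simp: step_inv_def has_ty_simps ac_simps)
  then show ?case using c ef cmap_upd[of "\<lambda>e'. Plus e' e2" e' s] by blast
next
  case (C_PlusR v e \<psi> c)
  have t: "\<tau> = TR" "has_ty None r [] e TR" "has_ty None r [] v TR" using C_PlusR.prems by (auto simp: has_ty_simps)
  obtain e' \<delta> g s where c: "c = upd e' s" and ef: "eff \<psi> \<delta> g s" and i: "step_inv r TR e e' \<delta> g"
    using C_PlusR.IH[OF t(2) C_PlusR.prems(2)] by blast
  have "has_ty None (r + \<delta>) [] v TR" by (rule has_ty_mono[OF t(3)]) auto
  then have "step_inv r \<tau> (Plus v e) (Plus v e') \<delta> g"
    using i t(1) C_PlusR.hyps(1) is_val_val[OF C_PlusR.hyps(1), of latent "fresh (r + \<delta>)" "fresh r"]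
    by (auto simp: step_inv_def has_ty_simps is_val_nn is_val_con is_val_red)
  then show ?case using c ef cmap_upd[of "Plus v" e' s] by blast
next
  case (C_PairL e \<psi> c e2)
  obtain \<tau>1 \<tau>2 where t: "\<tau> = TProd \<tau>1 \<tau>2" "has_ty None r [] e \<tau>1" "has_ty None r [] e2 \<tau>2"
    using C_PairL.prems by (auto simp: has_ty_simps)
  obtain e' \<delta> g s where c: "c = upd e' s" and ef: "eff \<psi> \<delta> g s" and i: "step_inv r \<tau>1 e e' \<delta> g"
    using C_PairL.IH[OF t(2) C_PairL.prems(2)] by blast
  have "has_ty None (r + \<delta>) [] e2 \<tau>2" by (rule has_ty_mono[OF t(3)]) auto
  then have "step_inv r \<tau> (Pair e e2) (Pair e' e2) \<delta> g"
    using i t(1) by (auto simp: step_inv_def has_ty_simps ac_simps)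
  then show ?case using c ef cmap_upd[of "\<lambda>e'. Pair e' e2" e' s] by blast
next
  case (C_PairR v e \<psi> c)
  obtain \<tau>1 \<tau>2 where t: "\<tau> = TProd \<tau>1 \<tau>2" "has_ty None r [] e \<tau>2" "has_ty None r [] v \<tau>1"
    using C_PairR.prems by (auto simp: has_ty_simps)
  obtain e' \<delta> g s where c: "c = upd e' s" and ef: "eff \<psi> \<delta> g s" and i: "step_inv r \<tau>2 e e' \<delta> g"
    using C_PairR.IH[OF t(2) C_PairR.prems(2)] by blast
  have "has_ty None (r + \<delta>) [] v \<tau>1" by (rule has_ty_mono[OF t(3)]) auto
  then have "step_inv r \<tau> (Pair v e) (Pair v e') \<delta> g"
    using i t(1) C_PairR.hyps(1) is_val_val[OF C_PairR.hyps(1), of latent "fresh (r + \<delta>)" "fresh r"]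
    by (auto simp: step_inv_def has_ty_simps is_val_nn is_val_con is_val_red)
  then show ?case using c ef cmap_upd[of "Pair v" e' s] by blast
next
  case (C_EqL e \<psi> c e2)
  have t: "\<tau> = TI" "has_ty None r [] e TR" "has_ty None r [] e2 TR" using C_EqL.prems by (auto simp: has_ty_simps)
  obtain e' \<delta> g s where c: "c = upd e' s" and ef: "eff \<psi> \<delta> g s" and i: "step_inv r TR e e' \<delta> g"
    using C_EqL.IH[OF t(2) C_EqL.prems(2)] by blast
  have "has_ty None (r + \<delta>) [] e2 TR" by (rule has_ty_mono[OF t(3)]) auto
  then have "step_inv r \<tau> (Eq e e2) (Eq e' e2) \<delta> g"
    using i t(1) by (auto simp: step_inv_def has_ty_simps ac_simps)
  then show ?case using c ef cmap_upd[of "\<lambda>e'. Eq e' e2" e' s] by blast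
next
  case (C_EqR v e \<psi> c)
  have t: "\<tau> = TI" "has_ty None r [] e TR" "has_ty None r [] v TR" using C_EqR.prems by (auto simp: has_ty_simps)
  obtain e' \<delta> g s where c: "c = upd e' s" and ef: "eff \<psi> \<delta> g s" and i: "step_inv r TR e e' \<delta> g"
    using C_EqR.IH[OF t(2) C_EqR.prems(2)] by blast
  have "has_ty None (r + \<delta>) [] v TR" by (rule has_ty_mono[OF t(3)]) auto
  then have "step_inv r \<tau> (Eq v e) (Eq v e') \<delta> g"
    using i t(1) C_EqR.hyps(1) is_val_val[OF C_EqR.hyps(1), of latent "fresh (r + \<delta>)" "fresh r"]
    by (auto simp: step_inv_def has_ty_simps is_val_nn is_val_con is_val_red)
  then show ?case using c ef cmap_upd[of "Eq v" e' s] by blast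
next
  case (C_Scale e \<psi> c \<alpha>)
  have t: "\<tau> = TR" "has_ty None r [] e TR" using C_Scale.prems by (auto simp: has_ty_simps)
  obtain e' \<delta> g s where c: "c = upd e' s" and ef: "eff \<psi> \<delta> g s" and i: "step_inv r TR e e' \<delta> g"
    using C_Scale.IH[OF t(2) C_Scale.prems(2)] by blast
  then have "step_inv r \<tau> (Scale \<alpha> e) (Scale \<alpha> e') \<delta> g"
    using i t(1) by (auto simp: step_inv_def has_ty_simps)
  then show ?case using c ef cmap_upd[of "Scale \<alpha>" e' s] by blast
next
  case (C_Let e \<psi> c x t)
  obtain \<tau>1 where t: "has_ty None r [] e \<tau>1" "has_ty None r [(x, \<tau>1)] t \<tau>"
    using C_Let.prems by (auto simp: has_ty_simps)
  obtain e' \<delta> g s where c: "c = upd e' s" and ef: "eff \<psi> \<delta> g s" and i: "step_inv r \<tau>1 e e' \<delta> g"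
    using C_Let.IH[OF t(1) C_Let.prems(2)] by blast
  have "has_ty None (r + \<delta>) [(x, \<tau>1)] t \<tau>" by (rule has_ty_mono[OF t(2)]) auto
  then have "step_inv r \<tau> (Let x e t) (Let x e' t) \<delta> g"
    using i by (auto simp: step_inv_def has_ty_simps ac_simps simp del: fun_upd_apply)
  then show ?case using c ef cmap_upd[of "\<lambda>e'. Let x e' t" e' s] by blast
next
  case (C_LetP e \<psi> c x y t)
  obtain \<tau>1 \<tau>2 where xy: "x \<noteq> y" and t: "has_ty None r [] e (TProd \<tau>1 \<tau>2)" "has_ty None r [(x, \<tau>1), (y, \<tau>2)] t \<tau>"
    using C_LetP.prems by (auto simp: has_ty_simps)
  obtain e' \<delta> g s where c: "c = upd e' s" and ef: "eff \<psi> \<delta> g s" and i: "step_inv r (TProd \<tau>1 \<tau>2) e e' \<delta> g"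
    using C_LetP.IH[OF t(1) C_LetP.prems(2)] by blast
  have "has_ty None (r + \<delta>) [(x, \<tau>1), (y, \<tau>2)] t \<tau>" by (rule has_ty_mono[OF t(2)]) auto
  then have "step_inv r \<tau> (LetP x y e t) (LetP x y e' t) \<delta> g"
    using i xy by (auto simp: step_inv_def has_ty_simps ac_simps simp del: fun_upd_apply)
  then show ?case using c ef cmap_upd[of "\<lambda>e'. LetP x y e' t" e' s] by blast
qed

section \<open>Values as affine functions of the latent variables\<close>

text \<open>Stated for every dimension from \<open>r\<close> on, because the functional is evaluated
  both in the present state and in the space of all draws of the complete run.\<close>

lemma val_lin:
  "is_val v \<Longrightarrow> has_ty None r [] v TR \<Longrightarrow>
   lin r v \<in> carrier_vec r \<and> (\<exists>f. val v latent X = VR f \<and>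
     (\<forall>n \<xi>. r \<le> n \<longrightarrow> \<xi> \<in> carrier_vec n \<longrightarrow> f \<xi> = lin r v \<bullet> vec_first \<xi> r + cst v))"
proof (induction v arbitrary: X)
  case (Lat i)
  have "unit_vec r i \<bullet> vec_first \<xi> r = \<xi> $ i" for \<xi> :: "real vec"
    using Lat scalar_prod_left_unit[of "vec_first \<xi> r" r i] by (simp add: has_ty_simps vec_first_def)
  then show ?case by (simp add: latent_def)
next
  case (Plus a b)
  have t: "is_val a" "is_val b" "has_ty None r [] a TR" "has_ty None r [] b TR"
    using Plus.prems by (auto simp: has_ty_simps)
  from Plus.IH(1)[OF t(1,3)] obtain f where f: "lin r a \<in> carrier_vec r" "val a latent X = VR f"
    "\<And>n \<xi>. r \<le> n \<Longrightarrow> \<xi> \<in> carrier_vec n \<Longrightarrow> f \<xi> = lin r a \<bullet> vec_first \<xi> r + cst a" by blast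
  from Plus.IH(2)[OF t(2,4)] obtain g where g: "lin r b \<in> carrier_vec r" "val b latent (shift (nn a) X) = VR g"
    "\<And>n \<xi>. r \<le> n \<Longrightarrow> \<xi> \<in> carrier_vec n \<Longrightarrow> g \<xi> = lin r b \<bullet> vec_first \<xi> r + cst b" by blast
  have "f \<xi> + g \<xi> = (lin r a + lin r b) \<bullet> vec_first \<xi> r + (cst a + cst b)"
    if "r \<le> n" "\<xi> \<in> carrier_vec n" for n \<xi>
    using f(3)[OF that] g(3)[OF that] add_scalar_prod_distrib[OF f(1) g(1), of "vec_first \<xi> r"] by simp
  then show ?case using f(1,2) g(1,2) by simp
next
  case (Scale \<alpha> a)
  have t: "is_val a" "has_ty None r [] a TR" using Scale.prems by (auto simp: has_ty_simps)
  from Scale.IH[OF t] obtain f where f: "lin r a \<in> carrier_vec r" "val a latent X = VR f"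
    "\<And>n \<xi>. r \<le> n \<Longrightarrow> \<xi> \<in> carrier_vec n \<Longrightarrow> f \<xi> = lin r a \<bullet> vec_first \<xi> r + cst a" by blast
  have "\<alpha> * f \<xi> = (\<alpha> \<cdot>\<^sub>v lin r a) \<bullet> vec_first \<xi> r + \<alpha> * cst a"
    if "r \<le> n" "\<xi> \<in> carrier_vec n" for n \<xi>
    using f(3)[OF that] smult_scalar_prod_distrib[OF f(1), of "vec_first \<xi> r" \<alpha>] by (simp add: algebra_simps)
  then show ?case using f(1,2) by simp
qed (auto simp: has_ty_simps)

lemma vec_first_first: "r \<le> r' \<Longrightarrow> vec_first (vec_first \<xi> r') r = vec_first \<xi> r"
  by (auto simp: vec_first_def)

lemma stdcond_carrier: "stdcond r L \<psi> \<Longrightarrow> L \<subseteq> carrier_vec r \<and> dim_vec (fst \<psi>) = r"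
  unfolding stdcond_def by auto

text \<open>The first claim transfers \<open>stdcond_step\<close> to the redex. The second says that
  the equation reads only the variables drawn so far, so it cuts out the same solutions whether
  imposed now or on the vector of all latent variables.\<close>

lemma cond_step_stdcond:
  fixes X :: "nat \<Rightarrow> real vec rv"
  assumes st: "stdcond r L \<psi>" and v: "is_val v" "has_ty None r [] v TR" and w: "is_val w" "has_ty None r [] w TR"
    and c: "cond_step v w \<psi> = upd Unit s"
  defines "g \<equiv> \<lambda>\<xi>. rvl (val v latent X) \<xi> - rvl (val w latent X) \<xi>"
  shows "case s of None \<Rightarrow> {\<xi> \<in> L. g \<xi> = 0} = {} | Some \<psi>' \<Rightarrow> stdcond r {\<xi> \<in> L. g \<xi> = 0} \<psi>'"
    and "\<And>n \<xi>. r \<le> n \<Longrightarrow> \<xi> \<in> carrier_vec n \<Longrightarrow> g \<xi> = g (vec_first \<xi> r)"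
proof -
  obtain \<mu> P where psi: "\<psi> = (\<mu>, P)" by force
  have m: "dim_vec \<mu> = r" and Lc: "L \<subseteq> carrier_vec r" using stdcond_carrier[OF st] psi by auto
  obtain f where f: "lin r v \<in> carrier_vec r" "val v latent X = VR f"
    "\<And>n \<xi>. r \<le> n \<Longrightarrow> \<xi> \<in> carrier_vec n \<Longrightarrow> f \<xi> = lin r v \<bullet> vec_first \<xi> r + cst v"
    using val_lin[OF v] by blast
  obtain h where h: "lin r w \<in> carrier_vec r" "val w latent X = VR h"
    "\<And>n \<xi>. r \<le> n \<Longrightarrow> \<xi> \<in> carrier_vec n \<Longrightarrow> h \<xi> = lin r w \<bullet> vec_first \<xi> r + cst w"
    using val_lin[OF w] by blast
  define u b where "u = lin r v - lin r w" and "b = cst v - cst w"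
  have u: "u \<in> carrier_vec r" using f h by (simp add: u_def)
  have g: "g \<xi> = u \<bullet> vec_first \<xi> r + b" if "r \<le> n" "\<xi> \<in> carrier_vec n" for n \<xi>
    using f(2) h(2) f(3)[OF that] h(3)[OF that] minus_scalar_prod_distrib[OF f(1) h(1), of "vec_first \<xi> r"]
    by (simp add: g_def u_def b_def)
  show "g \<xi> = g (vec_first \<xi> r)" if "r \<le> n" "\<xi> \<in> carrier_vec n" for n \<xi>
    using g[OF that] g[of r "vec_first \<xi> r"] by simp
  have L: "{\<xi> \<in> L. g \<xi> = 0} = {\<xi> \<in> L. u \<bullet> \<xi> + b = 0}" using g[OF order_refl] Lc by auto
  note S1 = stdcond_step(1)[OF st[unfolded psi] u, where b = b]
    and S3 = stdcond_step(3)[OF st[unfolded psi] u, where b = b]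
  let ?s = "u \<bullet> (P *\<^sub>v u)"
  have cs: "cond_step v w \<psi> = (if ?s = 0 then (if - b = u \<bullet> \<mu> then Conf Unit \<psi> else Bot)
      else Conf Unit (\<mu> + ((- b - u \<bullet> \<mu>) / ?s) \<cdot>\<^sub>v (P *\<^sub>v u), deflate P u))"
    unfolding cond_step_def deflate_def psi by (simp add: Let_def m u_def b_def)
  show "case s of None \<Rightarrow> {\<xi> \<in> L. g \<xi> = 0} = {} | Some \<psi>' \<Rightarrow> stdcond r {\<xi> \<in> L. g \<xi> = 0} \<psi>'"
  proof (cases "?s = 0")
    case True
    then have e: "{\<xi> \<in> L. g \<xi> = 0} = (if u \<bullet> \<mu> + b = 0 then L else {})" unfolding L by (rule S1)
    show ?thesis
    proof (cases "u \<bullet> \<mu> + b = 0")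
      case t: True
      then have "upd Unit s = Conf Unit \<psi>" using cs c True by (simp add: algebra_simps)
      then have "s = Some \<psi>" by (cases s) auto
      then show ?thesis using e t st by simp
    next
      case f: False
      then have "- b \<noteq> u \<bullet> \<mu>" by linarith
      then have "upd Unit s = Bot" using cs c True by simp
      then have "s = None" by (cases s) auto
      then show ?thesis using e f by simp
    qed
  next
    case False
    then have "upd Unit s = Conf Unit (\<mu> + ((- b - u \<bullet> \<mu>) / ?s) \<cdot>\<^sub>v (P *\<^sub>v u), deflate P u)" using cs c by simp
    then have "s = Some (\<mu> + ((- b - u \<bullet> \<mu>) / ?s) \<cdot>\<^sub>v (P *\<^sub>v u), deflate P u)" by (cases s) auto
    then show ?thesis using S3[OF False] L by simp
  qed
qed

section \<open>Complete runs and observed laws\<close>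

text \<open>The vectors of all \<open>n\<close> latent variables that are compatible with the state
  reached, through their first \<open>r\<close> coordinates, and with all equations still pending in
  \<open>e\<close>.\<close>

definition sols :: "nat \<Rightarrow> nat \<Rightarrow> real vec set \<Rightarrow> tm \<Rightarrow> real vec set" where
  "sols n r L e = {\<xi> \<in> carrier_vec n. vec_first \<xi> r \<in> L \<and> (\<forall>f \<in> set (con e latent (fresh r)). f \<xi> = 0)}"

text \<open>\<open>sols\<close> is invariant under reduction: a draw only moves a coordinate from
  the future to the past, and an equation moves from the pending conditions into the set
  \<open>L\<close> of the state. At a value nothing is pending, so the final state is the standard
  Gaussian conditioned on this set; a failing equation shows the set to be empty. The induction is
  on \<open>red\<close>.\<close>

lemma run:
  "has_ty None r [] e \<tau> \<Longrightarrow> stdcond r L \<psi> \<Longrightarrow>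
   (sols (r + nn e) r L e = {} \<and> steps (Conf e \<psi>) Bot) \<or>
   (\<exists>v \<psi>'. steps (Conf e \<psi>) (Conf v \<psi>') \<and> is_val v \<and> stdcond (r + nn e) (sols (r + nn e) r L e) \<psi>' \<and>
      has_ty None (r + nn e) [] v \<tau> \<and> val v latent (fresh (r + nn e)) = val e latent (fresh r))"
proof (induction "red e" arbitrary: e r L \<psi> rule: less_induct)
  case less
  note ty = less.prems(1) and st = less.prems(2)
  have Lc: "L \<subseteq> carrier_vec r" and dm: "r = dim_vec (fst \<psi>)" using stdcond_carrier[OF st] by auto
  show ?case
  proof (cases "is_val e")
    case True
    \<comment> \<open>At a value no equations and no draws remain.\<close>
    have "sols r r L e = L" unfolding sols_def is_val_con[OF True] using Lc by auto
    then show ?thesis using True st ty by (intro disjI2 exI[of _ e] exI[of _ \<psi>]) (simp add: is_val_nn)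
  next
    case False
    then obtain c where c: "step e \<psi> c" using progress[OF ty refl refl] by blast
    obtain e' \<delta> g s where ce: "c = upd e' s" and ef: "eff \<psi> \<delta> g s" and inv: "step_inv r \<tau> e e' \<delta> g"
      using step_sem[OF c ty dm] by blast
    have t': "has_ty None (r + \<delta>) [] e' \<tau>" and v': "val e' latent (fresh (r + \<delta>)) = val e latent (fresh r)"
      and c': "set (con e latent (fresh r)) = eqn g \<union> set (con e' latent (fresh (r + \<delta>)))"
      and n': "nn e = nn e' + \<delta>" and rd: "red e' < red e" using inv unfolding step_inv_def by auto
    have n: "r + nn e = (r + \<delta>) + nn e'" using n' by simp
    have cst: "cstep (Conf e \<psi>) (upd e' s)" using c ce by (auto intro: cstep.intros)
    \<comment> \<open>For each kind of successful step it remains to exhibit the affine set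
      \<open>L'\<close> of the new state and to check that the solution set of the whole run is the
      same.\<close>
    have fin: ?thesis if s: "s = Some \<psi>'" and st': "stdcond (r + \<delta>) L' \<psi>'"
      and sl: "sols (r + nn e) (r + \<delta>) L' e' = sols (r + nn e) r L e" for \<psi>' L'
    proof -
      have st1: "cstep (Conf e \<psi>) (Conf e' \<psi>')" using cst s by simp
      from less.hyps[OF rd t' st', folded n] show ?thesis
      proof (elim disjE exE conjE)
        assume a: "sols (r + nn e) (r + \<delta>) L' e' = {}" "steps (Conf e' \<psi>') Bot"
        then have "steps (Conf e \<psi>) Bot" using st1 by (meson converse_rtranclp_into_rtranclp)
        then show ?thesis using a(1) unfolding sl by blast
      next
        fix v \<psi>'' assume a: "steps (Conf e' \<psi>') (Conf v \<psi>'')" "is_val v"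
          "stdcond (r + nn e) (sols (r + nn e) (r + \<delta>) L' e') \<psi>''"
          "has_ty None (r + nn e) [] v \<tau>"
          "val v latent (fresh (r + nn e)) = val e' latent (fresh (r + \<delta>))"
        have "steps (Conf e \<psi>) (Conf v \<psi>'')" using a(1) st1 by (meson converse_rtranclp_into_rtranclp)
        then show ?thesis using a(2-5) unfolding sl v' by blast
      qed
    qed
    from ef[unfolded eff_def] show ?thesis
    proof (elim disjE exE conjE)
      assume d: "\<delta> = 1" "g = None" "s = Some (gauss_ext \<psi>)"
      have st': "stdcond (r + \<delta>) {\<xi> \<in> carrier_vec (r + \<delta>). vec_first \<xi> r \<in> L} (gauss_ext \<psi>)"
        using stdcond_ext[OF st] d by simp
      have "sols (r + nn e) (r + \<delta>) {\<xi> \<in> carrier_vec (r + \<delta>). vec_first \<xi> r \<in> L} e' = sols (r + nn e) r L e"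
        unfolding sols_def c' d(2) eqn_def by (auto simp: vec_first_first)
      then show ?thesis by (rule fin[OF d(3) st'])
    next
      assume d: "\<delta> = 0" "g = None" "s = Some \<psi>"
      have "sols (r + nn e) (r + \<delta>) L e' = sols (r + nn e) r L e"
        unfolding sols_def c' d(2) eqn_def using d(1) by auto
      moreover have "stdcond (r + \<delta>) L \<psi>" using st d by simp
      ultimately show ?thesis using fin[OF d(3)] by blast
    next
      fix v w assume d: "\<delta> = 0" "g = Some (v, w)" "is_val v" "is_val w"
        "has_ty None (dim_vec (fst \<psi>)) [] v TR" "has_ty None (dim_vec (fst \<psi>)) [] w TR" "cond_step v w \<psi> = upd Unit s"
      define h where "h = (\<lambda>\<xi>. rvl (val v latent (fresh 0)) \<xi> - rvl (val w latent (fresh 0)) \<xi>)"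
      note cs = cond_step_stdcond[OF st d(3) d(5)[folded dm] d(4) d(6)[folded dm] d(7), where X = "fresh 0"]
      have cs1: "case s of None \<Rightarrow> {\<xi> \<in> L. h \<xi> = 0} = {} | Some \<psi>' \<Rightarrow> stdcond r {\<xi> \<in> L. h \<xi> = 0} \<psi>'"
        unfolding h_def by (rule cs(1))
      have eq: "eqn g = {h}" by (simp add: d(2) eqn_def h_def)
      have "h \<xi> = h (vec_first \<xi> r)" if "\<xi> \<in> carrier_vec (r + nn e)" for \<xi>
        using cs(2)[OF _ that] by (simp add: h_def)
      then have sl: "sols (r + nn e) (r + \<delta>) {\<xi> \<in> L. h \<xi> = 0} e' = sols (r + nn e) r L e"
        unfolding sols_def c' eq using d(1) by auto
      show ?thesis
      proof (cases s)
        case None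
        have e: "{\<xi> \<in> L. h \<xi> = 0} = {}" using cs1 unfolding None option.case .
        have "sols (r + nn e) r L e = {}" unfolding sl[symmetric] e by (simp add: sols_def)
        moreover have "steps (Conf e \<psi>) Bot" using cst None by auto
        ultimately show ?thesis by blast
      next
        case (Some \<psi>')
        then have "stdcond (r + \<delta>) {\<xi> \<in> L. h \<xi> = 0} \<psi>'" using cs1 d(1) by simp
        then show ?thesis by (rule fin[OF Some _ sl])
      qed
    qed
  qed
qed

lemma flat_val:
  "is_val v \<Longrightarrow> has_ty None r [] v \<tau> \<Longrightarrow>
   flatv (val v latent X) = map (\<lambda>t. rvl (val t latent (fresh 0))) (flat v) \<and>
   (\<forall>t \<in> set (flat v). is_val t \<and> has_ty None r [] t TR)"
proof (induction v arbitrary: \<tau> X)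
  case (Plus a b)
  have "val (Plus a b) latent X = val (Plus a b) latent (fresh 0)" by (rule is_val_val[OF Plus.prems(1)])
  then show ?case using Plus.prems by (simp add: has_ty_simps)
next
  case (Scale \<alpha> a)
  have "val (Scale \<alpha> a) latent X = val (Scale \<alpha> a) latent (fresh 0)" by (rule is_val_val[OF Scale.prems(1)])
  then show ?case using Scale.prems by (simp add: has_ty_simps)
next
  case (Pair a b)
  obtain \<tau>1 \<tau>2 where t: "is_val a" "is_val b" "has_ty None r [] a \<tau>1" "has_ty None r [] b \<tau>2"
    using Pair.prems by (auto simp: has_ty_simps)
  show ?case using Pair.IH(1)[OF t(1,3), of X] Pair.IH(2)[OF t(2,4), of "shift (nn a) X"] by auto
next
  case (Lat i)
  from Lat.prems show ?case by (simp add: latent_def has_ty_simps)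
next
  case (Const \<beta>)
  show ?case by (simp add: has_ty_simps)
next
  case (Var x)
  from Var.prems(2) show ?case by (simp add: has_ty_simps)
next
  case (Let x a b)
  from Let.prems(1) show ?case by simp
next
  case (LetP x y a b)
  from LetP.prems(1) show ?case by simp
next
  case (Eq a b)
  from Eq.prems(1) show ?case by simp
qed simp_all

lemma push_pushf:
  assumes v: "is_val v" "has_ty None r [] v \<tau>" and m: "\<mu> \<in> carrier_vec r" and S: "S \<in> carrier_mat r r"
  shows "push v (\<mu>, S) = pushf r (flatv (val v latent X)) (\<mu>, S)"
proof -
  define fl where "fl = flat v"
  define N where "N = length fl"
  have fv: "flatv (val v latent X) = map (\<lambda>t. rvl (val t latent (fresh 0))) fl"
    and ft: "\<And>t. t \<in> set fl \<Longrightarrow> is_val t \<and> has_ty None r [] t TR"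
    using flat_val[OF v] unfolding fl_def by auto
  have l: "lin r (fl ! i) \<in> carrier_vec r \<and> (\<forall>\<xi> \<in> carrier_vec r. rvl (val (fl ! i) latent (fresh 0)) \<xi> = lin r (fl ! i) \<bullet> \<xi> + cst (fl ! i))"
    if "i < N" for i
  proof -
    have t: "is_val (fl ! i)" "has_ty None r [] (fl ! i) TR" using ft that by (auto simp: N_def)
    obtain f where f: "lin r (fl ! i) \<in> carrier_vec r" "val (fl ! i) latent (fresh 0) = VR f"
      "\<And>n \<xi>. r \<le> n \<Longrightarrow> \<xi> \<in> carrier_vec n \<Longrightarrow> f \<xi> = lin r (fl ! i) \<bullet> vec_first \<xi> r + cst (fl ! i)"
      using val_lin[OF t, of "fresh 0"] by blast
    show ?thesis using f(1,2) f(3)[OF order_refl] by simp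
  qed
  define A where "A = mat N r (\<lambda>(i, j). lin r (fl ! i) $ j)"
  have A: "A \<in> carrier_mat N r" by (simp add: A_def)
  have rA: "row A i = lin r (fl ! i)" if "i < N" for i
    using that l[OF that] by (intro eq_vecI) (auto simp: A_def)
  have lp: "lpart r (flatv (val v latent X) ! i) = lin r (fl ! i)" if "i < N" for i
    using l[OF that] that by (intro lpart_eqI[of _ _ _ "cst (fl ! i)"]) (auto simp: fv N_def)
  have "A *\<^sub>v \<mu> + vec N (\<lambda>i. cst (fl ! i)) = vec N (\<lambda>i. (flatv (val v latent X) ! i) \<mu>)"
    using l m A rA by (intro eq_vecI) (auto simp: fv N_def)
  moreover have "A * S * transpose_mat A = mat N N (\<lambda>(i, j). lpart r (flatv (val v latent X) ! i) \<bullet> (S *\<^sub>v lpart r (flatv (val v latent X) ! j)))"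
  proof (rule eq_matI)
    fix i j
    assume "i < dim_row (mat N N (\<lambda>(i, j). lpart r (flatv (val v latent X) ! i) \<bullet> (S *\<^sub>v lpart r (flatv (val v latent X) ! j))))"
      "j < dim_col (mat N N (\<lambda>(i, j). lpart r (flatv (val v latent X) ! i) \<bullet> (S *\<^sub>v lpart r (flatv (val v latent X) ! j))))"
    then have ij: "i < N" "j < N" by auto
    have "A * S * transpose_mat A = A * (S * transpose_mat A)" using A S by (intro assoc_mult_mat[of _ N r _ r _ N]) auto
    then have "(A * S * transpose_mat A) $$ (i, j) = row A i \<bullet> col (S * transpose_mat A) j"
      using A S ij by simp
    also have "col (S * transpose_mat A) j = S *\<^sub>v row A j"
      using A S ij by (subst col_mult2[of _ r r _ N]) auto
    finally show "(A * S * transpose_mat A) $$ (i, j) = mat N N (\<lambda>(i, j). lpart r (flatv (val v latent X) ! i) \<bullet> (S *\<^sub>v lpart r (flatv (val v latent X) ! j))) $$ (i, j)"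
      using ij rA lp by simp
  qed (use A in auto)
  ultimately show ?thesis
    unfolding push_def pushf_def using m by (simp add: Let_def fl_def[symmetric] N_def[symmetric] A_def fv)
qed

lemma cstep_deterministic: "cstep c c1 \<Longrightarrow> cstep c c2 \<Longrightarrow> c1 = c2"
  by (auto elim!: cstep.cases dest: step_deterministic)

lemma steps_normal_unique:
  assumes "steps c a" "steps c b" "\<And>d. \<not> cstep a d" "\<And>d. \<not> cstep b d"
  shows "a = b"
  using assms
proof (induction rule: converse_rtranclp_induct)
  case base
  then show ?case by (metis converse_rtranclpE)
next
  case (step c d)
  then have "c \<noteq> b" by auto
  then obtain d' where "cstep c d'" "steps d' b" using step.prems(1) by (metis converse_rtranclpE)
  then have "steps d b" using cstep_deterministic[OF step.hyps(1)] by auto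
  then show ?case using step by auto
qed

definition outs :: "tm \<Rightarrow> real vec rv list" where
  "outs e = flatv (val e latent (fresh 0))"

definition sols0 :: "tm \<Rightarrow> real vec set" where
  "sols0 e = {\<xi> \<in> carrier_vec (nn e). \<forall>f \<in> set (con e latent (fresh 0)). f \<xi> = 0}"

text \<open>The alternatives offered by \<open>run\<close> exclude each other: reduction is
  deterministic with \<open>Bot\<close> and values as normal forms, and the set of a conditioned
  Gaussian is never empty.\<close>

lemma operational_law:
  assumes ty: "has_ty None 0 [] e \<tau>"
  shows "steps (Conf e gauss0) Bot \<longleftrightarrow> sols0 e = {}"
    and "steps (Conf e gauss0) (Conf v \<psi>) \<Longrightarrow> is_val v \<Longrightarrow> has_law (nn e) (sols0 e) (outs e) (push v \<psi>)"
    and "sols0 e \<noteq> {} \<Longrightarrow> \<exists>v \<psi>. steps (Conf e gauss0) (Conf v \<psi>) \<and> is_val v"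
proof -
  have st0: "stdcond 0 (carrier_vec 0) gauss0"
    unfolding stdcond_def gauss0_def proj_def by (auto intro!: eq_matI eq_vecI)
  have s0: "sols (0 + nn e) 0 (carrier_vec 0) e = sols0 e"
    by (auto simp: sols_def sols0_def)
  have nB: "\<not> cstep Bot d" for d by (auto elim: cstep.cases)
  have nV: "\<not> cstep (Conf v \<psi>) d" if "is_val v" for v \<psi> d using that by (auto elim: cstep.cases dest: val_no_step)
  have R: "(sols0 e = {} \<and> steps (Conf e gauss0) Bot) \<or>
   (\<exists>v \<psi>'. steps (Conf e gauss0) (Conf v \<psi>') \<and> is_val v \<and> stdcond (nn e) (sols0 e) \<psi>' \<and>
      has_ty None (nn e) [] v \<tau> \<and> val v latent (fresh (nn e)) = val e latent (fresh 0))"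
    using run[OF ty st0] unfolding s0 by simp
  have good: "has_law (nn e) (sols0 e) (outs e) (push v \<psi>)"
    if h: "is_val v" "stdcond (nn e) (sols0 e) \<psi>" "has_ty None (nn e) [] v \<tau>" "val v latent (fresh (nn e)) = val e latent (fresh 0)"
    for v \<psi>
  proof -
    obtain \<mu> P where psi: "\<psi> = (\<mu>, P)" by force
    have "\<mu> \<in> carrier_vec (nn e)" "P \<in> carrier_mat (nn e) (nn e)"
      using h(2) unfolding stdcond_def proj_def psi by auto
    from push_pushf[OF h(1,3) this, of "fresh (nn e)"] have "push v \<psi> = pushf (nn e) (outs e) \<psi>"
      unfolding h(4) outs_def psi .
    then show ?thesis unfolding has_law_def using h(2) by metis
  qed
  have ne: "sols0 e \<noteq> {}" if "has_law (nn e) (sols0 e) (outs e) G" for G using has_law_nonempty[OF that] .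
  show "steps (Conf e gauss0) Bot \<longleftrightarrow> sols0 e = {}"
  proof
    assume b: "steps (Conf e gauss0) Bot"
    show "sols0 e = {}"
    proof (rule ccontr)
      assume "sols0 e \<noteq> {}"
      then obtain v \<psi>' where "steps (Conf e gauss0) (Conf v \<psi>')" "is_val v" using R by blast
      then show False using steps_normal_unique[OF b _ nB nV] by blast
    qed
  next
    assume "sols0 e = {}"
    then show "steps (Conf e gauss0) Bot" using R good ne by blast
  qed
  show "has_law (nn e) (sols0 e) (outs e) (push v \<psi>)" if s: "steps (Conf e gauss0) (Conf v \<psi>)" "is_val v"
    using R
  proof (elim disjE exE conjE)
    assume "steps (Conf e gauss0) Bot"
    then show ?thesis using steps_normal_unique[OF _ s(1) nB nV[OF s(2)]] by blast
  next
    fix v' \<psi>' assume h: "steps (Conf e gauss0) (Conf v' \<psi>')" "is_val v'" "stdcond (nn e) (sols0 e) \<psi>'"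
      "has_ty None (nn e) [] v' \<tau>" "val v' latent (fresh (nn e)) = val e latent (fresh 0)"
    have "Conf v' \<psi>' = Conf v \<psi>" by (rule steps_normal_unique[OF h(1) s(1) nV[OF h(2)] nV[OF s(2)]])
    then show ?thesis using good[OF h(2-5)] by simp
  qed
  show "\<exists>v \<psi>. steps (Conf e gauss0) (Conf v \<psi>) \<and> is_val v" if "sols0 e \<noteq> {}"
    using R that by blast
qed

text \<open>Every program reaches \<open>Bot\<close> or a value, so unless both fail the quantified
  implication has a genuine instance and compares the actual laws.\<close>

lemma operational_law_eq:
  assumes t1: "has_ty None 0 [] e1 \<tau>" and t2: "has_ty None 0 [] e2 \<tau>"
  shows "((steps (Conf e1 gauss0) Bot \<longleftrightarrow> steps (Conf e2 gauss0) Bot) \<and>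
        (\<forall>v1 \<psi>1 v2 \<psi>2. steps (Conf e1 gauss0) (Conf v1 \<psi>1) \<and> is_val v1 \<and>
                        steps (Conf e2 gauss0) (Conf v2 \<psi>2) \<and> is_val v2 \<longrightarrow>
                        push v1 \<psi>1 = push v2 \<psi>2)) \<longleftrightarrow>
     law_eq (nn e1) (sols0 e1) (outs e1) (nn e2) (sols0 e2) (outs e2)" (is "?lhs \<longleftrightarrow> ?rhs")
proof
  note o1 = operational_law[OF t1] and o2 = operational_law[OF t2]
  assume l: ?lhs
  show ?rhs
  proof (cases "sols0 e1 = {}")
    case True
    then show ?thesis using l o1(1) o2(1) unfolding law_eq_def by blast
  next
    case False
    then have F2: "sols0 e2 \<noteq> {}" using l o1(1) o2(1) by blast
    obtain v1 \<psi>1 where 1: "steps (Conf e1 gauss0) (Conf v1 \<psi>1)" "is_val v1" using o1(3)[OF False] by blast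
    obtain v2 \<psi>2 where 2: "steps (Conf e2 gauss0) (Conf v2 \<psi>2)" "is_val v2" using o2(3)[OF F2] by blast
    have "push v1 \<psi>1 = push v2 \<psi>2" using l 1 2 by blast
    then show ?thesis using o1(2)[OF 1] o2(2)[OF 2] unfolding law_eq_def by metis
  qed
next
  note o1 = operational_law[OF t1] and o2 = operational_law[OF t2]
  assume r: ?rhs
  have "sols0 e1 = {} \<longleftrightarrow> sols0 e2 = {}" using r has_law_nonempty unfolding law_eq_def by blast
  moreover have "push v1 \<psi>1 = push v2 \<psi>2" if 1: "steps (Conf e1 gauss0) (Conf v1 \<psi>1)" "is_val v1"
    and 2: "steps (Conf e2 gauss0) (Conf v2 \<psi>2)" "is_val v2" for v1 \<psi>1 v2 \<psi>2
  proof -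
    note l1 = o1(2)[OF 1] and l2 = o2(2)[OF 2]
    obtain G where "has_law (nn e1) (sols0 e1) (outs e1) G" "has_law (nn e2) (sols0 e2) (outs e2) G"
      using r has_law_nonempty[OF l1] unfolding law_eq_def by blast
    then show ?thesis using has_law_unique[OF l1] has_law_unique[OF l2] by blast
  qed
  ultimately show ?lhs using o1(1) o2(1) by blast
qed

subsection \<open>Terms in contexts\<close>

lemma fill_ty:
  "has_ty H r \<Delta> K \<sigma> \<Longrightarrow> H = Some (\<Gamma>, \<tau>) \<Longrightarrow> has_ty None 0 \<Gamma> e \<tau> \<Longrightarrow> has_ty None r \<Delta> (fill K e) \<sigma>"
proof (induction rule: has_ty.induct)
  case (T_Hole H \<Gamma>0 \<tau>0 \<Delta> r)
  then show ?case using has_ty_mono[of None 0 \<Gamma> e \<tau> \<Delta> r] by auto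
next
  case (T_LetP x y H r \<Gamma>' e' \<tau>1 \<tau>2 t \<tau>')
  show ?case unfolding fill.simps
    by (rule has_ty.T_LetP[OF T_LetP(1) T_LetP.IH(1)[OF T_LetP.prems] T_LetP.IH(2)[OF T_LetP.prems]])
next
  case (T_Let H r \<Gamma>' e' \<tau>1 x t \<tau>2)
  show ?case unfolding fill.simps
    by (rule has_ty.T_Let[OF T_Let.IH(1)[OF T_Let.prems] T_Let.IH(2)[OF T_Let.prems]])
qed (auto simp: has_ty_simps)

lemma has_ty_no_hole: "has_ty H r \<Gamma> e \<tau> \<Longrightarrow> holes e = 0 \<Longrightarrow> has_ty None r \<Gamma> e \<tau>"
proof (induction rule: has_ty.induct)
  case (T_LetP x y H r \<Gamma> e \<tau>1 \<tau>2 t \<tau>)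
  have "has_ty None r \<Gamma> e (TProd \<tau>1 \<tau>2)" "has_ty None r ((x, \<tau>1) # (y, \<tau>2) # \<Gamma>) t \<tau>" using T_LetP by auto
  then show ?case by (rule has_ty.T_LetP[OF T_LetP(1)])
next
  case (T_Let H r \<Gamma> e \<tau>1 x t \<tau>2)
  have "has_ty None r \<Gamma> e \<tau>1" "has_ty None r ((x, \<tau>1) # \<Gamma>) t \<tau>2" using T_Let by auto
  then show ?case by (rule has_ty.T_Let)
qed (auto simp: has_ty_simps)

lemma no_hole:
  "holes t = 0 \<Longrightarrow> fill t e = t \<and> val t (\<rho>(Hole := y)) X = val t \<rho> X \<and> con t (\<rho>(Hole := y)) X = con t \<rho> X"
proof (induction t arbitrary: \<rho> X)
  case (Let x a b)
  have "(\<rho>(Hole := y))(Var x := z) = (\<rho>(Var x := z))(Hole := y)" for z by (simp add: fun_upd_twist)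
  then show ?case using Let by (simp del: fun_upd_apply)
next
  case (LetP x1 x2 a b)
  have "(\<rho>(Hole := y))(Var x2 := z, Var x1 := z') = (\<rho>(Var x2 := z, Var x1 := z'))(Hole := y)" for z z'
    by (simp add: fun_upd_twist)
  then show ?case using LetP by (simp del: fun_upd_apply)
qed auto

lemma stream_cong:
  "(\<And>i. i < nn t \<Longrightarrow> X i = X' i) \<Longrightarrow> val t \<rho> X = val t \<rho> X' \<and> con t \<rho> X = con t \<rho> X'"
proof (induction t arbitrary: \<rho> X X')
  case (Plus a b)
  have "val a \<rho> X = val a \<rho> X' \<and> con a \<rho> X = con a \<rho> X'" by (rule Plus.IH(1)) (use Plus.prems in auto)
  moreover have "val b \<rho> (shift (nn a) X) = val b \<rho> (shift (nn a) X') \<and> con b \<rho> (shift (nn a) X) = con b \<rho> (shift (nn a) X')"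
    by (rule Plus.IH(2)) (use Plus.prems in \<open>auto simp: shift_def\<close>)
  ultimately show ?case by simp
next
  case (Pair a b)
  have "val a \<rho> X = val a \<rho> X' \<and> con a \<rho> X = con a \<rho> X'" by (rule Pair.IH(1)) (use Pair.prems in auto)
  moreover have "val b \<rho> (shift (nn a) X) = val b \<rho> (shift (nn a) X') \<and> con b \<rho> (shift (nn a) X) = con b \<rho> (shift (nn a) X')"
    by (rule Pair.IH(2)) (use Pair.prems in \<open>auto simp: shift_def\<close>)
  ultimately show ?case by simp
next
  case (Eq a b)
  have "val a \<rho> X = val a \<rho> X' \<and> con a \<rho> X = con a \<rho> X'" by (rule Eq.IH(1)) (use Eq.prems in auto)
  moreover have "val b \<rho> (shift (nn a) X) = val b \<rho> (shift (nn a) X') \<and> con b \<rho> (shift (nn a) X) = con b \<rho> (shift (nn a) X')"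
    by (rule Eq.IH(2)) (use Eq.prems in \<open>auto simp: shift_def\<close>)
  ultimately show ?case by simp
next
  case (Scale \<alpha> a)
  have "val a \<rho> X = val a \<rho> X' \<and> con a \<rho> X = con a \<rho> X'" by (rule Scale.IH) (use Scale.prems in auto)
  then show ?case by simp
next
  case (Let x a b)
  have a: "val a \<rho> X = val a \<rho> X' \<and> con a \<rho> X = con a \<rho> X'" by (rule Let.IH(1)) (use Let.prems in auto)
  have "val b \<rho>' (shift (nn a) X) = val b \<rho>' (shift (nn a) X') \<and> con b \<rho>' (shift (nn a) X) = con b \<rho>' (shift (nn a) X')" for \<rho>'
    by (rule Let.IH(2)) (use Let.prems in \<open>auto simp: shift_def\<close>)
  with a show ?case by (simp del: fun_upd_apply)
next
  case (LetP x y a b)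
  have a: "val a \<rho> X = val a \<rho> X' \<and> con a \<rho> X = con a \<rho> X'" by (rule LetP.IH(1)) (use LetP.prems in auto)
  have "val b \<rho>' (shift (nn a) X) = val b \<rho>' (shift (nn a) X') \<and> con b \<rho>' (shift (nn a) X) = con b \<rho>' (shift (nn a) X')" for \<rho>'
    by (rule LetP.IH(2)) (use LetP.prems in \<open>auto simp: shift_def\<close>)
  with a show ?case by (simp del: fun_upd_apply)
qed auto

section \<open>Plugging a term into the hole\<close>

text \<open>Number of draws before the hole is reached, and the environment in which it is evaluated.\<close>
fun nb :: "tm \<Rightarrow> nat" where
  "nb (Plus a b) = (if holes a > 0 then nb a else nn a + nb b)"
| "nb (Scale \<alpha> a) = nb a"
| "nb (Pair a b) = (if holes a > 0 then nb a else nn a + nb b)"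
| "nb (Let x a b) = (if holes a > 0 then nb a else nn a + nb b)"
| "nb (LetP x y a b) = (if holes a > 0 then nb a else nn a + nb b)"
| "nb (Eq a b) = (if holes a > 0 then nb a else nn a + nb b)"
| "nb _ = 0"

fun henv :: "tm \<Rightarrow> (tm \<Rightarrow> 'w rv sv) \<Rightarrow> (nat \<Rightarrow> 'w rv) \<Rightarrow> tm \<Rightarrow> 'w rv sv" where
  "henv (Plus a b) \<rho> X = (if holes a > 0 then henv a \<rho> X else henv b \<rho> (shift (nn a) X))"
| "henv (Scale \<alpha> a) \<rho> X = henv a \<rho> X"
| "henv (Pair a b) \<rho> X = (if holes a > 0 then henv a \<rho> X else henv b \<rho> (shift (nn a) X))"
| "henv (Let x a b) \<rho> X = (if holes a > 0 then henv a \<rho> X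
     else henv b (\<rho>(Var x := val a \<rho> X)) (shift (nn a) X))"
| "henv (LetP x y a b) \<rho> X = (if holes a > 0 then henv a \<rho> X
     else henv b (\<rho>(Var y := vsnd (val a \<rho> X), Var x := vfst (val a \<rho> X))) (shift (nn a) X))"
| "henv (Eq a b) \<rho> X = (if holes a > 0 then henv a \<rho> X else henv b \<rho> (shift (nn a) X))"
| "henv _ \<rho> X = \<rho>"

lemma nb_le: "nb K \<le> nn K"
  by (induction K) auto

text \<open>The stream as the context sees it: the \<open>d\<close> draws made by the term in the
  hole, which come after the first \<open>n\<close>, are skipped.\<close>

definition cut :: "nat \<Rightarrow> nat \<Rightarrow> (nat \<Rightarrow> 'a) \<Rightarrow> nat \<Rightarrow> 'a" where
  "cut n d X = (\<lambda>i. if i < n then X i else X (i + d))"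

lemma shift_cut: "n \<le> m \<Longrightarrow> shift m (cut n d X) = shift (m + d) X"
  by (auto simp: shift_def cut_def fun_eq_iff ac_simps)

lemma shift_cut': "shift m (cut (m + n) d X) = cut n d (shift m X)"
  by (auto simp: shift_def cut_def fun_eq_iff ac_simps)

lemma fill_no_hole: "holes t = 0 \<Longrightarrow> fill t e = t"
  by (induction t) auto

lemma one_hole: "holes a + holes b = 1 \<Longrightarrow> (holes a = 1 \<and> holes b = 0) \<or> (holes a = 0 \<and> holes b = 1)"
  by arith

lemma fill_nn: "holes K = 1 \<Longrightarrow> nn (fill K e) = nn K + nn e"
proof (induction K)
  case (Plus a b)
  then show ?case using one_hole[of a b] by (auto simp: fill_no_hole)
next
  case (Pair a b)
  then show ?case using one_hole[of a b] by (auto simp: fill_no_hole)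
next
  case (Eq a b)
  then show ?case using one_hole[of a b] by (auto simp: fill_no_hole)
next
  case (Let x a b)
  then show ?case using one_hole[of a b] by (auto simp: fill_no_hole)
next
  case (LetP x y a b)
  then show ?case using one_hole[of a b] by (auto simp: fill_no_hole)
qed auto

text \<open>The hole is evaluated once, in an environment and at a position of the stream that
  depend on the context alone. The plugged term therefore enters only through its value, now the
  entry of \<open>\<rho>\<close> at \<open>Hole\<close>, and through its own conditions. The
  conditions are compared as sets: plugging interleaves the lists, and only their common zeros
  matter.\<close>

lemma fill_sem:
  "holes K = 1 \<Longrightarrow>
   val (fill K e) \<rho> X = val K (\<rho>(Hole := val e (henv K \<rho> X) (shift (nb K) X))) (cut (nb K) (nn e) X) \<and>
   set (con (fill K e) \<rho> X) =
     set (con K (\<rho>(Hole := val e (henv K \<rho> X) (shift (nb K) X))) (cut (nb K) (nn e) X)) \<union>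
     set (con e (henv K \<rho> X) (shift (nb K) X))"
proof (induction K arbitrary: \<rho> X)
  case (Plus a b)
  from one_hole[of a b] Plus.prems consider "holes a = 1" "holes b = 0" | "holes a = 0" "holes b = 1" by auto
  then show ?case
  proof cases
    case 1
    have sh: "shift (nn a) (cut (nb a) (nn e) X) = shift (nn a + nn e) X" by (rule shift_cut[OF nb_le])
    show ?thesis using Plus.IH(1)[OF 1(1), of \<rho> X] 1
      by (simp add: no_hole[OF 1(2)] fill_no_hole fill_nn sh Un_ac del: fun_upd_apply)
  next
    case 2
    have sc: "val a \<rho> (cut (nn a + nb b) (nn e) X) = val a \<rho> X \<and> con a \<rho> (cut (nn a + nb b) (nn e) X) = con a \<rho> X"
      by (rule stream_cong) (simp add: cut_def)
    show ?thesis using Plus.IH(2)[OF 2(2), of \<rho> "shift (nn a) X"] 2 sc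
      by (simp add: no_hole[OF 2(1)] fill_no_hole shift_cut' Un_ac del: fun_upd_apply)
  qed
next
  case (Pair a b)
  from one_hole[of a b] Pair.prems consider "holes a = 1" "holes b = 0" | "holes a = 0" "holes b = 1" by auto
  then show ?case
  proof cases
    case 1
    have sh: "shift (nn a) (cut (nb a) (nn e) X) = shift (nn a + nn e) X" by (rule shift_cut[OF nb_le])
    show ?thesis using Pair.IH(1)[OF 1(1), of \<rho> X] 1
      by (simp add: no_hole[OF 1(2)] fill_no_hole fill_nn sh Un_ac del: fun_upd_apply)
  next
    case 2
    have sc: "val a \<rho> (cut (nn a + nb b) (nn e) X) = val a \<rho> X \<and> con a \<rho> (cut (nn a + nb b) (nn e) X) = con a \<rho> X"
      by (rule stream_cong) (simp add: cut_def)
    show ?thesis using Pair.IH(2)[OF 2(2), of \<rho> "shift (nn a) X"] 2 sc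
      by (simp add: no_hole[OF 2(1)] fill_no_hole shift_cut' Un_ac del: fun_upd_apply)
  qed
next
  case (Eq a b)
  from one_hole[of a b] Eq.prems consider "holes a = 1" "holes b = 0" | "holes a = 0" "holes b = 1" by auto
  then show ?case
  proof cases
    case 1
    have sh: "shift (nn a) (cut (nb a) (nn e) X) = shift (nn a + nn e) X" by (rule shift_cut[OF nb_le])
    show ?thesis using Eq.IH(1)[OF 1(1), of \<rho> X] 1
      by (simp add: no_hole[OF 1(2)] fill_no_hole fill_nn sh Un_ac del: fun_upd_apply)
  next
    case 2
    have sc: "val a \<rho> (cut (nn a + nb b) (nn e) X) = val a \<rho> X \<and> con a \<rho> (cut (nn a + nb b) (nn e) X) = con a \<rho> X"
      by (rule stream_cong) (simp add: cut_def)
    show ?thesis using Eq.IH(2)[OF 2(2), of \<rho> "shift (nn a) X"] 2 sc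
      by (simp add: no_hole[OF 2(1)] fill_no_hole shift_cut' Un_ac del: fun_upd_apply)
  qed
next
  case (Let x a b)
  from one_hole[of a b] Let.prems consider "holes a = 1" "holes b = 0" | "holes a = 0" "holes b = 1" by auto
  then show ?case
  proof cases
    case 1
    have sh: "shift (nn a) (cut (nb a) (nn e) X) = shift (nn a + nn e) X" by (rule shift_cut[OF nb_le])
    have tw: "(\<rho>(Hole := z))(Var x := w) = (\<rho>(Var x := w))(Hole := z)" for z w
      by (simp add: fun_upd_twist)
    show ?thesis using Let.IH(1)[OF 1(1), of \<rho> X] 1
      by (simp add: no_hole[OF 1(2)] fill_no_hole fill_nn sh Un_ac tw del: fun_upd_apply)
  next
    case 2
    have sc: "val a \<rho> (cut (nn a + nb b) (nn e) X) = val a \<rho> X \<and> con a \<rho> (cut (nn a + nb b) (nn e) X) = con a \<rho> X"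
      by (rule stream_cong) (simp add: cut_def)
    have tw: "(\<rho>(Hole := z))(Var x := w) = (\<rho>(Var x := w))(Hole := z)" for z w
      by (simp add: fun_upd_twist)
    show ?thesis using Let.IH(2)[OF 2(2), of "\<rho>(Var x := val a \<rho> X)" "shift (nn a) X"] 2 sc
      by (simp add: no_hole[OF 2(1)] fill_no_hole shift_cut' Un_ac tw del: fun_upd_apply)
  qed
next
  case (LetP x1 x2 a b)
  from one_hole[of a b] LetP.prems consider "holes a = 1" "holes b = 0" | "holes a = 0" "holes b = 1" by auto
  then show ?case
  proof cases
    case 1
    have sh: "shift (nn a) (cut (nb a) (nn e) X) = shift (nn a + nn e) X" by (rule shift_cut[OF nb_le])
    have tw: "(\<rho>(Hole := z))(Var x2 := w2, Var x1 := w1) = (\<rho>(Var x2 := w2, Var x1 := w1))(Hole := z)" for z w1 w2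
      by (simp add: fun_upd_twist)
    show ?thesis using LetP.IH(1)[OF 1(1), of \<rho> X] 1
      by (simp add: no_hole[OF 1(2)] fill_no_hole fill_nn sh Un_ac tw del: fun_upd_apply)
  next
    case 2
    have sc: "val a \<rho> (cut (nn a + nb b) (nn e) X) = val a \<rho> X \<and> con a \<rho> (cut (nn a + nb b) (nn e) X) = con a \<rho> X"
      by (rule stream_cong) (simp add: cut_def)
    have tw: "(\<rho>(Hole := z))(Var x2 := w2, Var x1 := w1) = (\<rho>(Var x2 := w2, Var x1 := w1))(Hole := z)" for z w1 w2
      by (simp add: fun_upd_twist)
    show ?thesis using LetP.IH(2)[OF 2(2), of "\<rho>(Var x2 := vsnd (val a \<rho> X), Var x1 := vfst (val a \<rho> X))" "shift (nn a) X"] 2 sc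
      by (simp add: no_hole[OF 2(1)] fill_no_hole shift_cut' Un_ac tw del: fun_upd_apply)
  qed
next
  case (Scale \<alpha> a)
  have "holes a = 1" using Scale.prems by simp
  from Scale.IH[OF this, of \<rho> X] show ?case by (simp del: fun_upd_apply)
qed auto

lemma henv_closed:
  assumes C: "rv_closed C"
  shows "(\<And>a. \<forall>f \<in> set (flatv (\<rho> a)). C f) \<Longrightarrow> (\<And>i. i < nb K \<Longrightarrow> C (X i)) \<Longrightarrow>
    \<forall>f \<in> set (flatv (henv K \<rho> X a)). C f"
proof (induction K arbitrary: \<rho> X)
  case (Plus b c)
  show ?case
  proof (cases "holes b > 0")
    case True
    have "\<forall>f \<in> set (flatv (henv b \<rho> X a)). C f" by (rule Plus.IH(1)) (use Plus.prems True in auto)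
    then show ?thesis using True by simp
  next
    case False
    have "\<forall>f \<in> set (flatv (henv c \<rho> (shift (nn b) X) a)). C f"
      by (rule Plus.IH(2)) (use Plus.prems False in \<open>auto simp: shift_def\<close>)
    then show ?thesis using False by simp
  qed
next
  case (Pair b c)
  show ?case
  proof (cases "holes b > 0")
    case True
    have "\<forall>f \<in> set (flatv (henv b \<rho> X a)). C f" by (rule Pair.IH(1)) (use Pair.prems True in auto)
    then show ?thesis using True by simp
  next
    case False
    have "\<forall>f \<in> set (flatv (henv c \<rho> (shift (nn b) X) a)). C f"
      by (rule Pair.IH(2)) (use Pair.prems False in \<open>auto simp: shift_def\<close>)
    then show ?thesis using False by simp
  qed
next
  case (Eq b c)
  show ?case
  proof (cases "holes b > 0")
    case True
    have "\<forall>f \<in> set (flatv (henv b \<rho> X a)). C f" by (rule Eq.IH(1)) (use Eq.prems True in auto)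
    then show ?thesis using True by simp
  next
    case False
    have "\<forall>f \<in> set (flatv (henv c \<rho> (shift (nn b) X) a)). C f"
      by (rule Eq.IH(2)) (use Eq.prems False in \<open>auto simp: shift_def\<close>)
    then show ?thesis using False by simp
  qed
next
  case (Let x b c)
  show ?case
  proof (cases "holes b > 0")
    case True
    have "\<forall>f \<in> set (flatv (henv b \<rho> X a)). C f" by (rule Let.IH(1)) (use Let.prems True in auto)
    then show ?thesis using True by simp
  next
    case False
    have v: "\<forall>f \<in> set (flatv (val b \<rho> X)). C f"
      using val_con_closed[OF C, of \<rho> b X] Let.prems False by auto
    have "\<forall>f \<in> set (flatv (henv c (\<rho>(Var x := val b \<rho> X)) (shift (nn b) X) a)). C f"
      by (rule Let.IH(2)) (use Let.prems False v in \<open>auto simp: shift_def\<close>)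
    then show ?thesis using False by simp
  qed
next
  case (LetP x y b c)
  show ?case
  proof (cases "holes b > 0")
    case True
    have "\<forall>f \<in> set (flatv (henv b \<rho> X a)). C f" by (rule LetP.IH(1)) (use LetP.prems True in auto)
    then show ?thesis using True by simp
  next
    case False
    have v: "\<forall>f \<in> set (flatv (val b \<rho> X)). C f"
      using val_con_closed[OF C, of \<rho> b X] LetP.prems False by auto
    have fs: "\<forall>f \<in> set (flatv (vfst v)) \<union> set (flatv (vsnd v)). C f" if "\<forall>f \<in> set (flatv v). C f" for v
      using that by (cases v) auto
    have "\<forall>f \<in> set (flatv (henv c (\<rho>(Var y := vsnd (val b \<rho> X), Var x := vfst (val b \<rho> X))) (shift (nn b) X) a)). C f"
      by (rule LetP.IH(2)) (use LetP.prems False fs[OF v] in \<open>auto simp: shift_def\<close>)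
    then show ?thesis using False by simp
  qed
next
  case (Scale \<alpha> b)
  have "\<forall>f \<in> set (flatv (henv b \<rho> X a)). C f" by (rule Scale.IH) (use Scale.prems in auto)
  then show ?case by simp
qed auto

text \<open>Plugging captures variables: the binders passed on the way supply the free variables of
  the plugged term, and the inclusion of contexts in the typing rule of the hole gives them the
  right types.\<close>

lemma henv_shp:
  "has_ty H r \<Delta> K \<sigma> \<Longrightarrow> H = Some (\<Gamma>0, \<tau>0) \<Longrightarrow> holes K = 1 \<Longrightarrow> env_shp None r \<Delta> \<rho> \<Longrightarrow>
   env_shp None 0 \<Gamma>0 (henv K \<rho> X)"
proof (induction arbitrary: \<rho> X rule: has_ty.induct)
  case (T_Plus H r \<Gamma> a b)
  then show ?case using one_hole[of a b] by auto
next
  case (T_Pair H r \<Gamma> a \<tau>1 b \<tau>2)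
  then show ?case using one_hole[of a b] by auto
next
  case (T_Eq H r \<Gamma> a b)
  then show ?case using one_hole[of a b] by auto
next
  case (T_Let H r \<Gamma> e \<tau>1 x t \<tau>2)
  from one_hole[of e t] T_Let.prems consider "holes e = 1" "holes t = 0" | "holes e = 0" "holes t = 1" by auto
  then show ?case
  proof cases
    case 1
    then show ?thesis using T_Let.IH(1)[OF T_Let.prems(1) _ T_Let.prems(3)] by simp
  next
    case 2
    have "shp \<tau>1 (val e \<rho> X)" by (rule shp_val[OF has_ty_no_hole[OF T_Let(1) 2(1)] T_Let.prems(3)])
    from T_Let.IH(2)[OF T_Let.prems(1) 2(2) env_shp_upd[OF T_Let.prems(3) this]] 2 show ?thesis
      by (simp del: fun_upd_apply)
  qed
next
  case (T_LetP x y H r \<Gamma> e \<tau>1 \<tau>2 t \<tau>)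
  from one_hole[of e t] T_LetP.prems consider "holes e = 1" "holes t = 0" | "holes e = 0" "holes t = 1" by auto
  then show ?case
  proof cases
    case 1
    then show ?thesis using T_LetP.IH(1)[OF T_LetP.prems(1) _ T_LetP.prems(3)] by simp
  next
    case 2
    have "shp (TProd \<tau>1 \<tau>2) (val e \<rho> X)" by (rule shp_val[OF has_ty_no_hole[OF T_LetP(2) 2(1)] T_LetP.prems(3)])
    then have s: "shp \<tau>1 (vfst (val e \<rho> X))" "shp \<tau>2 (vsnd (val e \<rho> X))" by auto
    from T_LetP.IH(2)[OF T_LetP.prems(1) 2(2) env_shp_upd[OF env_shp_upd[OF T_LetP.prems(3) s(2)] s(1)]] 2
    show ?thesis by (simp del: fun_upd_apply)
  qed
qed (auto simp: env_shp_def)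

section \<open>Change of sample space\<close>

lemma rvl_map: "rvl (map_sv (\<lambda>f \<omega>. f (g \<omega>)) v) = (\<lambda>\<omega>. rvl v (g \<omega>))"
  by (cases v) auto

lemma vfst_map: "vfst (map_sv h v) = map_sv h (vfst v)" and vsnd_map: "vsnd (map_sv h v) = map_sv h (vsnd v)"
  by (cases v; simp)+

lemma flatv_map: "flatv (map_sv h v) = map h (flatv v)"
  by (induction v) auto

lemma shift_comp: "shift n (\<lambda>i \<omega>. X i (g \<omega>)) = (\<lambda>i \<omega>. shift n X i (g \<omega>))"
  by (simp add: shift_def)

text \<open>Evaluation uses pointwise operations only, so it commutes with pulling random variables
  back along any map \<open>g\<close> of sample spaces. A context can thus be evaluated once on a
  generic space and pulled back to each filled program.\<close>

lemma naturality:
  "val t (\<lambda>a. map_sv (\<lambda>f \<omega>. f (g \<omega>)) (\<rho> a)) (\<lambda>i \<omega>. X i (g \<omega>)) = map_sv (\<lambda>f \<omega>. f (g \<omega>)) (val t \<rho> X) \<and>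
   con t (\<lambda>a. map_sv (\<lambda>f \<omega>. f (g \<omega>)) (\<rho> a)) (\<lambda>i \<omega>. X i (g \<omega>)) = map (\<lambda>f \<omega>. f (g \<omega>)) (con t \<rho> X)"
proof (induction t arbitrary: \<rho> X)
  case (Let x a b)
  have "(\<lambda>a. map_sv (\<lambda>f \<omega>. f (g \<omega>)) (\<rho> a))(Var x := map_sv (\<lambda>f \<omega>. f (g \<omega>)) v) = (\<lambda>a. map_sv (\<lambda>f \<omega>. f (g \<omega>)) ((\<rho>(Var x := v)) a))" for v
    by auto
  then show ?case using Let by (simp add: shift_comp del: fun_upd_apply)
next
  case (LetP x y a b)
  have "(\<lambda>a. map_sv (\<lambda>f \<omega>. f (g \<omega>)) (\<rho> a))(Var y := map_sv (\<lambda>f \<omega>. f (g \<omega>)) v, Var x := map_sv (\<lambda>f \<omega>. f (g \<omega>)) w)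
      = (\<lambda>a. map_sv (\<lambda>f \<omega>. f (g \<omega>)) ((\<rho>(Var y := v, Var x := w)) a))" for v w
    by auto
  then show ?case using LetP by (simp add: shift_comp vfst_map vsnd_map del: fun_upd_apply)
qed (auto simp: shift_comp rvl_map fun_eq_iff)

lemma val_no_lat:
  "has_ty H r \<Gamma> e \<tau> \<Longrightarrow> r = 0 \<Longrightarrow> (\<And>a. (\<And>i. a \<noteq> Lat i) \<Longrightarrow> \<rho> a = \<rho>' a) \<Longrightarrow>
    val e \<rho> X = val e \<rho>' X \<and> con e \<rho> X = con e \<rho>' X"
proof (induction arbitrary: \<rho> \<rho>' X rule: has_ty.induct)
  case (T_Plus H r \<Gamma> a b)
  show ?case using T_Plus.IH(1)[OF T_Plus.prems] T_Plus.IH(2)[OF T_Plus.prems] by simp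
next
  case (T_Scale H r \<Gamma> a \<alpha>)
  show ?case using T_Scale.IH[OF T_Scale.prems] by simp
next
  case (T_Pair H r \<Gamma> a \<tau>1 b \<tau>2)
  show ?case using T_Pair.IH(1)[OF T_Pair.prems] T_Pair.IH(2)[OF T_Pair.prems] by simp
next
  case (T_Eq H r \<Gamma> a b)
  show ?case using T_Eq.IH(1)[OF T_Eq.prems] T_Eq.IH(2)[OF T_Eq.prems] by simp
next
  case (T_Let H r \<Gamma> e \<tau>1 x t \<tau>2)
  have e: "val e \<rho> X = val e \<rho>' X \<and> con e \<rho> X = con e \<rho>' X" by (rule T_Let.IH(1)[OF T_Let.prems])
  have "val t (\<rho>(Var x := v)) Y = val t (\<rho>'(Var x := v)) Y \<and> con t (\<rho>(Var x := v)) Y = con t (\<rho>'(Var x := v)) Y" for v Y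
    by (rule T_Let.IH(2)) (use T_Let.prems in auto)
  with e show ?case by (simp del: fun_upd_apply)
next
  case (T_LetP x y H r \<Gamma> e \<tau>1 \<tau>2 t \<tau>)
  have e: "val e \<rho> X = val e \<rho>' X \<and> con e \<rho> X = con e \<rho>' X" by (rule T_LetP.IH(1)[OF T_LetP.prems])
  have "val t (\<rho>(Var y := v, Var x := w)) Y = val t (\<rho>'(Var y := v, Var x := w)) Y \<and>
      con t (\<rho>(Var y := v, Var x := w)) Y = con t (\<rho>'(Var y := v, Var x := w)) Y" for v w Y
    by (rule T_LetP.IH(2)) (use T_LetP.prems in auto)
  with e show ?case by (simp del: fun_upd_apply)
qed auto

definition void :: "tm \<Rightarrow> 'a sv" where
  "void = (\<lambda>_. VU)"

lemma closed_void:
  assumes "has_ty None 0 [] e \<tau>"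
  shows "outs e = flatv (val e void (fresh 0))"
    and "sols0 e = {\<xi> \<in> carrier_vec (nn e). \<forall>f \<in> set (con e void (fresh 0)). f \<xi> = 0}"
proof -
  have "val e latent (fresh 0) = val e void (fresh 0) \<and> con e latent (fresh 0) = con e void (fresh 0)"
    by (rule val_no_lat[OF assms refl]) (auto simp: latent_def void_def split: tm.split)
  then show "outs e = flatv (val e void (fresh 0))"
    and "sols0 e = {\<xi> \<in> carrier_vec (nn e). \<forall>f \<in> set (con e void (fresh 0)). f \<xi> = 0}"
    by (simp_all add: outs_def sols0_def)
qed

lemma law_eq_cong:
  assumes eq: "law_eq r1 L1 fs1 r2 L2 fs2"
    and len: "length fs1 = length gs1" "length fs2 = length gs2"
    and f1: "\<And>i \<xi>. i < length fs1 \<Longrightarrow> \<xi> \<in> carrier_vec r1 \<Longrightarrow> (fs1 ! i) \<xi> = (gs1 ! i) \<xi>"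
    and f2: "\<And>i \<xi>. i < length fs2 \<Longrightarrow> \<xi> \<in> carrier_vec r2 \<Longrightarrow> (fs2 ! i) \<xi> = (gs2 ! i) \<xi>"
  shows "law_eq r1 L1 gs1 r2 L2 gs2"
proof (cases "L1 = {} \<and> L2 = {}")
  case False
  then obtain G where G: "has_law r1 L1 fs1 G" "has_law r2 L2 fs2 G" using eq unfolding law_eq_def by blast
  have "has_law r1 L1 gs1 G" by (rule has_law_cong[OF G(1) len(1) f1])
  moreover have "has_law r2 L2 gs2 G" by (rule has_law_cong[OF G(2) len(2) f2])
  ultimately show ?thesis unfolding law_eq_def by blast
qed (simp add: law_eq_def)

section \<open>Running a term after an arbitrary state\<close>

lemma noise_fresh: "\<xi> \<in> carrier_vec (s + r) \<Longrightarrow> noise r (fresh s) \<xi> = vec_last \<xi> r"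
  by (auto simp: noise_def fresh_def vec_last_def)

text \<open>A term run after an arbitrary state: \<open>pa\<close>, \<open>pm\<close>, \<open>pc\<close> generate the extra outputs, the
  environment and the conditions of the state.\<close>
lemma state_rep:
  assumes ty: "has_ty None 0 \<Gamma> e \<tau>"
    and rep: "rep 0 (a + ctx_dim \<Gamma> + k) s \<psi> (\<lambda>x \<xi>. (pa \<xi> @\<^sub>v pm \<xi>) @\<^sub>v pc \<xi>)" and ob: "ob \<in> carrier_vec k"
    and car: "\<And>\<xi>. \<xi> \<in> carrier_vec s \<Longrightarrow> pa \<xi> \<in> carrier_vec a \<and> pm \<xi> \<in> carrier_vec (ctx_dim \<Gamma>) \<and> pc \<xi> \<in> carrier_vec k"
    and env: "\<And>\<xi>. \<xi> \<in> carrier_vec (s + nn e) \<Longrightarrow> env_rel \<Gamma> h \<xi> (pm (vec_first \<xi> s))"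
  defines "vs \<equiv> flatv (val e h (fresh s))" and "cs \<equiv> con e h (fresh s)"
  shows "\<exists>\<phi> k'. rep 0 (a + tdim \<tau> + (k' + k)) (s + nn e) (fst ((cid a \<otimes>\<^sub>c den \<Gamma> e) \<bullet>\<^sub>c (\<psi>, ob))) \<phi> \<and>
     snd ((cid a \<otimes>\<^sub>c den \<Gamma> e) \<bullet>\<^sub>c (\<psi>, ob)) = 0\<^sub>v k' @\<^sub>v ob \<and>
     length vs = tdim \<tau> \<and> length cs = k' \<and>
     (\<forall>\<xi> \<in> carrier_vec (s + nn e). \<phi> (0\<^sub>v 0) \<xi> =
        (pa (vec_first \<xi> s) @\<^sub>v evl vs \<xi>) @\<^sub>v (evl cs \<xi> @\<^sub>v pc (vec_first \<xi> s)))"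
proof -
  let ?m = "ctx_dim \<Gamma>"
  obtain k' v c where F: "crep ?m (tdim \<tau>) k' (nn e) (den \<Gamma> e) v c" "snd (den \<Gamma> e) = 0\<^sub>v k'"
    and vc: "\<And>\<omega> x \<rho> X. env_rel \<Gamma> \<rho> (\<omega> :: real vec) x \<Longrightarrow>
       v x (noise (nn e) X \<omega>) = evl (flatv (val e \<rho> X)) \<omega> \<and> c x (noise (nn e) X \<omega>) = evl (con e \<rho> X) \<omega>"
    using den_generates[OF ty refl refl, where 'w = "real vec"] unfolding generates_def by blast
  have P: "crep 0 (a + ?m) k s (\<psi>, ob) (\<lambda>x \<xi>. pa \<xi> @\<^sub>v pm \<xi>) (\<lambda>x \<xi>. pc \<xi>)"
    unfolding crep_def using rep ob car by simp
  note R = crep_cbullet[OF P crep_ctensor[OF crep_cid F(1)], unfolded add_0_left]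
  show ?thesis
  proof (intro exI conjI ballI)
    show "rep 0 (a + tdim \<tau> + (k' + k)) (s + nn e) (fst ((cid a \<otimes>\<^sub>c den \<Gamma> e) \<bullet>\<^sub>c (\<psi>, ob)))
      (\<lambda>x \<xi>. (vec_first (pa (vec_first \<xi> s) @\<^sub>v pm (vec_first \<xi> s)) a @\<^sub>v
           v (vec_last (pa (vec_first \<xi> s) @\<^sub>v pm (vec_first \<xi> s)) ?m) (vec_last (vec_last \<xi> (nn e)) (nn e))) @\<^sub>v
         ((0\<^sub>v 0 @\<^sub>v c (vec_last (pa (vec_first \<xi> s) @\<^sub>v pm (vec_first \<xi> s)) ?m) (vec_last (vec_last \<xi> (nn e)) (nn e))) @\<^sub>v
           pc (vec_first \<xi> s)))"
      using R unfolding crep_def by blast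
    show "snd ((cid a \<otimes>\<^sub>c den \<Gamma> e) \<bullet>\<^sub>c (\<psi>, ob)) = 0\<^sub>v k' @\<^sub>v ob"
      using F(2) by (simp add: cbullet_snd ctensor_snd cid_def)
    \<comment> \<open>The zero vector serves as a sample point at which lengths are read off; the
      lengths of \<open>vs\<close> and \<open>cs\<close> do not depend on the point.\<close>
    have env0: "env_rel \<Gamma> h (0\<^sub>v (s + nn e)) (pm (vec_first (0\<^sub>v (s + nn e)) s))" by (rule env) simp
    show "length vs = tdim \<tau>"
      unfolding vs_def by (rule length_flatv[OF shp_val[OF ty env_rel_shp[OF env0]]])
    have "c x \<xi> \<in> carrier_vec k'" if "x \<in> carrier_vec ?m" "\<xi> \<in> carrier_vec (nn e)" for x \<xi>
      using F(1) that unfolding crep_def by blast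
    from this[of "pm (vec_first (0\<^sub>v (s + nn e)) s)" "noise (nn e) (fresh s) (0\<^sub>v (s + nn e))"]
    have "c (pm (vec_first (0\<^sub>v (s + nn e)) s)) (noise (nn e) (fresh s) (0\<^sub>v (s + nn e))) \<in> carrier_vec k'"
      using car by simp
    then have "evl cs (0\<^sub>v (s + nn e)) \<in> carrier_vec k'" using vc[OF env0] unfolding cs_def by simp
    then have "dim_vec (evl cs (0\<^sub>v (s + nn e))) = k'" by (rule carrier_vecD)
    then show "length cs = k'" by simp
  next
    fix \<xi> :: "real vec" assume xi: "\<xi> \<in> carrier_vec (s + nn e)"
    have n: "vec_last (vec_last \<xi> (nn e)) (nn e) = noise (nn e) (fresh s) \<xi>"
      using noise_fresh[OF xi] by (simp add: vec_last_id)
    have c1: "pa (vec_first \<xi> s) \<in> carrier_vec a" "pm (vec_first \<xi> s) \<in> carrier_vec ?m"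
      using car[of "vec_first \<xi> s"] by auto
    show "(vec_first (pa (vec_first \<xi> s) @\<^sub>v pm (vec_first \<xi> s)) a @\<^sub>v
           v (vec_last (pa (vec_first \<xi> s) @\<^sub>v pm (vec_first \<xi> s)) ?m) (vec_last (vec_last \<xi> (nn e)) (nn e))) @\<^sub>v
         ((0\<^sub>v 0 @\<^sub>v c (vec_last (pa (vec_first \<xi> s) @\<^sub>v pm (vec_first \<xi> s)) ?m) (vec_last (vec_last \<xi> (nn e)) (nn e))) @\<^sub>v
           pc (vec_first \<xi> s))
      = (pa (vec_first \<xi> s) @\<^sub>v evl vs \<xi>) @\<^sub>v (evl cs \<xi> @\<^sub>v pc (vec_first \<xi> s))"
      unfolding n using c1 vc[OF env[OF xi], of "fresh s"] unfolding vs_def cs_def by simp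
  qed
qed

text \<open>Translates one instance of the test in \<open>cequiv\<close> into an equality of
  conditional laws. The observation splits into zeros for the conditions of the term and
  \<open>ob\<close> for those of the state. Both directions of the main result rest on this, with
  different states.\<close>

lemma state_law_eq:
  assumes t1: "has_ty None 0 \<Gamma> e1 \<tau>" and t2: "has_ty None 0 \<Gamma> e2 \<tau>"
    and rep: "rep 0 (a + ctx_dim \<Gamma> + k) s \<psi> (\<lambda>x \<xi>. (pa \<xi> @\<^sub>v pm \<xi>) @\<^sub>v pc \<xi>)" and ob: "ob \<in> carrier_vec k"
    and car: "\<And>\<xi>. \<xi> \<in> carrier_vec s \<Longrightarrow> pa \<xi> \<in> carrier_vec a \<and> pm \<xi> \<in> carrier_vec (ctx_dim \<Gamma>) \<and> pc \<xi> \<in> carrier_vec k"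
    and env: "\<And>n \<xi>. s \<le> n \<Longrightarrow> \<xi> \<in> carrier_vec n \<Longrightarrow> env_rel \<Gamma> h \<xi> (pm (vec_first \<xi> s))"
  defines "LL \<equiv> \<lambda>e. {\<xi> \<in> carrier_vec (s + nn e). (\<forall>f \<in> set (con e h (fresh s)). f \<xi> = 0) \<and> pc (vec_first \<xi> s) = ob}"
    and "ff \<equiv> \<lambda>e. map (\<lambda>i \<xi>. pa (vec_first \<xi> s) $ i) [0..<a] @ flatv (val e h (fresh s))"
    and "PP \<equiv> \<lambda>e. (cid a \<otimes>\<^sub>c den \<Gamma> e) \<bullet>\<^sub>c (\<psi>, ob)"
  shows "((succeeds (a + tdim \<tau>) (PP e1) \<longleftrightarrow> succeeds (a + tdim \<tau>) (PP e2)) \<and>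
      (succeeds (a + tdim \<tau>) (PP e1) \<and> succeeds (a + tdim \<tau>) (PP e2) \<longrightarrow>
         same_posterior (a + tdim \<tau>) (PP e1) (PP e2))) \<longleftrightarrow>
     law_eq (s + nn e1) (LL e1) (ff e1) (s + nn e2) (LL e2) (ff e2)"
proof -
  let ?N = "a + tdim \<tau>"
  have ex: "\<exists>\<phi> k'. rep 0 (?N + k') (s + nn e) (fst (PP e)) \<phi> \<and> snd (PP e) \<in> carrier_vec k' \<and>
      {\<xi> \<in> carrier_vec (s + nn e). \<forall>j<k'. \<phi> (0\<^sub>v 0) \<xi> $ (?N + j) = snd (PP e) $ j} = LL e \<and>
      length (ff e) = ?N \<and>
      (\<forall>i<?N. \<forall>\<xi> \<in> carrier_vec (s + nn e). \<phi> (0\<^sub>v 0) \<xi> $ i = (ff e ! i) \<xi>)"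
    if ty: "has_ty None 0 \<Gamma> e \<tau>" for e
  proof -
    define vs where "vs = flatv (val e h (fresh s))"
    define cs where "cs = con e h (fresh s)"
    have env': "\<And>\<xi>. \<xi> \<in> carrier_vec (s + nn e) \<Longrightarrow> env_rel \<Gamma> h \<xi> (pm (vec_first \<xi> s))"
      by (rule env[OF le_add1])
    obtain \<phi> k' where R: "rep 0 (?N + (k' + k)) (s + nn e) (fst (PP e)) \<phi>"
      and sn: "snd (PP e) = 0\<^sub>v k' @\<^sub>v ob" and lv: "length vs = tdim \<tau>" and lc: "length cs = k'"
      and ph: "\<And>\<xi>. \<xi> \<in> carrier_vec (s + nn e) \<Longrightarrow> \<phi> (0\<^sub>v 0) \<xi> =
        (pa (vec_first \<xi> s) @\<^sub>v evl vs \<xi>) @\<^sub>v (evl cs \<xi> @\<^sub>v pc (vec_first \<xi> s))"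
      using state_rep[OF ty rep ob car env'] unfolding PP_def vs_def cs_def by blast
    have dob: "dim_vec ob = k" using ob by simp
    have dims: "dim_vec (pa (vec_first \<xi> s)) = a" "dim_vec (pc (vec_first \<xi> s)) = k" for \<xi>
      using car[of "vec_first \<xi> s"] by auto
    have cond: "(\<forall>j<k' + k. \<phi> (0\<^sub>v 0) \<xi> $ (?N + j) = snd (PP e) $ j) \<longleftrightarrow>
       (\<forall>f \<in> set cs. f \<xi> = 0) \<and> pc (vec_first \<xi> s) = ob" if xi: "\<xi> \<in> carrier_vec (s + nn e)" for \<xi>
    proof -
      let ?u = "evl cs \<xi> @\<^sub>v pc (vec_first \<xi> s)"
      have "\<phi> (0\<^sub>v 0) \<xi> $ (?N + j) = ?u $ j" if "j < k' + k" for j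
        unfolding ph[OF xi] using that dims lv lc by simp
      then have "(\<forall>j<k' + k. \<phi> (0\<^sub>v 0) \<xi> $ (?N + j) = snd (PP e) $ j) \<longleftrightarrow> ?u = 0\<^sub>v k' @\<^sub>v ob"
        unfolding sn using dims lc dob by (auto simp: vec_eq_iff)
      also have "\<dots> \<longleftrightarrow> evl cs \<xi> = 0\<^sub>v k' \<and> pc (vec_first \<xi> s) = ob"
        using evl_carrier[OF lc] by (intro append_vec_eq) auto
      also have "evl cs \<xi> = 0\<^sub>v k' \<longleftrightarrow> (\<forall>f \<in> set cs. f \<xi> = 0)"
        using lc by (auto simp: vec_eq_iff all_set_conv_all_nth)
      finally show ?thesis .
    qed
    have out: "\<phi> (0\<^sub>v 0) \<xi> $ i = (ff e ! i) \<xi>" if "i < ?N" and xi: "\<xi> \<in> carrier_vec (s + nn e)" for i \<xi>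
      unfolding ph[OF xi] ff_def vs_def[symmetric] using that(1) dims lv lc by (auto simp: nth_append)
    have "snd (PP e) \<in> carrier_vec (k' + k)" unfolding sn using dob by (intro carrier_vecI) simp
    moreover have "length (ff e) = ?N" using lv by (simp add: ff_def vs_def)
    moreover have "{\<xi> \<in> carrier_vec (s + nn e). \<forall>j<k' + k. \<phi> (0\<^sub>v 0) \<xi> $ (?N + j) = snd (PP e) $ j} = LL e"
      unfolding LL_def cs_def[symmetric] using cond by blast
    ultimately show ?thesis using R out by blast
  qed
  obtain \<phi>1 k1 where 1: "rep 0 (?N + k1) (s + nn e1) (fst (PP e1)) \<phi>1" "snd (PP e1) \<in> carrier_vec k1"
      "{\<xi> \<in> carrier_vec (s + nn e1). \<forall>j<k1. \<phi>1 (0\<^sub>v 0) \<xi> $ (?N + j) = snd (PP e1) $ j} = LL e1"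
      "length (ff e1) = ?N"
      "\<And>i \<xi>. i < ?N \<Longrightarrow> \<xi> \<in> carrier_vec (s + nn e1) \<Longrightarrow> \<phi>1 (0\<^sub>v 0) \<xi> $ i = (ff e1 ! i) \<xi>"
    using ex[OF t1] by blast
  obtain \<phi>2 k2 where 2: "rep 0 (?N + k2) (s + nn e2) (fst (PP e2)) \<phi>2" "snd (PP e2) \<in> carrier_vec k2"
      "{\<xi> \<in> carrier_vec (s + nn e2). \<forall>j<k2. \<phi>2 (0\<^sub>v 0) \<xi> $ (?N + j) = snd (PP e2) $ j} = LL e2"
      "length (ff e2) = ?N"
      "\<And>i \<xi>. i < ?N \<Longrightarrow> \<xi> \<in> carrier_vec (s + nn e2) \<Longrightarrow> \<phi>2 (0\<^sub>v 0) \<xi> $ i = (ff e2 ! i) \<xi>"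
    using ex[OF t2] by blast
  note I = inference_law_eq[OF 1(1,2) 2(1,2), unfolded prod.collapse 1(3) 2(3)]
  have "law_eq (s + nn e1) (LL e1) (map (\<lambda>i \<xi>. \<phi>1 (0\<^sub>v 0) \<xi> $ i) [0..<?N])
     (s + nn e2) (LL e2) (map (\<lambda>i \<xi>. \<phi>2 (0\<^sub>v 0) \<xi> $ i) [0..<?N]) \<longleftrightarrow>
     law_eq (s + nn e1) (LL e1) (ff e1) (s + nn e2) (LL e2) (ff e2)" (is "?l \<longleftrightarrow> ?r")
  proof
    show "?l \<Longrightarrow> ?r" by (erule law_eq_cong) (use 1(4,5) 2(4,5) in \<open>simp_all del: zero_vec_zero\<close>)
    show "?r \<Longrightarrow> ?l" by (erule law_eq_cong) (use 1(4,5) 2(4,5) in \<open>simp_all del: zero_vec_zero\<close>)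
  qed
  with I show ?thesis by blast
qed

lemma aff_first:
  assumes "aff r f"
  shows "f \<xi> = f (vec_first \<xi> r)"
proof -
  from assms obtain u b where "\<And>\<xi>. f \<xi> = (\<Sum>i<r. u i * \<xi> $ i) + b" unfolding aff_def by blast
  then show ?thesis by (simp add: vec_first_def)
qed

text \<open>Turns symbolic quantities back into a Gaussian state, so that the situation of a context
  at its hole can be submitted to \<open>cequiv\<close>. The rows of the noise factor are the linear
  parts.\<close>

lemma rep_aff:
  assumes aff: "\<And>f. f \<in> set fs \<Longrightarrow> aff q f" and len: "length fs = n"
  shows "\<exists>\<psi>. is_gm 0 n \<psi> \<and> rep 0 n q \<psi> (\<lambda>x \<xi>. evl fs \<xi>)"
proof -
  define M where "M = mat n q (\<lambda>(i, j). lpart q (fs ! i) $ j)"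
  define b where "b = vec n (\<lambda>i. (fs ! i) (0\<^sub>v q))"
  have M: "M \<in> carrier_mat n q" and b: "b \<in> carrier_vec n" by (simp_all add: M_def b_def)
  have "evl fs \<xi> = 0\<^sub>m n 0 *\<^sub>v x + b + M *\<^sub>v \<xi>" if x: "x \<in> carrier_vec 0" and xi: "\<xi> \<in> carrier_vec q" for x \<xi>
  proof (rule eq_vecI)
    fix i assume "i < dim_vec (0\<^sub>m n 0 *\<^sub>v x + b + M *\<^sub>v \<xi>)"
    then have i: "i < n" using M by simp
    have "row M i = lpart q (fs ! i)" using i by (intro eq_vecI) (auto simp: M_def lpart_def)
    moreover have "(fs ! i) \<xi> = lpart q (fs ! i) \<bullet> \<xi> + (fs ! i) (0\<^sub>v q)"
      by (rule affv_lpart[OF aff_affv[OF aff] xi]) (use i len in simp)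
    ultimately show "evl fs \<xi> $ i = (0\<^sub>m n 0 *\<^sub>v x + b + M *\<^sub>v \<xi>) $ i"
      using i len M x by (simp add: b_def scalar_prod_def)
  qed (use M len in simp)
  then have "rep 0 n q (0\<^sub>m n 0, b, M * transpose_mat M) (\<lambda>x \<xi>. evl fs \<xi>)"
    unfolding rep_def using M b by (intro exI[of _ "0\<^sub>m n 0"] exI[of _ b] exI[of _ M]) auto
  moreover have "is_gm 0 n (0\<^sub>m n 0, b, M * transpose_mat M)"
    unfolding is_gm_def using M b psd_gram[OF M] by auto
  ultimately show ?thesis by blast
qed

lemma env_rel_concat:
  "(\<And>x \<tau>. (x, \<tau>) \<in> set \<Gamma> \<Longrightarrow> shp \<tau> (h (Var x))) \<Longrightarrow>
   env_rel \<Gamma> h \<omega> (evl (concat (map (\<lambda>(x, \<tau>). flatv (h (Var x))) \<Gamma>)) \<omega>)"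
proof (induction \<Gamma>)
  case Nil
  have "vNil \<in> carrier_vec 0" by (intro carrier_vecI) simp
  then show ?case by (simp add: env_rel_def ctx_dim_def)
next
  case (Cons p \<Gamma>)
  obtain x \<tau> where p: "p = (x, \<tau>)" by force
  have IH: "env_rel \<Gamma> h \<omega> (evl (concat (map (\<lambda>(x, \<tau>). flatv (h (Var x))) \<Gamma>)) \<omega>)"
    by (rule Cons.IH) (use Cons.prems in auto)
  have s: "shp \<tau> (h (Var x))" using Cons.prems[of x \<tau>] p by simp
  have "h(Var x := h (Var x)) = h" by simp
  with env_rel_upd[OF IH s, of x] show ?case by (simp add: p evl_append)
qed

section \<open>Generic values and weights independent of the sample space\<close>

definition coords :: "nat \<Rightarrow> nat \<Rightarrow> real vec rv list" where
  "coords i j = map (\<lambda>k \<xi>. \<xi> $ k) [i..<j]"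

lemma length_coords [simp]: "length (coords i j) = j - i"
  by (simp add: coords_def)

lemma coords_nth [simp]: "k < j - i \<Longrightarrow> coords i j ! k = (\<lambda>\<xi>. \<xi> $ (i + k))"
  by (simp add: coords_def)

lemma coords_aff: "f \<in> set (coords i j) \<Longrightarrow> j \<le> r \<Longrightarrow> aff r f"
  by (auto simp: coords_def intro: aff_coord)

lemma law_eq_exts:
  assumes eq: "law_eq r1 L1 fs1 r2 L2 fs2"
    and len: "length fs1 = n" "length fs2 = n"
    and aff: "\<And>f. f \<in> set fs1 \<Longrightarrow> aff r1 f" "\<And>f. f \<in> set fs2 \<Longrightarrow> aff r2 f"
    and sub: "L1 \<subseteq> carrier_vec r1" "L2 \<subseteq> carrier_vec r2"
  shows "law_eq (r1 + q) {\<xi> \<in> carrier_vec (r1 + q). vec_first \<xi> r1 \<in> L1} (fs1 @ coords r1 (r1 + q))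
                (r2 + q) {\<xi> \<in> carrier_vec (r2 + q). vec_first \<xi> r2 \<in> L2} (fs2 @ coords r2 (r2 + q))"
proof (induction q)
  case 0
  have "{\<xi> \<in> carrier_vec (r1 + 0). vec_first \<xi> r1 \<in> L1} = L1" "{\<xi> \<in> carrier_vec (r2 + 0). vec_first \<xi> r2 \<in> L2} = L2"
    using sub by auto
  then show ?case using eq by (simp add: coords_def)
next
  case (Suc q)
  have len': "length (fs1 @ coords r1 (r1 + q)) = n + q" "length (fs2 @ coords r2 (r2 + q)) = n + q"
    using len by simp_all
  have aff': "\<And>f. f \<in> set (fs1 @ coords r1 (r1 + q)) \<Longrightarrow> aff (r1 + q) f"
    "\<And>f. f \<in> set (fs2 @ coords r2 (r2 + q)) \<Longrightarrow> aff (r2 + q) f"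
    using aff_mono[OF aff(1), of _ "r1 + q"] aff_mono[OF aff(2), of _ "r2 + q"] coords_aff by auto
  have S: "{\<xi> \<in> carrier_vec (Suc (r + q)). vec_first \<xi> (r + q) \<in> {\<xi> \<in> carrier_vec (r + q). vec_first \<xi> r \<in> L}}
     = {\<xi> \<in> carrier_vec (r + Suc q). vec_first \<xi> r \<in> L}" for r and L :: "real vec set"
    by (auto simp: vec_first_first)
  have C: "(fs @ coords r (r + q)) @ [\<lambda>\<xi>. \<xi> $ (r + q)] = fs @ coords r (r + Suc q)" for fs r
    by (simp add: coords_def)
  show ?case using law_eq_ext[OF Suc len' aff'] unfolding S C add_Suc_right .
qed

text \<open>The generic value of a type: its leaves are consecutive entries of \<open>R\<close>, in
  the order in which \<open>flatv\<close> lists them.\<close>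

fun gen :: "(nat \<Rightarrow> 'a) \<Rightarrow> ty \<Rightarrow> nat \<Rightarrow> 'a sv" where
  "gen R TR off = VR (R off)"
| "gen R TI off = VU"
| "gen R (TProd \<tau>1 \<tau>2) off = VP (gen R \<tau>1 off) (gen R \<tau>2 (off + tdim \<tau>1))"

lemma gen_shp: "shp \<tau> (gen R \<tau> off)"
  by (induction \<tau> arbitrary: off) auto

lemma flatv_gen: "flatv (gen R \<tau> off) = map R [off..<off + tdim \<tau>]"
proof (induction \<tau> arbitrary: off)
  case (TProd \<tau>1 \<tau>2)
  have "[off..<off + (tdim \<tau>1 + tdim \<tau>2)] = [off..<off + tdim \<tau>1] @ [off + tdim \<tau>1..<off + tdim \<tau>1 + tdim \<tau>2]"
    using upt_add_eq_append[of off "off + tdim \<tau>1" "tdim \<tau>2"] by (simp add: add.assoc)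
  then show ?case using TProd.IH by (simp add: add.assoc)
qed auto

text \<open>Every value of the right shape is the pullback of the generic one along a map whose
  coordinates from \<open>off\<close> on are its leaves.\<close>

lemma gen_map:
  "shp \<tau> y \<Longrightarrow> (\<And>i \<xi>. i < tdim \<tau> \<Longrightarrow> G \<xi> $ (off + i) = (flatv y ! i) \<xi>) \<Longrightarrow>
   map_sv (\<lambda>f \<omega>. f (G \<omega>)) (gen (\<lambda>i \<omega>. \<omega> $ i) \<tau> off) = y"
proof (induction \<tau> arbitrary: off y)
  case TR
  then obtain f where y: "y = VR f" by auto
  have "G \<xi> $ off = f \<xi>" for \<xi> using TR.prems(2)[of 0 \<xi>] y by simp
  then show ?case using y by (simp add: fun_eq_iff)
next
  case (TProd \<tau>1 \<tau>2)
  then obtain a b where y: "y = VP a b" "shp \<tau>1 a" "shp \<tau>2 b" by auto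
  note l = length_flatv[OF y(2)] length_flatv[OF y(3)]
  have "map_sv (\<lambda>f \<omega>. f (G \<omega>)) (gen (\<lambda>i \<omega>. \<omega> $ i) \<tau>1 off) = a"
  proof (rule TProd.IH(1)[OF y(2)])
    fix i \<xi> assume "i < tdim \<tau>1"
    then show "G \<xi> $ (off + i) = (flatv a ! i) \<xi>" using TProd.prems(2)[of i \<xi>] y(1) l by (simp add: nth_append)
  qed
  moreover have "map_sv (\<lambda>f \<omega>. f (G \<omega>)) (gen (\<lambda>i \<omega>. \<omega> $ i) \<tau>2 (off + tdim \<tau>1)) = b"
  proof (rule TProd.IH(2)[OF y(3)])
    fix i \<xi> assume "i < tdim \<tau>2"
    then show "G \<xi> $ (off + tdim \<tau>1 + i) = (flatv b ! i) \<xi>"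
      using TProd.prems(2)[of "tdim \<tau>1 + i" \<xi>] y(1) l by (simp add: nth_append add.assoc)
  qed
  ultimately show ?case using y by simp
qed auto

text \<open>The order of quantifiers is the point: the weights depend on \<open>f\<close> only and
  not on the list \<open>gs\<close> substituted for the coordinates, so the same weights serve both
  filled programs.\<close>

lemma aff_weights: "\<exists>w b. \<forall>f. aff r f \<longrightarrow> (\<forall>gs \<xi>. length gs = r \<longrightarrow> f (evl gs \<xi>) = lcomb (w f) (b f) gs \<xi>)"
proof -
  have "\<forall>f. \<exists>p. aff r f \<longrightarrow> (\<forall>gs \<xi>. length gs = r \<longrightarrow> f (evl gs \<xi>) = lcomb (fst p) (snd p) gs \<xi>)"
  proof
    fix f :: "real vec \<Rightarrow> real"
    show "\<exists>p. aff r f \<longrightarrow> (\<forall>gs \<xi>. length gs = r \<longrightarrow> f (evl gs \<xi>) = lcomb (fst p) (snd p) gs \<xi>)"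
    proof (cases "aff r f")
      case True
      then obtain u b where "\<And>\<xi>. f \<xi> = (\<Sum>i<r. u i * \<xi> $ i) + b" unfolding aff_def by blast
      then show ?thesis by (intro exI[of _ "(u, b)"]) (simp add: lcomb_def)
    qed simp
  qed
  from choice[OF this] obtain p where
    "\<forall>f. aff r f \<longrightarrow> (\<forall>gs \<xi>. length gs = r \<longrightarrow> f (evl gs \<xi>) = lcomb (fst (p f)) (snd (p f)) gs \<xi>)" by blast
  then show ?thesis by (intro exI[of _ "\<lambda>f. fst (p f)"] exI[of _ "\<lambda>f. snd (p f)"])
qed

subsection \<open>Denotational equality implies contextual equivalence\<close>

text \<open>All draws made before the hole are exposed as auxiliary outputs, because the rest of the
  context may still use them. Their joint law with the value in the hole agrees for both terms by
  \<open>cequiv\<close>; the later draws are independent of these. The result and the conditions of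
  the context are combinations of this tuple, computed once on a generic sample space.\<close>

lemma cequiv_imp_ctx_equiv:
  assumes dist: "distinct (map fst \<Gamma>)"
    and t1: "has_ty None 0 \<Gamma> e1 \<tau>" and t2: "has_ty None 0 \<Gamma> e2 \<tau>"
    and ce: "cequiv (ctx_dim \<Gamma>) (tdim \<tau>) (den \<Gamma> e1) (den \<Gamma> e2)"
  shows "ctx_equiv \<Gamma> \<tau> e1 e2"
  unfolding ctx_equiv_def
proof (intro allI impI)
  fix K \<sigma> assume "has_ty (Some (\<Gamma>, \<tau>)) 0 [] K \<sigma> \<and> holes K = 1"
  then have tK: "has_ty (Some (\<Gamma>, \<tau>)) 0 [] K \<sigma>" and hK: "holes K = 1" by auto
  \<comment> \<open>The numbers of draws of the context before and after the hole, and of real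
    components of the value in the hole.\<close>
  define q1 q2 n where "q1 = nb K" and "q2 = nn K - nb K" and "n = tdim \<tau>"
  have q: "nn K = q1 + q2" using nb_le[of K] by (simp add: q1_def q2_def)
  define h where "h = henv K void (fresh 0)"
  have void_leaves: "flatv (void a :: 'b sv) = []" for a by (simp add: void_def)
  have env_h: "env_shp None 0 \<Gamma> h"
    unfolding h_def by (rule henv_shp[OF tK refl hK]) (simp add: env_shp_def)
  \<comment> \<open>Distinct names make every binding of \<open>\<Gamma>\<close> visible to lookup;
    each then has the shape of its own type, and the concatenation \<open>envs\<close> has the
    length of the environment.\<close>
  have shp_h: "shp \<sigma>' (h (Var x))" if "(x, \<sigma>') \<in> set \<Gamma>" for x \<sigma>'
    using env_h map_of_is_SomeI[OF dist that] unfolding env_shp_def by blast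
  have aff_h: "\<forall>f \<in> set (flatv (h a)). aff q1 f" for a
    unfolding h_def by (rule henv_closed[OF rv_closed_aff])
      (auto simp: void_leaves q1_def fresh_def intro: aff_coord)
  define envs where "envs = concat (map (\<lambda>(x, \<tau>). flatv (h (Var x))) \<Gamma>)"
  have rel: "env_rel \<Gamma> h \<xi> (evl envs \<xi>)" for \<xi>
    unfolding envs_def by (rule env_rel_concat) (rule shp_h)
  have aff_envs: "aff q1 f" if "f \<in> set envs" for f using that aff_h unfolding envs_def by auto
  have envs_first: "evl envs (vec_first \<xi> q1) = evl envs \<xi>" for \<xi>
  proof (rule eq_vecI)
    fix i assume "i < dim_vec (evl envs \<xi>)"
    then have i: "i < length envs" by simp
    from aff_first[OF aff_envs[OF nth_mem[OF i]], of \<xi>] i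
    show "evl envs (vec_first \<xi> q1) $ i = evl envs \<xi> $ i" by simp
  qed simp
  have len_envs: "length envs = ctx_dim \<Gamma>"
    using rel[of undefined] unfolding env_rel_def by (metis carrier_vecD dim_evl)
  obtain \<psi> where gm: "is_gm 0 (q1 + ctx_dim \<Gamma>) \<psi>"
    and rep: "rep 0 (q1 + ctx_dim \<Gamma>) q1 \<psi> (\<lambda>x \<xi>. evl (coords 0 q1 @ envs) \<xi>)"
    using rep_aff[of "coords 0 q1 @ envs" q1 "q1 + ctx_dim \<Gamma>"] aff_envs coords_aff len_envs by fastforce
  \<comment> \<open>The state carries no observation. Conditions that the context imposes before the
    hole are left to \<open>cg\<close> and imposed after those of the term, which gives the same
    solution set.\<close>
  have rep': "rep 0 (q1 + ctx_dim \<Gamma> + 0) q1 \<psi> (\<lambda>x \<xi>. (evl (coords 0 q1) \<xi> @\<^sub>v evl envs \<xi>) @\<^sub>v 0\<^sub>v 0)"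
    using rep by (simp add: evl_append)
  have z: "0\<^sub>v 0 \<in> carrier_vec 0" by simp
  define L where "L e = {\<xi> \<in> carrier_vec (q1 + nn e). \<forall>f \<in> set (con e h (fresh q1)). f \<xi> = 0}" for e
  define y where "y e = val e h (fresh q1)" for e
  define g0 where "g0 e = coords 0 q1 @ flatv (y e)" for e
  have law0: "law_eq (q1 + nn e1) (L e1) (g0 e1) (q1 + nn e2) (L e2) (g0 e2)"
  proof -
    let ?ff = "\<lambda>e. map (\<lambda>i \<xi>. evl (coords 0 q1) (vec_first \<xi> q1) $ i) [0..<q1] @ flatv (val e h (fresh q1))"
    let ?LL = "\<lambda>e. {\<xi> \<in> carrier_vec (q1 + nn e). (\<forall>f \<in> set (con e h (fresh q1)). f \<xi> = 0) \<and> 0\<^sub>v 0 = (0\<^sub>v 0 :: real vec)}"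
    let ?P = "\<lambda>e. (cid q1 \<otimes>\<^sub>c den \<Gamma> e) \<bullet>\<^sub>c (\<psi>, 0\<^sub>v 0)"
    have S: "((succeeds (q1 + tdim \<tau>) (?P e1) \<longleftrightarrow> succeeds (q1 + tdim \<tau>) (?P e2)) \<and>
      (succeeds (q1 + tdim \<tau>) (?P e1) \<and> succeeds (q1 + tdim \<tau>) (?P e2) \<longrightarrow>
         same_posterior (q1 + tdim \<tau>) (?P e1) (?P e2))) \<longleftrightarrow>
      law_eq (q1 + nn e1) (?LL e1) (?ff e1) (q1 + nn e2) (?LL e2) (?ff e2)"
      by (rule state_law_eq[OF t1 t2 rep' z])
        (use len_envs rel envs_first in \<open>auto intro!: carrier_vecI\<close>)
    have "is_cm 0 (q1 + ctx_dim \<Gamma>) (\<psi>, 0\<^sub>v 0)" using gm by (simp add: is_cm_def)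
    with ce have "law_eq (q1 + nn e1) (?LL e1) (?ff e1) (q1 + nn e2) (?LL e2) (?ff e2)"
      unfolding S[symmetric] cequiv_def by blast
    then have "law_eq (q1 + nn e1) (L e1) (?ff e1) (q1 + nn e2) (L e2) (?ff e2)" unfolding L_def by simp
    then show ?thesis unfolding g0_def y_def
      by (rule law_eq_cong) (auto simp: nth_append vec_first_def)
  qed
  have shp_y: "shp \<tau> (y e)" if "has_ty None 0 \<Gamma> e \<tau>" for e
    unfolding y_def by (rule shp_val[OF that env_h])
  have aff_y: "(\<forall>f \<in> set (flatv (y e)). aff (q1 + nn e) f) \<and> (\<forall>f \<in> set (con e h (fresh q1)). aff (q1 + nn e) f)" for e
    unfolding y_def
  proof (rule val_con_closed[OF rv_closed_aff])
    show "\<forall>f \<in> set (flatv (h a)). aff (q1 + nn e) f" for a using aff_h aff_mono by fastforce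
    show "i < nn e \<Longrightarrow> aff (q1 + nn e) (fresh q1 i)" for i by (simp add: fresh_def aff_coord)
  qed
  have len_g0: "length (g0 e) = q1 + n" if "has_ty None 0 \<Gamma> e \<tau>" for e
    using length_flatv[OF shp_y[OF that]] by (simp add: g0_def n_def)
  have aff_g0: "aff (q1 + nn e) f" if "f \<in> set (g0 e)" for e f
    using that aff_y coords_aff unfolding g0_def by auto
  define M where "M e = {\<xi> \<in> carrier_vec (q1 + nn e + q2). vec_first \<xi> (q1 + nn e) \<in> L e}" for e
  define gs where "gs e = g0 e @ coords (q1 + nn e) (q1 + nn e + q2)" for e
  have law1: "law_eq (q1 + nn e1 + q2) (M e1) (gs e1) (q1 + nn e2 + q2) (M e2) (gs e2)"
    unfolding M_def gs_def
    by (rule law_eq_exts[OF law0 len_g0[OF t1] len_g0[OF t2] aff_g0 aff_g0]) (auto simp: L_def)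
  have len_gs: "length (gs e) = q1 + n + q2" if "has_ty None 0 \<Gamma> e \<tau>" for e
    using len_g0[OF that] by (simp add: gs_def)
  have aff_gs: "affv (q1 + nn e + q2) f" if "f \<in> set (gs e)" for e f
    using that aff_mono[OF aff_g0, of f e "q1 + nn e + q2"] coords_aff unfolding gs_def by (auto intro!: aff_affv)
  \<comment> \<open>The generic space has dimension \<open>q1 + n + q2\<close>: draws before the
    hole, leaves of the value in the hole, draws after it. The context numbers its own draws
    consecutively, hence the offset \<open>n\<close> for the later ones.\<close>
  define Xg where "Xg = (\<lambda>i (\<omega> :: real vec). if i < q1 then \<omega> $ i else \<omega> $ (n + i))"
  define \<rho>g where "\<rho>g = void(Hole := gen (\<lambda>i (\<omega> :: real vec). \<omega> $ i) \<tau> q1)"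
  define cg where "cg = con K \<rho>g Xg"
  define vg where "vg = flatv (val K \<rho>g Xg)"
  have aff_g: "(\<forall>f \<in> set vg. aff (q1 + n + q2) f) \<and> (\<forall>f \<in> set cg. aff (q1 + n + q2) f)"
    unfolding vg_def cg_def
  proof (rule val_con_closed[OF rv_closed_aff])
    show "\<forall>f \<in> set (flatv (\<rho>g a)). aff (q1 + n + q2) f" for a
      by (auto simp: \<rho>g_def void_leaves flatv_gen n_def intro: aff_coord)
    show "i < nn K \<Longrightarrow> aff (q1 + n + q2) (Xg i)" for i
      by (cases "i < q1") (auto simp: Xg_def q intro: aff_coord)
  qed
  obtain w b where wb: "\<And>f gs \<xi>. aff (q1 + n + q2) f \<Longrightarrow> length gs = q1 + n + q2 \<Longrightarrow> f (evl gs \<xi>) = lcomb (w f) (b f) gs \<xi>"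
    using aff_weights[of "q1 + n + q2"] by blast
  have main: "sols0 (fill K e) = {\<xi> \<in> M e. \<forall>k<length cg. lcomb (w (cg ! k)) (b (cg ! k)) (gs e) \<xi> = 0} \<and>
      length (outs (fill K e)) = length vg \<and>
      (\<forall>i<length vg. \<forall>\<xi>. (outs (fill K e) ! i) \<xi> = lcomb (w (vg ! i)) (b (vg ! i)) (gs e) \<xi>) \<and>
      nn (fill K e) = q1 + nn e + q2"
    if te: "has_ty None 0 \<Gamma> e \<tau>" for e
  proof -
    \<comment> \<open>Sends a sample point of the filled program to the corresponding point of the
      generic space. The draws of \<open>e\<close> itself are forgotten; they act only through the
      value and the conditions of \<open>e\<close>.\<close>
    define G where "G = evl (gs e)"
    define X where "X = cut q1 (nn e) (fresh 0)"
    define \<rho> where "\<rho> = void(Hole := y e)"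
    have ly: "length (flatv (y e)) = n" using length_flatv[OF shp_y[OF te]] by (simp add: n_def)
    have fh: "fresh 0 = (\<lambda>i (\<xi> :: real vec). \<xi> $ i)" by (simp add: fresh_def)
    have sh: "shift q1 (fresh 0) = fresh q1" by simp
    have F: "val (fill K e) void (fresh 0) = val K \<rho> X"
      "set (con (fill K e) void (fresh 0)) = set (con K \<rho> X) \<union> set (con e h (fresh q1))"
      using fill_sem[OF hK, of e void "fresh 0"]
      unfolding h_def[symmetric] q1_def[symmetric] sh y_def[symmetric] \<rho>_def X_def by auto
    have Gi: "G \<xi> $ i = (gs e ! i) \<xi>" if "i < q1 + n + q2" for \<xi> i using that len_gs[OF te] by (simp add: G_def)
    have yg: "map_sv (\<lambda>f \<omega>. f (G \<omega>)) (gen (\<lambda>i \<omega>. \<omega> $ i) \<tau> q1) = y e"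
    proof (rule gen_map[OF shp_y[OF te]])
      fix i \<xi> assume "i < tdim \<tau>"
      then show "G \<xi> $ (q1 + i) = (flatv (y e) ! i) \<xi>"
        using Gi[of "q1 + i" \<xi>] ly by (simp add: gs_def g0_def nth_append n_def)
    qed
    have \<rho>eq: "(\<lambda>a. map_sv (\<lambda>f \<omega>. f (G \<omega>)) (\<rho>g a)) = \<rho>"
      using yg by (auto simp: \<rho>g_def \<rho>_def void_def fun_eq_iff)
    have Xeq: "X i = (\<lambda>\<omega>. Xg i (G \<omega>))" if i: "i < nn K" for i
    proof (cases "i < q1")
      case True
      then show ?thesis using Gi[of i] by (simp add: X_def cut_def Xg_def fh gs_def g0_def nth_append)
    next
      case False
      then obtain j where j: "i = q1 + j" using le_Suc_ex[of q1 i] by auto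
      then have "G \<xi> $ (n + i) = \<xi> $ (q1 + nn e + j)" for \<xi>
        using Gi[of "q1 + n + j" \<xi>] i q len_g0[OF te] by (simp add: gs_def nth_append ac_simps)
      then show ?thesis using False j by (simp add: X_def cut_def Xg_def fh ac_simps)
    qed
    have nat: "val K \<rho> X = map_sv (\<lambda>f \<omega>. f (G \<omega>)) (val K \<rho>g Xg) \<and> con K \<rho> X = map (\<lambda>f \<omega>. f (G \<omega>)) cg"
      using stream_cong[of K X "\<lambda>i \<omega>. Xg i (G \<omega>)" \<rho>] Xeq naturality[of K G \<rho>g Xg] unfolding \<rho>eq cg_def by simp
    have tF: "has_ty None 0 [] (fill K e) \<sigma>" by (rule fill_ty[OF tK refl te])
    have nF: "nn (fill K e) = q1 + nn e + q2" using fill_nn[OF hK] q by simp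
    have "outs (fill K e) = map (\<lambda>f \<omega>. f (G \<omega>)) vg"
      unfolding closed_void(1)[OF tF] F(1) using nat by (simp add: vg_def flatv_map)
    moreover have "(vg ! i) (G \<xi>) = lcomb (w (vg ! i)) (b (vg ! i)) (gs e) \<xi>" if "i < length vg" for i \<xi>
      unfolding G_def using aff_g that by (intro wb len_gs[OF te]) auto
    moreover have "sols0 (fill K e) = {\<xi> \<in> M e. \<forall>k<length cg. lcomb (w (cg ! k)) (b (cg ! k)) (gs e) \<xi> = 0}"
    proof -
      have c1: "(\<forall>f \<in> set (con K \<rho> X). f \<xi> = 0) \<longleftrightarrow> (\<forall>k<length cg. lcomb (w (cg ! k)) (b (cg ! k)) (gs e) \<xi> = 0)" for \<xi>
      proof -
        have "(cg ! k) (G \<xi>) = lcomb (w (cg ! k)) (b (cg ! k)) (gs e) \<xi>" if "k < length cg" for k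
          unfolding G_def using aff_g that by (intro wb len_gs[OF te]) auto
        then show ?thesis using nat by (simp add: all_set_conv_all_nth)
      qed
      have c2: "(\<forall>f \<in> set (con e h (fresh q1)). f \<xi> = 0) \<longleftrightarrow> vec_first \<xi> (q1 + nn e) \<in> L e" for \<xi>
      proof -
        have "f \<xi> = f (vec_first \<xi> (q1 + nn e))" if "f \<in> set (con e h (fresh q1))" for f
          using aff_first[of "q1 + nn e" f \<xi>] aff_y[of e] that by blast
        then have "(\<forall>f \<in> set (con e h (fresh q1)). f \<xi> = 0) \<longleftrightarrow>
            (\<forall>f \<in> set (con e h (fresh q1)). f (vec_first \<xi> (q1 + nn e)) = 0)" by metis
        then show ?thesis unfolding L_def by simp
      qed
      show ?thesis unfolding closed_void(2)[OF tF] F(2) nF M_def using c1 c2 by (auto simp: ball_Un)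
    qed
    ultimately show ?thesis using nF by simp
  qed
  note m1 = main[OF t1] and m2 = main[OF t2]
  have "law_eq (q1 + nn e1 + q2) (sols0 (fill K e1)) (gs e1) (q1 + nn e2 + q2) (sols0 (fill K e2)) (gs e2)"
    unfolding conjunct1[OF m1] conjunct1[OF m2]
    by (rule law_eq_cond[OF law1 len_gs[OF t1] len_gs[OF t2] aff_gs aff_gs])
  then have "law_eq (q1 + nn e1 + q2) (sols0 (fill K e1)) (outs (fill K e1))
      (q1 + nn e2 + q2) (sols0 (fill K e2)) (outs (fill K e2))"
    by (rule law_eq_out[OF _ len_gs[OF t1] len_gs[OF t2], where w = "\<lambda>i. w (vg ! i)" and b = "\<lambda>i. b (vg ! i)" and N = "length vg"])
      (use m1 m2 aff_gs in auto)
  then have "law_eq (nn (fill K e1)) (sols0 (fill K e1)) (outs (fill K e1))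
      (nn (fill K e2)) (sols0 (fill K e2)) (outs (fill K e2))" using m1 m2 by simp
  then show "(steps (Conf (fill K e1) gauss0) Bot \<longleftrightarrow> steps (Conf (fill K e2) gauss0) Bot) \<and>
        (\<forall>v1 \<psi>1 v2 \<psi>2. steps (Conf (fill K e1) gauss0) (Conf v1 \<psi>1) \<and> is_val v1 \<and>
                        steps (Conf (fill K e2) gauss0) (Conf v2 \<psi>2) \<and> is_val v2 \<longrightarrow>
                        push v1 \<psi>1 = push v2 \<psi>2)"
    unfolding operational_law_eq[OF fill_ty[OF tK refl t1] fill_ty[OF tK refl t2]] .
qed

subsection \<open>Factorisation of covariance matrices\<close>

text \<open>The form evaluated at \<open>x + t u\<close> is a nonnegative polynomial of degree at
  most two in t, and the inequality expresses its discriminant. It also covers the degenerate case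
  in which \<open>u\<close> has length zero.\<close>

lemma psd_cauchy:
  fixes S :: "real mat"
  assumes S: "S \<in> carrier_mat n n" and psd: "psd S" and u: "u \<in> carrier_vec n" and x: "x \<in> carrier_vec n"
  shows "(u \<bullet> (S *\<^sub>v x))\<^sup>2 \<le> (u \<bullet> (S *\<^sub>v u)) * (x \<bullet> (S *\<^sub>v x))"
proof -
  have sym: "transpose_mat S = S" and pos: "\<And>y. y \<in> carrier_vec n \<Longrightarrow> 0 \<le> y \<bullet> (S *\<^sub>v y)"
    using psd S unfolding psd_def by auto
  define a b c where "a = u \<bullet> (S *\<^sub>v u)" and "b = u \<bullet> (S *\<^sub>v x)" and "c = x \<bullet> (S *\<^sub>v x)"
  have b': "x \<bullet> (S *\<^sub>v u) = b" using sym_scalar_swap[OF S sym x u] by (simp add: b_def)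
  have quad: "0 \<le> c + 2 * t * b + t\<^sup>2 * a" for t
  proof -
    have Su: "S *\<^sub>v u \<in> carrier_vec n" "S *\<^sub>v x \<in> carrier_vec n" using S u x by auto
    have e: "S *\<^sub>v (x + t \<cdot>\<^sub>v u) = S *\<^sub>v x + t \<cdot>\<^sub>v (S *\<^sub>v u)"
      using mult_add_distrib_mat_vec[OF S x, of "t \<cdot>\<^sub>v u"] mult_mat_vec[OF S u, of t] u by simp
    have "(x + t \<cdot>\<^sub>v u) \<bullet> (S *\<^sub>v (x + t \<cdot>\<^sub>v u)) = c + t * (x \<bullet> (S *\<^sub>v u)) + (t * b + t * (t * a))"
      unfolding e a_def b_def c_def using x u Su
      by (simp add: add_scalar_prod_distrib[of _ n] scalar_prod_add_distrib[of _ n]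
          scalar_prod_smult_distrib[of _ n] smult_scalar_prod_distrib[of _ n] distrib_left)
    then show ?thesis using pos[of "x + t \<cdot>\<^sub>v u"] x u b' by (simp add: power2_eq_square algebra_simps)
  qed
  have "b\<^sup>2 \<le> a * c"
  proof (cases "a = 0")
    case True
    have "b = 0"
    proof (rule ccontr)
      assume nz: "b \<noteq> 0"
      \<comment> \<open>With \<open>a = 0\<close> the polynomial is linear; this point is chosen so
        that its value is -1.\<close>
      have "0 \<le> c + 2 * (- (c + 1) / (2 * b)) * b" using quad[of "- (c + 1) / (2 * b)"] True by simp
      also have "\<dots> = - 1" using nz by (simp add: field_simps)
      finally show False by simp
    qed
    then show ?thesis using True by simp
  next
    case False
    then have a: "a > 0" using pos[OF u] unfolding a_def by simp
    \<comment> \<open>The minimum of the polynomial is attained at t = -b/a.\<close>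
    have "0 \<le> c + 2 * (- b / a) * b + (- b / a)\<^sup>2 * a" by (rule quad)
    also have "\<dots> = c - b\<^sup>2 / a" using a by (simp add: power2_eq_square field_simps)
    finally show ?thesis using a by (simp add: field_simps)
  qed
  then show ?thesis unfolding a_def b_def c_def .
qed

text \<open>Symmetric elimination: after \<open>k\<close> rounds the remainder is positive
  semidefinite with its first \<open>k\<close> rows zero, and each round with a positive pivot
  splits off a rank-one term, appended to \<open>M\<close> as a column. A zero pivot needs no round,
  because its row vanishes already.\<close>

lemma psd_gram_factor:
  fixes S :: "real mat"
  assumes S: "S \<in> carrier_mat n n" and psd: "psd S"
  shows "\<exists>s M. M \<in> carrier_mat n s \<and> S = M * transpose_mat M"
proof -
  have "\<exists>s M S'. M \<in> carrier_mat n s \<and> S' \<in> carrier_mat n n \<and> psd S' \<and> S = M * transpose_mat M + S' \<and>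
      (\<forall>i<k. \<forall>j<n. S' $$ (i, j) = 0)" if "k \<le> n" for k
    using that
  proof (induction k)
    case 0
    have "S = 0\<^sub>m n 0 * transpose_mat (0\<^sub>m n 0) + S" using S by (intro eq_matI) (auto simp: scalar_prod_def)
    then show ?case using S psd by (intro exI[of _ 0] exI[of _ "0\<^sub>m n 0"] exI[of _ S]) auto
  next
    case (Suc k)
    then obtain s M S' where M: "M \<in> carrier_mat n s" and S': "S' \<in> carrier_mat n n" and p: "psd S'"
      and e: "S = M * transpose_mat M + S'" and z: "\<And>i j. i < k \<Longrightarrow> j < n \<Longrightarrow> S' $$ (i, j) = 0" by auto
    have sym: "transpose_mat S' = S'" and pos: "\<And>y. y \<in> carrier_vec n \<Longrightarrow> 0 \<le> y \<bullet> (S' *\<^sub>v y)"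
      using p S' unfolding psd_def by auto
    have symi: "S' $$ (i, j) = S' $$ (j, i)" if "i < n" "j < n" for i j
      using sym S' that by (metis index_transpose_mat(1) carrier_matD)
    have k: "k < n" using Suc.prems by simp
    define u where "u = (unit_vec n k :: real vec)"
    have u: "u \<in> carrier_vec n" by (simp add: u_def)
    have Su: "(S' *\<^sub>v u) $ i = S' $$ (i, k)" if "i < n" for i
      using S' that k by (simp add: u_def)
    have sk: "u \<bullet> (S' *\<^sub>v u) = S' $$ (k, k)"
      using S' k Su[OF k] scalar_prod_left_unit[of "S' *\<^sub>v u" n k] u by (simp add: u_def)
    show ?case
    proof (cases "S' $$ (k, k) = 0")
      case True
      \<comment> \<open>By the Cauchy-Schwarz inequality a zero on the diagonal of a positive
        semidefinite matrix forces its whole row to vanish.\<close>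
      have "S' $$ (k, j) = 0" if j: "j < n" for j
      proof -
        have "(u \<bullet> (S' *\<^sub>v unit_vec n j))\<^sup>2 \<le> 0"
          using psd_cauchy[OF S' p u, of "unit_vec n j"] sk True by simp
        then have "u \<bullet> (S' *\<^sub>v unit_vec n j) = 0" by simp
        then show ?thesis using S' k j scalar_prod_left_unit[of "S' *\<^sub>v unit_vec n j" n k] by (simp add: u_def)
      qed
      then have "\<forall>i<Suc k. \<forall>j<n. S' $$ (i, j) = 0" using z by (auto simp: less_Suc_eq)
      then show ?thesis using M S' p e by blast
    next
      case False
      then have sp: "S' $$ (k, k) > 0" using pos[OF u] sk by simp
      define S2 where "S2 = deflate S' u"
      have S2: "S2 \<in> carrier_mat n n" unfolding S2_def by (rule deflate_carrier[OF S'])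
      have S2i: "S2 $$ (i, j) = S' $$ (i, j) - S' $$ (i, k) * S' $$ (j, k) / S' $$ (k, k)" if "i < n" "j < n" for i j
        unfolding S2_def using deflate_index[OF S' sym u that] Su that sk by simp
      have psd2: "psd S2"
      proof -
        have "0 \<le> x \<bullet> (S2 *\<^sub>v x)" if x: "x \<in> carrier_vec n" for x
        proof -
          have ux: "(S' *\<^sub>v u) \<bullet> x = u \<bullet> (S' *\<^sub>v x)" using sym_scalar[OF S' sym u x] by simp
          have xu: "x \<bullet> (S' *\<^sub>v u) = u \<bullet> (S' *\<^sub>v x)" by (rule sym_scalar_swap[OF S' sym x u])
          have Sv: "S' *\<^sub>v x \<in> carrier_vec n" "S' *\<^sub>v u \<in> carrier_vec n" using S' x u by auto
          have "x \<bullet> (S2 *\<^sub>v x) = x \<bullet> (S' *\<^sub>v x) - (u \<bullet> (S' *\<^sub>v x))\<^sup>2 / S' $$ (k, k)"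
            unfolding S2_def deflate_mult_vec[OF S' sym u x] ux sk
            using x Sv xu by (simp add: scalar_prod_minus_distrib[of _ n] scalar_prod_smult_distrib[of _ n] power2_eq_square)
          moreover have "(u \<bullet> (S' *\<^sub>v x))\<^sup>2 / S' $$ (k, k) \<le> x \<bullet> (S' *\<^sub>v x)"
            using psd_cauchy[OF S' p u x] sk sp by (simp add: field_simps)
          ultimately show ?thesis by simp
        qed
        then show ?thesis unfolding psd_def using S2 deflate_sym[OF S' sym u] by (auto simp: S2_def)
      qed
      \<comment> \<open>Column \<open>k\<close> divided by the square root of the pivot, so that W
        W^T is precisely the term removed by \<open>deflate\<close>.\<close>
      define W where "W = mat n 1 (\<lambda>(i, j). S' $$ (i, k) / sqrt (S' $$ (k, k)))"
      have W: "W \<in> carrier_mat n 1" by (simp add: W_def)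
      have WW: "(W * transpose_mat W) $$ (i, j) = S' $$ (i, k) * S' $$ (j, k) / S' $$ (k, k)" if "i < n" "j < n" for i j
        using that sp by (simp add: W_def scalar_prod_def)
      have "S' = W * transpose_mat W + S2"
      proof (rule eq_matI)
        fix i j assume "i < dim_row (W * transpose_mat W + S2)" "j < dim_col (W * transpose_mat W + S2)"
        then have ij: "i < n" "j < n" using S2 by auto
        have "(W * transpose_mat W + S2) $$ (i, j) = (W * transpose_mat W) $$ (i, j) + S2 $$ (i, j)"
          using ij S2 by (intro index_add_mat) auto
        then show "S' $$ (i, j) = (W * transpose_mat W + S2) $$ (i, j)" unfolding WW[OF ij] S2i[OF ij] by simp
      qed (use S' S2 in auto)
      then have "S = hcat M W * transpose_mat (hcat M W) + S2"
        unfolding hcat_gram[OF M W] using e M W S2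
        by (metis assoc_add_mat mult_carrier_mat transpose_carrier_mat)
      moreover have "S2 $$ (i, j) = 0" if "i < Suc k" "j < n" for i j
      proof (cases "i = k")
        case True
        then show ?thesis using S2i[of k j] k that sp symi[OF k that(2)] by simp
      next
        case False
        then show ?thesis using S2i[of i j] z[of i j] z[of i k] that k by simp
      qed
      ultimately show ?thesis using hcat_carrier[OF M W] S2 psd2 by blast
    qed
  qed
  from this[of n] obtain s M S' where M: "M \<in> carrier_mat n s" and S': "S' \<in> carrier_mat n n"
    and e: "S = M * transpose_mat M + S'" and z: "\<forall>i<n. \<forall>j<n. S' $$ (i, j) = 0" by auto
  have "S' = 0\<^sub>m n n" using S' z by (intro eq_matI) auto
  then have "S = M * transpose_mat M" using e M by simp
  with M show ?thesis by blast
qed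

subsection \<open>Inference problems are definable\<close>

text \<open>Provides the noise vector of a state. The variable \<open>B\<close> is bound outermost,
  so draw number j is stored in \<open>B + j\<close>.\<close>

fun nlets :: "nat \<Rightarrow> nat \<Rightarrow> tm \<Rightarrow> tm" where
  "nlets B 0 t = t"
| "nlets B (Suc s) t = nlets B s (Let (B + s) Normal t)"

definition zenv :: "nat \<Rightarrow> nat \<Rightarrow> (tm \<Rightarrow> 'a sv) \<Rightarrow> (nat \<Rightarrow> 'a) \<Rightarrow> tm \<Rightarrow> 'a sv" where
  "zenv B s \<rho> X a = (case a of Var v \<Rightarrow> if B \<le> v \<and> v < B + s then VR (X (v - B)) else \<rho> a | _ \<Rightarrow> \<rho> a)"

lemma nlets_sem:
  "val (nlets B s t) \<rho> X = val t (zenv B s \<rho> X) (shift s X) \<and>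
   con (nlets B s t) \<rho> X = con t (zenv B s \<rho> X) (shift s X)"
proof (induction s arbitrary: t)
  case 0
  have "zenv B 0 \<rho> X = \<rho>" by (auto simp: zenv_def fun_eq_iff split: tm.split)
  then show ?case by simp
next
  case (Suc s)
  have "(zenv B s \<rho> X)(Var (B + s) := VR (X s)) = zenv B (Suc s) \<rho> X"
    by (auto simp: zenv_def fun_eq_iff split: tm.split)
  moreover have "shift s X 0 = X s" by (simp add: shift_def)
  ultimately show ?case using Suc[of "Let (B + s) Normal t"] by (simp del: fun_upd_apply)
qed

lemma nlets_simps [simp]:
  "nn (nlets B s t) = s + nn t" "holes (nlets B s t) = holes t" "fill (nlets B s t) e = nlets B s (fill t e)"
  by (induction s arbitrary: t) auto

definition zctx :: "nat \<Rightarrow> nat \<Rightarrow> env" where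
  "zctx B s = map (\<lambda>i. (B + i, TR)) (rev [0..<s])"

lemma nlets_ty: "has_ty H r (zctx B s @ \<Delta>) t \<tau> \<Longrightarrow> has_ty H r \<Delta> (nlets B s t) \<tau>"
proof (induction s arbitrary: t)
  case (Suc s)
  have "zctx B (Suc s) = (B + s, TR) # zctx B s" by (simp add: zctx_def)
  with Suc.prems have "has_ty H r (zctx B s @ \<Delta>) (Let (B + s) Normal t) \<tau>" by (auto simp: has_ty_simps)
  from Suc.IH[OF this] show ?case by simp
qed (simp add: zctx_def)

lemma zctx_lookup: "i < s \<Longrightarrow> map_of (zctx B s @ \<Delta>) (B + i) = Some TR"
  by (induction s) (auto simp: zctx_def less_Suc_eq)

text \<open>One coordinate of an affine image of the noise vector, as a term: \<open>w\<close> is a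
  row of the noise factor and \<open>b\<close> the entry of the mean.\<close>

fun rowt :: "nat \<Rightarrow> (nat \<Rightarrow> real) \<Rightarrow> real \<Rightarrow> nat \<Rightarrow> tm" where
  "rowt B w b 0 = Const b"
| "rowt B w b (Suc s) = Plus (rowt B w b s) (Scale (w s) (Var (B + s)))"

lemma rowt_simps [simp]: "nn (rowt B w b s) = 0" "holes (rowt B w b s) = 0" "con (rowt B w b s) \<rho> X = []"
  by (induction s arbitrary: X) auto

lemma rowt_sem:
  "(\<And>i. i < s \<Longrightarrow> \<rho> (Var (B + i)) = VR (Z i)) \<Longrightarrow>
   val (rowt B w b s) \<rho> X = VR (\<lambda>\<omega>. (\<Sum>i<s. w i * Z i \<omega>) + b)"
  by (induction s arbitrary: X) (auto simp: algebra_simps)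

lemma rowt_ty: "(\<And>i. i < s \<Longrightarrow> map_of \<Gamma> (B + i) = Some TR) \<Longrightarrow> has_ty H r \<Gamma> (rowt B w b s) TR"
  by (induction s) (auto simp: has_ty_simps)

fun tup :: "(nat \<Rightarrow> tm) \<Rightarrow> ty \<Rightarrow> nat \<Rightarrow> tm" where
  "tup rw TR off = rw off"
| "tup rw TI off = Unit"
| "tup rw (TProd \<tau>1 \<tau>2) off = Pair (tup rw \<tau>1 off) (tup rw \<tau>2 (off + tdim \<tau>1))"

text \<open>Requires the same result for every stream, no conditions and no draws, so that rows may
  be placed anywhere in a program without disturbing what surrounds them.\<close>

definition evals :: "(nat \<Rightarrow> tm) \<Rightarrow> (tm \<Rightarrow> 'w rv sv) \<Rightarrow> (nat \<Rightarrow> 'w rv) \<Rightarrow> bool" where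
  "evals rw \<rho> R \<longleftrightarrow> (\<forall>i X. val (rw i) \<rho> X = VR (R i) \<and> con (rw i) \<rho> X = [] \<and> nn (rw i) = 0)"

lemma tup_sem: "evals rw \<rho> R \<Longrightarrow>
    val (tup rw \<tau> off) \<rho> X = gen R \<tau> off \<and> con (tup rw \<tau> off) \<rho> X = [] \<and> nn (tup rw \<tau> off) = 0"
  by (induction \<tau> arbitrary: off X) (auto simp: evals_def)

lemma tup_ty: "(\<And>i. has_ty H r \<Gamma> (rw i) TR) \<Longrightarrow> has_ty H r \<Gamma> (tup rw \<tau> off) \<tau>"
  by (induction \<tau> arbitrary: off) (auto simp: has_ty_simps)

lemma tup_holes: "(\<And>i. holes (rw i) = 0) \<Longrightarrow> holes (tup rw \<tau> off) = 0"
  by (induction \<tau> arbitrary: off) auto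

fun otup :: "(nat \<Rightarrow> tm) \<Rightarrow> nat list \<Rightarrow> tm" where
  "otup rw [] = Unit"
| "otup rw (i # is) = Pair (rw i) (otup rw is)"

lemma otup_sem: "evals rw \<rho> R \<Longrightarrow>
    flatv (val (otup rw is) \<rho> X) = map R is \<and> con (otup rw is) \<rho> X = [] \<and> nn (otup rw is) = 0"
  by (induction "is" arbitrary: X) (auto simp: evals_def)

lemma otup_ty: "(\<And>i. has_ty H r \<Gamma> (rw i) TR) \<Longrightarrow> has_ty H r \<Gamma> (otup rw is) (foldr (\<lambda>_. TProd TR) is TI)"
  by (induction "is") (auto simp: has_ty_simps)

lemma otup_holes: "(\<And>i. holes (rw i) = 0) \<Longrightarrow> holes (otup rw is) = 0"
  by (induction "is") auto

text \<open>The head of \<open>\<Gamma>\<close> is bound innermost, hence most recently, in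
  agreement with the order of contexts; offsets nevertheless increase from the head, in agreement
  with \<open>lookup_off\<close>.\<close>

fun xlets :: "(nat \<Rightarrow> tm) \<Rightarrow> env \<Rightarrow> nat \<Rightarrow> tm \<Rightarrow> tm" where
  "xlets rw [] off t = t"
| "xlets rw ((x, \<tau>) # \<Gamma>) off t = xlets rw \<Gamma> (off + tdim \<tau>) (Let x (tup rw \<tau> off) t)"

fun xenv :: "(nat \<Rightarrow> 'a) \<Rightarrow> env \<Rightarrow> nat \<Rightarrow> (tm \<Rightarrow> 'a sv) \<Rightarrow> tm \<Rightarrow> 'a sv" where
  "xenv R [] off \<rho> = \<rho>"
| "xenv R ((x, \<tau>) # \<Gamma>) off \<rho> = (xenv R \<Gamma> (off + tdim \<tau>) \<rho>)(Var x := gen R \<tau> off)"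

lemma xenv_ge: "(\<And>x. x \<in> fst ` set \<Gamma> \<Longrightarrow> x < B) \<Longrightarrow> B \<le> v \<Longrightarrow> xenv R \<Gamma> off \<rho> (Var v) = \<rho> (Var v)"
proof (induction \<Gamma> arbitrary: off)
  case (Cons p \<Gamma>)
  then show ?case by (cases p) fastforce
qed simp

text \<open>The rows depend only on variables from \<open>B\<close> on. The names bound here all lie
  below \<open>B\<close>, so the bindings made by the outer lets do not affect the rows evaluated
  inside them.\<close>

lemma xlets_sem:
  "(\<And>\<rho>'. (\<And>v. B \<le> v \<Longrightarrow> \<rho>' (Var v) = \<rho> (Var v)) \<Longrightarrow> evals rw \<rho>' R) \<Longrightarrow>
   (\<And>x. x \<in> fst ` set \<Gamma> \<Longrightarrow> x < B) \<Longrightarrow>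
   val (xlets rw \<Gamma> off t) \<rho> X = val t (xenv R \<Gamma> off \<rho>) X \<and>
   con (xlets rw \<Gamma> off t) \<rho> X = con t (xenv R \<Gamma> off \<rho>) X \<and> nn (xlets rw \<Gamma> off t) = nn t"
proof (induction \<Gamma> arbitrary: off t)
  case (Cons p \<Gamma>)
  obtain x \<tau> where p: "p = (x, \<tau>)" by force
  have "evals rw (xenv R \<Gamma> (off + tdim \<tau>) \<rho>) R"
    by (rule Cons.prems(1)) (rule xenv_ge[of \<Gamma> B], use Cons.prems(2) in auto)
  note T = tup_sem[OF this, of \<tau> off]
  have "val (xlets rw \<Gamma> (off + tdim \<tau>) (Let x (tup rw \<tau> off) t)) \<rho> X = val (Let x (tup rw \<tau> off) t) (xenv R \<Gamma> (off + tdim \<tau>) \<rho>) X \<and>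
   con (xlets rw \<Gamma> (off + tdim \<tau>) (Let x (tup rw \<tau> off) t)) \<rho> X = con (Let x (tup rw \<tau> off) t) (xenv R \<Gamma> (off + tdim \<tau>) \<rho>) X \<and>
   nn (xlets rw \<Gamma> (off + tdim \<tau>) (Let x (tup rw \<tau> off) t)) = nn (Let x (tup rw \<tau> off) t)"
    by (rule Cons.IH[OF Cons.prems(1)]) (use Cons.prems(2) in auto)
  then show ?case using T by (simp add: p del: fun_upd_apply)
qed simp

lemma xlets_holes: "(\<And>i. holes (rw i) = 0) \<Longrightarrow> holes (xlets rw \<Gamma> off t) = holes t"
  by (induction rw \<Gamma> off t rule: xlets.induct) (auto simp: tup_holes)

lemma xlets_fill: "(\<And>i. holes (rw i) = 0) \<Longrightarrow> fill (xlets rw \<Gamma> off t) e = xlets rw \<Gamma> off (fill t e)"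
  by (induction rw \<Gamma> off t rule: xlets.induct) (auto simp: tup_holes fill_no_hole)

lemma xlets_ty:
  "has_ty H r (\<Gamma> @ \<Delta>) t \<tau> \<Longrightarrow>
   (\<And>\<Gamma>' i. (\<And>v. B \<le> v \<Longrightarrow> map_of \<Gamma>' v = map_of \<Delta> v) \<Longrightarrow> has_ty H r \<Gamma>' (rw i) TR) \<Longrightarrow>
   (\<And>x. x \<in> fst ` set \<Gamma> \<Longrightarrow> x < B) \<Longrightarrow> has_ty H r \<Delta> (xlets rw \<Gamma> off t) \<tau>"
proof (induction \<Gamma> arbitrary: off t)
  case (Cons p \<Gamma>)
  obtain x \<sigma> where p: "p = (x, \<sigma>)" by force
  have "map_of (\<Gamma> @ \<Delta>) v = map_of \<Delta> v" if "B \<le> v" for v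
  proof -
    have "v \<notin> fst ` set \<Gamma>" using Cons.prems(3)[of v] that by auto
    then have "map_of \<Gamma> v = None" by (simp add: map_of_eq_None_iff)
    then show ?thesis by (simp add: map_add_def)
  qed
  then have "has_ty H r (\<Gamma> @ \<Delta>) (tup rw \<sigma> off) \<sigma>" by (intro tup_ty Cons.prems(2))
  then have "has_ty H r (\<Gamma> @ \<Delta>) (Let x (tup rw \<sigma> off) t) \<tau>"
    using Cons.prems(1) by (auto simp: has_ty_simps p)
  then have "has_ty H r \<Delta> (xlets rw \<Gamma> (off + tdim \<sigma>) (Let x (tup rw \<sigma> off) t)) \<tau>"
    by (rule Cons.IH[OF _ Cons.prems(2)]) (use Cons.prems(3) in auto)
  then show ?case by (simp add: p)
qed simp

lemma xenv_rel: "env_rel \<Gamma> (xenv R \<Gamma> off \<rho>) \<omega> (evl (map R [off..<off + ctx_dim \<Gamma>]) \<omega>)"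
proof (induction \<Gamma> arbitrary: off)
  case Nil
  have "vNil \<in> carrier_vec 0" by (intro carrier_vecI) simp
  then show ?case by (simp add: env_rel_def ctx_dim_def)
next
  case (Cons p \<Gamma>)
  obtain x \<tau> where p: "p = (x, \<tau>)" by force
  have c: "ctx_dim (p # \<Gamma>) = tdim \<tau> + ctx_dim \<Gamma>" by (simp add: p ctx_dim_def)
  have u: "[off..<off + (tdim \<tau> + ctx_dim \<Gamma>)] = [off..<off + tdim \<tau>] @ [off + tdim \<tau>..<off + tdim \<tau> + ctx_dim \<Gamma>]"
    using upt_add_eq_append[of off "off + tdim \<tau>" "ctx_dim \<Gamma>"] by (simp add: add.assoc)
  show ?case
    using env_rel_upd[OF Cons[of "off + tdim \<tau>"] gen_shp[of \<tau> R off], of x]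
    unfolding c u map_append evl_append by (simp add: p flatv_gen del: fun_upd_apply)
qed

text \<open>Imposes equations one after the other for their effect only; \<open>U\<close> receives
  the unit results.\<close>

fun clets :: "vname \<Rightarrow> tm list \<Rightarrow> tm \<Rightarrow> tm" where
  "clets U [] t = t"
| "clets U (c # cs) t = Let U (Eq c (Const 0)) (clets U cs t)"

text \<open>Since \<open>U\<close> holds \<open>VU\<close> from the start, binding it to the result
  of an equation leaves the environment unchanged.\<close>

lemma clets_sem:
  "evals rw \<rho> R \<Longrightarrow> \<rho> (Var U) = VU \<Longrightarrow>
   val (clets U (map rw is) t) \<rho> X = val t \<rho> X \<and>
   set (con (clets U (map rw is) t) \<rho> X) = set (con t \<rho> X) \<union> R ` set is \<and>
   nn (clets U (map rw is) t) = nn t"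
proof (induction "is")
  case (Cons i "is")
  have "\<rho>(Var U := VU) = \<rho>" using Cons.prems(2) by (auto simp: fun_eq_iff)
  moreover have "val (rw i) \<rho> X = VR (R i)" "con (rw i) \<rho> X = []" "nn (rw i) = 0"
    using Cons.prems(1) unfolding evals_def by auto
  ultimately show ?case using Cons.IH[OF Cons.prems] by (auto simp del: fun_upd_apply)
qed simp

lemma clets_holes: "(\<And>i. holes (rw i) = 0) \<Longrightarrow> holes (clets U (map rw is) t) = holes t"
  by (induction "is") auto

lemma clets_fill: "(\<And>i. holes (rw i) = 0) \<Longrightarrow> fill (clets U (map rw is) t) e = clets U (map rw is) (fill t e)"
  by (induction "is") (auto simp: fill_no_hole)

lemma clets_ty:
  "(\<And>\<Gamma>' i. (\<And>v. v \<noteq> U \<Longrightarrow> map_of \<Gamma>' v = map_of \<Gamma> v) \<Longrightarrow> has_ty H r \<Gamma>' (rw i) TR) \<Longrightarrow>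
   (\<And>\<Gamma>'. (\<And>v. v \<noteq> U \<Longrightarrow> map_of \<Gamma>' v = map_of \<Gamma> v) \<Longrightarrow> has_ty H r \<Gamma>' t \<tau>) \<Longrightarrow>
   has_ty H r \<Gamma> (clets U (map rw is) t) \<tau>"
proof (induction "is" arbitrary: \<Gamma>)
  case (Cons i "is")
  have "has_ty H r \<Gamma> (rw i) TR" by (rule Cons.prems(1)) simp
  moreover have "has_ty H r ((U, TI) # \<Gamma>) (clets U (map rw is) t) \<tau>"
  proof (rule Cons.IH)
    show "has_ty H r \<Gamma>' (rw j) TR" if "\<And>v. v \<noteq> U \<Longrightarrow> map_of \<Gamma>' v = map_of ((U, TI) # \<Gamma>) v" for \<Gamma>' j
      by (rule Cons.prems(1)) (simp add: that)
    show "has_ty H r \<Gamma>' t \<tau>" if "\<And>v. v \<noteq> U \<Longrightarrow> map_of \<Gamma>' v = map_of ((U, TI) # \<Gamma>) v" for \<Gamma>'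
      by (rule Cons.prems(2)) (simp add: that)
  qed
  ultimately show ?case by (auto simp: has_ty_simps)
qed simp

text \<open>The context \<open>W\<close> draws the noise of the given state, imposes the
  observations of the state, binds the variables of \<open>\<Gamma>\<close> to its middle components
  and returns its first \<open>a\<close> components next to the hole. As these auxiliary components
  are part of the observed value, the program reveals the joint posterior and not only the marginal
  on the output of the term.\<close>

lemma ctx_equiv_imp_cequiv:
  assumes t1: "has_ty None 0 \<Gamma> e1 \<tau>" and t2: "has_ty None 0 \<Gamma> e2 \<tau>"
    and ctx: "ctx_equiv \<Gamma> \<tau> e1 e2"
  shows "cequiv (ctx_dim \<Gamma>) (tdim \<tau>) (den \<Gamma> e1) (den \<Gamma> e2)"
  unfolding cequiv_def
proof (intro allI impI)
  fix a \<Psi> assume cm: "is_cm 0 (a + ctx_dim \<Gamma>) \<Psi>"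
  define m where "m = ctx_dim \<Gamma>"
  obtain \<psi> ob where Psi: "\<Psi> = (\<psi>, ob)" by (cases \<Psi>)
  define k where "k = dim_vec ob"
  have ob: "ob \<in> carrier_vec k" by (simp add: k_def)
  have gm: "is_gm 0 (a + m + k) \<psi>" using cm by (simp add: is_cm_def Psi m_def k_def)
  obtain A b S where psi: "\<psi> = (A, b, S)" by (cases \<psi>)
  have A: "A \<in> carrier_mat (a + m + k) 0" and b: "b \<in> carrier_vec (a + m + k)"
    and S: "S \<in> carrier_mat (a + m + k) (a + m + k)" and psd: "psd S"
    using gm unfolding is_gm_def psi by auto
  obtain s M where M: "M \<in> carrier_mat (a + m + k) s" and SM: "S = M * transpose_mat M"
    using psd_gram_factor[OF S psd] by blast
  define y where "y \<xi> = b + M *\<^sub>v \<xi>" for \<xi>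
  have yc: "y \<xi> \<in> carrier_vec (a + m + k)" for \<xi>
    using M b unfolding y_def by (intro add_carrier_vec) (auto intro!: carrier_vecI)
  define pa where "pa \<xi> = vec a (\<lambda>i. y \<xi> $ i)" for \<xi>
  define pm where "pm \<xi> = vec m (\<lambda>i. y \<xi> $ (a + i))" for \<xi>
  define pc where "pc \<xi> = vec k (\<lambda>i. y \<xi> $ (a + m + i))" for \<xi>
  have split: "(pa \<xi> @\<^sub>v pm \<xi>) @\<^sub>v pc \<xi> = y \<xi>" for \<xi>
    using carrier_vecD[OF yc] by (intro eq_vecI) (auto simp: pa_def pm_def pc_def)
  have rep: "rep 0 (a + ctx_dim \<Gamma> + k) s \<psi> (\<lambda>x \<xi>. (pa \<xi> @\<^sub>v pm \<xi>) @\<^sub>v pc \<xi>)"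
  proof -
    have "A *\<^sub>v x + b + M *\<^sub>v \<xi> = y \<xi>" if "x \<in> carrier_vec 0" for x \<xi> :: "real vec"
      using A b M that unfolding y_def by (intro eq_vecI) (auto simp: scalar_prod_def)
    then show ?thesis unfolding split rep_def psi SM using A b M
      by (intro exI[of _ A] exI[of _ b] exI[of _ M]) (auto simp: m_def)
  qed
  have car: "pa \<xi> \<in> carrier_vec a \<and> pm \<xi> \<in> carrier_vec (ctx_dim \<Gamma>) \<and> pc \<xi> \<in> carrier_vec k" for \<xi>
    by (simp add: pa_def pm_def pc_def m_def)
  \<comment> \<open>For the conditioned components the observed value is subtracted from the mean:
    \<open>clets\<close> compares with the constant 0, so \<open>R i = 0\<close> has to express the
    observation.\<close>
  define c where "c i = b $ i - (if i < a + m then 0 else ob $ (i - (a + m)))" for i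
  define R where "R i = (\<lambda>\<xi> :: real vec. (\<Sum>j<s. M $$ (i, j) * \<xi> $ j) + c i)" for i
  have yR: "y (vec_first \<xi> s) $ i = R i \<xi> + (if i < a + m then 0 else ob $ (i - (a + m)))"
    if "i < a + m + k" for i \<xi>
    using that M b by (simp add: y_def R_def c_def scalar_prod_def vec_first_def lessThan_atLeast0)
  have paR: "pa (vec_first \<xi> s) $ i = R i \<xi>" if "i < a" for i \<xi>
    using that yR[of i \<xi>] by (simp add: pa_def)
  have pmR: "pm (vec_first \<xi> s) = evl (map R [a..<a + m]) \<xi>" for \<xi>
    using yR by (intro eq_vecI) (auto simp: pm_def)
  have pcR: "pc (vec_first \<xi> s) = ob \<longleftrightarrow> (\<forall>f \<in> R ` {a + m..<a + m + k}. f \<xi> = 0)" for \<xi>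
  proof -
    have "pc (vec_first \<xi> s) = ob \<longleftrightarrow> (\<forall>i<k. R (a + m + i) \<xi> = 0)"
      using yR by (auto simp: pc_def vec_eq_iff k_def)
    also have "\<dots> \<longleftrightarrow> (\<forall>i\<in>{a + m..<a + m + k}. R i \<xi> = 0)"
      by (metis atLeastLessThan_iff le_add1 le_Suc_ex nat_add_left_cancel_less)
    finally show ?thesis by simp
  qed
  obtain B where B: "\<And>x. x \<in> fst ` set \<Gamma> \<Longrightarrow> x < B"
    using finite_nat_set_iff_bounded[of "fst ` set \<Gamma>"] by auto
  \<comment> \<open>The first name after the noise variables, which start above all names of
    \<open>\<Gamma>\<close>. The initial environment is unit there, as \<open>clets_sem\<close>
    demands.\<close>
  define U where "U = B + s"
  define rw where "rw i = rowt B (\<lambda>j. M $$ (i, j)) (c i) s" for i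
  define W :: "tm \<Rightarrow> tm" where
    "W t = nlets B s (clets U (map rw [a + m..<a + m + k]) (xlets rw \<Gamma> a (Pair (otup rw [0..<a]) t)))" for t
  define \<rho> where "\<rho> = zenv B s void (fresh 0)"
  define h where "h = xenv R \<Gamma> a \<rho>"
  have hol: "holes (rw i) = 0" for i by (simp add: rw_def)
  have fillW: "fill (W Hole) e = W e" for e
    by (simp add: W_def clets_fill[OF hol] xlets_fill[OF hol] fill_no_hole otup_holes[OF hol])
  have holW: "holes (W Hole) = 1"
    by (simp add: W_def clets_holes[OF hol] xlets_holes[OF hol] otup_holes[OF hol])
  have rw_ty: "has_ty H 0 \<Gamma>' (rw i) TR" if "\<And>j. j < s \<Longrightarrow> map_of \<Gamma>' (B + j) = Some TR" for H \<Gamma>' i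
    unfolding rw_def by (rule rowt_ty[OF that])
  define \<sigma> where "\<sigma> = TProd (foldr (\<lambda>_. TProd TR) [0..<a] TI) \<tau>"
  have z: "map_of (zctx B s) (B + j) = Some TR" if "j < s" for j
    using zctx_lookup[OF that, of B "[]"] by simp
  have tyW: "has_ty (Some (\<Gamma>, \<tau>)) 0 [] (W Hole) \<sigma>"
    unfolding W_def
  proof (rule nlets_ty, unfold append_Nil2, rule clets_ty)
    show "has_ty (Some (\<Gamma>, \<tau>)) 0 \<Gamma>' (rw i) TR"
      if e: "\<And>v. v \<noteq> U \<Longrightarrow> map_of \<Gamma>' v = map_of (zctx B s) v" for \<Gamma>' i
      by (rule rw_ty) (simp add: e U_def z)
  next
    fix \<Gamma>' assume e: "\<And>v. v \<noteq> U \<Longrightarrow> map_of \<Gamma>' v = map_of (zctx B s) v"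
    show "has_ty (Some (\<Gamma>, \<tau>)) 0 \<Gamma>' (xlets rw \<Gamma> a (Pair (otup rw [0..<a]) Hole)) \<sigma>"
    proof (rule xlets_ty[OF _ _ B])
      have "has_ty (Some (\<Gamma>, \<tau>)) 0 (\<Gamma> @ \<Gamma>') (rw i) TR" for i
      proof (rule rw_ty)
        fix j assume j: "j < s"
        have "B + j \<notin> fst ` set \<Gamma>" using B[of "B + j"] by auto
        then have "map_of \<Gamma> (B + j) = None" by (simp add: map_of_eq_None_iff)
        then show "map_of (\<Gamma> @ \<Gamma>') (B + j) = Some TR" using e[of "B + j"] z[OF j] j by (simp add: map_add_def U_def)
      qed
      then have "has_ty (Some (\<Gamma>, \<tau>)) 0 (\<Gamma> @ \<Gamma>') (otup rw [0..<a]) (foldr (\<lambda>_. TProd TR) [0..<a] TI)"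
        by (rule otup_ty)
      moreover have "has_ty (Some (\<Gamma>, \<tau>)) 0 (\<Gamma> @ \<Gamma>') Hole \<tau>"
        by (auto simp: has_ty_simps map_add_def)
      ultimately show "has_ty (Some (\<Gamma>, \<tau>)) 0 (\<Gamma> @ \<Gamma>') (Pair (otup rw [0..<a]) Hole) \<sigma>"
        by (auto simp: has_ty_simps \<sigma>_def)
      show "has_ty (Some (\<Gamma>, \<tau>)) 0 \<Gamma>'' (rw i) TR" if e': "\<And>v. B \<le> v \<Longrightarrow> map_of \<Gamma>'' v = map_of \<Gamma>' v" for \<Gamma>'' i
        by (rule rw_ty) (simp add: e' e U_def z)
    qed
  qed
  have ev: "evals rw \<rho>' R" if "\<And>v. B \<le> v \<Longrightarrow> \<rho>' (Var v) = \<rho> (Var v)" for \<rho>'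
  proof -
    have "\<rho>' (Var (B + i)) = VR (\<lambda>\<xi>. \<xi> $ i)" if "i < s" for i
      using \<open>\<And>v. B \<le> v \<Longrightarrow> \<rho>' (Var v) = \<rho> (Var v)\<close>[of "B + i"] that by (simp add: \<rho>_def zenv_def fresh_def)
    from rowt_sem[of s \<rho>' B "\<lambda>i \<xi>. \<xi> $ i", OF this] show ?thesis
      by (simp add: evals_def rw_def R_def)
  qed
  have ev0: "evals rw \<rho> R" by (rule ev) simp
  have evh: "evals rw h R" unfolding h_def by (rule ev) (rule xenv_ge[OF B])
  have \<rho>U: "\<rho> (Var U) = VU" by (simp add: \<rho>_def zenv_def U_def void_def)
  have sem: "outs (W e) = map R [0..<a] @ flatv (val e h (fresh s)) \<and> nn (W e) = s + nn e \<and>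
      sols0 (W e) = {\<xi> \<in> carrier_vec (s + nn e). (\<forall>f \<in> set (con e h (fresh s)). f \<xi> = 0) \<and> pc (vec_first \<xi> s) = ob}"
    if te: "has_ty None 0 \<Gamma> e \<tau>" for e
  proof -
    let ?p = "Pair (otup rw [0..<a]) e"
    have tW: "has_ty None 0 [] (W e) \<sigma>" using fill_ty[OF tyW refl te] fillW by simp
    note N = nlets_sem[of B s "clets U (map rw [a + m..<a + m + k]) (xlets rw \<Gamma> a ?p)" void "fresh 0", folded W_def \<rho>_def]
    note C = clets_sem[OF ev0 \<rho>U, of "[a + m..<a + m + k]" "xlets rw \<Gamma> a ?p" "fresh s"]
    have X: "val (xlets rw \<Gamma> a ?p) \<rho> X = val ?p h X \<and> con (xlets rw \<Gamma> a ?p) \<rho> X = con ?p h X \<and>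
        nn (xlets rw \<Gamma> a ?p) = nn ?p" for X
      unfolding h_def by (rule xlets_sem[OF ev B])
    note O = otup_sem[OF evh, of "[0..<a]"]
    have v: "val (W e) void (fresh 0) = val ?p h (fresh s)" using N C X by simp
    have cn: "set (con (W e) void (fresh 0)) = set (con e h (fresh s)) \<union> R ` {a + m..<a + m + k}"
      using N C X O by simp
    have n: "nn (W e) = s + nn e" using C X O by (simp add: W_def)
    show ?thesis
      unfolding closed_void[OF tW] v cn n using O pcR by (auto simp: ball_Un)
  qed
  have env: "env_rel \<Gamma> h \<xi> (pm (vec_first \<xi> s))" for \<xi>
    unfolding pmR h_def m_def by (rule xenv_rel)
  let ?ff = "\<lambda>e. map (\<lambda>i \<xi>. pa (vec_first \<xi> s) $ i) [0..<a] @ flatv (val e h (fresh s))"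
  have "law_eq (nn (W e1)) (sols0 (W e1)) (outs (W e1)) (nn (W e2)) (sols0 (W e2)) (outs (W e2))"
    using ctx tyW holW
    unfolding ctx_equiv_def operational_law_eq[OF fill_ty[OF tyW refl t1] fill_ty[OF tyW refl t2], symmetric, unfolded fillW]
    by (metis fillW)
  then have "law_eq (s + nn e1)
      {\<xi> \<in> carrier_vec (s + nn e1). (\<forall>f \<in> set (con e1 h (fresh s)). f \<xi> = 0) \<and> pc (vec_first \<xi> s) = ob}
      (map R [0..<a] @ flatv (val e1 h (fresh s)))
     (s + nn e2)
      {\<xi> \<in> carrier_vec (s + nn e2). (\<forall>f \<in> set (con e2 h (fresh s)). f \<xi> = 0) \<and> pc (vec_first \<xi> s) = ob}
      (map R [0..<a] @ flatv (val e2 h (fresh s)))"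
    using sem[OF t1] sem[OF t2] by simp
  then have "law_eq (s + nn e1)
      {\<xi> \<in> carrier_vec (s + nn e1). (\<forall>f \<in> set (con e1 h (fresh s)). f \<xi> = 0) \<and> pc (vec_first \<xi> s) = ob}
      (?ff e1)
     (s + nn e2)
      {\<xi> \<in> carrier_vec (s + nn e2). (\<forall>f \<in> set (con e2 h (fresh s)). f \<xi> = 0) \<and> pc (vec_first \<xi> s) = ob}
      (?ff e2)"
    by (rule law_eq_cong) (auto simp: nth_append paR)
  then show "(succeeds (a + tdim \<tau>) (cid a \<otimes>\<^sub>c den \<Gamma> e1 \<bullet>\<^sub>c \<Psi>) \<longleftrightarrow> succeeds (a + tdim \<tau>) (cid a \<otimes>\<^sub>c den \<Gamma> e2 \<bullet>\<^sub>c \<Psi>)) \<and>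
      (succeeds (a + tdim \<tau>) (cid a \<otimes>\<^sub>c den \<Gamma> e1 \<bullet>\<^sub>c \<Psi>) \<and> succeeds (a + tdim \<tau>) (cid a \<otimes>\<^sub>c den \<Gamma> e2 \<bullet>\<^sub>c \<Psi>) \<longrightarrow>
         same_posterior (a + tdim \<tau>) (cid a \<otimes>\<^sub>c den \<Gamma> e1 \<bullet>\<^sub>c \<Psi>) (cid a \<otimes>\<^sub>c den \<Gamma> e2 \<bullet>\<^sub>c \<Psi>))"
    unfolding Psi using state_law_eq[OF t1 t2 rep ob car env] by blast
qed

theorem theorem6p2:
  fixes \<Gamma> :: env and e1 e2 :: tm and \<tau> :: ty
  assumes "distinct (map fst \<Gamma>)"
    and "has_ty None 0 \<Gamma> e1 \<tau>" and "has_ty None 0 \<Gamma> e2 \<tau>"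
  shows "cequiv (ctx_dim \<Gamma>) (tdim \<tau>) (den \<Gamma> e1) (den \<Gamma> e2) \<longleftrightarrow> ctx_equiv \<Gamma> \<tau> e1 e2"
  using cequiv_imp_ctx_equiv[OF assms] ctx_equiv_imp_cequiv[OF assms(2,3)] by blast

end
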